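(* Let $\mathcal{C}$ be a Cayley algebra over a field $\mathbb{F}$. Then, up to equivalence, the fine abelian group gradings on $\mathcal{C}$ and their universal grading groups are the following. (1) If $\mathcal{C}$ is split, the Cartan grading with universal group $\mathbb{Z}^2$. (2) If $\mathrm{char}\,\mathbb{F}\neq2$, the gradings $\Gamma_{\mathcal{C}}(\mathbb{Z}_2^3,\mathbb{F},\mathbb{Z}_2^3,\mu)$ (with $\mu\colon\mathbb{Z}_2^3\to\mathbb{F}^\times/(\mathbb{F}^\times)^2$ an admissible homomorphism) with universal group $\mathbb{Z}_2^3$; two such gradings, corresponding to $\mu$ and $\mu'$, are equivalent if and only if there is an automorphism $\varphi\in\mathrm{Aut}(\mathbb{Z}_2^3)$ such that $\mu'=\mu\circ\varphi$. (3) If $\mathrm{char}\,\mathbb{F}=2$, the gradings $\Gamma_{\mathcal{C}}(\mathbb{Z}_2^2,\mathcal{K},\mathbb{Z}_2^2,\mu)$ with universal group $\mathbb{Z}_2^2$, where $\mathcal{K}$ is a quadratic separable subfield of $\mathcal{C}$ (and $\mu\colon\mathbb{Z}_2^2\to\mathbb{F}^\times/n(\mathcal{K}^\times)$ is an admissible homomorphism); two such gradings, corresponding to $(\mathcal{K},\mu)$ and $(\mathcal{K}',\mu')$, are equivalent if and only if $\mathcal{K}$ and $\mathcal{K}'$ are isomorphic and there is an automorphism $\varphi\in\mathrm{Aut}(\mathbb{Z}_2^2)$ such that $\mu'=\mu\circ\varphi$.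
   Context: A $G$-grading on an algebra $\mathcal{U}$ ($G$ an abelian group) is a decomposition $\mathcal{U}=\bigoplus_{g\in G}\mathcal{U}_g$ with $\mathcal{U}_g\mathcal{U}_h\subset\mathcal{U}_{gh}$. An abelian group grading is fine if no abelian group grading properly refines it. Two gradings are equivalent if there is an algebra isomorphism mapping the nonzero homogeneous components of the first bijectively onto those of the second. The universal (abelian) grading group of a grading with support $S$ is the abelian group generated by $S$ with relations $s_1s_2=s_3$ whenever $0\neq\mathcal{U}_{s_1}\mathcal{U}_{s_2}\subset\mathcal{U}_{s_3}$. A Cayley algebra is an $8$-dimensional unital composition algebra with norm $n$. The split Cayley algebra has a basis $\{e_1,e_2,u_i,v_i\}_{i=1,2,3}$ with $e_i^2=e_i$, $e_1u_j=u_je_2=u_j$, $e_2v_j=v_je_1=v_j$, $u_ju_k=\varepsilon_{jkl}v_l$, $v_jv_k=\varepsilon_{jkl}u_l$ (Levi-Civita symbol), $u_jv_j=-e_1$, $v_ju_j=-e_2$, other products $0$. The Cartan grading on it is the $\mathbb{Z}^2$-grading with $\deg e_1=\deg e_2=(0,0)$, $\deg u_1=(1,0)=-\deg v_1$, $\deg u_2=(0,1)=-\deg v_2$, $-\deg u_3=(1,1)=\deg v_3$. $\Gamma_{\mathcal{C}}(G,\mathcal{K},T,\mu)$: let $\mathcal{K}$ be a quadratic separable subfield of $\mathcal{C}$ and $T=\{e,t_1,t_2,t_3\}\subset G$ an elementary abelian $2$-subgroup of order $4$. A homomorphism $\mu\colon T\to\mathbb{F}^\times/n(\mathcal{K}^\times)$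 is admissible if, for representatives $\tilde\mu_i\in\mathbb{F}^\times$ of $\mu(t_i)$, $n$ is isometric to $n_{\mathcal{K}}\perp\tilde\mu_1n_{\mathcal{K}}\perp\tilde\mu_2n_{\mathcal{K}}\perp\tilde\mu_3n_{\mathcal{K}}$, with $n_{\mathcal{K}}=n|_{\mathcal{K}}$. Writing $\mathcal{C}=\mathcal{K}\oplus\mathcal{K}u\oplus\mathcal{K}v\oplus\mathcal{K}(uv)$ (Cayley–Dickson doubling twice, nonisotropic $u\in\mathcal{K}^\perp$, $v\in(\mathcal{K}\oplus\mathcal{K}u)^\perp$) with $n(u)\in\mu(t_1)$, $n(v)\in\mu(t_2)$, the grading has $\mathcal{C}_e=\mathcal{K}$, $\mathcal{C}_{t_1}=\mathcal{K}u$, $\mathcal{C}_{t_2}=\mathcal{K}v$, $\mathcal{C}_{t_1t_2}=\mathcal{K}(uv)$; up to isomorphism it depends only on $\mathcal{K},T,\mu$. $\Gamma_{\mathcal{C}}(G,\mathbb{F},T,\mu)$ ($\mathrm{char}\,\mathbb{F}\neq2$): let $T=\{e,t_1,\dots,t_7\}\subset G$ be an elementary abelian $2$-subgroup of order $8$. A homomorphism $\mu\colon T\to\mathbb{F}^\times/(\mathbb{F}^\times)^2$ is admissible if, for representatives $\tilde\mu_i$ of $\mu(t_i)$, $n$ is isometric to $\mathrm{diag}(1,\tilde\mu_1,\dots,\tilde\mu_7)$. Choosing generators $s_1,s_2,s_3$ of $T$ and writing $\mathcal{C}=\mathrm{span}\{1,u,v,uv,w,uw,vw,(uv)w\}$ (Cayley–Dickson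 doubling three times from $\mathbb{F}$) with $n(u)\in\mu(s_1)$, $n(v)\in\mu(s_2)$, $n(w)\in\mu(s_3)$, the grading is determined by $\deg u=s_1$, $\deg v=s_2$, $\deg w=s_3$; up to isomorphism it depends only on $T,\mu$. *)

theory Defs
  imports
    "HOL-Algebra.Free_Abelian_Groups"
    "HOL-Computational_Algebra.Polynomial"
    "HOL-Library.Function_Algebras"
begin

section \<open>Cayley algebras\<close>

locale nonassoc_algebra = vector_space scale
  for scale :: "'f::field \<Rightarrow> 'c::ab_group_add \<Rightarrow> 'c" +
  fixes mul :: "'c \<Rightarrow> 'c \<Rightarrow> 'c"
  assumes mult_add_left: "mul (x + y) z = mul x z + mul y z"
    and mult_add_right: "mul x (y + z) = mul x y + mul x z"
    and mult_scale_left: "mul (scale a x) y = scale a (mul x y)"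
    and mult_scale_right: "mul x (scale a y) = scale a (mul x y)"

definition polar :: "('c::ab_group_add \<Rightarrow> 'f::field) \<Rightarrow> 'c \<Rightarrow> 'c \<Rightarrow> 'f" where
  "polar n x y = n (x + y) - n x - n y"

text \<open>A composition algebra is required to have a nondegenerate \<^emph>\<open>polar\<close> form, also in
  characteristic 2, where this is stronger than nondegeneracy of the quadratic form itself.\<close>

locale cayley_algebra = nonassoc_algebra scale mul
  for scale :: "'f::field \<Rightarrow> 'c::ab_group_add \<Rightarrow> 'c" and mul :: "'c \<Rightarrow> 'c \<Rightarrow> 'c" +
  fixes unit :: 'c and n :: "'c \<Rightarrow> 'f"
  assumes one_mult: "mul unit x = x"
    and mult_one: "mul x unit = x"
    and norm_scale: "n (scale a x) = a\<^sup>2 * n x"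
    and polar_add: "polar n (x + y) z = polar n x z + polar n y z"
    and polar_scale: "polar n (scale a x) y = a * polar n x y"
    and polar_nondegenerate: "(\<And>y. polar n x y = 0) \<Longrightarrow> x = 0"
    and norm_mult: "n (mul x y) = n x * n y"
    and dim_eq_8: "vector_space.dim scale (UNIV :: 'c set) = 8"

definition split_norm :: "('c::ab_group_add \<Rightarrow> 'f::field) \<Rightarrow> bool" where
  "split_norm n \<longleftrightarrow> (\<exists>x. x \<noteq> 0 \<and> n x = 0)"

definition alg_iso_on ::
  "('f::field \<Rightarrow> 'c::ab_group_add \<Rightarrow> 'c) \<Rightarrow> ('c \<Rightarrow> 'c \<Rightarrow> 'c) \<Rightarrow> ('c \<Rightarrow> 'c) \<Rightarrow> 'c set \<Rightarrow> 'c set \<Rightarrow> bool"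
where
  "alg_iso_on scale mul \<psi> A B \<longleftrightarrow>
     bij_betw \<psi> A B \<and>
     (\<forall>x\<in>A. \<forall>y\<in>A. \<psi> (x + y) = \<psi> x + \<psi> y) \<and>
     (\<forall>a. \<forall>x\<in>A. \<psi> (scale a x) = scale a (\<psi> x)) \<and>
     (\<forall>x\<in>A. \<forall>y\<in>A. \<psi> (mul x y) = mul (\<psi> x) (\<psi> y))"


section \<open>Gradings by abelian groups\<close>

definition grading ::
  "('f::field \<Rightarrow> 'c::ab_group_add \<Rightarrow> 'c) \<Rightarrow> ('c \<Rightarrow> 'c \<Rightarrow> 'c) \<Rightarrow>
   ('g, 'm) monoid_scheme \<Rightarrow> ('g \<Rightarrow> 'c set) \<Rightarrow> bool"
where
  "grading scale mul G \<Gamma> \<longleftrightarrow>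
     comm_group G \<and>
     (\<forall>g\<in>carrier G. Modules.module.subspace scale (\<Gamma> g)) \<and>
     (\<forall>x. \<exists>!f. finite {g. f g \<noteq> 0} \<and> {g. f g \<noteq> 0} \<subseteq> carrier G \<and>
               (\<forall>g\<in>carrier G. f g \<in> \<Gamma> g) \<and> x = (\<Sum>g | f g \<noteq> 0. f g)) \<and>
     (\<forall>g\<in>carrier G. \<forall>h\<in>carrier G. \<forall>x\<in>\<Gamma> g. \<forall>y\<in>\<Gamma> h. mul x y \<in> \<Gamma> (g \<otimes>\<^bsub>G\<^esub> h))"

definition support :: "('g, 'm) monoid_scheme \<Rightarrow> ('g \<Rightarrow> 'c::zero set) \<Rightarrow> 'g set" where
  "support G \<Gamma> = {g \<in> carrier G. \<Gamma> g \<noteq> {0}}"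

definition components :: "('g, 'm) monoid_scheme \<Rightarrow> ('g \<Rightarrow> 'c::zero set) \<Rightarrow> 'c set set" where
  "components G \<Gamma> = \<Gamma> ` support G \<Gamma>"

definition properly_refines ::
  "('h, 'm) monoid_scheme \<Rightarrow> ('h \<Rightarrow> 'c::zero set) \<Rightarrow>
   ('g, 'n) monoid_scheme \<Rightarrow> ('g \<Rightarrow> 'c set) \<Rightarrow> bool"
where
  "properly_refines H \<Delta> G \<Gamma> \<longleftrightarrow>
     (\<forall>X\<in>components H \<Delta>. \<exists>Y\<in>components G \<Gamma>. X \<subseteq> Y) \<and>
     (\<exists>X\<in>components H \<Delta>. \<exists>Y\<in>components G \<Gamma>. X \<subset> Y)"

text \<open>Quantifying over groups carried by subsets of \<^typ>\<open>nat\<close> loses nothing: the support of a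
  grading of a finite-dimensional algebra is finite, so the subgroup it generates is countable.
  Lemma \<open>fine_grading_no_refinement\<close> below removes the restriction.\<close>

definition fine_grading ::
  "('f::field \<Rightarrow> 'c::ab_group_add \<Rightarrow> 'c) \<Rightarrow> ('c \<Rightarrow> 'c \<Rightarrow> 'c) \<Rightarrow>
   ('g, 'm) monoid_scheme \<Rightarrow> ('g \<Rightarrow> 'c set) \<Rightarrow> bool"
where
  "fine_grading scale mul G \<Gamma> \<longleftrightarrow>
     grading scale mul G \<Gamma> \<and>
     \<not> (\<exists>(H :: nat monoid) \<Delta>. grading scale mul H \<Delta> \<and> properly_refines H \<Delta> G \<Gamma>)"

lemma grading_sum_eq_0:
  assumes "grading scale mul H \<Delta>" "vector_space scale"
    and A: "finite A" "A \<subseteq> carrier H" "\<And>g. g \<in> A \<Longrightarrow> f g \<in> \<Delta> g" "(\<Sum>g\<in>A. f g) = 0" "g \<in> A"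
  shows "f g = 0"
proof -
  interpret vector_space scale by fact
  note gd = assms(1)[unfolded grading_def]
  have sub: "\<And>h. h \<in> carrier H \<Longrightarrow> subspace (\<Delta> h)"
    using gd[THEN conjunct2, THEN conjunct1] by (rule bspec)
  have uniq: "\<exists>!f. finite {g. f g \<noteq> 0} \<and> {g. f g \<noteq> 0} \<subseteq> carrier H \<and>
               (\<forall>g\<in>carrier H. f g \<in> \<Delta> g) \<and> 0 = (\<Sum>g | f g \<noteq> 0. f g)"
    using gd[THEN conjunct2, THEN conjunct2, THEN conjunct1] by (rule spec)
  let ?f = "\<lambda>h. if h \<in> A then f h else 0"
  have fA: "{h. ?f h \<noteq> 0} \<subseteq> A" by auto
  have "(\<Sum>h | ?f h \<noteq> 0. ?f h) = (\<Sum>h\<in>A. ?f h)"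
    by (rule sum.mono_neutral_left) (use A fA in auto)
  also have "\<dots> = 0" using A(4) by simp
  finally have s: "0 = (\<Sum>h | ?f h \<noteq> 0. ?f h)" by simp
  have "finite {h. ?f h \<noteq> 0} \<and> {h. ?f h \<noteq> 0} \<subseteq> carrier H \<and>
        (\<forall>h\<in>carrier H. ?f h \<in> \<Delta> h) \<and> 0 = (\<Sum>h | ?f h \<noteq> 0. ?f h)"
  proof (intro conjI)
    show "finite {h. ?f h \<noteq> 0}" by (rule finite_subset[OF fA A(1)])
    show "{h. ?f h \<noteq> 0} \<subseteq> carrier H" using fA A(2) by (rule subset_trans)
    show "\<forall>h\<in>carrier H. ?f h \<in> \<Delta> h" using A(3) subspace_0[OF sub] by simp
  qed (rule s)
  moreover have "finite {h. (\<lambda>_. 0::'b) h \<noteq> 0} \<and> {h. (\<lambda>_. 0::'b) h \<noteq> 0} \<subseteq> carrier H \<and>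
        (\<forall>h\<in>carrier H. (\<lambda>_. 0) h \<in> \<Delta> h) \<and> 0 = (\<Sum>h | (\<lambda>_. 0::'b) h \<noteq> 0. (\<lambda>_. 0) h)"
    using subspace_0[OF sub] by simp
  ultimately have "?f = (\<lambda>_. 0)"
    by (rule Uniq_D[OF uniq[unfolded ex1_iff_ex_Uniq, THEN conjunct2]])
  then have "?f g = 0" by (rule fun_cong)
  then show ?thesis using A(5) by simp
qed

lemma grading_finite_support:
  assumes ca: "cayley_algebra scale mul unit n" and gr: "grading scale mul H \<Delta>"
  shows "finite (support H \<Delta>)"
proof -
  interpret cayley_algebra scale mul unit n by (rule ca)
  have vs: "vector_space scale" by (rule vector_space_axioms)
  have sub: "\<And>h. h \<in> carrier H \<Longrightarrow> subspace (\<Delta> h)"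
    using gr[unfolded grading_def, THEN conjunct2, THEN conjunct1] by (rule bspec)
  have "\<forall>g\<in>support H \<Delta>. \<exists>x. x \<in> \<Delta> g \<and> x \<noteq> 0"
  proof
    fix g assume "g \<in> support H \<Delta>"
    then have "g \<in> carrier H" "\<Delta> g \<noteq> {0}" by (auto simp: support_def)
    moreover from this(1) have "0 \<in> \<Delta> g" by (intro subspace_0[OF sub])
    ultimately show "\<exists>x. x \<in> \<Delta> g \<and> x \<noteq> 0" by blast
  qed
  from bchoice[OF this] obtain x where x: "\<And>g. g \<in> support H \<Delta> \<Longrightarrow> x g \<in> \<Delta> g \<and> x g \<noteq> 0"
    by blast
  have car: "support H \<Delta> \<subseteq> carrier H" by (auto simp: support_def)
  have inj: "inj_on x (support H \<Delta>)"
  proof (rule inj_onI, rule ccontr)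
    fix g h assume g: "g \<in> support H \<Delta>" and h: "h \<in> support H \<Delta>" and eq: "x g = x h" and ne: "g \<noteq> h"
    let ?f = "\<lambda>k. if k = g then x g else - x h"
    have gh: "g \<in> carrier H" "h \<in> carrier H" using g h car by auto
    have xg: "x g \<in> \<Delta> g" using x[OF g] by simp
    have xh: "- x h \<in> \<Delta> h" using x[OF h] by (intro subspace_neg[OF sub[OF gh(2)]]) simp
    have "?f g = 0"
    proof (rule grading_sum_eq_0[OF gr vs, where A = "{g, h}" and f = ?f and g = g])
      show "\<And>k. k \<in> {g, h} \<Longrightarrow> ?f k \<in> \<Delta> k"
        using xg xh by auto
      show "(\<Sum>k\<in>{g, h}. ?f k) = 0" using ne eq by simp
    qed (simp_all add: gh)
    then show False using x[OF g] by simp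
  qed
  have "independent (x ` support H \<Delta>)"
    unfolding independent_explicit_module
  proof (intro allI impI)
    fix t u v assume t: "finite t" "t \<subseteq> x ` support H \<Delta>" "(\<Sum>v\<in>t. scale (u v) v) = 0" "v \<in> t"
    then obtain A where A: "A \<subseteq> support H \<Delta>" "t = x ` A" by (meson subset_imageE)
    have inA: "inj_on x A" using inj A inj_on_subset by blast
    have fA: "finite A" using A t(1) inA finite_image_iff by blast
    obtain g where g: "g \<in> A" "v = x g" using A t by auto
    have "scale (u (x g)) (x g) = 0"
    proof (rule grading_sum_eq_0[OF gr vs fA, where f = "\<lambda>g. scale (u (x g)) (x g)" and g = g])
      show "\<And>g. g \<in> A \<Longrightarrow> scale (u (x g)) (x g) \<in> \<Delta> g"
        using x A car subspace_scale[OF sub] by blast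
      show "(\<Sum>g\<in>A. scale (u (x g)) (x g)) = 0"
        using t(3) by (simp add: A(2) sum.reindex[OF inA])
    qed (use A car g in auto)
    then show "u v = 0" using x g A by auto
  qed
  note ind = this
  obtain B where B: "UNIV \<subseteq> span B" "card B = dim (UNIV :: 'b set)"
    by (rule basis_exists[of UNIV])
  have "card B = 8" using B(2) dim_eq_8 by (rule trans)
  then have "finite B" by (intro card_ge_0_finite) simp
  from independent_span_bound[OF this ind subset_trans[OF subset_UNIV B(1)]]
  have "finite (x ` support H \<Delta>)" by (rule conjunct1)
  then show ?thesis using finite_image_iff[OF inj] by simp
qed

lemma (in group) countable_generate:
  assumes "countable S" "S \<subseteq> carrier G"
  shows "countable (generate G S)"
proof -
  let ?ev = "\<lambda>w. foldr (\<lambda>(a, b) y. (if b then a else inv a) \<otimes> y) w \<one>"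
  let ?W = "lists (S \<times> (UNIV :: bool set))"
  have cl: "?ev w \<in> carrier G" if "w \<in> ?W" for w
    using that assms(2) by (induction w) (auto simp: subset_iff)
  have app: "?ev (w @ w') = ?ev w \<otimes> ?ev w'" if "w \<in> ?W" "w' \<in> ?W" for w w'
    using that(1)
  proof (induction w)
    case Nil then show ?case using cl[OF that(2)] by simp
  next
    case (Cons p w)
    obtain a b where p: "p = (a, b)" by force
    have aS: "a \<in> S" and w: "w \<in> ?W" using Cons.hyps p by auto
    then have "a \<in> carrier G" using assms(2) by blast
    then have c: "(if b then a else inv a) \<in> carrier G" by simp
    have "?ev (w @ w') = ?ev w \<otimes> ?ev w'" using w Cons.IH by blast
    then show ?case using m_assoc[OF c cl[OF w] cl[OF that(2)]] by (simp add: p)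
  qed
  have "\<exists>w\<in>?W. h = ?ev w" if "h \<in> generate G S" for h
    using that
  proof (induction rule: generate.induct)
    case one show ?case by (intro bexI[of _ "[]"]) auto
  next
    case (incl h) then show ?case using assms(2) by (intro bexI[of _ "[(h, True)]"]) auto
  next
    case (inv h) then show ?case using assms(2) by (intro bexI[of _ "[(h, False)]"]) auto
  next
    case (eng h1 h2)
    then obtain w1 w2 where "w1 \<in> ?W" "h1 = ?ev w1" "w2 \<in> ?W" "h2 = ?ev w2" by blast
    then show ?case using app by (intro bexI[of _ "w1 @ w2"]) (auto simp del: foldr_append)
  qed
  then have "generate G S \<subseteq> ?ev ` ?W" by blast
  moreover have "countable ?W" using assms(1) by (intro countable_lists) auto
  ultimately show ?thesis by (meson countable_image countable_subset)
qed

lemma fine_grading_no_refinement: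
  fixes H :: "('h, 'k) monoid_scheme"
  assumes ca: "cayley_algebra scale mul unit n"
    and fine: "fine_grading scale mul G \<Gamma>" and gr: "grading scale mul H \<Delta>"
  shows "\<not> properly_refines H \<Delta> G \<Gamma>"
proof
  assume ref: "properly_refines H \<Delta> G \<Gamma>"
  interpret cayley_algebra scale mul unit n by (rule ca)
  interpret H: comm_group H using gr by (simp add: grading_def)
  note gd = gr[unfolded grading_def]
  note gd1 = gd[THEN conjunct2, THEN conjunct1]
    and gd2 = gd[THEN conjunct2, THEN conjunct2, THEN conjunct1]
    and gd3 = gd[THEN conjunct2, THEN conjunct2, THEN conjunct2]
  have sub: "\<And>h. h \<in> carrier H \<Longrightarrow> subspace (\<Delta> h)"
    using gd1 by (rule bspec)
  have prod: "\<And>g h x y. g \<in> carrier H \<Longrightarrow> h \<in> carrier H \<Longrightarrow> x \<in> \<Delta> g \<Longrightarrow> y \<in> \<Delta> h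
                 \<Longrightarrow> mul x y \<in> \<Delta> (g \<otimes>\<^bsub>H\<^esub> h)"
    by (rule gd3[THEN bspec, THEN bspec, THEN bspec, THEN bspec])
  have dec: "\<And>x. \<exists>!f. finite {g. f g \<noteq> 0} \<and> {g. f g \<noteq> 0} \<subseteq> carrier H \<and>
               (\<forall>g\<in>carrier H. f g \<in> \<Delta> g) \<and> x = (\<Sum>g | f g \<noteq> 0. f g)"
    using gd2 by (rule spec)
  have car: "support H \<Delta> \<subseteq> carrier H" by (auto simp: support_def)
  define P where "P = generate H (support H \<Delta>)"
  have P: "subgroup P H" unfolding P_def by (rule H.generate_is_subgroup[OF car])
  have Pc: "P \<subseteq> carrier H" using P by (rule subgroup.subset)
  have SP: "support H \<Delta> \<subseteq> P" by (auto simp: P_def intro: generate.incl)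
  have cP: "countable P" unfolding P_def
    by (rule H.countable_generate) (use grading_finite_support[OF ca gr] car in \<open>auto intro: countable_finite\<close>)
  define a where "a = to_nat_on P"
  define b where "b = from_nat_into P"
  have ba: "\<And>g. g \<in> P \<Longrightarrow> b (a g) = g" using cP by (simp add: a_def b_def)
  define N where "N = \<lparr>carrier = a ` P, monoid.mult = (\<lambda>i j. a (b i \<otimes>\<^bsub>H\<^esub> b j)), one = a \<one>\<^bsub>H\<^esub>\<rparr>"
  define D where "D = (\<lambda>i. \<Delta> (b i))"
  have Pm: "\<And>g h. g \<in> P \<Longrightarrow> h \<in> P \<Longrightarrow> g \<otimes>\<^bsub>H\<^esub> h \<in> P" using P by (rule subgroup.m_closed)
  have P1: "\<one>\<^bsub>H\<^esub> \<in> P" using P by (rule subgroup.one_closed)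
  have Pi: "\<And>g. g \<in> P \<Longrightarrow> inv\<^bsub>H\<^esub> g \<in> P" using P by (rule subgroup.m_inv_closed)
  have Pcc: "\<And>g. g \<in> P \<Longrightarrow> g \<in> carrier H" using Pc by blast
  have N: "comm_group N"
  proof (rule comm_groupI)
    fix x assume "x \<in> carrier N"
    then show "\<exists>y\<in>carrier N. y \<otimes>\<^bsub>N\<^esub> x = \<one>\<^bsub>N\<^esub>"
      by (auto simp: N_def ba Pcc Pi intro!: bexI[of _ "inv\<^bsub>H\<^esub> (b x)"])
  next
    fix x y assume "x \<in> carrier N" "y \<in> carrier N"
    then show "x \<otimes>\<^bsub>N\<^esub> y = y \<otimes>\<^bsub>N\<^esub> x"
      using H.m_comm Pcc by (force simp: N_def ba)
  qed (auto simp: N_def ba Pm P1 Pcc H.m_assoc)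
  have supN: "support N D = a ` support H \<Delta>"
    using SP Pc by (auto simp: support_def N_def D_def ba)
  have comp: "components N D = components H \<Delta>"
    unfolding components_def supN using SP ba by (auto simp: D_def image_image intro!: image_cong)
  have zero: "\<Delta> g = {0}" if "g \<in> carrier H" "g \<notin> P" for g
    using that SP by (auto simp: support_def)
  have inj: "inj_on a P" using ba by (metis inj_onI)
  have "grading scale mul N D"
    unfolding grading_def
  proof (intro conjI ballI allI N)
    show "subspace (D i)" if "i \<in> carrier N" for i
      using that sub Pcc by (auto simp: N_def D_def ba)
    show "mul x y \<in> D (i \<otimes>\<^bsub>N\<^esub> j)"
      if "i \<in> carrier N" "j \<in> carrier N" "x \<in> D i" "y \<in> D j" for i j x y
      using that prod Pcc by (auto simp: N_def D_def ba Pm)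
    fix x
    let ?Q = "\<lambda>f. finite {g. f g \<noteq> 0} \<and> {g. f g \<noteq> 0} \<subseteq> carrier H \<and>
               (\<forall>g\<in>carrier H. f g \<in> \<Delta> g) \<and> x = (\<Sum>g | f g \<noteq> 0. f g)"
    let ?R = "\<lambda>f. finite {g. f g \<noteq> 0} \<and> {g. f g \<noteq> 0} \<subseteq> carrier N \<and>
               (\<forall>g\<in>carrier N. f g \<in> D g) \<and> x = (\<Sum>g | f g \<noteq> 0. f g)"
    have tr: "?Q (\<lambda>g. if g \<in> P then f (a g) else 0)" if R: "?R f" for f :: "nat \<Rightarrow> 'b"
    proof -
      note R1 = R[THEN conjunct1] and R2 = R[THEN conjunct2, THEN conjunct1]
        and R3 = R[THEN conjunct2, THEN conjunct2, THEN conjunct1]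
        and R4 = R[THEN conjunct2, THEN conjunct2, THEN conjunct2]
      let ?f = "\<lambda>g. if g \<in> P then f (a g) else 0"
      have im: "{i. f i \<noteq> 0} = a ` {g. ?f g \<noteq> 0}"
      proof (intro equalityI subsetI)
        fix i assume i: "i \<in> {i. f i \<noteq> 0}"
        then have "i \<in> a ` P" using R2 unfolding N_def by auto
        then show "i \<in> a ` {g. ?f g \<noteq> 0}" using i by auto
      qed (auto split: if_splits)
      have ij: "inj_on a {g. ?f g \<noteq> 0}" by (rule inj_on_subset[OF inj]) auto
      have "finite {g. ?f g \<noteq> 0}" using R1 im finite_image_iff[OF ij] by simp
      moreover have "{g. ?f g \<noteq> 0} \<subseteq> carrier H" using Pc by auto
      moreover have "\<forall>g\<in>carrier H. ?f g \<in> \<Delta> g"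
        using R3 subspace_0[OF sub] by (auto simp: N_def D_def ba)
      moreover have "x = (\<Sum>g | ?f g \<noteq> 0. ?f g)"
      proof -
        have "x = (\<Sum>i | f i \<noteq> 0. f i)" by (rule R4)
        also have "\<dots> = (\<Sum>g | ?f g \<noteq> 0. f (a g))" unfolding im by (simp add: sum.reindex[OF ij])
        also have "\<dots> = (\<Sum>g | ?f g \<noteq> 0. ?f g)" by (rule sum.cong) (auto split: if_splits)
        finally show ?thesis .
      qed
      ultimately show ?thesis by (intro conjI)
    qed
    obtain f where f: "?Q f" by (rule ex1E[OF dec[of x]])
    note f1 = f[THEN conjunct1]
      and f3 = f[THEN conjunct2, THEN conjunct2, THEN conjunct1]
      and f4 = f[THEN conjunct2, THEN conjunct2, THEN conjunct2]
      and f2 = f[THEN conjunct2, THEN conjunct1]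
    have fP: "f g = 0" if "g \<notin> P" for g
      using f2 f3 zero[of g] that by (cases "g \<in> carrier H") auto
    let ?h = "\<lambda>i. if i \<in> a ` P then f (b i) else 0"
    have im: "{i. ?h i \<noteq> 0} = a ` {g. f g \<noteq> 0}"
    proof (intro equalityI subsetI)
      fix i assume "i \<in> {i. ?h i \<noteq> 0}"
      then obtain g where "g \<in> P" "i = a g" "f (b i) \<noteq> 0" by (auto split: if_splits)
      then show "i \<in> a ` {g. f g \<noteq> 0}" using ba by auto
    next
      fix i assume "i \<in> a ` {g. f g \<noteq> 0}"
      then obtain g where g: "i = a g" "f g \<noteq> 0" by blast
      then have "g \<in> P" using fP by blast
      then show "i \<in> {i. ?h i \<noteq> 0}" using g ba by auto
    qed
    have ij: "inj_on a {g. f g \<noteq> 0}" by (rule inj_on_subset[OF inj]) (use fP in auto)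
    have ex: "?R ?h"
    proof (intro conjI)
      show "finite {i. ?h i \<noteq> 0}" unfolding im using f1 by (rule finite_imageI)
      show "{i. ?h i \<noteq> 0} \<subseteq> carrier N" by (auto simp: N_def)
      show "\<forall>i\<in>carrier N. ?h i \<in> D i" using f3 Pcc by (auto simp: N_def D_def ba)
      have "x = (\<Sum>g | f g \<noteq> 0. f g)" by (rule f4)
      also have "\<dots> = (\<Sum>g | f g \<noteq> 0. ?h (a g))"
      proof (rule sum.cong[OF refl])
        fix g assume "g \<in> {g. f g \<noteq> 0}"
        then have "g \<in> P" using fP by blast
        then show "f g = ?h (a g)" by (simp add: ba)
      qed
      also have "\<dots> = (\<Sum>i | ?h i \<noteq> 0. ?h i)" unfolding im by (simp add: sum.reindex[OF ij])
      finally show "x = (\<Sum>i | ?h i \<noteq> 0. ?h i)" .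
    qed
    show "\<exists>!f. ?R f"
    proof (rule ex1I[of ?R, OF ex])
      fix f' assume R: "?R f'"
      have "(\<lambda>g. if g \<in> P then f' (a g) else 0) = (\<lambda>g. if g \<in> P then ?h (a g) else 0)"
        by (rule Uniq_D[where P = ?Q, OF dec[of x, unfolded ex1_iff_ex_Uniq, THEN conjunct2] tr[OF R] tr[OF ex]])
      note eq = fun_cong[OF this]
      have e: "f' (a g) = ?h (a g)" if "g \<in> P" for g
        using eq[of g] by (simp only: that if_True)
      show "f' = ?h"
      proof
        fix i show "f' i = ?h i"
        proof (cases "i \<in> a ` P")
          case True then show ?thesis using e by blast
        next
          case False then have "i \<notin> {i. f' i \<noteq> 0}" using R[THEN conjunct2, THEN conjunct1] unfolding N_def by auto
          then show ?thesis using False by simp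
        qed
      qed
    qed
  qed
  moreover have "properly_refines N D G \<Gamma>" using ref unfolding properly_refines_def comp .
  ultimately show False using fine unfolding fine_grading_def by blast
qed

definition equivalent_gradings ::
  "('f::field \<Rightarrow> 'c::ab_group_add \<Rightarrow> 'c) \<Rightarrow> ('c \<Rightarrow> 'c \<Rightarrow> 'c) \<Rightarrow>
   ('g, 'm) monoid_scheme \<Rightarrow> ('g \<Rightarrow> 'c set) \<Rightarrow> ('h, 'n) monoid_scheme \<Rightarrow> ('h \<Rightarrow> 'c set) \<Rightarrow> bool"
where
  "equivalent_gradings scale mul G \<Gamma> H \<Delta> \<longleftrightarrow>
     (\<exists>\<psi>. alg_iso_on scale mul \<psi> UNIV UNIV \<and>
          bij_betw ((`) \<psi>) (components G \<Gamma>) (components H \<Delta>))"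

definition set_prod ::
  "('f::field \<Rightarrow> 'c::ab_group_add \<Rightarrow> 'c) \<Rightarrow> ('c \<Rightarrow> 'c \<Rightarrow> 'c) \<Rightarrow> 'c set \<Rightarrow> 'c set \<Rightarrow> 'c set"
where
  "set_prod scale mul A B = Modules.module.span scale {mul x y | x y. x \<in> A \<and> y \<in> B}"

definition universal_relators ::
  "('f::field \<Rightarrow> 'c::ab_group_add \<Rightarrow> 'c) \<Rightarrow> ('c \<Rightarrow> 'c \<Rightarrow> 'c) \<Rightarrow>
   ('g, 'm) monoid_scheme \<Rightarrow> ('g \<Rightarrow> 'c set) \<Rightarrow> ('g \<Rightarrow>\<^sub>0 int) set"
where
  "universal_relators scale mul G \<Gamma> =
     {frag_of s1 + frag_of s2 - frag_of s3 | s1 s2 s3.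
        s1 \<in> support G \<Gamma> \<and> s2 \<in> support G \<Gamma> \<and> s3 \<in> support G \<Gamma> \<and>
        set_prod scale mul (\<Gamma> s1) (\<Gamma> s2) \<noteq> {0} \<and> set_prod scale mul (\<Gamma> s1) (\<Gamma> s2) \<subseteq> \<Gamma> s3}"

definition universal_group ::
  "('f::field \<Rightarrow> 'c::ab_group_add \<Rightarrow> 'c) \<Rightarrow> ('c \<Rightarrow> 'c \<Rightarrow> 'c) \<Rightarrow>
   ('g, 'm) monoid_scheme \<Rightarrow> ('g \<Rightarrow> 'c set) \<Rightarrow> ('g \<Rightarrow>\<^sub>0 int) set monoid"
where
  "universal_group scale mul G \<Gamma> =
     free_Abelian_group (support G \<Gamma>) Mod
       generate (free_Abelian_group (support G \<Gamma>)) (universal_relators scale mul G \<Gamma>)"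

abbreviation Z_sq :: "(int \<times> int) monoid" where
  "Z_sq \<equiv> integer_group \<times>\<times> integer_group"

abbreviation Z2_sq :: "(int \<times> int) monoid" where
  "Z2_sq \<equiv> integer_mod_group 2 \<times>\<times> integer_mod_group 2"

abbreviation Z2_cube :: "(int \<times> int \<times> int) monoid" where
  "Z2_cube \<equiv> integer_mod_group 2 \<times>\<times> integer_mod_group 2 \<times>\<times> integer_mod_group 2"


section \<open>The Cartan grading\<close>

definition levi_civita :: "nat \<Rightarrow> nat \<Rightarrow> nat \<Rightarrow> 'f::field" where
  "levi_civita j k l =
     (if (j, k, l) \<in> {(1, 2, 3), (2, 3, 1), (3, 1, 2)} then 1
      else if (j, k, l) \<in> {(2, 1, 3), (3, 2, 1), (1, 3, 2)} then -1
      else 0)"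

definition split_basis ::
  "('f::field \<Rightarrow> 'c::ab_group_add \<Rightarrow> 'c) \<Rightarrow> ('c \<Rightarrow> 'c \<Rightarrow> 'c) \<Rightarrow>
   'c \<Rightarrow> 'c \<Rightarrow> (nat \<Rightarrow> 'c) \<Rightarrow> (nat \<Rightarrow> 'c) \<Rightarrow> bool"
where
  "split_basis scale mul e1 e2 u v \<longleftrightarrow>
     distinct [e1, e2, u 1, u 2, u 3, v 1, v 2, v 3] \<and>
     \<not> Modules.module.dependent scale {e1, e2, u 1, u 2, u 3, v 1, v 2, v 3} \<and>
     Modules.module.span scale {e1, e2, u 1, u 2, u 3, v 1, v 2, v 3} = UNIV \<and>
     mul e1 e1 = e1 \<and> mul e2 e2 = e2 \<and> mul e1 e2 = 0 \<and> mul e2 e1 = 0 \<and>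
     (\<forall>j\<in>{1,2,3}.
        mul e1 (u j) = u j \<and> mul (u j) e2 = u j \<and> mul e2 (v j) = v j \<and> mul (v j) e1 = v j \<and>
        mul e2 (u j) = 0 \<and> mul (u j) e1 = 0 \<and> mul e1 (v j) = 0 \<and> mul (v j) e2 = 0) \<and>
     (\<forall>j\<in>{1,2,3}. \<forall>k\<in>{1,2,3}.
        mul (u j) (u k) = (\<Sum>l\<in>{1,2,3}. scale (levi_civita j k l) (v l)) \<and>
        mul (v j) (v k) = (\<Sum>l\<in>{1,2,3}. scale (levi_civita j k l) (u l)) \<and>
        mul (u j) (v k) = (if j = k then - e1 else 0) \<and>
        mul (v j) (u k) = (if j = k then - e2 else 0))"

definition cartan_grading ::
  "('f::field \<Rightarrow> 'c::ab_group_add \<Rightarrow> 'c) \<Rightarrow> ('c \<Rightarrow> 'c \<Rightarrow> 'c) \<Rightarrow> (int \<times> int \<Rightarrow> 'c set) \<Rightarrow> bool"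
where
  "cartan_grading scale mul \<Gamma> \<longleftrightarrow>
     (\<exists>e1 e2 u v. split_basis scale mul e1 e2 u v \<and>
        \<Gamma> (0, 0) = Modules.module.span scale {e1, e2} \<and>
        \<Gamma> (1, 0) = Modules.module.span scale {u 1} \<and>
        \<Gamma> (-1, 0) = Modules.module.span scale {v 1} \<and>
        \<Gamma> (0, 1) = Modules.module.span scale {u 2} \<and>
        \<Gamma> (0, -1) = Modules.module.span scale {v 2} \<and>
        \<Gamma> (-1, -1) = Modules.module.span scale {u 3} \<and>
        \<Gamma> (1, 1) = Modules.module.span scale {v 3} \<and>
        (\<forall>g. g \<notin> {(0, 0), (1, 0), (-1, 0), (0, 1), (0, -1), (-1, -1), (1, 1)} \<longrightarrow> \<Gamma> g = {0}))"


section \<open>Quadratic separable subfields and admissible homomorphisms\<close>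

definition alg_poly ::
  "('f::field \<Rightarrow> 'c::ab_group_add \<Rightarrow> 'c) \<Rightarrow> ('c \<Rightarrow> 'c \<Rightarrow> 'c) \<Rightarrow> 'c \<Rightarrow> 'f poly \<Rightarrow> 'c \<Rightarrow> 'c"
where
  "alg_poly scale mul unit p x = (\<Sum>i\<le>degree p. scale (coeff p i) ((mul x ^^ i) unit))"

definition quadratic_separable_subfield ::
  "('f::field \<Rightarrow> 'c::ab_group_add \<Rightarrow> 'c) \<Rightarrow> ('c \<Rightarrow> 'c \<Rightarrow> 'c) \<Rightarrow> 'c \<Rightarrow> 'c set \<Rightarrow> bool"
where
  "quadratic_separable_subfield scale mul unit K \<longleftrightarrow>
     Modules.module.subspace scale K \<and> vector_space.dim scale K = 2 \<and> unit \<in> K \<and>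
     (\<forall>x\<in>K. \<forall>y\<in>K. mul x y \<in> K) \<and>
     (\<forall>x\<in>K. \<forall>y\<in>K. mul x y = mul y x) \<and>
     (\<forall>x\<in>K. \<forall>y\<in>K. \<forall>z\<in>K. mul (mul x y) z = mul x (mul y z)) \<and>
     (\<forall>x\<in>K. x \<noteq> 0 \<longrightarrow> (\<exists>y\<in>K. mul x y = unit)) \<and>
     (\<forall>x\<in>K. \<exists>p. coprime p (pderiv p) \<and> alg_poly scale mul unit p x = 0)"

definition field_units :: "'f::field monoid" where
  "field_units = \<lparr>carrier = UNIV - {0}, monoid.mult = (*), one = 1\<rparr>"

definition unit_squares :: "'f::field set" where
  "unit_squares = {x\<^sup>2 | x. x \<noteq> 0}"

definition isometric ::
  "('f::field \<Rightarrow> 'v::ab_group_add \<Rightarrow> 'v) \<Rightarrow> 'v set \<Rightarrow> ('v \<Rightarrow> 'f) \<Rightarrow>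
   ('f \<Rightarrow> 'w::ab_group_add \<Rightarrow> 'w) \<Rightarrow> 'w set \<Rightarrow> ('w \<Rightarrow> 'f) \<Rightarrow> bool"
where
  "isometric s1 V q1 s2 W q2 \<longleftrightarrow>
     (\<exists>f. bij_betw f V W \<and>
          (\<forall>x\<in>V. \<forall>y\<in>V. f (x + y) = f x + f y) \<and>
          (\<forall>a. \<forall>x\<in>V. f (s1 a x) = s2 a (f x)) \<and>
          (\<forall>x\<in>V. q2 (f x) = q1 x))"

text \<open>The orthogonal sum of the forms \<open>r t * q\<close>, \<open>t \<in> T\<close>, where \<open>q\<close> is a form on \<open>V\<close>: its space
  consists of the functions from \<open>T\<close> to \<open>V\<close>, extended by zero.\<close>

definition orth_space :: "'t set \<Rightarrow> 'v::zero set \<Rightarrow> ('t \<Rightarrow> 'v) set" where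
  "orth_space T V = {x. (\<forall>t\<in>T. x t \<in> V) \<and> (\<forall>t. t \<notin> T \<longrightarrow> x t = 0)}"

definition orth_scale :: "('f \<Rightarrow> 'v \<Rightarrow> 'v) \<Rightarrow> 'f \<Rightarrow> ('t \<Rightarrow> 'v) \<Rightarrow> ('t \<Rightarrow> 'v)" where
  "orth_scale s a x = (\<lambda>t. s a (x t))"

definition orth_form :: "'t set \<Rightarrow> ('t \<Rightarrow> 'f::field) \<Rightarrow> ('v \<Rightarrow> 'f) \<Rightarrow> ('t \<Rightarrow> 'v) \<Rightarrow> 'f" where
  "orth_form T r q x = (\<Sum>t\<in>T. r t * q (x t))"

text \<open>The value of \<open>\<mu>\<close> at \<open>t\<close> is a coset, so \<open>r t \<in> \<mu> t\<close> says that \<open>r t\<close> represents it. The choice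
  of the representatives \<open>r t\<close>, \<open>t \<noteq> \<one>\<close>, does not affect the isometry class.\<close>

definition admissible_quadratic ::
  "('f::field \<Rightarrow> 'c::ab_group_add \<Rightarrow> 'c) \<Rightarrow> ('c \<Rightarrow> 'f) \<Rightarrow>
   ('g, 'm) monoid_scheme \<Rightarrow> 'c set \<Rightarrow> 'g set \<Rightarrow> ('g \<Rightarrow> 'f set) \<Rightarrow> bool"
where
  "admissible_quadratic scale n G K T \<mu> \<longleftrightarrow>
     \<mu> \<in> hom (G\<lparr>carrier := T\<rparr>) (field_units Mod (n ` (K - {0}))) \<and>
     (\<exists>r. r \<one>\<^bsub>G\<^esub> = 1 \<and> (\<forall>t\<in>T. r t \<in> \<mu> t) \<and>
          isometric scale UNIV n (orth_scale scale) (orth_space T K) (orth_form T r n))"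

definition admissible_base ::
  "('f::field \<Rightarrow> 'c::ab_group_add \<Rightarrow> 'c) \<Rightarrow> ('c \<Rightarrow> 'f) \<Rightarrow>
   ('g, 'm) monoid_scheme \<Rightarrow> 'g set \<Rightarrow> ('g \<Rightarrow> 'f set) \<Rightarrow> bool"
where
  "admissible_base scale n G T \<mu> \<longleftrightarrow>
     \<mu> \<in> hom (G\<lparr>carrier := T\<rparr>) (field_units Mod unit_squares) \<and>
     (\<exists>r. r \<one>\<^bsub>G\<^esub> = 1 \<and> (\<forall>t\<in>T. r t \<in> \<mu> t) \<and>
          isometric scale UNIV n (orth_scale (*)) (orth_space T UNIV) (orth_form T r power2))"


section \<open>Gradings obtained from the Cayley--Dickson doubling process\<close>

definition elementary_2_subgroup :: "('g, 'm) monoid_scheme \<Rightarrow> 'g set \<Rightarrow> nat \<Rightarrow> bool" where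
  "elementary_2_subgroup G T m \<longleftrightarrow>
     subgroup T G \<and> card T = m \<and> (\<forall>t\<in>T. t \<otimes>\<^bsub>G\<^esub> t = \<one>\<^bsub>G\<^esub>)"

text \<open>The gradings \<open>\<Gamma>\<^sub>C(G, K, T, \<mu>)\<close> and \<open>\<Gamma>\<^sub>C(G, F, T, \<mu>)\<close> are only determined up to isomorphism
  by their parameters, so they are rendered as predicates on gradings.\<close>

definition Gamma_quadratic ::
  "('f::field \<Rightarrow> 'c::ab_group_add \<Rightarrow> 'c) \<Rightarrow> ('c \<Rightarrow> 'c \<Rightarrow> 'c) \<Rightarrow> ('c \<Rightarrow> 'f) \<Rightarrow>
   ('g, 'm) monoid_scheme \<Rightarrow> 'c set \<Rightarrow> 'g set \<Rightarrow> ('g \<Rightarrow> 'f set) \<Rightarrow> ('g \<Rightarrow> 'c set) \<Rightarrow> bool"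
where
  "Gamma_quadratic scale mul n G K T \<mu> \<Gamma> \<longleftrightarrow>
     elementary_2_subgroup G T 4 \<and>
     (\<exists>t1 t2 u v.
        T = {\<one>\<^bsub>G\<^esub>, t1, t2, t1 \<otimes>\<^bsub>G\<^esub> t2} \<and>
        n u \<noteq> 0 \<and> (\<forall>x\<in>K. polar n u x = 0) \<and> n u \<in> \<mu> t1 \<and>
        n v \<noteq> 0 \<and> (\<forall>x\<in>K. \<forall>y\<in>K. polar n v (x + mul y u) = 0) \<and> n v \<in> \<mu> t2 \<and>
        \<Gamma> \<one>\<^bsub>G\<^esub> = K \<and>
        \<Gamma> t1 = {mul x u | x. x \<in> K} \<and>
        \<Gamma> t2 = {mul x v | x. x \<in> K} \<and>
        \<Gamma> (t1 \<otimes>\<^bsub>G\<^esub> t2) = {mul x (mul u v) | x. x \<in> K} \<and>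
        (\<forall>g\<in>carrier G - T. \<Gamma> g = {0}))"

definition Gamma_base ::
  "('f::field \<Rightarrow> 'c::ab_group_add \<Rightarrow> 'c) \<Rightarrow> ('c \<Rightarrow> 'c \<Rightarrow> 'c) \<Rightarrow> 'c \<Rightarrow> ('c \<Rightarrow> 'f) \<Rightarrow>
   ('g, 'm) monoid_scheme \<Rightarrow> 'g set \<Rightarrow> ('g \<Rightarrow> 'f set) \<Rightarrow> ('g \<Rightarrow> 'c set) \<Rightarrow> bool"
where
  "Gamma_base scale mul unit n G T \<mu> \<Gamma> \<longleftrightarrow>
     elementary_2_subgroup G T 8 \<and>
     (\<exists>s1 s2 s3 u v w.
        {s1, s2, s3} \<subseteq> T \<and> generate G {s1, s2, s3} = T \<and>
        n u \<noteq> 0 \<and> polar n u unit = 0 \<and> n u \<in> \<mu> s1 \<and>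
        n v \<noteq> 0 \<and> (\<forall>x\<in>{unit, u}. polar n v x = 0) \<and> n v \<in> \<mu> s2 \<and>
        n w \<noteq> 0 \<and> (\<forall>x\<in>{unit, u, v, mul u v}. polar n w x = 0) \<and> n w \<in> \<mu> s3 \<and>
        \<Gamma> \<one>\<^bsub>G\<^esub> = Modules.module.span scale {unit} \<and>
        \<Gamma> s1 = Modules.module.span scale {u} \<and>
        \<Gamma> s2 = Modules.module.span scale {v} \<and>
        \<Gamma> (s1 \<otimes>\<^bsub>G\<^esub> s2) = Modules.module.span scale {mul u v} \<and>
        \<Gamma> s3 = Modules.module.span scale {w} \<and>
        \<Gamma> (s1 \<otimes>\<^bsub>G\<^esub> s3) = Modules.module.span scale {mul u w} \<and>
        \<Gamma> (s2 \<otimes>\<^bsub>G\<^esub> s3) = Modules.module.span scale {mul v w} \<and>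
        \<Gamma> (s1 \<otimes>\<^bsub>G\<^esub> s2 \<otimes>\<^bsub>G\<^esub> s3) = Modules.module.span scale {mul (mul u v) w} \<and>
        (\<forall>g\<in>carrier G - T. \<Gamma> g = {0}))"

end

theory Submission
  imports Defs
begin

text \<open>
  Why the list is complete. Every grading of a Cayley algebra interacts with the norm in the simplest
  possible way: the unit lies in \<open>C\<^sub>e\<close>, a homogeneous element outside \<open>C\<^sub>e\<close> has trace zero because it
  satisfies \<open>x\<^sup>2 = t(x) x - n(x) 1\<close>, and hence \<open>C\<^sub>g\<close> is orthogonal to \<open>C\<^sub>h\<close> unless \<open>g h = e\<close>
  (\<open>unit_homogeneous\<close>, \<open>trace_homogeneous\<close>, \<open>bil_homogeneous\<close>). This leaves two possibilities.

  If some homogeneous \<open>x \<noteq> 0\<close> is isotropic, a homogeneous \<open>y\<close> with \<open>\<langle>x, y\<rangle> = 1\<close> has the inverse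
  degree, and \<open>x cnj(y)\<close> is an idempotent of \<open>C\<^sub>e\<close>. Splitting orthogonal complements with it twice
  yields a canonical split basis made of homogeneous elements (\<open>homogeneous_split_frame\<close>), so the
  Cartan grading refines the given one; if that one is fine, the two have the same components
  (\<open>fine_isotropic\<close>). The trivial grading falls under this case when the norm is isotropic, which
  also gives the existence of the Cartan grading.

  If all nonzero homogeneous elements are anisotropic, they are invertible, and every element of the
  support has order at most 2. Homogeneous generators for the Cayley--Dickson doubling process can then be
  picked one after the other from orthogonal complements: three of them, starting from the ground field,
  if the characteristic is not 2, and two of them if it is 2, starting from a quadratic subfield of \<open>C\<^sub>e\<close>.
  There the ground field cannot serve as a start, because its polar form vanishes. The grading so obtained
  refines the given one (\<open>fine_anisotropic_char_not_2\<close>, \<open>fine_anisotropic_char_2\<close>).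

  The graded division algebras so obtained are rigid. The value of \<open>\<mu>\<close> at \<open>g\<close> is the set of norms of
  nonzero elements of \<open>C\<^sub>g\<close>, which makes \<open>\<mu>\<close> an invariant up to automorphisms of the group
  (\<open>norms_determined\<close>, \<open>division_equivalence_iso\<close>). Conversely, an isomorphism between two composition
  subalgebras extends to their doublings by generators of equal norm (\<open>dbl_extend\<close>); hence equal
  values of \<open>\<mu>\<close> on generators produce an automorphism of \<open>C\<close> carrying one grading to the other.

  For the existence of a grading with a prescribed admissible \<open>\<mu>\<close>, the isometry in the
  definition of admissibility supplies an orthogonal frame with the right norms, but its vectors need not be
  products of one another. They are moved into position by isometries fixing what is already in place:
  left multiplication by a conjugate takes the first vector to the unit, and explicit reflections do
  the rest (\<open>base_triple_exists\<close>, \<open>quadratic_pair_exists\<close>). These replace Witt's cancellation theorem.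

  Finally, fineness is checked against an arbitrary refinement (\<open>fine_gradingI\<close>): a line cannot be split,
  and the components of dimension 2 are held together by multiplication. The
  universal group is computed from a set-theoretic section of its canonical map onto the grading group
  that is additive modulo the relations (\<open>universal_group_iso\<close>).\<close>

section \<open>Composition identities\<close>

context cayley_algebra
begin

notation mul (infixl "\<star>" 70)
notation scale (infixr "\<cdot>" 75)

abbreviation bil :: "'c \<Rightarrow> 'c \<Rightarrow> 'f" ("\<langle>_, _\<rangle>") where
  "\<langle>x, y\<rangle> \<equiv> polar n x y"

definition cnj :: "'c \<Rightarrow> 'c" where
  "cnj x = \<langle>x, unit\<rangle> \<cdot> unit - x"

lemma bil_commute: "\<langle>x, y\<rangle> = \<langle>y, x\<rangle>"
  by (simp add: polar_def add.commute)

lemma bil_add_right: "\<langle>x, y + z\<rangle> = \<langle>x, y\<rangle> + \<langle>x, z\<rangle>"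
  using polar_add[of y z x] by (simp add: bil_commute)

lemma bil_scale_right: "\<langle>x, a \<cdot> y\<rangle> = a * \<langle>x, y\<rangle>"
  using polar_scale[of a y x] by (simp add: bil_commute)

lemma bil_zero [simp]: "\<langle>0, x\<rangle> = 0" "\<langle>x, 0\<rangle> = 0"
  using polar_scale[of 0 0 x] bil_scale_right[of x 0 0] by simp_all

lemma bil_minus: "\<langle>- x, y\<rangle> = - \<langle>x, y\<rangle>" "\<langle>x, - y\<rangle> = - \<langle>x, y\<rangle>"
  using polar_scale[of "-1" x y] bil_scale_right[of x "-1" y] by simp_all

lemma bil_diff: "\<langle>x - y, z\<rangle> = \<langle>x, z\<rangle> - \<langle>y, z\<rangle>" "\<langle>x, y - z\<rangle> = \<langle>x, y\<rangle> - \<langle>x, z\<rangle>"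
  using polar_add[of x "-y" z] bil_add_right[of x y "-z"] by (simp_all add: bil_minus)

lemma bil_sum: "\<langle>sum f I, z\<rangle> = (\<Sum>i\<in>I. \<langle>f i, z\<rangle>)"
  by (induction I rule: infinite_finite_induct) (simp_all add: polar_add)

lemmas bil_simps = polar_add bil_add_right polar_scale bil_scale_right bil_minus bil_diff

lemma norm_zero [simp]: "n 0 = 0"
  using norm_scale[of 0 0] by simp

lemma norm_add: "n (x + y) = n x + n y + \<langle>x, y\<rangle>"
  by (simp add: polar_def)

lemma norm_minus [simp]: "n (- x) = n x"
  using norm_scale[of "-1" x] by simp

lemma norm_diff: "n (x - y) = n x + n y - \<langle>x, y\<rangle>"
  using norm_add[of x "-y"] by (simp add: bil_minus)

lemma bil_self: "\<langle>x, x\<rangle> = 2 * n x"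
  using norm_scale[of 2 x] by (simp add: polar_def scale_left_distrib[of 1 1 x, simplified, symmetric] power2_eq_square)

lemma mult_zero [simp]: "0 \<star> x = 0" "x \<star> 0 = 0"
  using mult_scale_left[of 0 0 x] mult_scale_right[of x 0 0] by simp_all

lemma mult_minus [simp]: "(- x) \<star> y = - (x \<star> y)" "x \<star> (- y) = - (x \<star> y)"
  using mult_scale_left[of "-1" x y] mult_scale_right[of x "-1" y] by simp_all

lemma mult_diff_left: "(x - y) \<star> z = x \<star> z - y \<star> z"
  using mult_add_left[of x "-y" z] by simp

lemma mult_diff_right: "x \<star> (y - z) = x \<star> y - x \<star> z"
  using mult_add_right[of x y "-z"] by simp

lemma mult_sum_left: "sum f I \<star> z = (\<Sum>i\<in>I. f i \<star> z)"
  by (induction I rule: infinite_finite_induct) (simp_all add: mult_add_left)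

lemma mult_sum_right: "z \<star> sum f I = (\<Sum>i\<in>I. z \<star> f i)"
  by (induction I rule: infinite_finite_induct) (simp_all add: mult_add_right)

lemmas mult_simps = mult_add_left mult_add_right mult_diff_left mult_diff_right
  mult_scale_left mult_scale_right one_mult mult_one

lemma eq_if_bil_eq: "(\<And>z. \<langle>x, z\<rangle> = \<langle>y, z\<rangle>) \<Longrightarrow> x = y"
  using polar_nondegenerate[of "x - y"] by (simp add: bil_diff)

text \<open>Multiplicativity only gives \<open>n(1) n(x) = n(x)\<close>. A vanishing norm has a vanishing polar form and would
  force the algebra to be zero.\<close>

lemma norm_unit [simp]: "n unit = 1"
proof -
  have "\<exists>x::'c. n x \<noteq> 0"
  proof (rule ccontr)
    assume "\<nexists>x::'c. n x \<noteq> 0"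
    then have "x = 0" for x :: 'c using polar_nondegenerate[of x] by (simp add: polar_def)
    then have U: "(UNIV :: 'c set) = {0}" by auto
    have "dim (UNIV :: 'c set) = 0" unfolding U using dim_eq_card[of "{}" "{0}"] independent_empty by simp
    then show False using dim_eq_8 by simp
  qed
  then show ?thesis using norm_mult[of unit] by (metis mult_cancel_right1 one_mult)
qed

lemma unit_nonzero: "unit \<noteq> 0"
  using norm_unit norm_zero by (metis zero_neq_one)

lemma bil_unit_unit [simp]: "\<langle>unit, unit\<rangle> = 2"
  by (simp add: bil_self)

text \<open>Polarising \<open>n(x y) = n(x) n(y)\<close> in one variable at a time, and then in both, gives
  the identities from which everything else about the product follows.\<close>

lemma bil_mult_left: "\<langle>x \<star> y, x \<star> z\<rangle> = n x * \<langle>y, z\<rangle>"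
  using norm_mult[of x "y + z"] by (simp add: mult_add_right polar_def norm_mult algebra_simps)

lemma bil_mult_right: "\<langle>x \<star> y, z \<star> y\<rangle> = \<langle>x, z\<rangle> * n y"
  using norm_mult[of "x + z" y] by (simp add: mult_add_left polar_def norm_mult algebra_simps)

lemma bil_mult_mult: "\<langle>x \<star> y, w \<star> z\<rangle> + \<langle>x \<star> z, w \<star> y\<rangle> = \<langle>x, w\<rangle> * \<langle>y, z\<rangle>"
  using bil_mult_right[of x "y + z" w] bil_mult_right[of x y w] bil_mult_right[of x z w]
  by (simp add: mult_add_right bil_simps norm_add algebra_simps)

text \<open>The case \<open>w = 1\<close> of \<open>bil_mult_mult\<close>; multiplications by \<open>x\<close> and by its conjugate are adjoint.\<close>

lemma adjoint_left: "\<langle>x \<star> y, z\<rangle> = \<langle>y, cnj x \<star> z\<rangle>"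
  using bil_mult_mult[of x y unit z]
  by (simp add: cnj_def mult_simps bil_simps bil_commute[of y] algebra_simps)

lemma adjoint_right: "\<langle>x \<star> y, z\<rangle> = \<langle>x, z \<star> cnj y\<rangle>"
  using bil_mult_mult[of x y z unit]
  by (simp add: cnj_def mult_simps bil_simps bil_commute[of unit y] algebra_simps)

lemma cnj_unit [simp]: "cnj unit = unit"
  by (simp add: cnj_def scale_left_distrib[of 1 1 unit, simplified])

lemma cnj_add: "cnj (x + y) = cnj x + cnj y"
  by (simp add: cnj_def bil_simps scale_left_distrib)

lemma cnj_minus: "cnj (- x) = - cnj x"
  by (simp add: cnj_def bil_simps)

lemma cnj_zero [simp]: "cnj 0 = 0" by (simp add: cnj_def)

lemma bil_cnj_unit [simp]: "\<langle>cnj x, unit\<rangle> = \<langle>x, unit\<rangle>"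
  by (simp add: cnj_def bil_simps)

lemma cnj_cnj [simp]: "cnj (cnj x) = x"
  using bil_cnj_unit[of x] unfolding cnj_def[of "cnj x"] by (simp add: cnj_def)

lemma norm_cnj [simp]: "n (cnj x) = n x"
  by (simp add: cnj_def norm_diff norm_scale bil_simps bil_commute[of unit x] power2_eq_square)

text \<open>The substitute for associativity: together with its mirror image and their linearisations
  it is the only way in which products are reassociated below.\<close>

lemma cnj_mult_mult: "cnj x \<star> (x \<star> y) = n x \<cdot> y"
proof (rule eq_if_bil_eq)
  fix z
  have "\<langle>cnj x \<star> (x \<star> y), z\<rangle> = \<langle>x \<star> y, x \<star> z\<rangle>" by (simp add: adjoint_left[of "cnj x"])
  then show "\<langle>cnj x \<star> (x \<star> y), z\<rangle> = \<langle>n x \<cdot> y, z\<rangle>" by (simp add: bil_mult_left bil_simps)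
qed

lemma mult_mult_cnj: "(y \<star> x) \<star> cnj x = n x \<cdot> y"
proof (rule eq_if_bil_eq)
  fix z
  have "\<langle>(y \<star> x) \<star> cnj x, z\<rangle> = \<langle>y \<star> x, z \<star> x\<rangle>" by (simp add: adjoint_right[of _ "cnj x"])
  then show "\<langle>(y \<star> x) \<star> cnj x, z\<rangle> = \<langle>n x \<cdot> y, z\<rangle>" by (simp add: bil_mult_right bil_simps)
qed

lemma cnj_mult_mult_linear: "cnj x \<star> (z \<star> y) + cnj z \<star> (x \<star> y) = \<langle>x, z\<rangle> \<cdot> y"
  using cnj_mult_mult[of "x + z" y] cnj_mult_mult[of x y] cnj_mult_mult[of z y]
  by (simp add: cnj_add mult_simps norm_add scale_left_distrib algebra_simps)

lemma mult_mult_cnj_linear: "(y \<star> x) \<star> cnj z + (y \<star> z) \<star> cnj x = \<langle>x, z\<rangle> \<cdot> y"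
  using mult_mult_cnj[of y "x + z"] mult_mult_cnj[of y x] mult_mult_cnj[of y z]
  by (simp add: cnj_add mult_simps norm_add scale_left_distrib algebra_simps)

lemma cnj_mult_self: "cnj x \<star> x = n x \<cdot> unit"
  using cnj_mult_mult[of x unit] by (simp add: mult_one)

lemma mult_cnj_self: "x \<star> cnj x = n x \<cdot> unit"
  using mult_mult_cnj[of unit x] by (simp add: one_mult)

lemma square_eq: "x \<star> x = \<langle>x, unit\<rangle> \<cdot> x - n x \<cdot> unit"
  using cnj_mult_self[of x] by (simp add: cnj_def mult_simps algebra_simps)

lemma trace_mult_cnj: "\<langle>x \<star> cnj y, unit\<rangle> = \<langle>x, y\<rangle>"
  by (simp add: adjoint_right one_mult)

lemma trace_cnj_mult: "\<langle>cnj x \<star> y, unit\<rangle> = \<langle>x, y\<rangle>"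
  by (metis adjoint_left bil_commute cnj_cnj mult_one)

lemma cnj_mult: "cnj (x \<star> y) = cnj y \<star> cnj x"
proof (rule eq_if_bil_eq)
  have tr: "\<langle>a, b\<rangle> = \<langle>cnj a \<star> b, unit\<rangle>" for a b by (simp add: trace_cnj_mult)
  have c: "\<langle>cnj a, b\<rangle> = \<langle>a, cnj b\<rangle>" for a b by (simp add: cnj_def bil_simps bil_commute)
  fix z
  have "\<langle>cnj (x \<star> y), z\<rangle> = \<langle>x \<star> y, cnj z\<rangle>" by (rule c)
  also have "\<dots> = \<langle>y, cnj x \<star> cnj z\<rangle>" by (rule adjoint_left)
  also have "\<dots> = \<langle>cnj x \<star> cnj z, y\<rangle>" by (rule bil_commute)
  also have "\<dots> = \<langle>cnj x, y \<star> z\<rangle>" by (simp add: adjoint_right[of "cnj x"])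
  also have "\<dots> = \<langle>cnj y \<star> cnj x, z\<rangle>" by (simp add: adjoint_left[of "cnj y"])
  finally show "\<langle>cnj (x \<star> y), z\<rangle> = \<langle>cnj y \<star> cnj x, z\<rangle>" .
qed

text \<open>Anisotropic elements are invertible; in general the algebra has zero divisors.\<close>

lemma mult_eq_zero_iff: assumes "n x \<noteq> 0" shows "x \<star> y = 0 \<longleftrightarrow> y = 0" "y \<star> x = 0 \<longleftrightarrow> y = 0"
  using cnj_mult_mult[of x y] mult_mult_cnj[of y x] assms by auto

lemma norm_sum_orthogonal:
  assumes "finite I" "\<And>i j. i \<in> I \<Longrightarrow> j \<in> I \<Longrightarrow> i \<noteq> j \<Longrightarrow> \<langle>f i, f j\<rangle> = 0"
  shows "n (sum f I) = (\<Sum>i\<in>I. n (f i))"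
  using assms
proof (induction I)
  case (insert i I)
  have "\<langle>f i, sum f I\<rangle> = 0"
    unfolding bil_commute[of "f i"] bil_sum by (rule sum.neutral) (use insert in auto)
  then show ?case using insert by (simp add: norm_add)
qed simp

section \<open>Composition subalgebras and Cayley--Dickson doubling\<close>

definition perp :: "'c set \<Rightarrow> 'c set" where
  "perp A = {x. \<forall>a\<in>A. \<langle>x, a\<rangle> = 0}"

text \<open>The last condition says that \<open>C = A \<oplus> A\<^sup>\<bottom>\<close>; it expresses that the polar form is
  nondegenerate on \<open>A\<close> in the form in which it is used, and it passes to doublings.\<close>

definition comp_subalgebra :: "'c set \<Rightarrow> bool" where
  "comp_subalgebra A \<longleftrightarrow> subspace A \<and> unit \<in> A \<and> (\<forall>x\<in>A. \<forall>y\<in>A. x \<star> y \<in> A) \<and>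
     (\<forall>x. \<exists>a\<in>A. x - a \<in> perp A)"

definition dbl :: "'c set \<Rightarrow> 'c \<Rightarrow> 'c set" where
  "dbl A u = {a + b \<star> u | a b. a \<in> A \<and> b \<in> A}"

lemma dblI: "a \<in> A \<Longrightarrow> b \<in> A \<Longrightarrow> a + b \<star> u \<in> dbl A u"
  by (auto simp: dbl_def)

lemma dblE: assumes "x \<in> dbl A u" obtains a b where "a \<in> A" "b \<in> A" "x = a + b \<star> u"
  using assms by (auto simp: dbl_def)

lemma comp_subalgebraD:
  assumes "comp_subalgebra A"
  shows "subspace A" "unit \<in> A" "\<And>x y. x \<in> A \<Longrightarrow> y \<in> A \<Longrightarrow> x \<star> y \<in> A"
    "\<And>x. x \<in> A \<Longrightarrow> cnj x \<in> A" "0 \<in> A" "\<And>x y. x \<in> A \<Longrightarrow> y \<in> A \<Longrightarrow> x + y \<in> A"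
    "\<And>x y. x \<in> A \<Longrightarrow> y \<in> A \<Longrightarrow> x - y \<in> A" "\<And>a x. x \<in> A \<Longrightarrow> a \<cdot> x \<in> A" "\<And>x. x \<in> A \<Longrightarrow> - x \<in> A"
  using assms unfolding comp_subalgebra_def cnj_def
  by (auto intro: subspace_0 subspace_add subspace_diff subspace_scale subspace_neg)

lemma comp_subalgebra_proj:
  assumes "comp_subalgebra A" obtains a where "a \<in> A" "x - a \<in> perp A"
  using assms unfolding comp_subalgebra_def by blast

lemma perpD: "x \<in> perp A \<Longrightarrow> a \<in> A \<Longrightarrow> \<langle>x, a\<rangle> = 0" "x \<in> perp A \<Longrightarrow> a \<in> A \<Longrightarrow> \<langle>a, x\<rangle> = 0"
  by (simp_all add: perp_def bil_commute[of a])

lemma subspace_perp: "subspace (perp A)"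
  by (auto simp: subspace_def perp_def bil_simps)

lemma perp_span: "perp (span A) = perp A"
proof
  show "perp A \<subseteq> perp (span A)"
  proof
    fix x assume x: "x \<in> perp A"
    have "subspace {a. \<langle>x, a\<rangle> = 0}" by (auto simp: subspace_def bil_simps)
    then have "span A \<subseteq> {a. \<langle>x, a\<rangle> = 0}" by (intro span_minimal) (use x in \<open>auto simp: perp_def\<close>)
    then show "x \<in> perp (span A)" by (auto simp: perp_def)
  qed
qed (auto simp: perp_def intro: span_base)

lemma comp_subalgebra_inter_perp:
  assumes "comp_subalgebra A" "x \<in> A" "x \<in> perp A" shows "x = 0"
proof (rule polar_nondegenerate)
  fix y
  obtain a where a: "a \<in> A" "y - a \<in> perp A" by (rule comp_subalgebra_proj[OF assms(1)])
  have "\<langle>x, y\<rangle> = \<langle>x, y - a\<rangle> + \<langle>x, a\<rangle>" by (simp add: bil_simps)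
  then show "\<langle>x, y\<rangle> = 0" using assms a by (simp add: perpD)
qed

text \<open>The polar form is nondegenerate on \<open>A\<^sup>\<bottom>\<close>, so the norm cannot vanish there identically.\<close>

lemma comp_subalgebra_perp_anisotropic:
  assumes A: "comp_subalgebra A" "A \<noteq> UNIV"
  obtains u where "u \<in> perp A" "n u \<noteq> 0"
proof -
  have "\<exists>u\<in>perp A. n u \<noteq> 0"
  proof (rule ccontr)
    assume "\<not> ?thesis"
    then have n0: "n u = 0" if "u \<in> perp A" for u using that by blast
    have z: "u = 0" if u: "u \<in> perp A" for u
    proof (rule polar_nondegenerate)
      fix y
      obtain a where a: "a \<in> A" "y - a \<in> perp A" by (rule comp_subalgebra_proj[OF A(1)])
      have "\<langle>u, y - a\<rangle> = 0"
        using n0[OF u] n0[OF a(2)] n0[OF subspace_add[OF subspace_perp u a(2)]] by (simp add: polar_def)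
      then show "\<langle>u, y\<rangle> = 0" using perpD(1)[OF u a(1)] by (simp add: bil_simps)
    qed
    have "x \<in> A" for x
    proof -
      obtain a where a: "a \<in> A" "x - a \<in> perp A" by (rule comp_subalgebra_proj[OF A(1)])
      then show ?thesis using z[of "x - a"] by simp
    qed
    then show False using A(2) by blast
  qed
  then show thesis using that by blast
qed

text \<open>The doubling \<open>A \<oplus> A u\<close>. Its three product formulas come from the linearised identities above:
  since \<open>u\<close> is orthogonal to \<open>A\<close>, the scalar terms drop out, and every conjugate of an element
  of \<open>A u\<close> is its negative.\<close>

context
  fixes A u
  assumes A: "comp_subalgebra A" and u: "u \<in> perp A" and nu: "n u \<noteq> 0"
begin

private lemma perp_cnj: "cnj u = - u"
  using perpD(1)[OF u comp_subalgebraD(2)[OF A]] by (simp add: cnj_def)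

lemma dbl_bil: assumes "a \<in> A" "b \<in> A" shows "\<langle>a, b \<star> u\<rangle> = 0" "\<langle>b \<star> u, a\<rangle> = 0"
proof -
  have "\<langle>b \<star> u, a\<rangle> = \<langle>u, cnj b \<star> a\<rangle>" by (rule adjoint_left)
  then show "\<langle>b \<star> u, a\<rangle> = 0" using perpD(1)[OF u] assms comp_subalgebraD(3,4)[OF A] by simp
  then show "\<langle>a, b \<star> u\<rangle> = 0" by (simp add: bil_commute)
qed

lemma cnj_dbl: assumes "b \<in> A" shows "cnj (b \<star> u) = - (b \<star> u)"
  using dbl_bil(2)[OF comp_subalgebraD(2)[OF A] assms] by (simp add: cnj_def)

lemma mult_u_commute: assumes "b \<in> A" shows "u \<star> b = cnj b \<star> u"
proof -
  have "cnj (cnj b \<star> u) = cnj u \<star> b" by (simp add: cnj_mult)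
  then show ?thesis using cnj_dbl[OF comp_subalgebraD(4)[OF A assms]] by (simp add: perp_cnj)
qed

lemma dbl_mult_1: assumes "a \<in> A" "b \<in> A" shows "a \<star> (b \<star> u) = (b \<star> a) \<star> u"
proof -
  have "a \<star> (u \<star> cnj b) - u \<star> (cnj a \<star> cnj b) = \<langle>cnj a, u\<rangle> \<cdot> cnj b"
    using cnj_mult_mult_linear[of "cnj a" u "cnj b"] by (simp add: perp_cnj)
  also have "\<langle>cnj a, u\<rangle> = 0" using perpD(2)[OF u] comp_subalgebraD(4)[OF A] assms by simp
  finally show ?thesis
    using mult_u_commute[of "cnj b"] mult_u_commute[of "cnj a \<star> cnj b"] assms comp_subalgebraD(3,4)[OF A]
    by (simp add: cnj_mult)
qed

lemma dbl_mult_2: assumes "a \<in> A" "b \<in> A" shows "(a \<star> u) \<star> b = (a \<star> cnj b) \<star> u"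
  using mult_mult_cnj_linear[of a u "cnj b"] perpD(1)[OF u comp_subalgebraD(4)[OF A assms(2)]]
  by (simp add: perp_cnj)

lemma dbl_mult_3: assumes "a \<in> A" "b \<in> A" shows "(a \<star> u) \<star> (b \<star> u) = - (n u \<cdot> (cnj b \<star> a))"
proof -
  have 1: "(a \<star> u) \<star> u = - (n u \<cdot> a)" using mult_mult_cnj[of a u] by (simp add: perp_cnj minus_equation_iff)
  have "\<langle>a \<star> u, b\<rangle> = 0" using dbl_bil(2)[of b a] assms by simp
  then show ?thesis
    using cnj_mult_mult_linear[of "- (a \<star> u)" b u] cnj_dbl[OF assms(1)]
    by (simp add: cnj_minus 1 mult_scale_right bil_simps eq_neg_iff_add_eq_0)
qed

lemma dbl_mult: assumes "a \<in> A" "b \<in> A" "c \<in> A" "d \<in> A"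
  shows "(a + b \<star> u) \<star> (c + d \<star> u) = (a \<star> c - n u \<cdot> (cnj d \<star> b)) + (d \<star> a + b \<star> cnj c) \<star> u"
  using assms by (simp add: mult_add_left mult_add_right dbl_mult_1 dbl_mult_2 dbl_mult_3 algebra_simps)

lemma dbl_unique: assumes "a \<in> A" "b \<in> A" "c \<in> A" "d \<in> A" "a + b \<star> u = c + d \<star> u"
  shows "a = c" "b = d"
proof -
  have 1: "a - c = (d - b) \<star> u" using assms(5) by (simp add: mult_diff_left algebra_simps)
  have "a - c = 0"
  proof (rule comp_subalgebra_inter_perp[OF A])
    show "a - c \<in> A" using assms comp_subalgebraD(7)[OF A] by simp
    show "a - c \<in> perp A" unfolding 1 perp_def
      using dbl_bil(2)[of _ "d - b"] assms comp_subalgebraD(7)[OF A] by simp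
  qed
  then show "a = c" "b = d" using 1 mult_eq_zero_iff(2)[OF nu, of "d - b"] by simp_all
qed

lemma dbl_base: "A \<subseteq> dbl A u" "u \<in> dbl A u" "b \<in> A \<Longrightarrow> b \<star> u \<in> dbl A u"
proof -
  note D = comp_subalgebraD[OF A]
  have "a + 0 \<star> u \<in> dbl A u" if "a \<in> A" for a unfolding dbl_def using that D(5) by blast
  then show "A \<subseteq> dbl A u" by auto
  have *: "0 + b \<star> u \<in> dbl A u" if "b \<in> A" for b unfolding dbl_def using that D(5) by blast
  then show "b \<in> A \<Longrightarrow> b \<star> u \<in> dbl A u" by auto
  show "u \<in> dbl A u" using *[OF D(2)] by (simp add: one_mult)
qed

lemma comp_subalgebra_dbl: "comp_subalgebra (dbl A u)"
  unfolding comp_subalgebra_def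
proof (intro conjI ballI allI)
  note D = comp_subalgebraD[OF A]
  show "subspace (dbl A u)"
    unfolding subspace_def
  proof (intro conjI ballI allI)
    show "0 \<in> dbl A u" using dbl_base(1) D(5) by blast
    fix x y assume "x \<in> dbl A u" "y \<in> dbl A u"
    then obtain a b c d where "a \<in> A" "b \<in> A" "c \<in> A" "d \<in> A" "x = a + b \<star> u" "y = c + d \<star> u"
      by (auto simp: dbl_def)
    then have "x + y = (a + c) + (b + d) \<star> u" "a + c \<in> A" "b + d \<in> A"
      by (auto simp: mult_add_left algebra_simps D)
    then show "x + y \<in> dbl A u" unfolding dbl_def by blast
  next
    fix t x assume "x \<in> dbl A u"
    then obtain a b where "a \<in> A" "b \<in> A" "x = a + b \<star> u"
      by (auto simp: dbl_def)
    then have "t \<cdot> x = t \<cdot> a + (t \<cdot> b) \<star> u" "t \<cdot> a \<in> A" "t \<cdot> b \<in> A"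
      by (auto simp: mult_scale_left scale_right_distrib D)
    then show "t \<cdot> x \<in> dbl A u" unfolding dbl_def by blast
  qed
  show "unit \<in> dbl A u" using dbl_base D by blast
  fix x y assume "x \<in> dbl A u" "y \<in> dbl A u"
  then obtain a b c d where "a \<in> A" "b \<in> A" "c \<in> A" "d \<in> A" "x = a + b \<star> u" "y = c + d \<star> u"
    by (auto simp: dbl_def)
  then have "x \<star> y = (a \<star> c - n u \<cdot> (cnj d \<star> b)) + (d \<star> a + b \<star> cnj c) \<star> u"
    "a \<star> c - n u \<cdot> (cnj d \<star> b) \<in> A" "d \<star> a + b \<star> cnj c \<in> A"
    by (auto simp: dbl_mult D)
  then show "x \<star> y \<in> dbl A u" unfolding dbl_def by blast
next
  note D = comp_subalgebraD[OF A]
  fix x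
  obtain a where a: "a \<in> A" "x - a \<in> perp A" by (rule comp_subalgebra_proj[OF A])
  \<comment> \<open>the coordinate along \<open>A u\<close> is \<open>n(u)\<inverse>\<close> times the projection of \<open>x cnj(u)\<close>, as right
      multiplication by \<open>cnj u\<close> is adjoint to the one by \<open>u\<close>\<close>
  obtain b where b: "b \<in> A" "x \<star> cnj u - b \<in> perp A" by (rule comp_subalgebra_proj[OF A])
  define b' where "b' = inverse (n u) \<cdot> b"
  have b': "b' \<in> A" "n u \<cdot> b' = b" using b nu by (auto simp: b'_def D)
  have "x - (a + b' \<star> u) \<in> perp (dbl A u)"
    unfolding perp_def
  proof (intro CollectI ballI)
    fix z assume "z \<in> dbl A u"
    then obtain c d where z: "c \<in> A" "d \<in> A" "z = c + d \<star> u" by (auto simp: dbl_def)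
    have "\<langle>x - (a + b' \<star> u), c\<rangle> = \<langle>x - a, c\<rangle> - \<langle>b' \<star> u, c\<rangle>" by (simp add: bil_simps)
    also have "\<dots> = 0" using perpD(1)[OF a(2) z(1)] dbl_bil(2)[OF z(1) b'(1)] by simp
    finally have 1: "\<langle>x - (a + b' \<star> u), c\<rangle> = 0" .
    have "\<langle>x - (a + b' \<star> u), d \<star> u\<rangle> = \<langle>x, d \<star> u\<rangle> - \<langle>b' \<star> u, d \<star> u\<rangle>"
      using dbl_bil(1)[OF a(1) z(2)] by (simp add: bil_simps)
    also have "\<langle>x, d \<star> u\<rangle> = \<langle>x \<star> cnj u, d\<rangle>" using adjoint_right[of d u x] by (simp add: bil_commute)
    also have "\<langle>b' \<star> u, d \<star> u\<rangle> = \<langle>b, d\<rangle>" by (simp add: bil_mult_right b'_def bil_simps nu)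
    also have "\<langle>x \<star> cnj u, d\<rangle> - \<langle>b, d\<rangle> = 0" using perpD(1)[OF b(2) z(2)] by (simp add: bil_simps)
    finally have "\<langle>x - (a + b' \<star> u), d \<star> u\<rangle> = 0" .
    then show "\<langle>x - (a + b' \<star> u), z\<rangle> = 0" using 1 by (simp add: z bil_add_right)
  qed
  moreover have "a + b' \<star> u \<in> dbl A u" using a b' by (auto simp: dbl_def)
  ultimately show "\<exists>a\<in>dbl A u. x - a \<in> perp (dbl A u)" by blast
qed

end

lemma independent_Un_direct:
  assumes "subspace S" "subspace T" "S \<inter> T = {0}" "B \<subseteq> S" "C \<subseteq> T" "independent B" "independent C"
  shows "independent (B \<union> C)" "B \<inter> C = {}"
proof -
  have "0 \<notin> B" using dependent_zero assms(6) by blast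
  moreover have "B \<inter> C \<subseteq> {0}" using assms(3-5) by blast
  ultimately show d: "B \<inter> C = {}" by blast
  show "independent (B \<union> C)"
    unfolding independent_explicit_module
  proof (intro allI impI)
    fix t f v assume t: "finite t" "t \<subseteq> B \<union> C" "(\<Sum>v\<in>t. f v \<cdot> v) = 0" "v \<in> t"
    let ?s = "\<lambda>X. \<Sum>v\<in>t \<inter> X. f v \<cdot> v"
    have "t = (t \<inter> B) \<union> (t \<inter> C)" using t by blast
    then have "(\<Sum>v\<in>t. f v \<cdot> v) = ?s B + ?s C"
      using sum.union_disjoint[of "t \<inter> B" "t \<inter> C" "\<lambda>v. f v \<cdot> v"] d t(1) by auto
    then have e: "?s B = - ?s C" using t(3) by (simp add: eq_neg_iff_add_eq_0)
    have "?s B \<in> S" by (intro subspace_sum subspace_scale assms) (use assms in auto)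
    moreover have "- ?s C \<in> T" by (intro subspace_neg subspace_sum subspace_scale assms) (use assms in auto)
    then have "?s B \<in> T" by (simp only: e)
    ultimately have "?s B \<in> S \<inter> T" by (rule IntI)
    then have sB: "?s B = 0" by (simp only: assms(3) singleton_iff)
    then have sC: "?s C = 0" using e by simp
    show "f v = 0"
      using assms(6)[unfolded independent_explicit_module, rule_format, of "t \<inter> B" f v, OF _ _ sB]
        assms(7)[unfolded independent_explicit_module, rule_format, of "t \<inter> C" f v, OF _ _ sC] t by blast
  qed
qed

text \<open>Right multiplication by the anisotropic \<open>u\<close> is injective and \<open>A\<close> meets \<open>A u\<close> trivially. This serves to
  recognise when a tower of doublings has reached dimension 8, the whole algebra.\<close>

lemma dbl_independent:
  assumes A: "comp_subalgebra A" and u: "u \<in> perp A" and nu: "n u \<noteq> 0"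
    and B: "finite B" "B \<subseteq> A" "independent B"
  shows "\<exists>B'. finite B' \<and> B' \<subseteq> dbl A u \<and> independent B' \<and> card B' = 2 * card B"
proof -
  note D = comp_subalgebraD[OF A]
  let ?f = "\<lambda>b. b \<star> u"
  interpret vector_space_pair scale scale by unfold_locales
  have lin: "Vector_Spaces.linear scale scale ?f"
    by unfold_locales (auto simp: mult_simps)
  have inj: "inj ?f"
    using mult_eq_zero_iff(2)[OF nu] by (intro injI) (metis eq_iff_diff_eq_0 mult_diff_left)
  have iC: "independent (?f ` B)"
    by (rule linear_independent_injective_image[OF lin B(3)]) (use inj inj_on_subset in blast)
  have S: "subspace (?f ` A)"
    by (rule linear_subspace_image[OF lin D(1)])
  have z: "A \<inter> ?f ` A = {0}"
  proof -
    have "x = 0" if "x \<in> A" "x = b \<star> u" "b \<in> A" for x b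
      using dbl_unique[OF A u nu, of x 0 0 b] that D(5) by simp
    moreover have "0 \<in> ?f ` A" using D(5) by (intro image_eqI[of _ _ 0]) auto
    ultimately show ?thesis using D(5) by auto
  qed
  note I = independent_Un_direct[OF D(1) S z B(2) image_mono[OF B(2)] B(3) iC]
  have "card (B \<union> ?f ` B) = 2 * card B"
    using card_Un_disjoint[OF B(1) finite_imageI[OF B(1), of ?f] I(2)] card_image[OF inj_on_subset[OF inj, of B]] by simp
  moreover have "B \<union> ?f ` B \<subseteq> dbl A u" using dbl_base[OF A u nu] B by auto
  ultimately show ?thesis using I(1) B(1) by (intro exI[of _ "B \<union> ?f ` B"]) auto
qed

lemma finite_dimensional:
  obtains B where "finite_dimensional_vector_space scale B"
proof -
  obtain B where B: "independent B" "UNIV \<subseteq> span B" "card B = 8"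
    using basis_exists[of UNIV] dim_eq_8 by metis
  moreover have "finite B" using B(3) by (intro card_ge_0_finite) simp
  ultimately have "finite_dimensional_vector_space scale B" by unfold_locales auto
  then show thesis by (rule that)
qed

lemma independent_spans_subspace:
  assumes "independent B" "B \<subseteq> V" "card B = dim V" "subspace V" shows "span B = V"
proof -
  obtain B0 where "finite_dimensional_vector_space scale B0" by (rule finite_dimensional)
  then interpret fd: finite_dimensional_vector_space scale B0 .
  have "V \<subseteq> span B" by (rule fd.card_ge_dim_independent[OF assms(2,1)]) (simp add: assms(3))
  then show ?thesis using span_minimal[OF assms(2,4)] by blast
qed

lemma independent_8_spans: "independent B \<Longrightarrow> card B = 8 \<Longrightarrow> span B = UNIV"
  by (rule independent_spans_subspace) (simp_all add: dim_eq_8 subspace_UNIV)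

lemma spanning_8_independent:
  assumes "span B = UNIV" "card B = 8" shows "independent B"
proof -
  obtain B0 where "finite_dimensional_vector_space scale B0" by (rule finite_dimensional)
  then interpret fd: finite_dimensional_vector_space scale B0 .
  have "finite B" using assms(2) by (intro card_ge_0_finite) simp
  moreover have "card B = dim (UNIV :: 'c set)" unfolding dim_eq_8 by (rule assms(2))
  ultimately show ?thesis using fd.card_eq_dim[OF subset_UNIV] assms(1) by blast
qed

section \<open>Extending isomorphisms to doublings\<close>

lemma alg_iso_onD:
  assumes "alg_iso_on scale mul \<sigma> A B"
  shows "bij_betw \<sigma> A B" "\<And>x y. x \<in> A \<Longrightarrow> y \<in> A \<Longrightarrow> \<sigma> (x + y) = \<sigma> x + \<sigma> y"
    "\<And>a x. x \<in> A \<Longrightarrow> \<sigma> (a \<cdot> x) = a \<cdot> \<sigma> x" "\<And>x y. x \<in> A \<Longrightarrow> y \<in> A \<Longrightarrow> \<sigma> (x \<star> y) = \<sigma> x \<star> \<sigma> y"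
    "\<And>x. x \<in> A \<Longrightarrow> \<sigma> x \<in> B"
  using assms unfolding alg_iso_on_def by (auto simp: bij_betw_apply)

lemma alg_iso_on_diff:
  assumes "alg_iso_on scale mul \<sigma> A B" "subspace A" "x \<in> A" "y \<in> A"
  shows "\<sigma> (x - y) = \<sigma> x - \<sigma> y" "\<sigma> 0 = 0"
proof -
  have "\<sigma> (x + (-1) \<cdot> y) = \<sigma> x + (-1) \<cdot> \<sigma> y"
    using alg_iso_onD[OF assms(1)] assms subspace_scale by metis
  then show "\<sigma> (x - y) = \<sigma> x - \<sigma> y" by simp
  show "\<sigma> 0 = 0" using alg_iso_onD(3)[OF assms(1,3), of 0] by simp
qed

lemma alg_iso_on_unit:
  assumes "alg_iso_on scale mul \<sigma> A B" "unit \<in> A" "unit \<in> B"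
  shows "\<sigma> unit = unit"
proof -
  obtain x where "x \<in> A" "\<sigma> x = unit" using alg_iso_onD(1)[OF assms(1)] assms(3)
    by (metis bij_betw_imp_surj_on imageE)
  then show ?thesis using alg_iso_onD(4)[OF assms(1,2), of x] by (simp add: one_mult mult_one)
qed

text \<open>Trace and norm are the coefficients of the quadratic equation \<open>x\<^sup>2 = t(x) x - n(x) 1\<close>, which
  determines them unless \<open>x\<close> is a scalar. So a mere algebra isomorphism is already an isometry.\<close>

lemma alg_iso_on_norm:
  assumes iso: "alg_iso_on scale mul \<sigma> A B" and A: "subspace A" "unit \<in> A" "unit \<in> B" and x: "x \<in> A"
  shows "n (\<sigma> x) = n x"
proof -
  note I = alg_iso_onD[OF iso] and U = alg_iso_on_unit[OF iso A(2,3)]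
  show ?thesis
  proof (cases "\<exists>c. x = c \<cdot> unit")
    case True
    then show ?thesis using I(3)[OF A(2)] U by (auto simp: norm_scale)
  next
    case False
    have ns: "\<sigma> x \<noteq> c \<cdot> unit" for c
    proof
      assume "\<sigma> x = c \<cdot> unit"
      then have "\<sigma> x = \<sigma> (c \<cdot> unit)" using I(3)[OF A(2)] U by simp
      then show False using False I(1) x A subspace_scale[OF A(1,2)]
        by (metis bij_betw_imp_inj_on inj_onD)
    qed
    have sx: "t \<cdot> x \<in> A" "t \<cdot> unit \<in> A" for t using x A subspace_scale by auto
    have "\<sigma> (x \<star> x) = \<langle>x, unit\<rangle> \<cdot> \<sigma> x - n x \<cdot> unit"
      unfolding square_eq using alg_iso_on_diff(1)[OF iso A(1) sx] I(3)[OF x] I(3)[OF A(2)] U by simp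
    moreover have "\<sigma> (x \<star> x) = \<langle>\<sigma> x, unit\<rangle> \<cdot> \<sigma> x - n (\<sigma> x) \<cdot> unit"
      using I(4)[OF x x] square_eq[of "\<sigma> x"] by simp
    ultimately have e: "(\<langle>x, unit\<rangle> - \<langle>\<sigma> x, unit\<rangle>) \<cdot> \<sigma> x = (n x - n (\<sigma> x)) \<cdot> unit"
      by (simp add: scale_left_diff_distrib algebra_simps)
    have "\<langle>x, unit\<rangle> = \<langle>\<sigma> x, unit\<rangle>"
    proof (rule ccontr)
      let ?d = "\<langle>x, unit\<rangle> - \<langle>\<sigma> x, unit\<rangle>"
      assume "\<langle>x, unit\<rangle> \<noteq> \<langle>\<sigma> x, unit\<rangle>"
      then have "\<sigma> x = inverse ?d \<cdot> (?d \<cdot> \<sigma> x)" by simp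
      also have "\<dots> = (inverse ?d * (n x - n (\<sigma> x))) \<cdot> unit" unfolding e by simp
      finally show False using ns by blast
    qed
    then show ?thesis using e unit_nonzero by simp
  qed
qed

lemma alg_iso_on_bil:
  assumes "alg_iso_on scale mul \<sigma> A B" "subspace A" "unit \<in> A" "unit \<in> B" "x \<in> A" "y \<in> A"
  shows "\<langle>\<sigma> x, \<sigma> y\<rangle> = \<langle>x, y\<rangle>"
  using alg_iso_on_norm[OF assms(1-4)] alg_iso_onD(2)[OF assms(1,5,6), symmetric] assms subspace_add
  by (simp add: polar_def)

lemma alg_iso_on_cnj:
  assumes "alg_iso_on scale mul \<sigma> A B" "subspace A" "unit \<in> A" "unit \<in> B" "x \<in> A"
  shows "\<sigma> (cnj x) = cnj (\<sigma> x)"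
  using alg_iso_on_bil[OF assms(1-5,3)] alg_iso_on_diff(1)[OF assms(1,2), of "\<langle>x, unit\<rangle> \<cdot> unit" x]
    alg_iso_onD(3)[OF assms(1,3)] alg_iso_on_unit[OF assms(1,3,4)] assms subspace_scale
  by (simp add: cnj_def)

text \<open>The product on \<open>A \<oplus> A u\<close> is expressed through the product and conjugation of \<open>A\<close> and the scalar
  \<open>n u\<close> alone (\<open>dbl_mult\<close>), so \<open>a + b u \<mapsto> \<sigma>(a) + \<sigma>(b) u'\<close> respects it as soon as \<open>n u' = n u\<close>. All
  automorphisms that relate division gradings arise from this lemma.\<close>

lemma dbl_extend:
  assumes A: "comp_subalgebra A" and u: "u \<in> perp A" "n u \<noteq> 0"
    and A': "comp_subalgebra A'" and u': "u' \<in> perp A'" "n u' = n u"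
    and iso: "alg_iso_on scale mul \<sigma> A A'"
  obtains \<tau> where "alg_iso_on scale mul \<tau> (dbl A u) (dbl A' u')"
    "\<And>a b. a \<in> A \<Longrightarrow> b \<in> A \<Longrightarrow> \<tau> (a + b \<star> u) = \<sigma> a + \<sigma> b \<star> u'"
    "\<And>a. a \<in> A \<Longrightarrow> \<tau> a = \<sigma> a" "\<And>b. b \<in> A \<Longrightarrow> \<tau> (b \<star> u) = \<sigma> b \<star> u'" "\<tau> u = u'"
proof -
  note D = comp_subalgebraD[OF A] and D' = comp_subalgebraD[OF A'] and I = alg_iso_onD[OF iso]
  have nu': "n u' \<noteq> 0" using u u' by simp
  note un = dbl_unique[OF A u] and un' = dbl_unique[OF A' u'(1) nu']
  have U: "\<sigma> unit = unit" by (rule alg_iso_on_unit[OF iso D(2) D'(2)])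
  have Z: "\<sigma> 0 = 0" by (rule alg_iso_on_diff(2)[OF iso D(1,5,5)])
  \<comment> \<open>the coordinates are unique by \<open>dbl_unique\<close>\<close>
  define \<tau> where "\<tau> x = (let p = SOME p. fst p \<in> A \<and> snd p \<in> A \<and> x = fst p + snd p \<star> u in \<sigma> (fst p) + \<sigma> (snd p) \<star> u')" for x
  have \<tau>: "\<tau> (a + b \<star> u) = \<sigma> a + \<sigma> b \<star> u'" if ab: "a \<in> A" "b \<in> A" for a b
  proof -
    let ?P = "\<lambda>p. fst p \<in> A \<and> snd p \<in> A \<and> a + b \<star> u = fst p + snd p \<star> u"
    have "?P (SOME p. ?P p)" by (rule someI[of ?P "(a, b)"]) (use ab in simp)
    moreover define p where "p = (SOME p. ?P p)"
    ultimately have p: "?P p" by blast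
    have "fst p = a" "snd p = b" using un[OF ab, of "fst p" "snd p"] p by auto
    then show ?thesis by (simp add: \<tau>_def Let_def p_def)
  qed
  have e1: "\<tau> a = \<sigma> a" if "a \<in> A" for a using \<tau>[OF that D(5)] Z by simp
  have e2: "\<tau> (b \<star> u) = \<sigma> b \<star> u'" if "b \<in> A" for b using \<tau>[OF D(5) that] Z by simp
  have e3: "\<tau> u = u'" using e2[OF D(2)] U by (simp add: one_mult)
  have "alg_iso_on scale mul \<tau> (dbl A u) (dbl A' u')"
    unfolding alg_iso_on_def
  proof (intro conjI ballI allI)
    show "bij_betw \<tau> (dbl A u) (dbl A' u')"
      unfolding bij_betw_def
    proof
      show "inj_on \<tau> (dbl A u)"
      proof (rule inj_onI)
        fix x y assume "x \<in> dbl A u" "y \<in> dbl A u" and e: "\<tau> x = \<tau> y"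
        then obtain a b c d where *: "a \<in> A" "b \<in> A" "c \<in> A" "d \<in> A" "x = a + b \<star> u" "y = c + d \<star> u"
          by (auto simp: dbl_def)
        then have "\<sigma> a = \<sigma> c" "\<sigma> b = \<sigma> d"
          using un'[of "\<sigma> a" "\<sigma> b" "\<sigma> c" "\<sigma> d"] e by (simp_all add: \<tau> I(5))
        then show "x = y" using * I(1) by (metis bij_betw_imp_inj_on inj_onD)
      qed
      have s: "A' = \<sigma> ` A" using I(1) by (simp add: bij_betw_imp_surj_on)
      show "\<tau> ` dbl A u = dbl A' u'"
      proof
        show "\<tau> ` dbl A u \<subseteq> dbl A' u'" by (auto simp: \<tau> intro!: dblI I(5) elim!: dblE)
        show "dbl A' u' \<subseteq> \<tau> ` dbl A u"
        proof
          fix y assume "y \<in> dbl A' u'"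
          then obtain a b where "a \<in> A" "b \<in> A" "y = \<sigma> a + \<sigma> b \<star> u'" unfolding dbl_def s by auto
          then show "y \<in> \<tau> ` dbl A u"
            by (intro image_eqI[of _ _ "a + b \<star> u"]) (auto simp: \<tau> intro: dblI)
        qed
      qed
    qed
    fix x y assume "x \<in> dbl A u" "y \<in> dbl A u"
    then obtain a b c d where *: "a \<in> A" "b \<in> A" "c \<in> A" "d \<in> A" "x = a + b \<star> u" "y = c + d \<star> u"
      by (auto simp: dbl_def)
    have "x + y = (a + c) + (b + d) \<star> u" by (simp add: * mult_add_left algebra_simps)
    then have "\<tau> (x + y) = \<sigma> (a + c) + \<sigma> (b + d) \<star> u'" by (simp only: \<tau> D * not_False_eq_True)
    then show "\<tau> (x + y) = \<tau> x + \<tau> y" using * by (simp add: \<tau> I(2) mult_add_left algebra_simps)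
    have cl: "a \<star> c \<in> A" "n u \<cdot> (cnj d \<star> b) \<in> A" "d \<star> a \<in> A" "b \<star> cnj c \<in> A" "cnj d \<star> b \<in> A"
      "cnj c \<in> A" "cnj d \<in> A" "a \<star> c - n u \<cdot> (cnj d \<star> b) \<in> A" "d \<star> a + b \<star> cnj c \<in> A"
      using * D by auto
    have "\<tau> (x \<star> y) = \<sigma> (a \<star> c - n u \<cdot> (cnj d \<star> b)) + \<sigma> (d \<star> a + b \<star> cnj c) \<star> u'"
      unfolding * dbl_mult[OF A u *(1-4)] by (rule \<tau>) (use cl in auto)
    also have "\<sigma> (a \<star> c - n u \<cdot> (cnj d \<star> b)) = \<sigma> a \<star> \<sigma> c - n u' \<cdot> (cnj (\<sigma> d) \<star> \<sigma> b)"
      using * cl u' by (simp add: alg_iso_on_diff(1)[OF iso D(1)] I alg_iso_on_cnj[OF iso D(1,2) D'(2)])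
    also have "\<sigma> (d \<star> a + b \<star> cnj c) = \<sigma> d \<star> \<sigma> a + \<sigma> b \<star> cnj (\<sigma> c)"
      using * cl u' by (simp add: I alg_iso_on_cnj[OF iso D(1,2) D'(2)])
    finally show "\<tau> (x \<star> y) = \<tau> x \<star> \<tau> y"
      using dbl_mult[OF A' u'(1) nu' I(5)[OF *(1)] I(5)[OF *(2)] I(5)[OF *(3)] I(5)[OF *(4)]]
      by (simp add: \<tau> *(5,6) \<tau>[OF *(1,2)] \<tau>[OF *(3,4)])
  next
    fix t x assume "x \<in> dbl A u"
    then obtain a b where *: "a \<in> A" "b \<in> A" "x = a + b \<star> u"
      by (auto simp: dbl_def)
    have "t \<cdot> x = t \<cdot> a + (t \<cdot> b) \<star> u" using * by (simp add: mult_scale_left scale_right_distrib)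
    then have "\<tau> (t \<cdot> x) = \<sigma> (t \<cdot> a) + \<sigma> (t \<cdot> b) \<star> u'" using \<tau>[OF D(8)[OF *(1)] D(8)[OF *(2)]] by simp
    then show "\<tau> (t \<cdot> x) = t \<cdot> \<tau> x" using * by (simp add: \<tau> I mult_scale_left scale_right_distrib)
  qed
  from that[OF this \<tau> e1 e2 e3] show thesis by blast
qed

section \<open>The starting points of the doubling process\<close>

lemma two_nonzero: assumes "CHAR('f) \<noteq> 2" shows "(2::'f) \<noteq> 0"
proof
  assume "(2::'f) = 0"
  then have "of_nat 2 = (0::'f)" by simp
  then have "CHAR('f) dvd 2" by (simp only: of_nat_eq_0_iff_char_dvd)
  then have "CHAR('f) = 1 \<or> CHAR('f) = 2" using prime_nat_iff two_is_prime_nat by blast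
  then show False using assms CHAR_not_1 by auto
qed

lemma two_zero: assumes "CHAR('f) = 2" shows "(2::'f) = 0"
  using of_nat_CHAR[where 'a = 'f] assms by simp

text \<open>The polar form on the scalars has Gram matrix \<open>(2)\<close>, which is why this start is reserved for
  characteristic different from 2.\<close>

lemma comp_subalgebra_base:
  assumes "CHAR('f) \<noteq> 2" shows "comp_subalgebra (span {unit})"
  unfolding comp_subalgebra_def
proof (intro conjI ballI allI)
  show "subspace (span {unit})" by simp
  show "unit \<in> span {unit}" by (simp add: span_base)
  fix x y assume "x \<in> span {unit}" "y \<in> span {unit}"
  then show "x \<star> y \<in> span {unit}" by (auto simp: span_singleton mult_simps)
next
  have two: "(2::'f) \<noteq> 0" by (rule two_nonzero[OF assms])
  fix x
  have "x - (\<langle>x, unit\<rangle> / 2) \<cdot> unit \<in> perp (span {unit})"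
    unfolding perp_span by (simp add: perp_def bil_simps two)
  then show "\<exists>a\<in>span {unit}. x - a \<in> perp (span {unit})"
    by (intro bexI[of _ "(\<langle>x, unit\<rangle> / 2) \<cdot> unit"]) (auto simp: span_scale span_base)
qed

lemma span_pairE:
  assumes "x \<in> span {p, q}" obtains a b where "x = a \<cdot> p + b \<cdot> q"
proof -
  obtain a where "x - a \<cdot> p \<in> span {q}" using assms by (auto simp: span_insert)
  then obtain b where "x - a \<cdot> p = b \<cdot> q" by (auto simp: span_singleton)
  then have "x = a \<cdot> p + b \<cdot> q" by (simp add: algebra_simps)
  then show thesis by (rule that)
qed

text \<open>The hypothesis is that the Gram determinant of \<open>1, k\<close> is nonzero; the projection is then given by
  Cramer's rule.\<close>

lemma comp_subalgebra_quadratic: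
  assumes "4 * n k \<noteq> \<langle>k, unit\<rangle>\<^sup>2" shows "comp_subalgebra (span {unit, k})"
  unfolding comp_subalgebra_def
proof (intro conjI ballI allI)
  let ?S = "span {unit, k}"
  show S: "subspace ?S" by simp
  have b: "unit \<in> ?S" "k \<in> ?S" by (simp_all add: span_base)
  then show "unit \<in> ?S" by simp
  have kk: "k \<star> k \<in> ?S" unfolding square_eq using b by (intro span_diff span_scale)
  fix x y assume "x \<in> ?S" "y \<in> ?S"
  then obtain a b c d where *: "x = a \<cdot> unit + b \<cdot> k" "y = c \<cdot> unit + d \<cdot> k"
    by (meson span_pairE)
  have "x \<star> y = (a * c) \<cdot> unit + ((b * c) \<cdot> k + ((a * d) \<cdot> k + (b * d) \<cdot> (k \<star> k)))"
    unfolding * by (simp add: mult_simps scale_right_distrib algebra_simps)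
  then show "x \<star> y \<in> ?S" using b kk span_add span_scale by metis
next
  let ?S = "span {unit, k}" and ?t = "\<langle>k, unit\<rangle>" and ?D = "4 * n k - \<langle>k, unit\<rangle>\<^sup>2"
  have D: "?D \<noteq> 0" using assms by simp
  fix x
  define p q where "p = \<langle>x, unit\<rangle>" and "q = \<langle>x, k\<rangle>"
  define a b where "a = (2 * n k * p - ?t * q) / ?D" and "b = (2 * q - ?t * p) / ?D"
  have "a * 2 + b * ?t = p * ?D / ?D" "a * ?t + b * (2 * n k) = q * ?D / ?D"
    unfolding a_def b_def times_divide_eq_left add_divide_distrib[symmetric]
    by (simp_all add: algebra_simps power2_eq_square)
  then have "p - (a * 2 + b * ?t) = 0" "q - (a * ?t + b * (2 * n k)) = 0"
    using D by simp_all
  then have "x - (a \<cdot> unit + b \<cdot> k) \<in> perp ?S"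
    unfolding perp_span by (simp add: perp_def bil_simps p_def q_def bil_commute[of unit k] bil_self)
  moreover have "a \<cdot> unit + b \<cdot> k \<in> ?S" by (intro span_add span_scale span_base) auto
  ultimately show "\<exists>a\<in>?S. x - a \<in> perp ?S" by blast
qed

lemma comp_subalgebra_quadratic_char_2:
  assumes ch: "CHAR('f) = 2" and k: "\<langle>k, unit\<rangle> \<noteq> 0"
  shows "comp_subalgebra (span {unit, k})"
proof (rule comp_subalgebra_quadratic)
  have "4 = 2 * (2::'f)" by simp
  then have "4 = (0::'f)" unfolding two_zero[OF ch] by simp
  then show "4 * n k \<noteq> \<langle>k, unit\<rangle>\<^sup>2" using k by simp
qed

lemma perp_dbl_span: "perp (dbl (span S) u) = perp (S \<union> (\<lambda>s. s \<star> u) ` S)"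
proof
  have "s \<in> dbl (span S) u" "s \<star> u \<in> dbl (span S) u" if "s \<in> S" for s
    using dblI[of s "span S" 0 u] dblI[of 0 "span S" s u] that by (simp_all add: span_base span_zero)
  then show "perp (dbl (span S) u) \<subseteq> perp (S \<union> (\<lambda>s. s \<star> u) ` S)" by (auto simp: perp_def)
  show "perp (S \<union> (\<lambda>s. s \<star> u) ` S) \<subseteq> perp (dbl (span S) u)"
  proof
    fix x assume x: "x \<in> perp (S \<union> (\<lambda>s. s \<star> u) ` S)"
    have "subspace {b. \<langle>x, b \<star> u\<rangle> = 0}" by (auto simp: subspace_def bil_simps mult_simps)
    then have "span S \<subseteq> {b. \<langle>x, b \<star> u\<rangle> = 0}" by (intro span_minimal) (use x in \<open>auto simp: perp_def\<close>)
    moreover have "x \<in> perp (span S)" unfolding perp_span using x by (auto simp: perp_def)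
    ultimately show "x \<in> perp (dbl (span S) u)" by (auto simp: perp_def dbl_def bil_simps)
  qed
qed

lemma dbl_span: "dbl (span S) u = span (S \<union> (\<lambda>s. s \<star> u) ` S)"
proof
  let ?X = "span (S \<union> (\<lambda>s. s \<star> u) ` S)"
  show "dbl (span S) u \<subseteq> ?X"
  proof
    fix x assume "x \<in> dbl (span S) u"
    then obtain a b where ab: "a \<in> span S" "b \<in> span S" "x = a + b \<star> u" by (rule dblE)
    have "subspace {b. b \<star> u \<in> ?X}"
      by (auto simp: subspace_def mult_simps span_add span_scale span_zero)
    then have "span S \<subseteq> {b. b \<star> u \<in> ?X}" by (intro span_minimal) (auto intro: span_base)
    moreover have "span S \<subseteq> ?X" by (intro span_mono) simp
    ultimately show "x \<in> ?X" using ab by (auto intro: span_add)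
  qed
  have "s \<in> dbl (span S) u" "s \<star> u \<in> dbl (span S) u" if "s \<in> S" for s
    using dblI[of s "span S" 0 u] dblI[of 0 "span S" s u] that by (simp_all add: span_base span_zero)
  moreover have "subspace (dbl (span S) u)"
  proof -
    have "dbl (span S) u = {x + y |x y. x \<in> span S \<and> y \<in> (\<lambda>b. b \<star> u) ` span S}" by (auto simp: dbl_def)
    moreover have "subspace ((\<lambda>b. b \<star> u) ` span S)"
    proof -
      have "Vector_Spaces.linear scale scale (\<lambda>b. b \<star> u)" by unfold_locales (auto simp: mult_simps)
      then interpret l: Vector_Spaces.linear scale scale "\<lambda>b. b \<star> u" .
      show ?thesis by (rule l.subspace_image) simp
    qed
    ultimately show ?thesis using subspace_sums[OF subspace_span] by simp
  qed
  ultimately show "?X \<subseteq> dbl (span S) u" by (intro span_minimal) auto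
qed

text \<open>The conditions on \<open>u\<close>, \<open>v\<close>, \<open>w\<close> in \<open>Gamma_base\<close>: they are successive
  doubling generators, starting from the ground field.\<close>

definition base_triple :: "'c \<Rightarrow> 'c \<Rightarrow> 'c \<Rightarrow> bool" where
  "base_triple u v w \<longleftrightarrow> n u \<noteq> 0 \<and> n v \<noteq> 0 \<and> n w \<noteq> 0 \<and>
     u \<in> perp {unit} \<and> v \<in> perp {unit, u} \<and> w \<in> perp {unit, u, v, u \<star> v}"

lemma base_triple_tower:
  assumes "CHAR('f) \<noteq> 2" and t: "base_triple u v w"
  defines "A \<equiv> span {unit}"
  shows "comp_subalgebra A" "u \<in> perp A" "n u \<noteq> 0"
    "comp_subalgebra (dbl A u)" "v \<in> perp (dbl A u)" "n v \<noteq> 0"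
    "comp_subalgebra (dbl (dbl A u) v)" "w \<in> perp (dbl (dbl A u) v)" "n w \<noteq> 0"
    "dbl (dbl (dbl A u) v) w = UNIV"
proof -
  show A: "comp_subalgebra A" unfolding A_def by (rule comp_subalgebra_base[OF assms(1)])
  show n: "n u \<noteq> 0" "n v \<noteq> 0" "n w \<noteq> 0" using t by (auto simp: base_triple_def)
  show u: "u \<in> perp A" using t by (simp add: A_def perp_span base_triple_def)
  show B: "comp_subalgebra (dbl A u)" by (rule comp_subalgebra_dbl[OF A u n(1)])
  show v: "v \<in> perp (dbl A u)"
    using t by (simp add: A_def perp_dbl_span base_triple_def one_mult insert_commute)
  show C: "comp_subalgebra (dbl (dbl A u) v)" by (rule comp_subalgebra_dbl[OF B v n(2)])
  show w: "w \<in> perp (dbl (dbl A u) v)"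
    using t by (simp add: A_def dbl_span perp_dbl_span perp_span base_triple_def one_mult insert_commute)
  have i0: "independent {unit}" by (simp add: unit_nonzero)
  have "{unit} \<subseteq> A" by (simp add: A_def span_base)
  then obtain B1 where B1: "finite B1" "B1 \<subseteq> dbl A u" "independent B1" "card B1 = 2"
    using dbl_independent[OF A u n(1) _ _ i0] by auto
  then obtain B2 where B2: "finite B2" "B2 \<subseteq> dbl (dbl A u) v" "independent B2" "card B2 = 4"
    using dbl_independent[OF B v n(2) B1(1-3)] by auto
  then obtain B3 where B3: "finite B3" "B3 \<subseteq> dbl (dbl (dbl A u) v) w" "independent B3" "card B3 = 8"
    using dbl_independent[OF C w n(3) B2(1-3)] by auto
  have "span B3 \<subseteq> dbl (dbl (dbl A u) v) w"
    by (rule span_minimal[OF B3(2) comp_subalgebraD(1)[OF comp_subalgebra_dbl[OF C w n(3)]]])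
  then show "dbl (dbl (dbl A u) v) w = UNIV" using independent_8_spans[OF B3(3,4)] by blast
qed

lemma quadratic_tower:
  assumes K: "comp_subalgebra K" and d: "dim K = 2" and u: "u \<in> perp K" "n u \<noteq> 0"
    and v: "v \<in> perp (dbl K u)" "n v \<noteq> 0"
  shows "dbl (dbl K u) v = UNIV"
proof -
  note B = comp_subalgebra_dbl[OF K u] and C = comp_subalgebra_dbl[OF comp_subalgebra_dbl[OF K u] v]
  obtain B0 where B0: "B0 \<subseteq> K" "independent B0" "card B0 = 2" using basis_exists[of K] d by metis
  have f: "finite B0" using B0(3) by (intro card_ge_0_finite) simp
  obtain B1 where B1: "finite B1" "B1 \<subseteq> dbl K u" "independent B1" "card B1 = 4"
    using dbl_independent[OF K u f B0(1,2)] B0(3) by auto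
  obtain B2 where B2: "finite B2" "B2 \<subseteq> dbl (dbl K u) v" "independent B2" "card B2 = 8"
    using dbl_independent[OF B v B1(1-3)] B1(4) by auto
  have "span B2 \<subseteq> dbl (dbl K u) v" by (rule span_minimal[OF B2(2) comp_subalgebraD(1)[OF C]])
  then show ?thesis using independent_8_spans[OF B2(3,4)] by blast
qed

lemma alg_iso_on_id: "alg_iso_on scale mul id A A"
  by (simp add: alg_iso_on_def bij_betw_def)

lemma base_triple_automorphism:
  assumes ch: "CHAR('f) \<noteq> 2" and t: "base_triple u v w" "base_triple u' v' w'"
    and eq: "n u' = n u" "n v' = n v" "n w' = n w"
  obtains \<psi> where "alg_iso_on scale mul \<psi> UNIV UNIV" "\<psi> u = u'" "\<psi> v = v'" "\<psi> w = w'"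
proof -
  let ?A = "span {unit}"
  note T = base_triple_tower[OF ch t(1)] and T' = base_triple_tower[OF ch t(2)]
  obtain \<psi>1 where 1: "alg_iso_on scale mul \<psi>1 (dbl ?A u) (dbl ?A u')" "\<psi>1 u = u'"
    by (rule dbl_extend[OF T(1-3) T'(1,2) eq(1) alg_iso_on_id]) blast
  obtain \<psi>2 where 2: "alg_iso_on scale mul \<psi>2 (dbl (dbl ?A u) v) (dbl (dbl ?A u') v')"
    "\<And>x. x \<in> dbl ?A u \<Longrightarrow> \<psi>2 x = \<psi>1 x" "\<psi>2 v = v'"
    by (rule dbl_extend[OF T(4-6) T'(4,5) eq(2) 1(1)]) blast
  obtain \<psi>3 where 3: "alg_iso_on scale mul \<psi>3 UNIV UNIV"
    "\<And>x. x \<in> dbl (dbl ?A u) v \<Longrightarrow> \<psi>3 x = \<psi>2 x" "\<psi>3 w = w'"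
    by (rule dbl_extend[OF T(7-9) T'(7,8) eq(3) 2(1), unfolded T(10) T'(10)]) blast
  have "u \<in> dbl ?A u" by (rule dbl_base(2)[OF T(1-3)])
  moreover have "u \<in> dbl (dbl ?A u) v" using dbl_base(1)[OF T(4-6)] calculation by blast
  moreover have "v \<in> dbl (dbl ?A u) v" by (rule dbl_base(2)[OF T(4-6)])
  ultimately show thesis using 1 2 3 that by auto
qed

lemma quadratic_automorphism:
  assumes K: "comp_subalgebra K" "comp_subalgebra K'" "dim K = 2" "dim K' = 2"
    and \<sigma>: "alg_iso_on scale mul \<sigma> K K'"
    and u: "u \<in> perp K" "n u \<noteq> 0" and v: "v \<in> perp (dbl K u)" "n v \<noteq> 0"
    and u': "u' \<in> perp K'" "n u' = n u" and v': "v' \<in> perp (dbl K' u')" "n v' = n v"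
  obtains \<psi> where "alg_iso_on scale mul \<psi> UNIV UNIV" "\<And>x. x \<in> K \<Longrightarrow> \<psi> x = \<sigma> x" "\<psi> u = u'" "\<psi> v = v'"
proof -
  have n': "n u' \<noteq> 0" "n v' \<noteq> 0" using u u' v v' by auto
  note B = comp_subalgebra_dbl[OF K(1) u] and B' = comp_subalgebra_dbl[OF K(2) u'(1) n'(1)]
  obtain \<psi>1 where 1: "alg_iso_on scale mul \<psi>1 (dbl K u) (dbl K' u')"
     "\<And>x. x \<in> K \<Longrightarrow> \<psi>1 x = \<sigma> x" "\<psi>1 u = u'"
    by (rule dbl_extend[OF K(1) u K(2) u' \<sigma>]) blast
  obtain \<psi>2 where 2: "alg_iso_on scale mul \<psi>2 UNIV UNIV"
    "\<And>x. x \<in> dbl K u \<Longrightarrow> \<psi>2 x = \<psi>1 x" "\<psi>2 v = v'"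
    by (rule dbl_extend[OF B v B' v' 1(1), unfolded quadratic_tower[OF K(1,3) u v]
          quadratic_tower[OF K(2,4) u'(1) n'(1) v'(1) n'(2)]]) blast
  show thesis
    by (rule that[OF 2(1)]) (use 1 2 dbl_base[OF K(1) u] in auto)
qed

section \<open>From orthogonal frames to doubling generators\<close>

definition orth_map :: "('c \<Rightarrow> 'c) \<Rightarrow> bool" where
  "orth_map R \<longleftrightarrow> (\<forall>x. n (R x) = n x) \<and> (\<forall>x y. \<langle>R x, R y\<rangle> = \<langle>x, y\<rangle>)"

lemma orth_map_comp: "orth_map R \<Longrightarrow> orth_map S \<Longrightarrow> orth_map (\<lambda>x. R (S x))"
  by (simp add: orth_map_def)

definition reflect :: "'c \<Rightarrow> 'c \<Rightarrow> 'c" where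
  "reflect d x = x - (\<langle>x, d\<rangle> / n d) \<cdot> d"

lemma orth_map_reflect: assumes "n d \<noteq> 0" shows "orth_map (reflect d)"
proof -
  have "n (reflect d x) = n x" for x
    using assms by (simp add: reflect_def norm_diff norm_scale bil_simps power2_eq_square)
  moreover have "\<langle>reflect d x, reflect d y\<rangle> = \<langle>x, y\<rangle>" for x y
    using assms by (simp add: reflect_def bil_simps bil_self bil_commute[of d] field_simps)
  ultimately show ?thesis by (simp add: orth_map_def)
qed

lemma reflect_fix: "\<langle>x, d\<rangle> = 0 \<Longrightarrow> reflect d x = x"
  by (simp add: reflect_def)

lemma reflect_swap: assumes "n y = n z" "n (y - z) \<noteq> 0" shows "reflect (y - z) y = z"
proof -
  have "\<langle>y, y - z\<rangle> = n (y - z)" using assms(1) by (simp add: norm_diff bil_simps bil_self)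
  then show ?thesis using assms(2) by (simp add: reflect_def)
qed

lemma orth_map_left_mult: "n x = 1 \<Longrightarrow> orth_map (\<lambda>y. cnj x \<star> y)"
  by (simp add: orth_map_def norm_mult bil_mult_left)

text \<open>The frame vectors \<open>x 0, \<dots>, x 4\<close> have the norms of \<open>1, u, v, u v, w\<close>, up to a square in the case of
  \<open>u v\<close>. Left multiplication by \<open>cnj (x 0)\<close> is an isometry taking \<open>x 0\<close> to the unit; then \<open>u\<close>, \<open>v\<close>
  are taken from the frame, and a reflection carries the fourth vector to \<open>\<plusminus> u v\<close> without disturbing
  \<open>1, u, v\<close>. The image of the last vector is \<open>w\<close>.\<close>

lemma base_triple_exists:
  assumes ch: "CHAR('f) \<noteq> 2"
    and orth: "\<And>i j. i < 5 \<Longrightarrow> j < 5 \<Longrightarrow> i \<noteq> j \<Longrightarrow> \<langle>x i, x j\<rangle> = 0"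
    and nx: "n (x 0) = 1" "n (x 1) \<noteq> 0" "n (x 2) \<noteq> 0" "n (x 3) = q\<^sup>2 * (n (x 1) * n (x 2))" "q \<noteq> 0" "n (x (4::nat)) \<noteq> 0"
  obtains u v w where "base_triple u v w" "n u = n (x 1)" "n v = n (x 2)" "n w = n (x 4)"
proof -
  define c where "c i = cnj (x 0) \<star> x i" for i
  have c0: "c 0 = unit" using nx(1) by (simp add: c_def cnj_mult_self)
  have nc: "n (c i) = n (x i)" for i by (simp add: c_def norm_mult nx(1))
  have oc: "\<langle>c i, c j\<rangle> = 0" if "i < 5" "j < 5" "i \<noteq> j" for i j
    using orth[OF that] by (simp add: c_def bil_mult_left)
  define u v y where "u = c 1" and "v = c 2" and "y = inverse q \<cdot> c 3"
  have o: "\<langle>u, unit\<rangle> = 0" "\<langle>v, unit\<rangle> = 0" "\<langle>v, u\<rangle> = 0" "\<langle>u, v\<rangle> = 0"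
    "\<langle>y, unit\<rangle> = 0" "\<langle>y, u\<rangle> = 0" "\<langle>y, v\<rangle> = 0" "\<langle>c 4, unit\<rangle> = 0" "\<langle>c 4, u\<rangle> = 0" "\<langle>c 4, v\<rangle> = 0" "\<langle>c 4, y\<rangle> = 0"
    unfolding c0[symmetric] u_def v_def y_def by (simp_all add: oc bil_simps)
  have cu: "cnj u = - u" using o by (simp add: cnj_def)
  have p: "\<langle>u \<star> v, unit\<rangle> = 0" "\<langle>u \<star> v, u\<rangle> = 0" "\<langle>u \<star> v, v\<rangle> = 0"
    using adjoint_left[of u v unit] bil_mult_left[of u v unit] bil_mult_right[of u v unit] o
    by (simp_all add: cu mult_one one_mult bil_minus)
  \<comment> \<open>the factor \<open>q\<close> makes the norms of \<open>y\<close> and \<open>u v\<close> equal, not just equal up to a square\<close>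
  have ny: "n y = n (u \<star> v)"
    using nx(5) by (simp add: y_def u_def v_def norm_scale nc nx(4) norm_mult field_simps)
  have nuv: "n (u \<star> v) \<noteq> 0" using nx by (simp add: u_def v_def norm_mult nc)
  \<comment> \<open>\<open>y\<close> and \<open>u v\<close> have the same norm, so the norms of \<open>y - u v\<close> and \<open>y + u v\<close> add up to \<open>4 n(u v) \<noteq> 0\<close>\<close>
  have "n (y - u \<star> v) + n (y - (- (u \<star> v))) = 2 * (2 * n (u \<star> v))"
    by (simp add: norm_diff norm_add ny)
  moreover have "2 * (2 * n (u \<star> v)) \<noteq> 0" using two_nonzero[OF ch] nuv by (simp only: mult_eq_0_iff) simp
  ultimately have "n (y - u \<star> v) + n (y - (- (u \<star> v))) \<noteq> 0" by metis
  then have "\<exists>z. (z = u \<star> v \<or> z = - (u \<star> v)) \<and> n (y - z) \<noteq> 0"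
    by (metis add.right_neutral)
  then obtain z where z: "z = u \<star> v \<or> z = - (u \<star> v)" "n (y - z) \<noteq> 0" by blast
  define R where "R = reflect (y - z)"
  have R: "orth_map R" unfolding R_def by (rule orth_map_reflect[OF z(2)])
  have Ry: "R y = z" unfolding R_def by (rule reflect_swap[OF _ z(2)]) (use z(1) ny in auto)
  have zz: "\<langle>z, a\<rangle> = 0" if "a \<in> {unit, u, v}" for a using z(1) p that by (auto simp: bil_simps)
  have fixR: "R a = a" if "a \<in> {unit, u, v}" for a unfolding R_def
    by (rule reflect_fix) (use that o zz[OF that] in \<open>auto simp: bil_simps bil_commute[of _ y] bil_commute[of _ z]\<close>)
  have Rb: "\<langle>R a, R b\<rangle> = \<langle>a, b\<rangle>" for a b using R by (simp add: orth_map_def)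
  have w1: "\<langle>R (c 4), a\<rangle> = 0" if "a \<in> {unit, u, v}" for a
    using Rb[of "c 4" a] fixR[OF that] o that by auto
  have "\<langle>R (c 4), z\<rangle> = 0" using Rb[of "c 4" y] Ry o by simp
  then have w2: "\<langle>R (c 4), u \<star> v\<rangle> = 0" using z(1) by (auto simp: bil_simps)
  have nR: "n (R (c 4)) = n (x 4)" using R nc by (simp add: orth_map_def)
  show thesis
    by (rule that[of u v "R (c 4)"])
      (use o w1 w2 nR nx in \<open>simp_all add: base_triple_def perp_def nc[of 1] nc[of 2] u_def[symmetric] v_def[symmetric] nc[of 1, folded u_def] nc[of 2, folded v_def]\<close>)
qed

text \<open>In characteristic 2 one reflection may fail to carry \<open>y\<close> to \<open>y'\<close>, because \<open>y - y'\<close> may be isotropic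
  and the sign of \<open>y'\<close> is of no help. Reflecting first in \<open>a\<close> repairs this: it fixes \<open>a\<close>, which is
  orthogonal to itself, and changes \<open>y - y'\<close> by a nonzero multiple of \<open>a\<close>, to an anisotropic vector.\<close>

lemma orth_map_move_char_2:
  assumes ch: "CHAR('f) = 2" and na: "n a \<noteq> 0" and e: "n y = n y'" "\<langle>a, y\<rangle> = \<langle>a, y'\<rangle>" "\<langle>a, y\<rangle> \<noteq> 0"
  obtains R where "orth_map R" "R a = a" "R y = y'"
    "\<And>z. \<langle>z, a\<rangle> = 0 \<Longrightarrow> \<langle>z, y\<rangle> = 0 \<Longrightarrow> \<langle>z, y'\<rangle> = 0 \<Longrightarrow> R z = z"
proof (cases "n (y - y') = 0")
  case False
  show thesis
  proof (rule that[of "reflect (y - y')"])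
    show "reflect (y - y') y = y'" by (rule reflect_swap[OF e(1) False])
  qed (auto intro!: reflect_fix orth_map_reflect False simp: bil_simps e(2))
next
  case True
  have two: "2 = (0::'f)" by (rule two_zero[OF ch])
  define c where "c = \<langle>y, a\<rangle> / n a"
  define y1 where "y1 = reflect a y"
  have y1: "y1 = y - c \<cdot> a" by (simp add: y1_def c_def reflect_def)
  have "n (y1 - y') = n ((y - y') - c \<cdot> a)" by (simp add: y1 algebra_simps)
  also have "\<dots> = c\<^sup>2 * n a"
    using True e(2) by (simp add: norm_diff[of "y - y'"] norm_scale bil_simps bil_commute[of _ a])
  finally have nd: "n (y1 - y') \<noteq> 0" using na e(3) by (simp add: c_def bil_commute)
  have n1: "n y1 = n y'" using orth_map_reflect[OF na] e(1) by (simp add: orth_map_def y1_def)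
  have aa: "\<langle>a, a\<rangle> = 0" by (simp add: bil_self two)
  show thesis
  proof (rule that[of "\<lambda>x. reflect (y1 - y') (reflect a x)"])
    show "orth_map (\<lambda>x. reflect (y1 - y') (reflect a x))"
      by (rule orth_map_comp[OF orth_map_reflect[OF nd] orth_map_reflect[OF na]])
    show "reflect (y1 - y') (reflect a y) = y'"
      unfolding y1_def[symmetric] by (rule reflect_swap[OF n1 nd])
    have "reflect a a = a" by (rule reflect_fix[OF aa])
    then show "reflect (y1 - y') (reflect a a) = a"
      by (simp add: reflect_fix y1 bil_simps e(2) aa)
    fix z assume "\<langle>z, a\<rangle> = 0" "\<langle>z, y\<rangle> = 0" "\<langle>z, y'\<rangle> = 0"
    then show "reflect (y1 - y') (reflect a z) = z" by (simp add: reflect_fix y1 bil_simps)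
  qed
qed

text \<open>The planes spanned by \<open>x i\<close> and \<open>x' i\<close> are copies of \<open>K = span {1, k}\<close> scaled by \<open>n (x i)\<close>. Once \<open>x 0\<close>
  is at the unit, one isometry fixing \<open>1\<close> takes \<open>x' 0\<close> to \<open>k\<close>, and another one fixing \<open>K\<close> and
  \<open>u = x 1\<close> takes \<open>x' 1\<close> to \<open>k u\<close>. What remains of \<open>x 2\<close> is orthogonal to \<open>K \<oplus> K u\<close>.\<close>

lemma quadratic_pair_exists:
  assumes ch: "CHAR('f) = 2" and K: "K = span {unit, k}" and tk: "\<langle>k, unit\<rangle> \<noteq> 0"
    and orth: "\<And>i j. i < 3 \<Longrightarrow> j < 3 \<Longrightarrow> i \<noteq> j \<Longrightarrow> \<langle>x i, x j\<rangle> = 0 \<and> \<langle>x' i, x j\<rangle> = 0 \<and> \<langle>x i, x' j\<rangle> = 0 \<and> \<langle>x' i, x' j\<rangle> = 0"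
    and nx: "n (x 0) = 1" "n (x 1) \<noteq> 0" "n (x (2::nat)) \<noteq> 0"
    and nx': "\<And>i. i < 2 \<Longrightarrow> n (x' i) = n (x i) * n k" "\<And>i. i < 2 \<Longrightarrow> \<langle>x i, x' i\<rangle> = n (x i) * \<langle>unit, k\<rangle>"
  obtains u v where "u \<in> perp K" "v \<in> perp (dbl K u)" "n u = n (x 1)" "n v = n (x 2)"
proof -
  let ?L = "\<lambda>y. cnj (x 0) \<star> y"
  have L: "orth_map ?L" by (rule orth_map_left_mult[OF nx(1)])
  have L0: "?L (x 0) = unit" by (simp add: cnj_mult_self nx(1))
  have Lb: "\<langle>?L a, ?L b\<rangle> = \<langle>a, b\<rangle>" "n (?L a) = n a" for a b using L by (auto simp: orth_map_def)
  have "n (?L (x' 0)) = n k" using nx'(1)[of 0] nx(1) Lb by simp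
  moreover have "\<langle>unit, ?L (x' 0)\<rangle> = \<langle>unit, k\<rangle>" using Lb(1)[of "x 0" "x' 0"] nx'(2)[of 0] nx(1) L0 by simp
  moreover have tk': "\<langle>unit, k\<rangle> \<noteq> 0" using tk by (simp add: bil_commute)
  ultimately obtain R where R: "orth_map R" "R unit = unit" "R (?L (x' 0)) = k"
    using orth_map_move_char_2[OF ch _ , of unit "?L (x' 0)" k] by (metis norm_unit zero_neq_one)
  define S where "S y = R (?L y)" for y
  have S: "\<langle>S a, S b\<rangle> = \<langle>a, b\<rangle>" "n (S a) = n a" for a b
    using R(1) Lb by (auto simp: orth_map_def S_def)
  have S0: "S (x 0) = unit" "S (x' 0) = k" using R L0 by (auto simp: S_def)
  define u where "u = S (x 1)"
  have sk: "\<langle>a, k\<rangle> = 0 \<Longrightarrow> \<langle>a, unit\<rangle> = 0 \<Longrightarrow> a \<in> perp K" for a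
    unfolding K perp_span by (simp add: perp_def)
  have u: "u \<in> perp K" "n u = n (x 1)"
    using S(1)[of "x 1" "x 0"] S(1)[of "x 1" "x' 0"] orth[of 1 0] S(2) unfolding u_def S0 by (auto intro: sk)
  have x1: "S (x' 1) \<in> perp K" "\<langle>u, S (x' 1)\<rangle> = n u * \<langle>unit, k\<rangle>" "n (S (x' 1)) = n u * n k"
    using S(1)[of "x' 1" "x 0"] S(1)[of "x' 1" "x' 0"] orth[of 1 0] S(1)[of "x 1" "x' 1"] nx'[of 1] S(2)
    unfolding u_def S0 by (auto intro: sk)
  have x2: "S (x 2) \<in> perp K" "\<langle>S (x 2), u\<rangle> = 0" "\<langle>S (x 2), S (x' 1)\<rangle> = 0" "n (S (x 2)) = n (x 2)"
    using S(1)[of "x 2" "x 0"] S(1)[of "x 2" "x' 0"] orth[of 2 0] orth[of 2 1] S(1)[of "x 2" "x 1"]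
      S(1)[of "x 2" "x' 1"] S(2) unfolding u_def S0 by (auto intro: sk)
  have kK: "k \<in> K" "unit \<in> K" unfolding K by (simp_all add: span_base)
  have ku1: "\<langle>u, k \<star> u\<rangle> = \<langle>unit, k\<rangle> * n u" using bil_mult_right[of unit u k] by (simp add: one_mult)
  have KK: "comp_subalgebra K" unfolding K by (rule comp_subalgebra_quadratic_char_2[OF ch tk])
  have ku: "k \<star> u \<in> perp K"
    using dbl_bil[OF KK u(1) _ _ kK(1)] u nx by (auto simp: perp_def)
  obtain R' where R': "orth_map R'" "R' u = u" "R' (S (x' 1)) = k \<star> u"
    "\<And>z. \<langle>z, u\<rangle> = 0 \<Longrightarrow> \<langle>z, S (x' 1)\<rangle> = 0 \<Longrightarrow> \<langle>z, k \<star> u\<rangle> = 0 \<Longrightarrow> R' z = z"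
  proof (rule orth_map_move_char_2[OF ch, of u "S (x' 1)" "k \<star> u"])
    show "n u \<noteq> 0" "\<langle>u, S (x' 1)\<rangle> \<noteq> 0" using u nx x1 tk' by auto
    show "n (S (x' 1)) = n (k \<star> u)" "\<langle>u, S (x' 1)\<rangle> = \<langle>u, k \<star> u\<rangle>" using x1 ku1 by (simp_all add: norm_mult)
  qed blast
  have Rf: "R' z = z" if "z \<in> K" for z
    by (rule R'(4)) (use perpD(2)[OF _ that] u x1 ku in auto)
  have Rb: "\<langle>R' a, R' b\<rangle> = \<langle>a, b\<rangle>" "n (R' a) = n a" for a b using R'(1) by (auto simp: orth_map_def)
  define v where "v = R' (S (x 2))"
  have "\<langle>v, a\<rangle> = 0" if "a \<in> K" for a
    using Rb(1)[of "S (x 2)" a] Rf[OF that] perpD(1)[OF x2(1) that] by (simp add: v_def)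
  then have "v \<in> perp K" by (simp add: perp_def)
  moreover have "\<langle>v, u\<rangle> = 0" using Rb(1)[of "S (x 2)" u] R'(2) x2 by (simp add: v_def)
  moreover have "\<langle>v, k \<star> u\<rangle> = 0" using Rb(1)[of "S (x 2)" "S (x' 1)"] R'(3) x2 by (simp add: v_def)
  ultimately have "v \<in> perp (dbl K u)"
    unfolding K perp_dbl_span by (auto simp: perp_def span_base one_mult)
  moreover have "n v = n (x 2)" using Rb(2) x2 by (simp add: v_def)
  ultimately show thesis using u that by blast
qed

text \<open>Evaluating the inverse of the isometry on functions supported at one point of \<open>T\<close> turns the
  orthogonal sum into maps \<open>g t\<close> that scale \<open>q\<close> by \<open>r t\<close> and have orthogonal images.\<close>

lemma isometric_frame:
  fixes T :: "'t set" and V :: "'v::ab_group_add set"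
  assumes iso: "isometric scale UNIV n s (orth_space T V) (orth_form T r q)"
    and T: "finite T" and V: "0 \<in> V" "q 0 = (0::'f)" "\<And>x y. x \<in> V \<Longrightarrow> y \<in> V \<Longrightarrow> x + y \<in> V"
  obtains g where "\<And>t x. t \<in> T \<Longrightarrow> x \<in> V \<Longrightarrow> n (g t x) = r t * q x"
    "\<And>t t' x y. t \<in> T \<Longrightarrow> t' \<in> T \<Longrightarrow> t \<noteq> t' \<Longrightarrow> x \<in> V \<Longrightarrow> y \<in> V \<Longrightarrow> \<langle>g t x, g t' y\<rangle> = 0"
    "\<And>t x y. t \<in> T \<Longrightarrow> x \<in> V \<Longrightarrow> y \<in> V \<Longrightarrow> g t (x + y) = g t x + g t y"
proof -
  obtain f where f: "bij_betw f UNIV (orth_space T V)" "\<And>x y. f (x + y) = f x + f y"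
    "\<And>x. orth_form T r q (f x) = n x"
    using iso unfolding isometric_def by auto
  let ?d = "\<lambda>t x t'. if t' = t then x else (0::'v)"
  define g where "g t x = inv_into UNIV f (?d t x)" for t x
  have d: "?d t x \<in> orth_space T V" if "t \<in> T" "x \<in> V" for t x
    using that V by (auto simp: orth_space_def)
  have inj: "inj f" using f(1) by (simp add: bij_betw_def)
  have fg: "f (g t x) = ?d t x" if "t \<in> T" "x \<in> V" for t x
    using f(1) d[OF that] unfolding g_def bij_betw_def by (metis f_inv_into_f)
  have n1: "n (g t x) = r t * q x" if "t \<in> T" "x \<in> V" for t x
  proof -
    have "n (g t x) = orth_form T r q (?d t x)" using f(3)[of "g t x"] fg[OF that] by simp
    also have "\<dots> = (\<Sum>t'\<in>T. if t' = t then r t * q x else 0)"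
      unfolding orth_form_def by (rule sum.cong) (auto simp: V)
    finally show ?thesis using that T by simp
  qed
  show thesis
  proof (rule that[of g])
    fix t t' x y assume *: "t \<in> T" "t' \<in> T" "t \<noteq> t'" "x \<in> V" "y \<in> V"
    have "n (g t x + g t' y) = orth_form T r q (?d t x + ?d t' y)"
      using f(3)[of "g t x + g t' y"] fg * by (simp add: f(2))
    also have "\<dots> = (\<Sum>i\<in>T. (if i = t then r t * q x else 0) + (if i = t' then r t' * q y else 0))"
      unfolding orth_form_def by (rule sum.cong) (use *(3) in \<open>auto simp: V\<close>)
    also have "\<dots> = r t * q x + r t' * q y" using * T by (simp add: sum.distrib)
    finally show "\<langle>g t x, g t' y\<rangle> = 0" using n1 * by (simp add: polar_def)
  next
    fix t x y assume *: "t \<in> T" "x \<in> V" "y \<in> V"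
    have "f (g t (x + y)) = f (g t x + g t y)"
      using fg[OF *(1,2)] fg[OF *(1,3)] fg[OF *(1) V(3)[OF *(2,3)]] by (auto simp: f(2))
    then show "g t (x + y) = g t x + g t y" using inj by (simp add: inj_eq)
  qed (use n1 in auto)
qed

end

section \<open>Gradings of a Cayley algebra\<close>

text \<open>Uniqueness of the homogeneous decomposition reduces to the vanishing of the components of zero, and
  only a finite set \<open>T\<close> of degrees has to be inspected.\<close>

lemma gradingI:
  fixes scale :: "'f::field \<Rightarrow> 'c::ab_group_add \<Rightarrow> 'c"
  assumes vs: "vector_space scale" and G: "comm_group G"
    and sub: "\<And>g. g \<in> carrier G \<Longrightarrow> module.subspace scale (\<Gamma> g)"
    and T: "finite T" "T \<subseteq> carrier G" "\<And>g. g \<in> carrier G \<Longrightarrow> g \<notin> T \<Longrightarrow> \<Gamma> g = {0}"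
    and ex: "\<And>x. \<exists>f. (\<forall>g\<in>T. f g \<in> \<Gamma> g) \<and> x = (\<Sum>g\<in>T. f g)"
    and ind: "\<And>f g. (\<And>g. g \<in> T \<Longrightarrow> f g \<in> \<Gamma> g) \<Longrightarrow> (\<Sum>g\<in>T. f g) = 0 \<Longrightarrow> g \<in> T \<Longrightarrow> f g = 0"
    and mult: "\<And>g h x y. g \<in> T \<Longrightarrow> h \<in> T \<Longrightarrow> x \<in> \<Gamma> g \<Longrightarrow> y \<in> \<Gamma> h \<Longrightarrow> mul x y \<in> \<Gamma> (g \<otimes>\<^bsub>G\<^esub> h)"
    and zero: "\<And>x. mul x 0 = 0" "\<And>x. mul 0 x = 0"
  shows "grading scale mul G \<Gamma>"
proof -
  interpret vector_space scale by fact
  interpret G: comm_group G by fact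
  have s0: "0 \<in> \<Gamma> g" if "g \<in> carrier G" for g using sub[OF that] by (rule subspace_0)
  show ?thesis
    unfolding grading_def
  proof (intro conjI ballI allI G sub)
    fix g h x y assume *: "g \<in> carrier G" "h \<in> carrier G" "x \<in> \<Gamma> g" "y \<in> \<Gamma> h"
    show "mul x y \<in> \<Gamma> (g \<otimes>\<^bsub>G\<^esub> h)"
    proof (cases "g \<in> T \<and> h \<in> T")
      case False
      then have "x = 0 \<or> y = 0" using T(3) * by blast
      then show ?thesis using s0 zero * by auto
    qed (use mult * in auto)
  next
    fix x
    let ?P = "\<lambda>f. finite {g. f g \<noteq> 0} \<and> {g. f g \<noteq> 0} \<subseteq> carrier G \<and>
      (\<forall>g\<in>carrier G. f g \<in> \<Gamma> g) \<and> x = (\<Sum>g | f g \<noteq> 0. f g)"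
    have P: "{g. f g \<noteq> 0} \<subseteq> T \<and> (\<forall>g\<in>T. f g \<in> \<Gamma> g) \<and> x = (\<Sum>g\<in>T. f g)" if f: "?P f" for f
    proof -
      have fT: "{g. f g \<noteq> 0} \<subseteq> T"
      proof
        fix g assume g: "g \<in> {g. f g \<noteq> 0}"
        then have "g \<in> carrier G" "f g \<in> \<Gamma> g" using f by auto
        then show "g \<in> T" using T(3)[of g] g by auto
      qed
      then have "(\<Sum>g | f g \<noteq> 0. f g) = (\<Sum>g\<in>T. f g)"
        by (intro sum.mono_neutral_left T(1)) auto
      then show ?thesis using f fT T(2) by auto
    qed
    obtain f where f: "\<forall>g\<in>T. f g \<in> \<Gamma> g" "x = (\<Sum>g\<in>T. f g)" using ex by blast
    let ?f = "\<lambda>g. if g \<in> T then f g else 0"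
    have fT: "{g. ?f g \<noteq> 0} \<subseteq> T" by auto
    have "(\<Sum>g | ?f g \<noteq> 0. ?f g) = (\<Sum>g\<in>T. ?f g)"
      by (intro sum.mono_neutral_left T(1)) auto
    then have "?P ?f"
      using f s0 T(2) finite_subset[OF fT T(1)] fT by auto
    moreover have "h = ?f" if h: "?P h" for h
    proof
      fix g
      show "h g = ?f g"
      proof (cases "g \<in> T")
        case True
        have "h g - f g = 0"
        proof (rule ind[where f = "\<lambda>g. h g - f g", OF _ _ True])
          show "(\<Sum>g\<in>T. h g - f g) = 0" using P[OF h] f(2) by (simp add: sum_subtractf)
          show "h g - f g \<in> \<Gamma> g" if "g \<in> T" for g
            using P[OF h] f(1) that T(2) by (intro subspace_diff[OF sub]) auto
        qed
        then show ?thesis using True by simp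
      next
        case False
        then show ?thesis using P[OF h] by auto
      qed
    qed
    ultimately show "\<exists>!f. ?P f" by (rule ex1I)
  qed
qed

lemma gradingD:
  assumes "grading scale mul G \<Gamma>"
  shows "comm_group G" "\<And>g. g \<in> carrier G \<Longrightarrow> module.subspace scale (\<Gamma> g)"
    "\<And>x. \<exists>f. finite {g. f g \<noteq> 0} \<and> {g. f g \<noteq> 0} \<subseteq> carrier G \<and>
               (\<forall>g\<in>carrier G. f g \<in> \<Gamma> g) \<and> x = (\<Sum>g | f g \<noteq> 0. f g)"
    "\<And>g h x y. g \<in> carrier G \<Longrightarrow> h \<in> carrier G \<Longrightarrow> x \<in> \<Gamma> g \<Longrightarrow> y \<in> \<Gamma> h \<Longrightarrow> mul x y \<in> \<Gamma> (g \<otimes>\<^bsub>G\<^esub> h)"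
proof -
  note g = assms[unfolded grading_def]
  show "comm_group G" using g by (rule conjunct1)
  show "module.subspace scale (\<Gamma> g)" if "g \<in> carrier G" for g
    using g[THEN conjunct2, THEN conjunct1] that by (rule bspec)
  show "\<exists>f. finite {g. f g \<noteq> 0} \<and> {g. f g \<noteq> 0} \<subseteq> carrier G \<and>
               (\<forall>g\<in>carrier G. f g \<in> \<Gamma> g) \<and> x = (\<Sum>g | f g \<noteq> 0. f g)" for x
    using g[THEN conjunct2, THEN conjunct2, THEN conjunct1, THEN spec, of x] by (rule ex1_implies_ex)
  show "mul x y \<in> \<Gamma> (g \<otimes>\<^bsub>G\<^esub> h)" if "g \<in> carrier G" "h \<in> carrier G" "x \<in> \<Gamma> g" "y \<in> \<Gamma> h" for g h x y
    using g[THEN conjunct2, THEN conjunct2, THEN conjunct2] that by blast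
qed

context cayley_algebra
begin

text \<open>The homogeneous component in degree \<open>g\<close>; by uniqueness of the decomposition there is just one
  function to choose from.\<close>

definition hcomp :: "('g, 'm) monoid_scheme \<Rightarrow> ('g \<Rightarrow> 'c set) \<Rightarrow> 'c \<Rightarrow> 'g \<Rightarrow> 'c" where
  "hcomp G \<Gamma> x = (SOME f. finite {g. f g \<noteq> 0} \<and> {g. f g \<noteq> 0} \<subseteq> carrier G \<and>
               (\<forall>g\<in>carrier G. f g \<in> \<Gamma> g) \<and> x = (\<Sum>g | f g \<noteq> 0. f g))"

context
  fixes G :: "('g, 'm) monoid_scheme" and \<Gamma> :: "'g \<Rightarrow> 'c set"
  assumes gr: "grading scale mul G \<Gamma>"
begin

lemma grading_comm_group: "comm_group G" by (rule gradingD(1)[OF gr])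

interpretation G: comm_group G by (rule grading_comm_group)

lemma grading_subspace: "g \<in> carrier G \<Longrightarrow> subspace (\<Gamma> g)" by (rule gradingD(2)[OF gr])

lemma grading_0: "g \<in> carrier G \<Longrightarrow> 0 \<in> \<Gamma> g" by (rule subspace_0[OF grading_subspace])

lemma grading_mult: "g \<in> carrier G \<Longrightarrow> h \<in> carrier G \<Longrightarrow> x \<in> \<Gamma> g \<Longrightarrow> y \<in> \<Gamma> h \<Longrightarrow> x \<star> y \<in> \<Gamma> (g \<otimes>\<^bsub>G\<^esub> h)"
  by (rule gradingD(4)[OF gr])

lemma support_subset: "support G \<Gamma> \<subseteq> carrier G" by (auto simp: support_def)

lemma finite_support: "finite (support G \<Gamma>)"
  by (rule grading_finite_support[OF cayley_algebra_axioms gr])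

lemma not_support: "g \<in> carrier G \<Longrightarrow> g \<notin> support G \<Gamma> \<Longrightarrow> x \<in> \<Gamma> g \<Longrightarrow> x = 0"
  by (auto simp: support_def)

lemma support_iff: "g \<in> carrier G \<Longrightarrow> g \<in> support G \<Gamma> \<longleftrightarrow> (\<exists>x\<in>\<Gamma> g. x \<noteq> 0)"
  using grading_0[of g] by (auto simp: support_def)

lemma hcomp:
  shows hcomp_in: "g \<in> carrier G \<Longrightarrow> hcomp G \<Gamma> x g \<in> \<Gamma> g"
    and hcomp_sum: "(\<Sum>g\<in>support G \<Gamma>. hcomp G \<Gamma> x g) = x"
proof -
  let ?P = "\<lambda>f. finite {g. f g \<noteq> 0} \<and> {g. f g \<noteq> 0} \<subseteq> carrier G \<and>
      (\<forall>g\<in>carrier G. f g \<in> \<Gamma> g) \<and> x = (\<Sum>g | f g \<noteq> 0. f g)"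
  have P: "?P (hcomp G \<Gamma> x)" unfolding hcomp_def by (rule someI_ex[OF gradingD(3)[OF gr]])
  then show "g \<in> carrier G \<Longrightarrow> hcomp G \<Gamma> x g \<in> \<Gamma> g" for g by blast
  have "{g. hcomp G \<Gamma> x g \<noteq> 0} \<subseteq> support G \<Gamma>"
  proof
    fix g assume "g \<in> {g. hcomp G \<Gamma> x g \<noteq> 0}"
    then show "g \<in> support G \<Gamma>" using P not_support[of g "hcomp G \<Gamma> x g"] by auto
  qed
  then have "(\<Sum>g | hcomp G \<Gamma> x g \<noteq> 0. hcomp G \<Gamma> x g) = (\<Sum>g\<in>support G \<Gamma>. hcomp G \<Gamma> x g)"
    by (intro sum.mono_neutral_left finite_support) auto
  then show "(\<Sum>g\<in>support G \<Gamma>. hcomp G \<Gamma> x g) = x" using P by simp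
qed

lemma hcomp_eqI:
  assumes A: "finite A" "A \<subseteq> carrier G" "\<And>g. g \<in> A \<Longrightarrow> f g \<in> \<Gamma> g" "x = (\<Sum>g\<in>A. f g)" and g: "g \<in> carrier G"
  shows "hcomp G \<Gamma> x g = (if g \<in> A then f g else 0)"
proof -
  let ?B = "A \<union> support G \<Gamma>"
  let ?f = "\<lambda>g. (if g \<in> A then f g else 0) - (if g \<in> support G \<Gamma> then hcomp G \<Gamma> x g else 0)"
  have B: "finite ?B" "?B \<subseteq> carrier G" using A finite_support support_subset by auto
  have "(\<Sum>g\<in>?B. if g \<in> A then f g else 0) = (\<Sum>g\<in>A. f g)"
    using B(1) by (intro sum.mono_neutral_cong_right) auto
  moreover have "(\<Sum>g\<in>?B. if g \<in> support G \<Gamma> then hcomp G \<Gamma> x g else 0) = (\<Sum>g\<in>support G \<Gamma>. hcomp G \<Gamma> x g)"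
    using B(1) by (intro sum.mono_neutral_cong_right) auto
  ultimately have s: "(\<Sum>g\<in>?B. ?f g) = 0" using A(4) by (simp add: sum_subtractf hcomp_sum)
  have inG: "?f g \<in> \<Gamma> g" if "g \<in> ?B" for g
    using that A hcomp_in[of g x] B(2) grading_0[of g]
    by (intro subspace_diff[OF grading_subspace]) auto
  have z: "?f g = 0" if "g \<in> ?B" for g
    by (rule grading_sum_eq_0[OF gr vector_space_axioms B inG s that])
  show ?thesis
  proof (cases "g \<in> support G \<Gamma>")
    case True
    then show ?thesis using z[of g] by simp
  next
    case False
    then have 0: "hcomp G \<Gamma> x g = 0" using not_support hcomp_in g by blast
    show ?thesis
    proof (cases "g \<in> A")
      case True
      then show ?thesis using 0 not_support[OF g False A(3)] by simp
    qed (simp add: 0)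
  qed
qed

lemma hcomp_homogeneous:
  assumes "x \<in> \<Gamma> h" "h \<in> carrier G" "g \<in> carrier G"
  shows "hcomp G \<Gamma> x g = (if g = h then x else 0)"
  using hcomp_eqI[of "{h}" "\<lambda>_. x" x g] assms by simp

lemma hcomp_add: assumes "g \<in> carrier G" shows "hcomp G \<Gamma> (x + y) g = hcomp G \<Gamma> x g + hcomp G \<Gamma> y g"
proof -
  have "hcomp G \<Gamma> (x + y) g = (if g \<in> support G \<Gamma> then hcomp G \<Gamma> x g + hcomp G \<Gamma> y g else 0)"
    by (rule hcomp_eqI[OF finite_support support_subset])
      (use assms hcomp_in support_subset in \<open>auto simp: sum.distrib hcomp_sum intro: subspace_add[OF grading_subspace]\<close>)
  then show ?thesis using not_support[OF assms _ hcomp_in[OF assms]] by auto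
qed

lemma hcomp_zero: "g \<in> carrier G \<Longrightarrow> hcomp G \<Gamma> 0 g = 0"
  using hcomp_add[of g 0 0] by simp

lemma hcomp_sum_distrib: "g \<in> carrier G \<Longrightarrow> hcomp G \<Gamma> (sum f I) g = (\<Sum>i\<in>I. hcomp G \<Gamma> (f i) g)"
  by (induction I rule: infinite_finite_induct) (simp_all add: hcomp_add hcomp_zero)

lemma hcomp_nonzero:
  assumes "x \<noteq> 0" obtains g where "g \<in> carrier G" "hcomp G \<Gamma> x g \<noteq> 0"
proof -
  have "\<exists>g\<in>support G \<Gamma>. hcomp G \<Gamma> x g \<noteq> 0"
  proof (rule ccontr)
    assume "\<not> ?thesis"
    then have "(\<Sum>g\<in>support G \<Gamma>. hcomp G \<Gamma> x g) = 0" by (intro sum.neutral) auto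
    then show False using assms by (simp add: hcomp_sum)
  qed
  then show thesis using that support_subset by blast
qed

lemma homogeneous_unique:
  assumes "x \<in> \<Gamma> g" "x \<in> \<Gamma> h" "g \<in> carrier G" "h \<in> carrier G" "x \<noteq> 0" shows "g = h"
  using hcomp_homogeneous[OF assms(1,3,3)] hcomp_homogeneous[OF assms(2,4,3)] assms(5) by (auto split: if_splits)

text \<open>Comparing components of degree \<open>h\<close> in \<open>1 x = x\<close>, for \<open>x\<close> of degree \<open>h\<close>, shows that the component of the
  unit in degree \<open>e\<close> is a left unit on homogeneous elements, hence equal to the unit.\<close>

lemma unit_homogeneous: "unit \<in> \<Gamma> \<one>\<^bsub>G\<^esub>"
proof -
  let ?e = "hcomp G \<Gamma> unit \<one>\<^bsub>G\<^esub>"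
  have h: "?e \<star> x = x" if x: "x \<in> \<Gamma> h" "h \<in> carrier G" for x h
  proof -
    let ?A = "(\<lambda>g. g \<otimes>\<^bsub>G\<^esub> h) ` support G \<Gamma>"
    let ?f = "\<lambda>k. hcomp G \<Gamma> unit (k \<otimes>\<^bsub>G\<^esub> inv\<^bsub>G\<^esub> h) \<star> x"
    have inj: "inj_on (\<lambda>g. g \<otimes>\<^bsub>G\<^esub> h) (support G \<Gamma>)"
      using support_subset x(2) by (intro inj_onI) (metis G.right_cancel subsetD)
    have rc: "g \<otimes>\<^bsub>G\<^esub> h \<otimes>\<^bsub>G\<^esub> inv\<^bsub>G\<^esub> h = g" if "g \<in> carrier G" for g
      using that x(2) by (simp add: G.m_assoc)
    have "hcomp G \<Gamma> x h = (if h \<in> ?A then ?f h else 0)"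
    proof (rule hcomp_eqI[of ?A ?f])
      show "finite ?A" using finite_support by simp
      show "?A \<subseteq> carrier G" using support_subset x(2) by auto
      show "?f k \<in> \<Gamma> k" if "k \<in> ?A" for k
      proof -
        from that obtain g where g: "g \<in> support G \<Gamma>" "k = g \<otimes>\<^bsub>G\<^esub> h" by blast
        then have gc: "g \<in> carrier G" using support_subset by blast
        then show ?thesis using grading_mult[OF gc x(2) hcomp_in[OF gc] x(1)] by (simp add: g(2) rc)
      qed
      have "x = (\<Sum>g\<in>support G \<Gamma>. hcomp G \<Gamma> unit g) \<star> x" by (simp add: hcomp_sum one_mult)
      also have "\<dots> = (\<Sum>g\<in>support G \<Gamma>. hcomp G \<Gamma> unit g \<star> x)" by (rule mult_sum_left)
      also have "\<dots> = (\<Sum>g\<in>support G \<Gamma>. ?f (g \<otimes>\<^bsub>G\<^esub> h))"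
        by (rule sum.cong) (use rc support_subset in auto)
      also have "\<dots> = sum ?f ?A" by (simp add: sum.reindex[OF inj])
      finally show "x = sum ?f ?A" .
    qed (rule x(2))
    moreover have "h \<otimes>\<^bsub>G\<^esub> inv\<^bsub>G\<^esub> h = \<one>\<^bsub>G\<^esub>" by (rule G.r_inv[OF x(2)])
    moreover have "hcomp G \<Gamma> x h = x" using hcomp_homogeneous[OF x x(2)] by simp
    ultimately have eq: "x = (if h \<in> ?A then ?e \<star> x else 0)" by argo
    show ?thesis
    proof (cases "h \<in> ?A")
      case True
      then show ?thesis using eq by argo
    next
      case False
      then have "x = 0" using eq by argo
      then show ?thesis by simp
    qed
  qed
  \<comment> \<open>a left unit on all of the algebra: \<open>?e = ?e 1 = 1\<close>\<close>
  have "?e = ?e \<star> (\<Sum>g\<in>support G \<Gamma>. hcomp G \<Gamma> unit g)" by (simp add: hcomp_sum mult_one)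
  also have "\<dots> = (\<Sum>g\<in>support G \<Gamma>. hcomp G \<Gamma> unit g)"
    unfolding mult_sum_right by (rule sum.cong) (use h[OF hcomp_in] support_subset in auto)
  finally have "?e = unit" by (simp add: hcomp_sum)
  then show ?thesis using hcomp_in[of "\<one>\<^bsub>G\<^esub>" unit] by simp
qed

text \<open>In \<open>x\<^sup>2 = t(x) x - n(x) 1\<close> the middle term has degree \<open>g\<close>, the others have degrees \<open>g\<^sup>2\<close> and \<open>e\<close>.\<close>

lemma trace_homogeneous:
  assumes x: "x \<in> \<Gamma> g" "g \<in> carrier G" "g \<noteq> \<one>\<^bsub>G\<^esub>" shows "\<langle>x, unit\<rangle> = 0"
proof -
  have gg: "g \<otimes>\<^bsub>G\<^esub> g \<noteq> g" using x by (metis G.r_cancel_one)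
  have sc: "a \<cdot> y \<in> \<Gamma> k" if "y \<in> \<Gamma> k" "k \<in> carrier G" for a y k
    using subspace_scale[OF grading_subspace] that by blast
  have "\<langle>x, unit\<rangle> \<cdot> x = x \<star> x + n x \<cdot> unit" by (simp add: square_eq)
  then have "hcomp G \<Gamma> (\<langle>x, unit\<rangle> \<cdot> x) g = hcomp G \<Gamma> (x \<star> x) g + hcomp G \<Gamma> (n x \<cdot> unit) g"
    by (simp only: hcomp_add[OF x(2)])
  then have "\<langle>x, unit\<rangle> \<cdot> x = 0"
    using hcomp_homogeneous[OF sc[OF x(1,2)] x(2,2)] hcomp_homogeneous[OF grading_mult[OF x(2,2,1,1)] _ x(2)]
      hcomp_homogeneous[OF sc[OF unit_homogeneous] _ x(2)] x gg by simp
  then show ?thesis by auto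
qed

lemma cnj_homogeneous: assumes "x \<in> \<Gamma> g" "g \<in> carrier G" shows "cnj x \<in> \<Gamma> g"
proof (cases "g = \<one>\<^bsub>G\<^esub>")
  case True
  then show ?thesis unfolding cnj_def using unit_homogeneous assms
    by (auto intro: subspace_diff[OF grading_subspace] subspace_scale[OF grading_subspace])
next
  case False
  then show ?thesis using trace_homogeneous[OF assms False] subspace_neg[OF grading_subspace] assms
    by (simp add: cnj_def)
qed

text \<open>\<open>\<langle>x, y\<rangle>\<close> is the trace of \<open>x cnj(y)\<close>, which is homogeneous of degree \<open>g h\<close>.\<close>

lemma bil_homogeneous:
  assumes "x \<in> \<Gamma> g" "y \<in> \<Gamma> h" "g \<in> carrier G" "h \<in> carrier G" "g \<otimes>\<^bsub>G\<^esub> h \<noteq> \<one>\<^bsub>G\<^esub>" shows "\<langle>x, y\<rangle> = 0"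
  using trace_homogeneous[OF grading_mult[OF assms(3,4,1) cnj_homogeneous[OF assms(2,4)]]] assms
  by (simp add: trace_mult_cnj)

text \<open>Orthogonal complements of homogeneous sets are graded subspaces: each homogeneous \<open>b\<close> pairs with a single
  component of \<open>y\<close>.\<close>

lemma hcomp_perp:
  assumes B: "\<And>b. b \<in> B \<Longrightarrow> \<exists>k\<in>carrier G. b \<in> \<Gamma> k" and y: "y \<in> perp B" and g: "g \<in> carrier G"
  shows "hcomp G \<Gamma> y g \<in> perp B"
  unfolding perp_def
proof (intro CollectI ballI)
  fix b assume b: "b \<in> B"
  then obtain k where k: "k \<in> carrier G" "b \<in> \<Gamma> k" using B by blast
  show "\<langle>hcomp G \<Gamma> y g, b\<rangle> = 0"
  proof (cases "g \<otimes>\<^bsub>G\<^esub> k = \<one>\<^bsub>G\<^esub> \<and> g \<in> support G \<Gamma>")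
    case False
    then show ?thesis
      using bil_homogeneous[OF hcomp_in[OF g] k(2) g k(1)] not_support[OF g _ hcomp_in[OF g], of y] by auto
  next
    case True
    have "0 = \<langle>\<Sum>h\<in>support G \<Gamma>. hcomp G \<Gamma> y h, b\<rangle>" using y b by (simp add: hcomp_sum perp_def)
    also have "\<dots> = (\<Sum>h\<in>support G \<Gamma>. \<langle>hcomp G \<Gamma> y h, b\<rangle>)" by (rule bil_sum)
    also have "\<dots> = (\<Sum>h\<in>{g}. \<langle>hcomp G \<Gamma> y h, b\<rangle>)"
    proof (rule sum.mono_neutral_right[OF finite_support])
      show "\<forall>h\<in>support G \<Gamma> - {g}. \<langle>hcomp G \<Gamma> y h, b\<rangle> = 0"
      proof
        fix h assume h: "h \<in> support G \<Gamma> - {g}"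
        then have hc: "h \<in> carrier G" using support_subset by blast
        have "h \<otimes>\<^bsub>G\<^esub> k \<noteq> \<one>\<^bsub>G\<^esub>" using True h hc g k(1) by (metis DiffE G.right_cancel singletonI)
        then show "\<langle>hcomp G \<Gamma> y h, b\<rangle> = 0" using bil_homogeneous[OF hcomp_in[OF hc] k(2) hc k(1)] by simp
      qed
    qed (use True in auto)
    finally show ?thesis by simp
  qed
qed

lemma homogeneous_in_perp:
  assumes B: "\<And>b. b \<in> B \<Longrightarrow> \<exists>k\<in>carrier G. b \<in> \<Gamma> k" and y: "y \<in> perp B" "y \<noteq> 0"
  obtains g x where "g \<in> carrier G" "x \<in> \<Gamma> g" "x \<in> perp B" "x \<noteq> 0"
proof -
  obtain g where g: "g \<in> carrier G" "hcomp G \<Gamma> y g \<noteq> 0" by (rule hcomp_nonzero[OF y(2)])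
  show thesis by (rule that[OF g(1) hcomp_in[OF g(1)] hcomp_perp[OF B y(1) g(1)] g(2)])
qed

end

section \<open>Refinements and fineness\<close>

definition refines :: "('h, 'k) monoid_scheme \<Rightarrow> ('h \<Rightarrow> 'c set) \<Rightarrow> ('g, 'm) monoid_scheme \<Rightarrow> ('g \<Rightarrow> 'c set) \<Rightarrow> bool" where
  "refines H \<Delta> G \<Gamma> \<longleftrightarrow> (\<forall>h\<in>support H \<Delta>. \<exists>g\<in>support G \<Gamma>. \<Delta> h \<subseteq> \<Gamma> g)"

lemma properly_refines_iff:
  "properly_refines H \<Delta> G \<Gamma> \<longleftrightarrow>
     refines H \<Delta> G \<Gamma> \<and> (\<exists>h\<in>support H \<Delta>. \<exists>g\<in>support G \<Gamma>. \<Delta> h \<subset> \<Gamma> g)"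
  by (simp add: properly_refines_def refines_def components_def)

text \<open>Each component of \<open>\<Delta>\<close> lies in one component of \<open>\<Gamma>\<close>, so grouping the \<open>\<Delta>\<close>-components of \<open>x\<close> according to
  where they lie yields its \<open>\<Gamma>\<close>-decomposition, in which only the group of degree \<open>g\<close> survives.\<close>

lemma refinement_hcomp:
  assumes G: "grading scale mul G \<Gamma>" and H: "grading scale mul H \<Delta>" and r: "refines H \<Delta> G \<Gamma>"
    and x: "x \<in> \<Gamma> g" "g \<in> carrier G" and h: "h \<in> carrier H"
  shows "hcomp H \<Delta> x h \<in> \<Gamma> g"
proof -
  let ?S = "support H \<Delta>" and ?c = "hcomp H \<Delta> x"
  let ?f = "\<lambda>h. if \<Delta> h \<subseteq> \<Gamma> g then ?c h else 0"
  have Sc: "k \<in> carrier H" if "k \<in> ?S" for k using that by (simp add: support_def)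
  have "hcomp G \<Gamma> (?c k) g = ?f k" if k: "k \<in> ?S" for k
  proof -
    obtain g' where g': "g' \<in> support G \<Gamma>" "\<Delta> k \<subseteq> \<Gamma> g'" using r k unfolding refines_def by blast
    have gc: "g' \<in> carrier G" using g'(1) by (simp add: support_def)
    have ck: "?c k \<in> \<Gamma> g'" using hcomp_in[OF H Sc[OF k]] g'(2) by blast
    show ?thesis
    proof (cases "\<Delta> k \<subseteq> \<Gamma> g")
      case True
      then have "?c k \<in> \<Gamma> g" using hcomp_in[OF H Sc[OF k]] by blast
      then show ?thesis using True hcomp_homogeneous[OF G _ x(2) x(2)] by simp
    next
      case False
      then have "g \<noteq> g'" using g'(2) by blast
      then show ?thesis using False hcomp_homogeneous[OF G ck gc x(2)] by simp
    qed
  qed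
  then have "hcomp G \<Gamma> (\<Sum>k\<in>?S. ?c k) g = (\<Sum>k\<in>?S. ?f k)"
    by (simp add: hcomp_sum_distrib[OF G x(2)])
  then have s: "x = (\<Sum>k\<in>?S. ?f k)"
    using hcomp_homogeneous[OF G x(1,2,2)] by (simp add: hcomp_sum[OF H])
  have "?c h = (if h \<in> ?S then ?f h else 0)"
    by (rule hcomp_eqI[OF H finite_support[OF H] support_subset[OF H] _ s h])
      (use hcomp_in[OF H] grading_0[OF H] Sc in auto)
  moreover have "0 \<in> \<Gamma> g" by (rule grading_0[OF G x(2)])
  ultimately show ?thesis using hcomp_in[OF H h, of x] by (auto split: if_splits)
qed

text \<open>Distinct components of \<open>\<Delta>\<close> intersect in zero. If each component of \<open>\<Gamma>\<close> is contained in one of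
  \<open>\<Delta>\<close>, then a component of \<open>\<Delta>\<close> cannot be strictly smaller than the one of \<open>\<Gamma>\<close> around it.\<close>

lemma fine_gradingI:
  fixes G :: "('g, 'm) monoid_scheme"
  assumes G: "grading scale mul G \<Gamma>"
    and whole: "\<And>(H :: nat monoid) \<Delta> g. \<lbrakk>grading scale mul H \<Delta>; refines H \<Delta> G \<Gamma>; g \<in> support G \<Gamma>\<rbrakk>
      \<Longrightarrow> \<exists>h\<in>carrier H. \<Gamma> g \<subseteq> \<Delta> h"
  shows "fine_grading scale mul G \<Gamma>"
  unfolding fine_grading_def
proof (intro conjI G notI)
  assume "\<exists>(H :: nat monoid) \<Delta>. grading scale mul H \<Delta> \<and> properly_refines H \<Delta> G \<Gamma>"
  then obtain H :: "nat monoid" and \<Delta> h g where H: "grading scale mul H \<Delta>" "refines H \<Delta> G \<Gamma>"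
    and h: "h \<in> support H \<Delta>" and g: "g \<in> support G \<Gamma>" "\<Delta> h \<subset> \<Gamma> g"
    unfolding properly_refines_iff by blast
  obtain k where k: "k \<in> carrier H" "\<Gamma> g \<subseteq> \<Delta> k" using whole[OF H g(1)] by blast
  have hc: "h \<in> carrier H" using h by (simp add: support_def)
  obtain x where x: "x \<in> \<Delta> h" "x \<noteq> 0" using h support_iff[OF H(1) hc] by blast
  have "h = k" using homogeneous_unique[OF H(1) x(1) _ hc k(1) x(2)] x(1) g(2) k(2) by blast
  then show False using g(2) k(2) by blast
qed

lemma line_in_refinement:
  assumes G: "grading scale mul G \<Gamma>" and H: "grading scale mul H \<Delta>" "refines H \<Delta> G \<Gamma>"
    and g: "g \<in> carrier G" "\<Gamma> g = span {b}" and b: "b \<noteq> 0"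
  obtains h where "h \<in> carrier H" "b \<in> \<Delta> h"
proof -
  obtain h where h: "h \<in> carrier H" "hcomp H \<Delta> b h \<noteq> 0" by (rule hcomp_nonzero[OF H(1) b])
  have "b \<in> \<Gamma> g" unfolding g(2) by (simp add: span_base)
  from refinement_hcomp[OF G H this g(1) h(1)] obtain c where c: "hcomp H \<Delta> b h = c \<cdot> b"
    unfolding g(2) by (auto simp: span_singleton)
  then have "b = inverse c \<cdot> hcomp H \<Delta> b h" using h(2) by auto
  also have "\<dots> \<in> \<Delta> h" by (rule subspace_scale[OF grading_subspace[OF H(1) h(1)] hcomp_in[OF H(1) h(1)]])
  finally show thesis by (rule that[OF h(1)])
qed

text \<open>The form in which fineness enters the classification: as the refinement is not proper, the
  two gradings have the same nonzero components, and the identity map is an equivalence.\<close>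

lemma fine_grading_equivalent:
  assumes fine: "fine_grading scale mul G \<Gamma>" and H: "grading scale mul H \<Delta>"
    and r: "\<And>h. h \<in> support H \<Delta> \<Longrightarrow> \<exists>k\<in>carrier G. \<Delta> h \<subseteq> \<Gamma> k"
  shows "equivalent_gradings scale mul G \<Gamma> H \<Delta>"
proof -
  have G: "grading scale mul G \<Gamma>" using fine unfolding fine_grading_def by (rule conjunct1)
  have Sc: "h \<in> carrier H" "\<exists>y\<in>\<Delta> h. y \<noteq> 0" if "h \<in> support H \<Delta>" for h
    using that support_iff[OF H] by (auto simp: support_def)
  have ref: "refines H \<Delta> G \<Gamma>"
    unfolding refines_def
  proof
    fix h assume h: "h \<in> support H \<Delta>"
    obtain k where k: "k \<in> carrier G" "\<Delta> h \<subseteq> \<Gamma> k" using r[OF h] by blast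
    then have "k \<in> support G \<Gamma>" using Sc(2)[OF h] support_iff[OF G] by blast
    then show "\<exists>g\<in>support G \<Gamma>. \<Delta> h \<subseteq> \<Gamma> g" using k(2) by blast
  qed
  have np: "\<not> (\<exists>h\<in>support H \<Delta>. \<exists>g\<in>support G \<Gamma>. \<Delta> h \<subset> \<Gamma> g)"
    using fine_grading_no_refinement[OF cayley_algebra_axioms fine H] ref unfolding properly_refines_iff by simp
  have eq: "\<exists>g\<in>support G \<Gamma>. \<Delta> h = \<Gamma> g" if h: "h \<in> support H \<Delta>" for h
  proof -
    obtain g where g: "g \<in> support G \<Gamma>" "\<Delta> h \<subseteq> \<Gamma> g" using ref h unfolding refines_def by (elim ballE bexE) auto
    have "\<not> \<Delta> h \<subset> \<Gamma> g" using np h g(1) by (metis (no_types))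
    then show ?thesis using g by (intro bexI[of _ g]) auto
  qed
  have "\<exists>h\<in>support H \<Delta>. \<Gamma> g = \<Delta> h" if g: "g \<in> support G \<Gamma>" for g
  proof -
    have gc: "g \<in> carrier G" using g by (simp add: support_def)
    obtain y where y: "y \<in> \<Gamma> g" "y \<noteq> 0" using g support_iff[OF G gc] by blast
    obtain h where h: "h \<in> carrier H" "hcomp H \<Delta> y h \<noteq> 0" by (rule hcomp_nonzero[OF H y(2)])
    note yh = hcomp_in[OF H h(1), of y]
    have hS: "h \<in> support H \<Delta>" using support_iff[OF H h(1)] yh h(2) by blast
    then obtain g' where g': "g' \<in> support G \<Gamma>" "\<Delta> h = \<Gamma> g'" using eq by blast
    then have "g' \<in> carrier G" by (simp add: support_def)
    then have "g' = g"
      using homogeneous_unique[OF G _ refinement_hcomp[OF G H ref y(1) gc h(1)] _ gc h(2)] yh g'(2) by simp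
    then show ?thesis using hS g'(2) by blast
  qed
  then have "components G \<Gamma> = components H \<Delta>" using eq unfolding components_def by blast
  then show ?thesis
    unfolding equivalent_gradings_def by (intro exI[of _ id]) (simp add: alg_iso_on_id bij_betw_def)
qed

end

section \<open>Universal groups\<close>

lemma comm_group_field_units: "comm_group (field_units :: 'f::field monoid)"
proof (rule comm_groupI)
  fix x :: 'f assume "x \<in> carrier field_units"
  then show "\<exists>y\<in>carrier field_units. y \<otimes>\<^bsub>field_units\<^esub> x = \<one>\<^bsub>field_units\<^esub>"
    by (intro bexI[of _ "inverse x"]) (auto simp: field_units_def)
qed (auto simp: field_units_def)

lemma field_units_simps [simp]: "x \<otimes>\<^bsub>field_units\<^esub> y = x * y" "\<one>\<^bsub>field_units\<^esub> = 1"
  "x \<in> carrier field_units \<longleftrightarrow> x \<noteq> 0"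
  by (simp_all add: field_units_def)

lemma group_isoD:
  assumes "\<chi> \<in> iso G H" "comm_group G" "comm_group H"
  shows "\<And>g. g \<in> carrier G \<Longrightarrow> \<chi> g \<in> carrier H"
    "\<And>g h. g \<in> carrier G \<Longrightarrow> h \<in> carrier G \<Longrightarrow> \<chi> (g \<otimes>\<^bsub>G\<^esub> h) = \<chi> g \<otimes>\<^bsub>H\<^esub> \<chi> h"
    "\<chi> \<one>\<^bsub>G\<^esub> = \<one>\<^bsub>H\<^esub>"
    "\<And>g h. \<chi> g = \<chi> h \<Longrightarrow> g \<in> carrier G \<Longrightarrow> h \<in> carrier G \<Longrightarrow> g = h"
  using assms hom_one[of \<chi> G H] comm_group.axioms(2)[of G] comm_group.axioms(2)[of H] unfolding iso_def
  by (auto simp: hom_def bij_betw_def inj_on_def)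

context cayley_algebra
begin

lemma universal_relators_subset:
  "universal_relators scale mul G \<Gamma> \<subseteq> carrier (free_Abelian_group (support G \<Gamma>))"
proof
  fix r assume "r \<in> universal_relators scale mul G \<Gamma>"
  then obtain s1 s2 s3 where "r = frag_of s1 + frag_of s2 - frag_of s3"
    "s1 \<in> support G \<Gamma>" "s2 \<in> support G \<Gamma>" "s3 \<in> support G \<Gamma>"
    unfolding universal_relators_def by blast
  then show "r \<in> carrier (free_Abelian_group (support G \<Gamma>))"
    using keys_add[of "frag_of s1" "frag_of s2"] keys_diff[of "frag_of s1 + frag_of s2" "frag_of s3"] by auto
qed

text \<open>Sending \<open>s\<close> to \<open>s\<close> defines a homomorphism \<open>\<theta>\<close> from the free abelian group on the support onto \<open>G\<close> that
  kills the relators. A map \<open>\<rho>\<close> in the other direction, additive modulo the relators and inverse to \<open>\<theta>\<close> on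
  generators, satisfies \<open>c \<equiv> \<rho>(\<theta>(c))\<close> for all \<open>c\<close> by induction, which identifies the kernel.\<close>

lemma universal_group_iso:
  fixes G :: "('g, 'm) monoid_scheme" and \<rho> :: "'g \<Rightarrow> 'g \<Rightarrow>\<^sub>0 int"
  assumes gr: "grading scale mul G \<Gamma>"
    and gen: "\<And>H. subgroup H G \<Longrightarrow> support G \<Gamma> \<subseteq> H \<Longrightarrow> carrier G \<subseteq> H"
  defines "F \<equiv> free_Abelian_group (support G \<Gamma>)"
  defines "N \<equiv> generate F (universal_relators scale mul G \<Gamma>)"
  assumes \<rho>: "\<And>x. x \<in> carrier G \<Longrightarrow> \<rho> x \<in> carrier F"
    and \<rho>_supp: "\<And>s. s \<in> support G \<Gamma> \<Longrightarrow> frag_of s - \<rho> s \<in> N"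
    and \<rho>_mult: "\<And>x y. x \<in> carrier G \<Longrightarrow> y \<in> carrier G \<Longrightarrow> \<rho> (x \<otimes>\<^bsub>G\<^esub> y) - \<rho> x - \<rho> y \<in> N"
  shows "universal_group scale mul G \<Gamma> \<cong> G"
proof -
  let ?S = "support G \<Gamma>" and ?R = "universal_relators scale mul G \<Gamma>"
  interpret G: comm_group G by (rule grading_comm_group[OF gr])
  interpret F: comm_group F unfolding F_def by (rule abelian_free_Abelian_group)
  have SG: "?S \<subseteq> carrier G" by (auto simp: support_def)
  have RF: "?R \<subseteq> carrier F" unfolding F_def by (rule universal_relators_subset)
  have N: "subgroup N F" unfolding N_def by (rule F.generate_is_subgroup[OF RF])
  have Nc: "x \<in> carrier F" if "x \<in> N" for x using that N subgroup.subset by blast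
  have N0: "0 \<in> N" using subgroup.one_closed[OF N] by (simp add: F_def)
  have Na: "x + y \<in> N" if "x \<in> N" "y \<in> N" for x y using subgroup.m_closed[OF N that] by (simp add: F_def)
  have Nm: "- x \<in> N" if "x \<in> N" for x
    using subgroup.m_inv_closed[OF N that] Nc[OF that] by (simp add: F_def)
  have Nd: "x - y \<in> N" if "x \<in> N" "y \<in> N" for x y using Na[OF that(1) Nm[OF that(2)]] by simp
  obtain \<theta> where \<theta>: "\<theta> \<in> hom F G" "\<And>s. s \<in> ?S \<Longrightarrow> \<theta> (frag_of s) = s"
    using G.free_Abelian_group_universal[of id ?S] SG unfolding F_def by auto
  interpret \<theta>: group_hom F G \<theta> by (unfold_locales) (rule \<theta>(1))
  have \<theta>_add: "\<theta> (x + y) = \<theta> x \<otimes>\<^bsub>G\<^esub> \<theta> y" if "x \<in> carrier F" "y \<in> carrier F" for x y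
    using \<theta>.hom_mult[OF that] by (simp add: F_def)
  have \<theta>_minus: "\<theta> (- x) = inv\<^bsub>G\<^esub> \<theta> x" if "x \<in> carrier F" for x
    using \<theta>.hom_inv[OF that] that by (simp add: F_def)
  have Fm: "- x \<in> carrier F" if "x \<in> carrier F" for x
    using F.inv_closed[OF that] that by (simp add: F_def)
  have Fa: "x + y \<in> carrier F" if "x \<in> carrier F" "y \<in> carrier F" for x y
    using F.m_closed[OF that] by (simp add: F_def)
  have \<theta>_diff: "\<theta> (x - y) = \<theta> x \<otimes>\<^bsub>G\<^esub> inv\<^bsub>G\<^esub> \<theta> y" if "x \<in> carrier F" "y \<in> carrier F" for x y
    using \<theta>_add[OF that(1) Fm[OF that(2)]] \<theta>_minus[OF that(2)] by simp
  have fr: "frag_of s \<in> carrier F" if "s \<in> ?S" for s using that by (simp add: F_def)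
  have Rker: "\<theta> r = \<one>\<^bsub>G\<^esub>" if "r \<in> ?R" for r
  proof -
    obtain s1 s2 s3 where s: "r = frag_of s1 + frag_of s2 - frag_of s3" "s1 \<in> ?S" "s2 \<in> ?S" "s3 \<in> ?S"
      and P: "set_prod scale mul (\<Gamma> s1) (\<Gamma> s2) \<noteq> {0}" "set_prod scale mul (\<Gamma> s1) (\<Gamma> s2) \<subseteq> \<Gamma> s3"
      using \<open>r \<in> ?R\<close> unfolding universal_relators_def by blast
    have sc: "s1 \<in> carrier G" "s2 \<in> carrier G" "s3 \<in> carrier G" using s SG by auto
    have "\<exists>x\<in>\<Gamma> s1. \<exists>y\<in>\<Gamma> s2. x \<star> y \<noteq> 0"
    proof (rule ccontr)
      assume "\<not> ?thesis"
      then have "{x \<star> y |x y. x \<in> \<Gamma> s1 \<and> y \<in> \<Gamma> s2} \<subseteq> {0}" by auto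
      then have "set_prod scale mul (\<Gamma> s1) (\<Gamma> s2) \<subseteq> {0}"
        unfolding set_prod_def by (intro span_minimal) auto
      then show False using P(1) span_zero unfolding set_prod_def by blast
    qed
    then obtain x y where xy: "x \<in> \<Gamma> s1" "y \<in> \<Gamma> s2" "x \<star> y \<noteq> 0" by blast
    have "x \<star> y \<in> \<Gamma> s3" using P(2) xy unfolding set_prod_def by (blast intro: span_base)
    then have "s3 = s1 \<otimes>\<^bsub>G\<^esub> s2"
      using homogeneous_unique[OF gr _ grading_mult[OF gr sc(1,2) xy(1,2)] sc(3) _ xy(3)] sc by simp
    then show ?thesis using s fr sc by (simp add: \<theta>_diff \<theta>_add Fa \<theta>(2))
  qed
  have ker: "kernel F G \<theta> = N"
  proof
    have "subgroup (kernel F G \<theta>) F" by (rule \<theta>.subgroup_kernel)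
    moreover have "?R \<subseteq> kernel F G \<theta>" using RF Rker by (auto simp: kernel_def)
    ultimately show "N \<subseteq> kernel F G \<theta>" unfolding N_def by (rule F.generate_subgroup_incl[rotated])
    have \<rho>1: "\<rho> \<one>\<^bsub>G\<^esub> \<in> N" using Nm[OF \<rho>_mult[OF G.one_closed G.one_closed]] by simp
    have \<rho>inv: "\<rho> (inv\<^bsub>G\<^esub> x) + \<rho> x \<in> N" if "x \<in> carrier G" for x
      using Nd[OF \<rho>1 \<rho>_mult[of x "inv\<^bsub>G\<^esub> x"]] that by (simp add: algebra_simps)
    \<comment> \<open>the inductive statement carries the support along, as \<open>\<theta>\<close> is controlled only there\<close>
    have main: "Poly_Mapping.keys c \<subseteq> ?S \<and> c - \<rho> (\<theta> c) \<in> N" if "Poly_Mapping.keys c \<subseteq> ?S" for c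
      using that
    proof (induction c rule: frag_induction)
      case zero
      have "\<theta> 0 = \<one>\<^bsub>G\<^esub>" using \<theta>.hom_one by (simp add: F_def)
      then show ?case using Nm[OF \<rho>1] by simp
    next
      case (one s)
      then show ?case using \<rho>_supp by (simp add: \<theta>(2))
    next
      case (diff a b)
      then have c: "a \<in> carrier F" "b \<in> carrier F" by (auto simp: F_def)
      have t: "\<theta> a \<in> carrier G" "inv\<^bsub>G\<^esub> \<theta> b \<in> carrier G" "\<theta> b \<in> carrier G" using c by auto
      have ab: "a - \<rho> (\<theta> a) \<in> N" "b - \<rho> (\<theta> b) \<in> N" using diff by auto
      have "(a - \<rho> (\<theta> a)) - (b - \<rho> (\<theta> b)) - (\<rho> (\<theta> a \<otimes>\<^bsub>G\<^esub> inv\<^bsub>G\<^esub> \<theta> b) - \<rho> (\<theta> a) - \<rho> (inv\<^bsub>G\<^esub> \<theta> b))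
        - (\<rho> (inv\<^bsub>G\<^esub> \<theta> b) + \<rho> (\<theta> b)) \<in> N"
        by (rule Nd[OF Nd[OF Nd[OF ab] \<rho>_mult[OF t(1,2)]] \<rho>inv[OF t(3)]])
      then have "a - b - \<rho> (\<theta> (a - b)) \<in> N" by (simp add: \<theta>_diff[OF c] algebra_simps)
      moreover have "Poly_Mapping.keys (a - b) \<subseteq> ?S" using diff keys_diff[of a b] by blast
      ultimately show ?case by blast
    qed
    show "kernel F G \<theta> \<subseteq> N"
    proof
      fix c assume "c \<in> kernel F G \<theta>"
      then have "Poly_Mapping.keys c \<subseteq> ?S" "\<theta> c = \<one>\<^bsub>G\<^esub>" by (auto simp: kernel_def F_def)
      then have "c - \<rho> \<one>\<^bsub>G\<^esub> \<in> N" using main[of c] by simp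
      then show "c \<in> N" using Na[OF _ \<rho>1] by fastforce
    qed
  qed
  have "?S \<subseteq> \<theta> ` carrier F" using \<theta>(2) fr by (metis image_eqI subsetI)
  then have "\<theta> ` carrier F = carrier G" using gen[OF \<theta>.img_is_subgroup] by auto
  then have "F Mod (kernel F G \<theta>) \<cong> G" by (rule \<theta>.FactGroup_iso)
  then show ?thesis unfolding ker unfolding universal_group_def N_def F_def .
qed

lemma universal_relatorI:
  assumes gr: "grading scale mul G \<Gamma>" and s: "s \<in> support G \<Gamma>" "t \<in> support G \<Gamma>"
    and xy: "x \<in> \<Gamma> s" "y \<in> \<Gamma> t" "x \<star> y \<noteq> 0"
  shows "frag_of s + frag_of t - frag_of (s \<otimes>\<^bsub>G\<^esub> t) \<in> universal_relators scale mul G \<Gamma>"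
proof -
  interpret G: comm_group G by (rule grading_comm_group[OF gr])
  have sc: "s \<in> carrier G" "t \<in> carrier G" using s by (auto simp: support_def)
  have st: "x \<star> y \<in> \<Gamma> (s \<otimes>\<^bsub>G\<^esub> t)" by (rule grading_mult[OF gr sc xy(1,2)])
  have "s \<otimes>\<^bsub>G\<^esub> t \<in> support G \<Gamma>" using support_iff[OF gr] st xy(3) sc by auto
  moreover have "x \<star> y \<in> set_prod scale mul (\<Gamma> s) (\<Gamma> t)"
    unfolding set_prod_def using xy by (blast intro: span_base)
  moreover have "set_prod scale mul (\<Gamma> s) (\<Gamma> t) \<subseteq> \<Gamma> (s \<otimes>\<^bsub>G\<^esub> t)"
    unfolding set_prod_def
    by (rule span_minimal) (use grading_mult[OF gr sc] grading_subspace[OF gr] sc in auto)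
  ultimately show ?thesis unfolding universal_relators_def using s xy(3) by blast
qed

section \<open>Division gradings and the norms of their components\<close>

definition norms :: "'c set \<Rightarrow> 'f set" where
  "norms X = n ` (X - {0})"

lemma norms_match:
  assumes "norms X = norms Y" "x \<in> X" "n x \<noteq> 0" shows "\<exists>y\<in>Y. y \<noteq> 0 \<and> n y = n x"
proof -
  have "n x \<in> norms X" using assms(2,3) by (auto simp: norms_def)
  then show ?thesis unfolding assms(1) by (auto simp: norms_def)
qed

text \<open>Graded-division algebras whose support is the whole group, phrased through the norm: the anisotropic
  elements are the invertible ones. Both kinds of gradings obtained by doubling are of this form.\<close>

definition division_grading :: "('g, 'm) monoid_scheme \<Rightarrow> ('g \<Rightarrow> 'c set) \<Rightarrow> bool" where
  "division_grading G \<Gamma> \<longleftrightarrow> grading scale mul G \<Gamma> \<and>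
     (\<forall>g\<in>carrier G. \<Gamma> g \<noteq> {0} \<and> (\<forall>x\<in>\<Gamma> g. x \<noteq> 0 \<longrightarrow> n x \<noteq> 0))"

context
  fixes G :: "('g, 'm) monoid_scheme" and \<Gamma> :: "'g \<Rightarrow> 'c set"
  assumes dg: "division_grading G \<Gamma>"
begin

lemma division_grading_grading: "grading scale mul G \<Gamma>"
  using dg by (simp add: division_grading_def)

lemmas gr = division_grading_grading

interpretation G: comm_group G by (rule grading_comm_group[OF gr])

lemma division_anisotropic: "g \<in> carrier G \<Longrightarrow> x \<in> \<Gamma> g \<Longrightarrow> x \<noteq> 0 \<Longrightarrow> n x \<noteq> 0"
  using dg by (auto simp: division_grading_def)

lemma division_nonzero: assumes "g \<in> carrier G" obtains x where "x \<in> \<Gamma> g" "x \<noteq> 0"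
  using dg grading_0[OF gr assms] assms by (force simp: division_grading_def)

lemma division_support: "support G \<Gamma> = carrier G"
  using dg by (auto simp: division_grading_def support_def)

lemma division_mult_nonzero:
  "\<lbrakk>g \<in> carrier G; h \<in> carrier G; x \<in> \<Gamma> g; y \<in> \<Gamma> h; x \<noteq> 0; y \<noteq> 0\<rbrakk> \<Longrightarrow> x \<star> y \<noteq> 0"
  using division_anisotropic[of g x] mult_eq_zero_iff(1)[of x y] by simp

text \<open>Outside \<open>C\<^sub>e\<close> the trace vanishes, so that \<open>x\<^sup>2\<close> is the nonzero scalar \<open>- n(x)\<close>.\<close>

lemma homogeneous_anisotropic_square:
  assumes "g \<in> carrier G" "x \<in> \<Gamma> g" "n x \<noteq> 0" shows "g \<otimes>\<^bsub>G\<^esub> g = \<one>\<^bsub>G\<^esub>"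
proof (cases "g = \<one>\<^bsub>G\<^esub>")
  case False
  have "x \<star> x = - (n x \<cdot> unit)" using trace_homogeneous[OF gr assms(2,1) False] by (simp add: square_eq)
  moreover have "- (n x \<cdot> unit) \<in> \<Gamma> \<one>\<^bsub>G\<^esub>"
    using unit_homogeneous[OF gr] grading_subspace[OF gr] by (simp add: subspace_neg subspace_scale)
  moreover have "x \<star> x \<in> \<Gamma> (g \<otimes>\<^bsub>G\<^esub> g)" using grading_mult[OF gr] assms by blast
  moreover have "- (n x \<cdot> unit) \<noteq> 0" using assms(3) unit_nonzero by simp
  ultimately show ?thesis using homogeneous_unique[OF gr, of "x \<star> x" "g \<otimes>\<^bsub>G\<^esub> g" "\<one>\<^bsub>G\<^esub>"] assms(1) by simp
qed simp

lemma division_square: assumes "g \<in> carrier G" shows "g \<otimes>\<^bsub>G\<^esub> g = \<one>\<^bsub>G\<^esub>"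
proof -
  obtain x where "x \<in> \<Gamma> g" "x \<noteq> 0" by (rule division_nonzero[OF assms])
  then show ?thesis using homogeneous_anisotropic_square division_anisotropic assms by blast
qed

text \<open>Homogeneous elements can be divided by homogeneous elements. So each component is a one-dimensional
  module over \<open>C\<^sub>e\<close>, as the next lemma says.\<close>

lemma division_quotient:
  assumes g: "g \<in> carrier G" "h \<in> carrier G" and b: "b \<in> \<Gamma> h" "b \<noteq> 0" and z: "z \<in> \<Gamma> (g \<otimes>\<^bsub>G\<^esub> h)"
  obtains a where "a \<in> \<Gamma> g" "z = a \<star> b"
proof -
  have nb: "n b \<noteq> 0" by (rule division_anisotropic[OF g(2) b])
  have "z \<star> cnj b \<in> \<Gamma> (g \<otimes>\<^bsub>G\<^esub> h \<otimes>\<^bsub>G\<^esub> h)"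
    using grading_mult[OF gr _ g(2) z cnj_homogeneous[OF gr b(1) g(2)]] g by simp
  also have "g \<otimes>\<^bsub>G\<^esub> h \<otimes>\<^bsub>G\<^esub> h = g" using g by (simp add: G.m_assoc division_square)
  finally have "inverse (n b) \<cdot> (z \<star> cnj b) \<in> \<Gamma> g" by (rule subspace_scale[OF grading_subspace[OF gr g(1)]])
  moreover have "z = (inverse (n b) \<cdot> (z \<star> cnj b)) \<star> b"
    using mult_mult_cnj[of z "cnj b"] nb by (simp add: mult_scale_left)
  ultimately show thesis by (rule that)
qed

lemma division_component:
  assumes "g \<in> carrier G" "b \<in> \<Gamma> g" "b \<noteq> 0" shows "\<Gamma> g = {x \<star> b | x. x \<in> \<Gamma> \<one>\<^bsub>G\<^esub>}"
proof
  show "\<Gamma> g \<subseteq> {x \<star> b | x. x \<in> \<Gamma> \<one>\<^bsub>G\<^esub>}"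
  proof
    fix z assume "z \<in> \<Gamma> g"
    then have "z \<in> \<Gamma> (\<one>\<^bsub>G\<^esub> \<otimes>\<^bsub>G\<^esub> g)" using assms(1) by simp
    then obtain a where "a \<in> \<Gamma> \<one>\<^bsub>G\<^esub>" "z = a \<star> b" by (rule division_quotient[OF G.one_closed assms])
    then show "z \<in> {x \<star> b | x. x \<in> \<Gamma> \<one>\<^bsub>G\<^esub>}" by blast
  qed
  show "{x \<star> b | x. x \<in> \<Gamma> \<one>\<^bsub>G\<^esub>} \<subseteq> \<Gamma> g"
    using grading_mult[OF gr G.one_closed assms(1) _ assms(2)] assms(1) by auto
qed

lemma division_orthogonal:
  assumes "g \<in> carrier G" "h \<in> carrier G" "g \<noteq> h" "x \<in> \<Gamma> g" "y \<in> \<Gamma> h" shows "\<langle>x, y\<rangle> = 0"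
proof (rule bil_homogeneous[OF gr assms(4,5,1,2)])
  have "h \<otimes>\<^bsub>G\<^esub> h = \<one>\<^bsub>G\<^esub>" by (rule division_square[OF assms(2)])
  then show "g \<otimes>\<^bsub>G\<^esub> h \<noteq> \<one>\<^bsub>G\<^esub>" using assms(1-3) by (metis G.right_cancel)
qed

lemma division_representatives:
  obtains b where "\<And>g. g \<in> carrier G \<Longrightarrow> b g \<in> \<Gamma> g" "\<And>g. g \<in> carrier G \<Longrightarrow> b g \<noteq> 0" "b \<one>\<^bsub>G\<^esub> = unit"
proof -
  have "\<forall>g\<in>carrier G. \<exists>x. x \<in> \<Gamma> g \<and> x \<noteq> 0" using division_nonzero by metis
  then obtain b where b: "\<forall>g\<in>carrier G. b g \<in> \<Gamma> g \<and> b g \<noteq> 0" by metis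
  show thesis
    by (rule that[of "b(\<one>\<^bsub>G\<^esub> := unit)"]) (use b unit_homogeneous[OF gr] unit_nonzero in auto)
qed

lemma norms_nonzero: "g \<in> carrier G \<Longrightarrow> norms (\<Gamma> g) \<subseteq> carrier field_units"
  using division_anisotropic[of g] by (auto simp: norms_def) blast

lemma norms_mult:
  assumes g: "g \<in> carrier G" "h \<in> carrier G"
  shows "norms (\<Gamma> g) <#>\<^bsub>field_units\<^esub> norms (\<Gamma> h) = norms (\<Gamma> (g \<otimes>\<^bsub>G\<^esub> h))"
proof
  show "norms (\<Gamma> g) <#>\<^bsub>field_units\<^esub> norms (\<Gamma> h) \<subseteq> norms (\<Gamma> (g \<otimes>\<^bsub>G\<^esub> h))"
  proof
    fix a assume "a \<in> norms (\<Gamma> g) <#>\<^bsub>field_units\<^esub> norms (\<Gamma> h)"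
    then obtain x y where "x \<in> \<Gamma> g" "x \<noteq> 0" "y \<in> \<Gamma> h" "y \<noteq> 0" "a = n x * n y"
      by (auto simp: set_mult_def norms_def)
    then show "a \<in> norms (\<Gamma> (g \<otimes>\<^bsub>G\<^esub> h))"
      using grading_mult[OF gr g] division_mult_nonzero[OF g] unfolding norms_def
      by (intro image_eqI[of _ _ "x \<star> y"]) (auto simp: norm_mult)
  qed
  show "norms (\<Gamma> (g \<otimes>\<^bsub>G\<^esub> h)) \<subseteq> norms (\<Gamma> g) <#>\<^bsub>field_units\<^esub> norms (\<Gamma> h)"
  proof
    fix a assume "a \<in> norms (\<Gamma> (g \<otimes>\<^bsub>G\<^esub> h))"
    then obtain z where z: "z \<in> \<Gamma> (g \<otimes>\<^bsub>G\<^esub> h)" "z \<noteq> 0" "a = n z" by (auto simp: norms_def)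
    obtain b where b: "b \<in> \<Gamma> h" "b \<noteq> 0" by (rule division_nonzero[OF g(2)])
    obtain x where x: "x \<in> \<Gamma> g" "z = x \<star> b" by (rule division_quotient[OF g b z(1)])
    then have "x \<noteq> 0" using z by auto
    then show "a \<in> norms (\<Gamma> g) <#>\<^bsub>field_units\<^esub> norms (\<Gamma> h)"
      using x b z by (auto simp: set_mult_def norms_def norm_mult)
  qed
qed

lemma norms_one_subgroup: "subgroup (norms (\<Gamma> \<one>\<^bsub>G\<^esub>)) field_units"
proof -
  interpret U: comm_group "field_units :: 'f monoid" by (rule comm_group_field_units)
  show ?thesis
  proof (rule U.subgroupI)
    show "norms (\<Gamma> \<one>\<^bsub>G\<^esub>) \<subseteq> carrier field_units" by (rule norms_nonzero) simp
    show "norms (\<Gamma> \<one>\<^bsub>G\<^esub>) \<noteq> {}" using unit_homogeneous[OF gr] unit_nonzero by (auto simp: norms_def)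
    fix a assume a: "a \<in> norms (\<Gamma> \<one>\<^bsub>G\<^esub>)"
    then obtain x where x: "x \<in> \<Gamma> \<one>\<^bsub>G\<^esub>" "x \<noteq> 0" "a = n x" by (auto simp: norms_def)
    have a0: "a \<noteq> 0" using division_anisotropic[OF G.one_closed x(1,2)] x(3) by simp
    have i: "inv\<^bsub>field_units\<^esub> a = inverse a" by (rule U.inv_equality) (use a0 in auto)
    \<comment> \<open>\<open>n(x)\<inverse>\<close> is itself a norm from \<open>C\<^sub>e\<close>\<close>
    have "n (inverse (n x) \<cdot> x) = inverse a" using a0 x(3) by (simp add: norm_scale power2_eq_square field_simps)
    moreover have "inverse (n x) \<cdot> x \<in> \<Gamma> \<one>\<^bsub>G\<^esub>" using x grading_subspace[OF gr] by (simp add: subspace_scale)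
    ultimately show "inv\<^bsub>field_units\<^esub> a \<in> norms (\<Gamma> \<one>\<^bsub>G\<^esub>)"
      unfolding i norms_def using x a0 by (intro image_eqI[of _ _ "inverse (n x) \<cdot> x"]) auto
    fix b assume "b \<in> norms (\<Gamma> \<one>\<^bsub>G\<^esub>)"
    then have "a * b \<in> norms (\<Gamma> \<one>\<^bsub>G\<^esub>) <#>\<^bsub>field_units\<^esub> norms (\<Gamma> \<one>\<^bsub>G\<^esub>)"
      using a by (auto simp: set_mult_def)
    then show "a \<otimes>\<^bsub>field_units\<^esub> b \<in> norms (\<Gamma> \<one>\<^bsub>G\<^esub>)" by (simp add: norms_mult)
  qed
qed

text \<open>All components are translates \<open>C\<^sub>e b\<close>, so their sets of norms are cosets of the group of norms
  from \<open>C\<^sub>e\<close>; by multiplicativity of the norm they multiply as the degrees do.\<close>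

lemma norms_coset:
  assumes "g \<in> carrier G" "b \<in> \<Gamma> g" "b \<noteq> 0"
  shows "norms (\<Gamma> g) = norms (\<Gamma> \<one>\<^bsub>G\<^esub>) #>\<^bsub>field_units\<^esub> n b"
proof -
  have "\<Gamma> g - {0} = (\<lambda>x. x \<star> b) ` (\<Gamma> \<one>\<^bsub>G\<^esub> - {0})"
  proof -
    have "x \<star> b = 0 \<longleftrightarrow> x = 0" for x
      by (rule mult_eq_zero_iff(2)[OF division_anisotropic[OF assms]])
    then show ?thesis by (subst division_component[OF assms]) auto
  qed
  then show ?thesis by (auto simp: norms_def r_coset_def norm_mult image_image)
qed

lemma norms_hom: "(\<lambda>g. norms (\<Gamma> g)) \<in> hom G (field_units Mod norms (\<Gamma> \<one>\<^bsub>G\<^esub>))"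
  unfolding hom_def
proof (intro CollectI conjI ballI Pi_I)
  fix g assume g: "g \<in> carrier G"
  obtain b where b: "b \<in> \<Gamma> g" "b \<noteq> 0" by (rule division_nonzero[OF g])
  show "norms (\<Gamma> g) \<in> carrier (field_units Mod norms (\<Gamma> \<one>\<^bsub>G\<^esub>))"
    using division_anisotropic[OF g b] unfolding norms_coset[OF g b] FactGroup_def RCOSETS_def by auto
  fix h assume "h \<in> carrier G"
  then show "norms (\<Gamma> (g \<otimes>\<^bsub>G\<^esub> h)) = norms (\<Gamma> g) \<otimes>\<^bsub>field_units Mod norms (\<Gamma> \<one>\<^bsub>G\<^esub>)\<^esub> norms (\<Gamma> h)"
    using g by (simp add: FactGroup_def norms_mult)
qed

text \<open>This is how the parameter \<open>\<mu>\<close> is read off from the grading: the coset belonging to a degree is known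
  from the norm of one homogeneous element, and two homomorphisms that agree on generators agree everywhere.\<close>

lemma norms_determined:
  assumes \<mu>: "\<mu> \<in> hom G (field_units Mod norms (\<Gamma> \<one>\<^bsub>G\<^esub>))"
  shows "\<mu> \<one>\<^bsub>G\<^esub> = norms (\<Gamma> \<one>\<^bsub>G\<^esub>)"
    and "\<And>g b. g \<in> carrier G \<Longrightarrow> b \<in> \<Gamma> g \<Longrightarrow> b \<noteq> 0 \<Longrightarrow> n b \<in> \<mu> g \<Longrightarrow> \<mu> g = norms (\<Gamma> g)"
    and "\<And>g h. \<lbrakk>g \<in> carrier G; h \<in> carrier G; \<mu> g = norms (\<Gamma> g); \<mu> h = norms (\<Gamma> h)\<rbrakk>
      \<Longrightarrow> \<mu> (g \<otimes>\<^bsub>G\<^esub> h) = norms (\<Gamma> (g \<otimes>\<^bsub>G\<^esub> h))"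
proof -
  let ?N = "norms (\<Gamma> \<one>\<^bsub>G\<^esub>)"
  interpret U: comm_group "field_units :: 'f monoid" by (rule comm_group_field_units)
  interpret N: normal ?N field_units by (rule U.subgroup_imp_normal[OF norms_one_subgroup])
  interpret \<mu>: group_hom G "field_units Mod ?N" \<mu>
    by (intro group_hom.intro group_hom_axioms.intro G.is_group N.factorgroup_is_group \<mu>)
  show "\<mu> \<one>\<^bsub>G\<^esub> = ?N" using \<mu>.hom_one by (simp add: FactGroup_def)
  show "\<mu> g = norms (\<Gamma> g)" if g: "g \<in> carrier G" and b: "b \<in> \<Gamma> g" "b \<noteq> 0" "n b \<in> \<mu> g" for g b
  proof -
    have "\<mu> g \<in> carrier (field_units Mod ?N)" using g by simp
    then obtain a where a: "a \<in> carrier field_units" "\<mu> g = ?N #>\<^bsub>field_units\<^esub> a"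
      by (auto simp: FactGroup_def RCOSETS_def)
    then have "\<mu> g = ?N #>\<^bsub>field_units\<^esub> n b"
      using U.repr_independence[OF _ a(1) norms_one_subgroup, of "n b"] b(3) by simp
    then show ?thesis by (simp add: norms_coset[OF g b(1,2)])
  qed
  show "\<mu> (g \<otimes>\<^bsub>G\<^esub> h) = norms (\<Gamma> (g \<otimes>\<^bsub>G\<^esub> h))"
    if "g \<in> carrier G" "h \<in> carrier G" "\<mu> g = norms (\<Gamma> g)" "\<mu> h = norms (\<Gamma> h)" for g h
    using \<mu>.hom_mult[OF that(1,2)] that by (simp add: FactGroup_def norms_mult)
qed

text \<open>The product of two nonzero components is never zero, so there is a relator for each entry of
  the multiplication table of \<open>G\<close>, and the section is \<open>g \<mapsto> g\<close>.\<close>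

lemma division_universal_group: "universal_group scale mul G \<Gamma> \<cong> G"
proof (rule universal_group_iso[OF gr])
  let ?F = "free_Abelian_group (support G \<Gamma>)"
  interpret F: comm_group ?F by (rule abelian_free_Abelian_group)
  let ?N = "generate ?F (universal_relators scale mul G \<Gamma>)"
  show "carrier G \<subseteq> H" if "support G \<Gamma> \<subseteq> H" for H using that by (simp add: division_support)
  show "frag_of s - frag_of s \<in> ?N" for s using generate.one[of ?F] by simp
  show "frag_of x \<in> carrier ?F" if "x \<in> carrier G" for x using that by (simp add: division_support)
  fix x y assume xy: "x \<in> carrier G" "y \<in> carrier G"
  obtain a b where ab: "a \<in> \<Gamma> x" "a \<noteq> 0" "b \<in> \<Gamma> y" "b \<noteq> 0"
    using division_nonzero xy by metis
  let ?r = "frag_of x + frag_of y - frag_of (x \<otimes>\<^bsub>G\<^esub> y)"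
  have r: "?r \<in> universal_relators scale mul G \<Gamma>"
    by (rule universal_relatorI[OF gr _ _ ab(1,3) division_mult_nonzero[OF xy ab(1,3,2,4)]])
      (use xy division_support in auto)
  have k: "Poly_Mapping.keys ?r \<subseteq> support G \<Gamma>" using subsetD[OF universal_relators_subset r] by simp
  have "inv\<^bsub>?F\<^esub> ?r = frag_of (x \<otimes>\<^bsub>G\<^esub> y) - frag_of x - frag_of y"
    unfolding inv_free_Abelian_group[OF k] by simp
  then show "frag_of (x \<otimes>\<^bsub>G\<^esub> y) - frag_of x - frag_of y \<in> ?N"
    using generate.inv[OF r, of ?F] by argo
qed

end

text \<open>Nonzero products force an equivalence to permute degrees by a group isomorphism; being an isometry,
  it preserves the norms of the components, and it maps the neutral component to the neutral component.\<close>

lemma division_equivalence_iso: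
  assumes G: "division_grading G \<Gamma>" and H: "division_grading H \<Delta>"
    and eq: "equivalent_gradings scale mul G \<Gamma> H \<Delta>"
  obtains \<alpha> \<psi> where "\<alpha> \<in> iso G H" "\<And>g. g \<in> carrier G \<Longrightarrow> norms (\<Gamma> g) = norms (\<Delta> (\<alpha> g))"
    "alg_iso_on scale mul \<psi> UNIV UNIV" "\<psi> ` \<Gamma> \<one>\<^bsub>G\<^esub> = \<Delta> \<one>\<^bsub>H\<^esub>"
proof -
  note gG = division_grading_grading[OF G] and gH = division_grading_grading[OF H]
  interpret G: comm_group G by (rule grading_comm_group[OF gG])
  interpret H: comm_group H by (rule grading_comm_group[OF gH])
  obtain \<psi> where \<psi>: "alg_iso_on scale mul \<psi> UNIV UNIV" "bij_betw ((`) \<psi>) (\<Gamma> ` carrier G) (\<Delta> ` carrier H)"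
    using eq unfolding equivalent_gradings_def components_def division_support[OF G] division_support[OF H] by blast
  note I = alg_iso_onD[OF \<psi>(1)]
  have n\<psi>: "n (\<psi> x) = n x" for x by (rule alg_iso_on_norm[OF \<psi>(1)]) auto
  have inj: "inj \<psi>" using I(1) by (simp add: bij_betw_def)
  have \<psi>0: "\<psi> 0 = 0" using alg_iso_on_diff(2)[OF \<psi>(1), of 0 0] by simp
  have \<psi>0': "\<psi> x = 0 \<longleftrightarrow> x = 0" for x using inj \<psi>0 by (metis injD)
  have injH: "h = h'" if "\<Delta> h = \<Delta> h'" "h \<in> carrier H" "h' \<in> carrier H" for h h'
    using division_nonzero[OF H that(2)] homogeneous_unique[OF gH] that by metis
  have "\<exists>h. h \<in> carrier H \<and> \<psi> ` \<Gamma> g = \<Delta> h" if "g \<in> carrier G" for g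
    using bij_betw_apply[OF \<psi>(2), of "\<Gamma> g"] that by auto
  then obtain \<alpha> where \<alpha>: "\<And>g. g \<in> carrier G \<Longrightarrow> \<alpha> g \<in> carrier H \<and> \<psi> ` \<Gamma> g = \<Delta> (\<alpha> g)" by metis
  have hom: "\<alpha> (g \<otimes>\<^bsub>G\<^esub> h) = \<alpha> g \<otimes>\<^bsub>H\<^esub> \<alpha> h" if gh: "g \<in> carrier G" "h \<in> carrier G" for g h
  proof -
    obtain x y where xy: "x \<in> \<Gamma> g" "x \<noteq> 0" "y \<in> \<Gamma> h" "y \<noteq> 0" using division_nonzero[OF G] gh by metis
    have "\<psi> (x \<star> y) \<in> \<Delta> (\<alpha> (g \<otimes>\<^bsub>G\<^esub> h))" using \<alpha>[of "g \<otimes>\<^bsub>G\<^esub> h"] gh grading_mult[OF gG gh xy(1,3)] by auto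
    moreover have "\<psi> (x \<star> y) \<in> \<Delta> (\<alpha> g \<otimes>\<^bsub>H\<^esub> \<alpha> h)"
      using grading_mult[OF gH, of "\<alpha> g" "\<alpha> h" "\<psi> x" "\<psi> y"] \<alpha>[OF gh(1)] \<alpha>[OF gh(2)] xy by (auto simp: I(4))
    moreover have "\<psi> (x \<star> y) \<noteq> 0" using division_mult_nonzero[OF G gh xy(1,3,2,4)] \<psi>0' by simp
    ultimately show ?thesis using homogeneous_unique[OF gH] \<alpha> gh by (metis G.m_closed H.m_closed)
  qed
  have "bij_betw \<alpha> (carrier G) (carrier H)"
    unfolding bij_betw_def
  proof
    show "inj_on \<alpha> (carrier G)"
    proof (rule inj_onI)
      fix g h assume gh: "g \<in> carrier G" "h \<in> carrier G" "\<alpha> g = \<alpha> h"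
      then have "\<psi> ` \<Gamma> g = \<psi> ` \<Gamma> h" using \<alpha> by simp
      then have "\<Gamma> g = \<Gamma> h" by (simp add: inj_image_eq_iff[OF inj])
      then show "g = h" using division_nonzero[OF G gh(1)] homogeneous_unique[OF gG] gh by metis
    qed
    show "\<alpha> ` carrier G = carrier H"
    proof
      show "carrier H \<subseteq> \<alpha> ` carrier G"
      proof
        fix h assume h: "h \<in> carrier H"
        then have "\<Delta> h \<in> ((`) \<psi>) ` (\<Gamma> ` carrier G)" using \<psi>(2) by (auto simp: bij_betw_def)
        then obtain g where "g \<in> carrier G" "\<Delta> h = \<psi> ` \<Gamma> g" by auto
        then show "h \<in> \<alpha> ` carrier G" using injH[of h "\<alpha> g"] \<alpha>[of g] h by auto
      qed
    qed (use \<alpha> in auto)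
  qed
  then have iso: "\<alpha> \<in> iso G H" using \<alpha> hom by (auto simp: iso_def hom_def)
  then have "\<alpha> \<one>\<^bsub>G\<^esub> = \<one>\<^bsub>H\<^esub>" using G.is_group H.is_group hom_one unfolding iso_def by blast
  then have one: "\<psi> ` \<Gamma> \<one>\<^bsub>G\<^esub> = \<Delta> \<one>\<^bsub>H\<^esub>" using \<alpha>[of "\<one>\<^bsub>G\<^esub>"] by simp
  have "norms (\<psi> ` X) = norms X" for X
  proof -
    have "\<psi> ` X - {0} = \<psi> ` (X - {0})" using \<psi>0' by auto
    then show ?thesis by (simp add: norms_def image_image n\<psi>)
  qed
  then have "norms (\<Gamma> g) = norms (\<Delta> (\<alpha> g))" if "g \<in> carrier G" for g using \<alpha>[OF that] by metis
  then show thesis using that iso \<psi>(1) one by blast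
qed

text \<open>An automorphism compatible with the relabelling \<open>\<chi>\<close> on one homogeneous element for each
  generator is compatible with it on one homogeneous element of each degree, by multiplying. As components are
  translates of the neutral one, they are then mapped onto each other. Closure under products suffices
  in the formulation of generation, because all degrees have order at most 2.\<close>

lemma division_equivalenceI:
  assumes G: "division_grading G \<Gamma>" and H: "division_grading H \<Delta>"
    and \<psi>: "alg_iso_on scale mul \<psi> UNIV UNIV" "\<psi> ` \<Gamma> \<one>\<^bsub>G\<^esub> = \<Delta> \<one>\<^bsub>H\<^esub>" and \<chi>: "\<chi> \<in> iso G H"
    and gen: "\<And>Y. \<lbrakk>Y \<subseteq> carrier G; \<And>g h. g \<in> Y \<Longrightarrow> h \<in> Y \<Longrightarrow> g \<otimes>\<^bsub>G\<^esub> h \<in> Y; \<one>\<^bsub>G\<^esub> \<in> Y; M \<subseteq> Y\<rbrakk> \<Longrightarrow> carrier G \<subseteq> Y"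
    and M: "M \<subseteq> carrier G" "\<And>g. g \<in> M \<Longrightarrow> \<exists>x\<in>\<Gamma> g. x \<noteq> 0 \<and> \<psi> x \<in> \<Delta> (\<chi> g)"
  shows "equivalent_gradings scale mul G \<Gamma> H \<Delta>"
proof -
  note gG = division_grading_grading[OF G] and gH = division_grading_grading[OF H]
  interpret G: comm_group G by (rule grading_comm_group[OF gG])
  interpret H: comm_group H by (rule grading_comm_group[OF gH])
  note I = alg_iso_onD[OF \<psi>(1)]
  have inj: "inj \<psi>" using I(1) by (simp add: bij_betw_def)
  have \<psi>0: "\<psi> 0 = 0" using alg_iso_on_diff(2)[OF \<psi>(1), of 0 0] by simp
  have \<psi>0': "\<psi> x = 0 \<longleftrightarrow> x = 0" for x using inj \<psi>0 by (metis injD)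
  note X = group_isoD[OF \<chi> G.comm_group_axioms H.comm_group_axioms]
  let ?Y = "{g \<in> carrier G. \<exists>x\<in>\<Gamma> g. x \<noteq> 0 \<and> \<psi> x \<in> \<Delta> (\<chi> g)}"
  have "carrier G \<subseteq> ?Y"
  proof (rule gen)
    show "M \<subseteq> ?Y" using M by auto
    show "\<one>\<^bsub>G\<^esub> \<in> ?Y"
    proof -
      have "\<psi> unit \<in> \<Delta> \<one>\<^bsub>H\<^esub>" using unit_homogeneous[OF gG] \<psi>(2) by blast
      then show ?thesis using unit_homogeneous[OF gG] unit_nonzero X(3) by auto
    qed
    fix g h assume "g \<in> ?Y" "h \<in> ?Y"
    then obtain x y where xy: "g \<in> carrier G" "h \<in> carrier G" "x \<in> \<Gamma> g" "y \<in> \<Gamma> h" "x \<noteq> 0" "y \<noteq> 0"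
      "\<psi> x \<in> \<Delta> (\<chi> g)" "\<psi> y \<in> \<Delta> (\<chi> h)" by auto
    have "\<psi> (x \<star> y) \<in> \<Delta> (\<chi> (g \<otimes>\<^bsub>G\<^esub> h))"
      using grading_mult[OF gH X(1)[OF xy(1)] X(1)[OF xy(2)] xy(7,8)] xy(1,2) by (simp add: X(2) I(4))
    then show "g \<otimes>\<^bsub>G\<^esub> h \<in> ?Y"
      using grading_mult[OF gG xy(1-4)] division_mult_nonzero[OF G xy(1-6)] xy(1,2) by auto
  qed auto
  have im: "\<psi> ` \<Gamma> g = \<Delta> (\<chi> g)" if g: "g \<in> carrier G" for g
  proof -
    obtain b where b: "b \<in> \<Gamma> g" "b \<noteq> 0" "\<psi> b \<in> \<Delta> (\<chi> g)" using g \<open>carrier G \<subseteq> ?Y\<close> by blast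
    have "\<Delta> (\<chi> g) = {x \<star> \<psi> b | x. x \<in> \<Delta> \<one>\<^bsub>H\<^esub>}"
      by (rule division_component[OF H X(1)[OF g] b(3)]) (use b \<psi>0' in simp)
    also have "\<dots> = \<psi> ` {x \<star> b | x. x \<in> \<Gamma> \<one>\<^bsub>G\<^esub>}"
      unfolding \<psi>(2)[symmetric] by (simp add: Setcompr_eq_image image_image I(4))
    also have "\<dots> = \<psi> ` \<Gamma> g" using division_component[OF G g b(1,2)] by simp
    finally show ?thesis by simp
  qed
  have "bij_betw ((`) \<psi>) (\<Gamma> ` carrier G) (\<Delta> ` carrier H)"
    unfolding bij_betw_def
  proof
    show "inj_on ((`) \<psi>) (\<Gamma> ` carrier G)" by (rule inj_onI) (simp add: inj_image_eq_iff[OF inj])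
    have "\<chi> ` carrier G = carrier H" using \<chi> by (simp add: iso_def bij_betw_def)
    moreover have "((`) \<psi>) ` (\<Gamma> ` carrier G) = \<Delta> ` (\<chi> ` carrier G)"
      using im by (auto simp: image_iff)
    ultimately show "((`) \<psi>) ` (\<Gamma> ` carrier G) = \<Delta> ` carrier H" by simp
  qed
  then show ?thesis
    unfolding equivalent_gradings_def components_def division_support[OF G] division_support[OF H]
    using \<psi>(1) by blast
qed

end

section \<open>Gradings along the doubling process\<close>

lemma comm_group_DirProd:
  assumes "comm_group G" "comm_group H" shows "comm_group (G \<times>\<times> H)"
proof -
  interpret G: comm_group G by fact
  interpret H: comm_group H by fact
  show ?thesis
    by (rule group.group_comm_groupI[OF DirProd_group[OF G.is_group H.is_group]])
      (auto simp: mult_DirProd' G.m_comm H.m_comm)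
qed

lemma subgroup_adjoin_involution:
  assumes "comm_group G" "subgroup T G" "s \<in> carrier G" "s \<otimes>\<^bsub>G\<^esub> s = \<one>\<^bsub>G\<^esub>"
  shows "subgroup (T \<union> (\<lambda>g. g \<otimes>\<^bsub>G\<^esub> s) ` T) G"
proof -
  interpret G: comm_group G by fact
  interpret T: subgroup T G by fact
  have swap: "(g \<otimes>\<^bsub>G\<^esub> s) \<otimes>\<^bsub>G\<^esub> h = (g \<otimes>\<^bsub>G\<^esub> h) \<otimes>\<^bsub>G\<^esub> s" if "g \<in> carrier G" "h \<in> carrier G" for g h
    using that assms(3) by (simp add: G.m_ac)
  have ss: "(g \<otimes>\<^bsub>G\<^esub> s) \<otimes>\<^bsub>G\<^esub> (h \<otimes>\<^bsub>G\<^esub> s) = g \<otimes>\<^bsub>G\<^esub> h" if "g \<in> carrier G" "h \<in> carrier G" for g h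
    using that assms(3,4) swap[of g "h \<otimes>\<^bsub>G\<^esub> s"] by (simp add: G.m_assoc)
  have inv: "inv\<^bsub>G\<^esub> (g \<otimes>\<^bsub>G\<^esub> s) = inv\<^bsub>G\<^esub> g \<otimes>\<^bsub>G\<^esub> s" if "g \<in> carrier G" for g
    using that assms(3) ss[of g "inv\<^bsub>G\<^esub> g"] G.m_comm by (intro G.inv_equality) auto
  show ?thesis
  proof (rule G.subgroupI)
    show "T \<union> (\<lambda>g. g \<otimes>\<^bsub>G\<^esub> s) ` T \<subseteq> carrier G" using assms(3) by auto
    show "T \<union> (\<lambda>g. g \<otimes>\<^bsub>G\<^esub> s) ` T \<noteq> {}" using T.one_closed by blast
    fix x assume x: "x \<in> T \<union> (\<lambda>g. g \<otimes>\<^bsub>G\<^esub> s) ` T"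
    then show "inv\<^bsub>G\<^esub> x \<in> T \<union> (\<lambda>g. g \<otimes>\<^bsub>G\<^esub> s) ` T" using inv by auto
    fix y assume y: "y \<in> T \<union> (\<lambda>g. g \<otimes>\<^bsub>G\<^esub> s) ` T"
    have as: "g \<otimes>\<^bsub>G\<^esub> (h \<otimes>\<^bsub>G\<^esub> s) = (g \<otimes>\<^bsub>G\<^esub> h) \<otimes>\<^bsub>G\<^esub> s" if "g \<in> T" "h \<in> T" for g h
      using that assms(3) by (simp add: G.m_assoc)
    show "x \<otimes>\<^bsub>G\<^esub> y \<in> T \<union> (\<lambda>g. g \<otimes>\<^bsub>G\<^esub> s) ` T"
      using x
    proof
      assume "x \<in> T"
      with y show ?thesis using as by auto
    next
      assume "x \<in> (\<lambda>g. g \<otimes>\<^bsub>G\<^esub> s) ` T"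
      then obtain g where "g \<in> T" "x = g \<otimes>\<^bsub>G\<^esub> s" by blast
      with y show ?thesis using swap ss T.m_closed T.mem_carrier by auto
    qed
  qed
qed

context cayley_algebra
begin

text \<open>A grading of a subalgebra with degrees in an elementary abelian 2-subgroup, stable under conjugation. In
  contrast to \<open>grading\<close>, it can be extended one doubling at a time.\<close>

definition graded_on :: "('g, 'm) monoid_scheme \<Rightarrow> 'g set \<Rightarrow> ('g \<Rightarrow> 'c set) \<Rightarrow> 'c set \<Rightarrow> bool" where
  "graded_on G T \<Gamma> A \<longleftrightarrow> subgroup T G \<and> finite T \<and> (\<forall>g\<in>T. g \<otimes>\<^bsub>G\<^esub> g = \<one>\<^bsub>G\<^esub>) \<and>
     (\<forall>g\<in>T. subspace (\<Gamma> g) \<and> \<Gamma> g \<subseteq> A) \<and>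
     (\<forall>x\<in>A. \<exists>f. (\<forall>g\<in>T. f g \<in> \<Gamma> g) \<and> x = (\<Sum>g\<in>T. f g)) \<and>
     (\<forall>f. (\<forall>g\<in>T. f g \<in> \<Gamma> g) \<and> (\<Sum>g\<in>T. f g) = 0 \<longrightarrow> (\<forall>g\<in>T. f g = 0)) \<and>
     (\<forall>g\<in>T. \<forall>h\<in>T. \<forall>x\<in>\<Gamma> g. \<forall>y\<in>\<Gamma> h. x \<star> y \<in> \<Gamma> (g \<otimes>\<^bsub>G\<^esub> h)) \<and>
     (\<forall>g\<in>T. \<forall>x\<in>\<Gamma> g. cnj x \<in> \<Gamma> g)"

lemma graded_onD:
  assumes "graded_on G T \<Gamma> A"
  shows "subgroup T G" "finite T" "\<And>g. g \<in> T \<Longrightarrow> g \<otimes>\<^bsub>G\<^esub> g = \<one>\<^bsub>G\<^esub>"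
    "\<And>g. g \<in> T \<Longrightarrow> subspace (\<Gamma> g)" "\<And>g x. g \<in> T \<Longrightarrow> x \<in> \<Gamma> g \<Longrightarrow> x \<in> A"
    "\<And>x. x \<in> A \<Longrightarrow> \<exists>f. (\<forall>g\<in>T. f g \<in> \<Gamma> g) \<and> x = (\<Sum>g\<in>T. f g)"
    "\<And>f g. (\<And>g. g \<in> T \<Longrightarrow> f g \<in> \<Gamma> g) \<Longrightarrow> (\<Sum>g\<in>T. f g) = 0 \<Longrightarrow> g \<in> T \<Longrightarrow> f g = 0"
    "\<And>g h x y. g \<in> T \<Longrightarrow> h \<in> T \<Longrightarrow> x \<in> \<Gamma> g \<Longrightarrow> y \<in> \<Gamma> h \<Longrightarrow> x \<star> y \<in> \<Gamma> (g \<otimes>\<^bsub>G\<^esub> h)"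
    "\<And>g x. g \<in> T \<Longrightarrow> x \<in> \<Gamma> g \<Longrightarrow> cnj x \<in> \<Gamma> g"
proof -
  note g = assms[unfolded graded_on_def]
  note c = g[THEN conjunct1] g[THEN conjunct2]
  note c2 = c(2)[THEN conjunct2] note c3 = c2[THEN conjunct2] note c4 = c3[THEN conjunct2]
  note c5 = c4[THEN conjunct2] note c6 = c5[THEN conjunct2] note c7 = c6[THEN conjunct2]
  show "subgroup T G" by (rule c(1))
  show "finite T" using c(2) by (rule conjunct1)
  show "g \<otimes>\<^bsub>G\<^esub> g = \<one>\<^bsub>G\<^esub>" if "g \<in> T" for g using c2[THEN conjunct1] that by blast
  show "subspace (\<Gamma> g)" if "g \<in> T" for g using c3[THEN conjunct1] that by blast
  show "x \<in> A" if "g \<in> T" "x \<in> \<Gamma> g" for g x using c3[THEN conjunct1] that by blast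
  show "\<exists>f. (\<forall>g\<in>T. f g \<in> \<Gamma> g) \<and> x = (\<Sum>g\<in>T. f g)" if "x \<in> A" for x
    using c4[THEN conjunct1] that by (rule bspec)
  show "f g = 0" if "\<And>g. g \<in> T \<Longrightarrow> f g \<in> \<Gamma> g" "(\<Sum>g\<in>T. f g) = 0" "g \<in> T" for f g
    using c5[THEN conjunct1, THEN spec, of f] that by simp
  show "x \<star> y \<in> \<Gamma> (g \<otimes>\<^bsub>G\<^esub> h)" if "g \<in> T" "h \<in> T" "x \<in> \<Gamma> g" "y \<in> \<Gamma> h" for g h x y
    using c6[THEN conjunct1] that by blast
  show "cnj x \<in> \<Gamma> g" if "g \<in> T" "x \<in> \<Gamma> g" for g x using c7 that by blast
qed

lemma graded_on_trivial:
  assumes "group G" "comp_subalgebra A" "\<Gamma> \<one>\<^bsub>G\<^esub> = A" shows "graded_on G {\<one>\<^bsub>G\<^esub>} \<Gamma> A"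
proof -
  interpret group G by fact
  show ?thesis
    unfolding graded_on_def using assms(3) comp_subalgebraD[OF assms(2)] triv_subgroup
    by auto
qed

text \<open>The new generator gets a degree of order 2 outside \<open>T\<close>. The three product formulas for \<open>A \<oplus> A u\<close>
  involve only products and conjugates of elements of \<open>A\<close>, in an order that is irrelevant for the
  degrees.\<close>

lemma graded_on_dbl:
  assumes A: "comp_subalgebra A" and u: "u \<in> perp A" "n u \<noteq> 0"
    and G: "comm_group G" and gr: "graded_on G T \<Gamma> A"
    and s: "s \<in> carrier G" "s \<notin> T" "s \<otimes>\<^bsub>G\<^esub> s = \<one>\<^bsub>G\<^esub>"
    and \<Gamma>s: "\<And>g. g \<in> T \<Longrightarrow> \<Gamma> (g \<otimes>\<^bsub>G\<^esub> s) = (\<lambda>x. x \<star> u) ` \<Gamma> g"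
  shows "graded_on G (T \<union> (\<lambda>g. g \<otimes>\<^bsub>G\<^esub> s) ` T) \<Gamma> (dbl A u)"
proof -
  interpret G: comm_group G by fact
  note D = graded_onD[OF gr] and C = comp_subalgebraD[OF A]
  interpret T: subgroup T G by (rule D(1))
  let ?Ts = "(\<lambda>g. g \<otimes>\<^bsub>G\<^esub> s) ` T"
  have ss: "(g \<otimes>\<^bsub>G\<^esub> s) \<otimes>\<^bsub>G\<^esub> s = g" if "g \<in> carrier G" for g
    using that s by (simp add: G.m_assoc)
  have inj: "inj_on (\<lambda>g. g \<otimes>\<^bsub>G\<^esub> s) T" using ss by (intro inj_onI) (metis T.mem_carrier)
  have notT: "g \<otimes>\<^bsub>G\<^esub> s \<notin> T" if "g \<in> T" for g
  proof
    assume gs: "g \<otimes>\<^bsub>G\<^esub> s \<in> T"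
    have "g \<otimes>\<^bsub>G\<^esub> (g \<otimes>\<^bsub>G\<^esub> s) = s"
      using that s D(3)[OF that] by (simp add: G.m_assoc[symmetric])
    then show False using T.m_closed[OF that gs] s(2) by simp
  qed
  have sum: "(\<Sum>g\<in>T \<union> ?Ts. f g) = (\<Sum>g\<in>T. f g) + (\<Sum>g\<in>T. f (g \<otimes>\<^bsub>G\<^esub> s))" for f :: "_ \<Rightarrow> 'c"
  proof -
    have "(\<Sum>g\<in>T \<union> ?Ts. f g) = (\<Sum>g\<in>T. f g) + (\<Sum>g\<in>?Ts. f g)"
      by (rule sum.union_disjoint) (use D(2) notT in auto)
    then show ?thesis by (simp add: sum.reindex[OF inj])
  qed
  have comm: "(g \<otimes>\<^bsub>G\<^esub> s) \<otimes>\<^bsub>G\<^esub> h = (g \<otimes>\<^bsub>G\<^esub> h) \<otimes>\<^bsub>G\<^esub> s" if "g \<in> T" "h \<in> T" for g h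
    using that s(1) by (simp add: G.m_ac)
  have sq: "(g \<otimes>\<^bsub>G\<^esub> s) \<otimes>\<^bsub>G\<^esub> (h \<otimes>\<^bsub>G\<^esub> s) = g \<otimes>\<^bsub>G\<^esub> h" if "g \<in> T" "h \<in> T" for g h
    using comm[OF that] that s G.m_assoc[of "g \<otimes>\<^bsub>G\<^esub> s" h s] ss[of "g \<otimes>\<^bsub>G\<^esub> h"] by simp
  show ?thesis
    unfolding graded_on_def
  proof (intro conjI)
    show "subgroup (T \<union> ?Ts) G" by (rule subgroup_adjoin_involution[OF G D(1) s(1,3)])
    show "finite (T \<union> ?Ts)" using D(2) by simp
    show "\<forall>g\<in>T \<union> ?Ts. g \<otimes>\<^bsub>G\<^esub> g = \<one>\<^bsub>G\<^esub>" using D(3) sq by auto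
    show "\<forall>g\<in>T \<union> ?Ts. subspace (\<Gamma> g) \<and> \<Gamma> g \<subseteq> dbl A u"
    proof
      fix g assume "g \<in> T \<union> ?Ts"
      then consider "g \<in> T" | h where "h \<in> T" "g = h \<otimes>\<^bsub>G\<^esub> s" by blast
      then show "subspace (\<Gamma> g) \<and> \<Gamma> g \<subseteq> dbl A u"
      proof cases
        case 1
        then show ?thesis using D(4,5) dbl_base(1)[OF A u] by blast
      next
        case 2
        have "Vector_Spaces.linear scale scale (\<lambda>x. x \<star> u)" by unfold_locales (auto simp: mult_simps)
        then interpret l: Vector_Spaces.linear scale scale "\<lambda>x. x \<star> u" .
        have "subspace ((\<lambda>x. x \<star> u) ` \<Gamma> h)" by (rule l.subspace_image[OF D(4)[OF 2(1)]])
        then show ?thesis using 2 D(5) dbl_base(3)[OF A u] by (auto simp: \<Gamma>s)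
      qed
    qed
    show "\<forall>x\<in>dbl A u. \<exists>f. (\<forall>g\<in>T \<union> ?Ts. f g \<in> \<Gamma> g) \<and> x = (\<Sum>g\<in>T \<union> ?Ts. f g)"
    proof
      fix x assume "x \<in> dbl A u"
      then obtain a b where ab: "a \<in> A" "b \<in> A" "x = a + b \<star> u" by (rule dblE)
      obtain p q where p: "\<forall>g\<in>T. p g \<in> \<Gamma> g" "a = (\<Sum>g\<in>T. p g)" and q: "\<forall>g\<in>T. q g \<in> \<Gamma> g" "b = (\<Sum>g\<in>T. q g)"
        using D(6)[OF ab(1)] D(6)[OF ab(2)] by blast
      let ?f = "\<lambda>g. if g \<in> T then p g else q (g \<otimes>\<^bsub>G\<^esub> s) \<star> u"
      have fs: "?f (g \<otimes>\<^bsub>G\<^esub> s) = q g \<star> u" if "g \<in> T" for g using that notT[OF that] by (simp add: ss)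
      have "(\<Sum>g\<in>T. ?f (g \<otimes>\<^bsub>G\<^esub> s)) = b \<star> u"
        unfolding q(2) mult_sum_left by (rule sum.cong) (auto simp only: fs)
      then have "x = (\<Sum>g\<in>T \<union> ?Ts. ?f g)" unfolding sum ab(3) p(2) by simp
      moreover have "\<forall>g\<in>T \<union> ?Ts. ?f g \<in> \<Gamma> g"
      proof
        fix g assume "g \<in> T \<union> ?Ts"
        then consider "g \<in> T" | h where "h \<in> T" "g = h \<otimes>\<^bsub>G\<^esub> s" by blast
        then show "?f g \<in> \<Gamma> g"
        proof cases
          case 2
          have "q h \<star> u \<in> \<Gamma> g" using q(1) 2 \<Gamma>s by auto
          then show ?thesis unfolding fs[OF 2(1), folded 2(2)] .
        qed (use p in simp)
      qed
      ultimately show "\<exists>f. (\<forall>g\<in>T \<union> ?Ts. f g \<in> \<Gamma> g) \<and> x = (\<Sum>g\<in>T \<union> ?Ts. f g)"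
        by (intro exI[of _ ?f] conjI)
    qed
    show "\<forall>f. (\<forall>g\<in>T \<union> ?Ts. f g \<in> \<Gamma> g) \<and> (\<Sum>g\<in>T \<union> ?Ts. f g) = 0 \<longrightarrow> (\<forall>g\<in>T \<union> ?Ts. f g = 0)"
    proof (intro allI impI)
      fix f assume f: "(\<forall>g\<in>T \<union> ?Ts. f g \<in> \<Gamma> g) \<and> (\<Sum>g\<in>T \<union> ?Ts. f g) = 0"
      then have "\<forall>g\<in>T. \<exists>y. y \<in> \<Gamma> g \<and> f (g \<otimes>\<^bsub>G\<^esub> s) = y \<star> u" using \<Gamma>s by blast
      then obtain q where q: "\<And>g. g \<in> T \<Longrightarrow> q g \<in> \<Gamma> g \<and> f (g \<otimes>\<^bsub>G\<^esub> s) = q g \<star> u" by metis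
      have "(\<Sum>g\<in>T. f (g \<otimes>\<^bsub>G\<^esub> s)) = (\<Sum>g\<in>T. q g) \<star> u"
        unfolding mult_sum_left by (rule sum.cong) (use q in auto)
      then have e: "(\<Sum>g\<in>T. f g) + (\<Sum>g\<in>T. q g) \<star> u = 0 + 0 \<star> u" using f by (simp add: sum)
      have "(\<Sum>g\<in>T. f g) \<in> A" "(\<Sum>g\<in>T. q g) \<in> A"
        using f q D(5) by (auto intro!: subspace_sum[OF C(1)])
      then have "(\<Sum>g\<in>T. f g) = 0" "(\<Sum>g\<in>T. q g) = 0" using dbl_unique[OF A u _ _ C(5,5) e] by auto
      then have "f g = 0" "q g = 0" if "g \<in> T" for g
        using D(7)[of f g] D(7)[of q g] f q that by auto
      then show "\<forall>g\<in>T \<union> ?Ts. f g = 0" using q by auto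
    qed
    show "\<forall>g\<in>T \<union> ?Ts. \<forall>h\<in>T \<union> ?Ts. \<forall>x\<in>\<Gamma> g. \<forall>y\<in>\<Gamma> h. x \<star> y \<in> \<Gamma> (g \<otimes>\<^bsub>G\<^esub> h)"
    proof (intro ballI)
      fix g h x y assume gh: "g \<in> T \<union> ?Ts" "h \<in> T \<union> ?Ts" and xy: "x \<in> \<Gamma> g" "y \<in> \<Gamma> h"
      consider "g \<in> T" "h \<in> T" | h' where "g \<in> T" "h' \<in> T" "h = h' \<otimes>\<^bsub>G\<^esub> s"
        | g' where "g' \<in> T" "h \<in> T" "g = g' \<otimes>\<^bsub>G\<^esub> s"
        | g' h' where "g' \<in> T" "h' \<in> T" "g = g' \<otimes>\<^bsub>G\<^esub> s" "h = h' \<otimes>\<^bsub>G\<^esub> s"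
        using gh by blast
      then show "x \<star> y \<in> \<Gamma> (g \<otimes>\<^bsub>G\<^esub> h)"
      proof cases
        case 1
        then show ?thesis using D(8) xy by blast
      next
        case 2
        then obtain b where b: "b \<in> \<Gamma> h'" "y = b \<star> u" using xy \<Gamma>s by auto
        have "x \<star> y = (b \<star> x) \<star> u"
          unfolding b(2) by (rule dbl_mult_1[OF A u]) (use 2 xy b D(5) in auto)
        moreover have "g \<otimes>\<^bsub>G\<^esub> h = (h' \<otimes>\<^bsub>G\<^esub> g) \<otimes>\<^bsub>G\<^esub> s"
          using 2 s(1) by (simp add: G.m_ac)
        moreover have "b \<star> x \<in> \<Gamma> (h' \<otimes>\<^bsub>G\<^esub> g)" using D(8) 2 b xy by blast
        ultimately show ?thesis using \<Gamma>s[OF T.m_closed[OF 2(2,1)]] by auto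
      next
        case 3
        then obtain a where a: "a \<in> \<Gamma> g'" "x = a \<star> u" using xy \<Gamma>s by auto
        have "x \<star> y = (a \<star> cnj y) \<star> u"
          unfolding a(2) by (rule dbl_mult_2[OF A u]) (use 3 xy a D(5) in auto)
        moreover have "g \<otimes>\<^bsub>G\<^esub> h = (g' \<otimes>\<^bsub>G\<^esub> h) \<otimes>\<^bsub>G\<^esub> s" using comm 3 by simp
        moreover have "a \<star> cnj y \<in> \<Gamma> (g' \<otimes>\<^bsub>G\<^esub> h)" using D(8,9) 3 a xy by blast
        ultimately show ?thesis using \<Gamma>s[OF T.m_closed[OF 3(1,2)]] by auto
      next
        case 4
        then obtain a b where ab: "a \<in> \<Gamma> g'" "x = a \<star> u" "b \<in> \<Gamma> h'" "y = b \<star> u" using xy \<Gamma>s by auto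
        have "x \<star> y = - (n u \<cdot> (cnj b \<star> a))"
          unfolding ab(2,4) by (rule dbl_mult_3[OF A u]) (use 4 ab D(5) in auto)
        moreover have "g \<otimes>\<^bsub>G\<^esub> h = h' \<otimes>\<^bsub>G\<^esub> g'" using sq[OF 4(1,2)] 4 by (simp add: G.m_comm)
        moreover have "cnj b \<star> a \<in> \<Gamma> (h' \<otimes>\<^bsub>G\<^esub> g')" using D(8,9) 4 ab by blast
        ultimately show ?thesis using D(4)[OF T.m_closed[OF 4(2,1)]] by (auto intro: subspace_neg subspace_scale)
      qed
    qed
    show "\<forall>g\<in>T \<union> ?Ts. \<forall>x\<in>\<Gamma> g. cnj x \<in> \<Gamma> g"
    proof (intro ballI)
      fix g x assume "g \<in> T \<union> ?Ts" and x: "x \<in> \<Gamma> g"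
      then consider "g \<in> T" | h where "h \<in> T" "g = h \<otimes>\<^bsub>G\<^esub> s" by blast
      then show "cnj x \<in> \<Gamma> g"
      proof cases
        case 2
        then obtain b where b: "b \<in> \<Gamma> h" "x = b \<star> u" using x \<Gamma>s by auto
        then have "cnj x = (- b) \<star> u" using cnj_dbl[OF A u] D(5)[OF 2(1)] by simp
        moreover have "- b \<in> \<Gamma> h" using subspace_neg[OF D(4)] 2 b by blast
        ultimately have "cnj x \<in> (\<lambda>x. x \<star> u) ` \<Gamma> h" by (rule image_eqI)
        then show ?thesis using 2 \<Gamma>s by simp
      qed (use D(9) x in blast)
    qed
  qed
qed

lemma graded_on_grading:
  assumes G: "comm_group G" and gr: "graded_on G T \<Gamma> UNIV" and z: "\<forall>g\<in>carrier G - T. \<Gamma> g = {0}"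
  shows "grading scale mul G \<Gamma>"
proof (rule gradingI[OF vector_space_axioms G, where T = T])
  note D = graded_onD[OF gr]
  show "subspace (\<Gamma> g)" if "g \<in> carrier G" for g
    using D(4) z that by (cases "g \<in> T") auto
  show "T \<subseteq> carrier G" using D(1) subgroup.subset by blast
  show "\<Gamma> g = {0}" if "g \<in> carrier G" "g \<notin> T" for g using z that by blast
  show "f g = 0" if "\<And>g. g \<in> T \<Longrightarrow> f g \<in> \<Gamma> g" "(\<Sum>g\<in>T. f g) = 0" "g \<in> T" for f g
    using D(7) that by blast
qed (use graded_onD[OF gr] in auto)

lemma fine_grading_if_lines:
  assumes gr: "grading scale mul G \<Gamma>" and line: "\<And>g. g \<in> support G \<Gamma> \<Longrightarrow> \<exists>b. \<Gamma> g = span {b}"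
  shows "fine_grading scale mul G \<Gamma>"
proof (rule fine_gradingI[OF gr])
  fix H :: "nat monoid" and \<Delta> g
  assume H: "grading scale mul H \<Delta>" "refines H \<Delta> G \<Gamma>" and g: "g \<in> support G \<Gamma>"
  obtain b where b: "\<Gamma> g = span {b}" using line[OF g] by blast
  have gc: "g \<in> carrier G" using g by (simp add: support_def)
  have b0: "b \<noteq> 0" using g unfolding support_def by (auto simp only: mem_Collect_eq b span_insert_0 span_empty)
  obtain h where h: "h \<in> carrier H" "b \<in> \<Delta> h" by (rule line_in_refinement[OF gr H gc b b0])
  then have "span {b} \<subseteq> \<Delta> h" by (intro span_minimal grading_subspace[OF H(1)]) auto
  then show "\<exists>h\<in>carrier H. \<Gamma> g \<subseteq> \<Delta> h" using h(1) b by blast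
qed

end

section \<open>Isometries and relabellings\<close>

text \<open>Isometry is stated with an explicit map, and the maps that arise naturally go from the
  orthogonal sum to the algebra; so they have to be inverted.\<close>

lemma isometric_sym:
  assumes f: "bij_betw f W V" "\<And>x y. x \<in> W \<Longrightarrow> y \<in> W \<Longrightarrow> f (x + y) = f x + f y"
    "\<And>a x. x \<in> W \<Longrightarrow> f (s2 a x) = s1 a (f x)" "\<And>x. x \<in> W \<Longrightarrow> q1 (f x) = q2 x"
    and W: "\<And>x y. x \<in> W \<Longrightarrow> y \<in> W \<Longrightarrow> x + y \<in> W" "\<And>a x. x \<in> W \<Longrightarrow> s2 a x \<in> W"
  shows "isometric s1 V q1 s2 W q2"
proof -
  let ?g = "inv_into W f"
  have g: "bij_betw ?g V W" by (rule bij_betw_inv_into[OF f(1)])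
  have gW: "?g x \<in> W" "f (?g x) = x" if "x \<in> V" for x
    using that f(1) bij_betw_apply[OF g] by (auto simp: bij_betw_inv_into_right)
  have gI: "?g x = w" if "w \<in> W" "f w = x" for x w using that f(1) by (auto simp: bij_betw_inv_into_left)
  have "\<forall>x\<in>V. \<forall>y\<in>V. ?g (x + y) = ?g x + ?g y" using gW W f by (intro ballI gI) auto
  moreover have "\<forall>a. \<forall>x\<in>V. ?g (s1 a x) = s2 a (?g x)" using gW W f by (intro allI ballI gI) auto
  moreover have "\<forall>x\<in>V. q2 (?g x) = q1 x" using gW f(4) by (metis)
  ultimately show ?thesis unfolding isometric_def using g by blast
qed

lemma iso_relabel_sym:
  assumes "group G" "\<phi> \<in> iso G G" "\<forall>t\<in>carrier G. \<mu>' t = \<mu> (\<phi> t)"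
  shows "\<exists>\<chi>\<in>iso G G. \<forall>t\<in>carrier G. \<mu> t = \<mu>' (\<chi> t)"
proof (intro bexI[of _ "inv_into (carrier G) \<phi>"] ballI)
  show "inv_into (carrier G) \<phi> \<in> iso G G" by (rule group.iso_set_sym[OF assms(1,2)])
  fix t assume t: "t \<in> carrier G"
  have b: "bij_betw \<phi> (carrier G) (carrier G)" using assms(2) by (simp add: iso_def)
  have "inv_into (carrier G) \<phi> t \<in> carrier G" using bij_betw_apply[OF bij_betw_inv_into[OF b] t] .
  moreover have "\<phi> (inv_into (carrier G) \<phi> t) = t" by (rule bij_betw_inv_into_right[OF b t])
  ultimately show "\<mu> t = \<mu>' (inv_into (carrier G) \<phi> t)" using assms(3) by metis
qed

text \<open>With all squares trivial, inverses come for free.\<close>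

lemma involutive_generate:
  assumes G: "comm_group G" and sq: "\<And>g. g \<in> carrier G \<Longrightarrow> g \<otimes>\<^bsub>G\<^esub> g = \<one>\<^bsub>G\<^esub>"
    and gen: "generate G M = carrier G"
    and Y: "Y \<subseteq> carrier G" "\<And>g h. g \<in> Y \<Longrightarrow> h \<in> Y \<Longrightarrow> g \<otimes>\<^bsub>G\<^esub> h \<in> Y" "\<one>\<^bsub>G\<^esub> \<in> Y" "M \<subseteq> Y"
  shows "carrier G \<subseteq> Y"
proof -
  interpret G: comm_group G by fact
  have "inv\<^bsub>G\<^esub> g = g" if "g \<in> carrier G" for g using sq[OF that] that by (intro G.inv_equality) auto
  then have "subgroup Y G" using Y by (intro G.subgroupI) auto
  then have "generate G M \<subseteq> Y" by (rule G.generate_subgroup_incl[OF Y(4)])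
  then show ?thesis using gen by simp
qed

lemma unit_squares_coset:
  assumes X: "X \<in> carrier (field_units Mod (unit_squares :: 'f::field set))" and a: "a \<in> X" "b \<in> X"
  obtains p where "p \<noteq> 0" "b = p\<^sup>2 * a" "a \<noteq> 0"
proof -
  obtain c where c: "c \<noteq> 0" "X = unit_squares #>\<^bsub>field_units\<^esub> c"
    using X by (auto simp: FactGroup_def RCOSETS_def)
  then obtain p q where "a = p\<^sup>2 * c" "b = q\<^sup>2 * c" "p \<noteq> 0" "q \<noteq> 0"
    using a by (auto simp: r_coset_def unit_squares_def)
  then show thesis using c(1) by (intro that[of "q / p"]) (auto simp: field_simps power2_eq_square)
qed

context cayley_algebra
begin

text \<open>The components of a division grading are orthogonal, and on \<open>C\<^sub>e b\<close> the norm is \<open>n(b)\<close> times the norm of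
  \<open>C\<^sub>e\<close>. The parametrisation \<open>\<iota>\<close> allows \<open>C\<^sub>e\<close> to be replaced by the ground field.\<close>

lemma division_isometric:
  fixes G :: "('g, 'm) monoid_scheme" and \<iota> :: "'v::ab_group_add \<Rightarrow> 'c"
  assumes dg: "division_grading G \<Gamma>" and fin: "finite (carrier G)"
    and b: "\<And>t. t \<in> carrier G \<Longrightarrow> b t \<in> \<Gamma> t \<and> b t \<noteq> 0"
    and \<iota>: "bij_betw \<iota> V (\<Gamma> \<one>\<^bsub>G\<^esub>)" "\<And>x y. x \<in> V \<Longrightarrow> y \<in> V \<Longrightarrow> \<iota> (x + y) = \<iota> x + \<iota> y"
      "\<And>a x. x \<in> V \<Longrightarrow> \<iota> (s a x) = a \<cdot> \<iota> x" "\<And>x. x \<in> V \<Longrightarrow> n (\<iota> x) = q x"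
    and V: "\<And>x y. x \<in> V \<Longrightarrow> y \<in> V \<Longrightarrow> x + y \<in> V" "\<And>a x. x \<in> V \<Longrightarrow> s a x \<in> V" "\<And>a. s a 0 = 0"
  shows "isometric scale UNIV n (orth_scale s) (orth_space (carrier G) V)
           (orth_form (carrier G) (\<lambda>t. n (b t)) q)"
proof (rule isometric_sym)
  note gr = division_grading_grading[OF dg]
  interpret G: comm_group G by (rule grading_comm_group[OF gr])
  let ?C = "carrier G" and ?W = "orth_space (carrier G) V"
  \<comment> \<open>the natural map goes from the orthogonal sum to the algebra\<close>
  let ?f = "\<lambda>y. \<Sum>t\<in>?C. \<iota> (y t) \<star> b t"
  have \<iota>\<Gamma>: "\<iota> x \<in> \<Gamma> \<one>\<^bsub>G\<^esub>" if "x \<in> V" for x using bij_betw_apply[OF \<iota>(1) that] .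
  have yV: "y t \<in> V" if "y \<in> ?W" "t \<in> ?C" for y t using that by (auto simp: orth_space_def)
  have trm: "\<iota> (y t) \<star> b t \<in> \<Gamma> t" if "y \<in> ?W" "t \<in> ?C" for y t
    using grading_mult[OF gr G.one_closed that(2) \<iota>\<Gamma>[OF yV[OF that]]] b[OF that(2)] that(2) by simp
  have comp: "hcomp G \<Gamma> (?f y) t = \<iota> (y t) \<star> b t" if "y \<in> ?W" "t \<in> ?C" for y t
    using hcomp_eqI[OF gr fin subset_refl trm[OF that(1)] refl that(2)] that(2) by simp
  have bn: "n (b t) \<noteq> 0" if "t \<in> ?C" for t using division_anisotropic[OF dg that] b[OF that] by blast
  show "bij_betw ?f ?W UNIV"
    unfolding bij_betw_def
  proof
    show "inj_on ?f ?W"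
    proof (rule inj_onI)
      fix y y' assume y: "y \<in> ?W" "y' \<in> ?W" "?f y = ?f y'"
      show "y = y'"
      proof
        fix t
        show "y t = y' t"
        proof (cases "t \<in> ?C")
          case True
          have "\<iota> (y t) \<star> b t = \<iota> (y' t) \<star> b t"
            using comp[OF y(1) True] comp[OF y(2) True] unfolding y(3) by simp
          then have "(\<iota> (y t) - \<iota> (y' t)) \<star> b t = 0" by (simp add: mult_diff_left)
          then have "\<iota> (y t) = \<iota> (y' t)" using mult_eq_zero_iff(2)[OF bn[OF True]] by simp
          then show ?thesis using \<iota>(1) yV[OF y(1) True] yV[OF y(2) True] by (meson bij_betw_def inj_onD)
        qed (use y in \<open>auto simp: orth_space_def\<close>)
      qed
    qed
    have "x \<in> ?f ` ?W" for x
    proof -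
      have "\<exists>a. a \<in> V \<and> hcomp G \<Gamma> x t = \<iota> a \<star> b t" if t: "t \<in> ?C" for t
      proof -
        have "hcomp G \<Gamma> x t \<in> {z \<star> b t | z. z \<in> \<Gamma> \<one>\<^bsub>G\<^esub>}"
          using division_component[OF dg t] b[OF t] hcomp_in[OF gr t] by blast
        then obtain z where z: "z \<in> \<Gamma> \<one>\<^bsub>G\<^esub>" "hcomp G \<Gamma> x t = z \<star> b t" by blast
        have "z \<in> \<iota> ` V" using \<iota>(1) z(1) unfolding bij_betw_def by simp
        then obtain a where "a \<in> V" "z = \<iota> a" by (rule imageE)
        then show ?thesis using z(2) by (intro exI[of _ a]) simp
      qed
      then obtain y where y: "\<And>t. t \<in> ?C \<Longrightarrow> y t \<in> V \<and> hcomp G \<Gamma> x t = \<iota> (y t) \<star> b t" by metis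
      let ?y = "\<lambda>t. if t \<in> ?C then y t else 0"
      have "?f ?y = (\<Sum>t\<in>?C. hcomp G \<Gamma> x t)" by (rule sum.cong) (use y in auto)
      also have "\<dots> = x" using hcomp_sum[OF gr, of x] by (simp add: division_support[OF dg])
      finally have "x = ?f ?y" by simp
      moreover have "?y \<in> ?W" using y by (auto simp: orth_space_def)
      ultimately show ?thesis by (rule image_eqI)
    qed
    then show "?f ` ?W = UNIV" by blast
  qed
  show "?f (x + y) = ?f x + ?f y" if "x \<in> ?W" "y \<in> ?W" for x y
    unfolding sum.distrib[symmetric]
    by (rule sum.cong) (use yV that in \<open>auto simp: \<iota>(2) mult_add_left\<close>)
  show "?f (orth_scale s a x) = a \<cdot> ?f x" if "x \<in> ?W" for a x
    unfolding scale_sum_right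
    by (rule sum.cong) (use yV that in \<open>auto simp: orth_scale_def \<iota>(3) mult_scale_left\<close>)
  show "n (?f x) = orth_form ?C (\<lambda>t. n (b t)) q x" if x: "x \<in> ?W" for x
  proof -
    have "n (?f x) = (\<Sum>t\<in>?C. n (\<iota> (x t) \<star> b t))"
      by (rule norm_sum_orthogonal[OF fin]) (use division_orthogonal[OF dg] trm[OF x] in auto)
    also have "\<dots> = orth_form ?C (\<lambda>t. n (b t)) q x"
      unfolding orth_form_def by (rule sum.cong) (use yV[OF x] in \<open>auto simp: norm_mult \<iota>(4)\<close>)
    finally show ?thesis .
  qed
  show "x + y \<in> ?W" if "x \<in> ?W" "y \<in> ?W" for x y using that V by (auto simp: orth_space_def)
  show "orth_scale s a x \<in> ?W" if "x \<in> ?W" for a x using that V by (auto simp: orth_space_def orth_scale_def)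
qed

section \<open>Doubling the ground field: components of dimension 1\<close>

lemma line_anisotropic: assumes "n b \<noteq> 0"
  shows "x \<in> span {b} \<Longrightarrow> x \<noteq> 0 \<Longrightarrow> n x \<noteq> 0" "span {b} \<noteq> {0}"
proof -
  show "x \<in> span {b} \<Longrightarrow> x \<noteq> 0 \<Longrightarrow> n x \<noteq> 0" using assms by (auto simp: span_singleton norm_scale)
  have "b \<in> span {b}" "b \<noteq> 0" using assms by (auto simp: span_base)
  then show "span {b} \<noteq> {0}" by blast
qed

lemma line_mult: "span {b \<star> u} = (\<lambda>x. x \<star> u) ` span {b}"
  by (simp add: span_singleton image_image mult_scale_left)

lemma norms_line_unit: "norms (span {unit}) = unit_squares"
proof -
  have "span {unit} - {0} = (\<lambda>c. c \<cdot> unit) ` (UNIV - {0})"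
  proof (intro equalityI subsetI)
    fix x assume x: "x \<in> span {unit} - {0}"
    then obtain c where c: "x = c \<cdot> unit" by (auto simp: span_singleton)
    then have "c \<noteq> 0" using x by auto
    then show "x \<in> (\<lambda>c. c \<cdot> unit) ` (UNIV - {0})" using c by (intro image_eqI[of _ _ c]) auto
  qed (auto simp: unit_nonzero span_scale span_base)
  then have "norms (span {unit}) = (\<lambda>c. c\<^sup>2) ` (UNIV - {0})"
    by (simp add: norms_def image_image norm_scale)
  then show ?thesis by (auto simp: unit_squares_def)
qed

text \<open>The definition of \<open>Gamma_base\<close> describes the components on generators; that this is a grading follows
  from three applications of \<open>graded_on_dbl\<close>. They require each generator to be outside the
  subgroup generated by the previous ones. This holds by counting: adjoining an element of order at most
  2 at most doubles a subgroup and does nothing if the element is already there, but three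
  steps lead from order 1 to order 8.\<close>

lemma Gamma_base_structure:
  assumes ch: "CHAR('f) \<noteq> 2" and G: "comm_group G"
    and \<Gamma>: "Gamma_base scale mul unit n G (carrier G) \<mu> \<Gamma>"
  obtains s1 s2 s3 u v w where "base_triple u v w" "{s1, s2, s3} \<subseteq> carrier G"
    "generate G {s1, s2, s3} = carrier G"
    "s1 \<noteq> \<one>\<^bsub>G\<^esub>" "s2 \<notin> {\<one>\<^bsub>G\<^esub>, s1}" "s3 \<notin> {\<one>\<^bsub>G\<^esub>, s1, s2, s1 \<otimes>\<^bsub>G\<^esub> s2}"
    "u \<in> \<Gamma> s1" "v \<in> \<Gamma> s2" "w \<in> \<Gamma> s3" "n u \<in> \<mu> s1" "n v \<in> \<mu> s2" "n w \<in> \<mu> s3"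
    "division_grading G \<Gamma>" "\<Gamma> \<one>\<^bsub>G\<^esub> = span {unit}" "\<And>g. g \<in> carrier G \<Longrightarrow> \<exists>b. \<Gamma> g = span {b}"
    "finite (carrier G)"
proof -
  interpret G: comm_group G by fact
  obtain s1 s2 s3 u v w where s: "{s1, s2, s3} \<subseteq> carrier G" "generate G {s1, s2, s3} = carrier G"
    and u: "n u \<noteq> 0" "polar n u unit = 0" "n u \<in> \<mu> s1"
    and v: "n v \<noteq> 0" "\<forall>x\<in>{unit, u}. polar n v x = 0" "n v \<in> \<mu> s2"
    and w: "n w \<noteq> 0" "\<forall>x\<in>{unit, u, v, u \<star> v}. polar n w x = 0" "n w \<in> \<mu> s3"
    and \<Gamma>8: "\<Gamma> \<one>\<^bsub>G\<^esub> = span {unit}" "\<Gamma> s1 = span {u}" "\<Gamma> s2 = span {v}" "\<Gamma> (s1 \<otimes>\<^bsub>G\<^esub> s2) = span {u \<star> v}"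
      "\<Gamma> s3 = span {w}" "\<Gamma> (s1 \<otimes>\<^bsub>G\<^esub> s3) = span {u \<star> w}" "\<Gamma> (s2 \<otimes>\<^bsub>G\<^esub> s3) = span {v \<star> w}"
      "\<Gamma> (s1 \<otimes>\<^bsub>G\<^esub> s2 \<otimes>\<^bsub>G\<^esub> s3) = span {(u \<star> v) \<star> w}"
    using \<Gamma>[unfolded Gamma_base_def, THEN conjunct2] by (elim exE conjE) (rule that; assumption)
  have el: "card (carrier G) = 8" "\<forall>t\<in>carrier G. t \<otimes>\<^bsub>G\<^esub> t = \<one>\<^bsub>G\<^esub>"
    using \<Gamma>[unfolded Gamma_base_def, THEN conjunct1] unfolding elementary_2_subgroup_def by auto
  have sc: "s1 \<in> carrier G" "s2 \<in> carrier G" "s3 \<in> carrier G" using s by auto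
  have t: "base_triple u v w" using u v w by (simp add: base_triple_def perp_def)
  let ?adj = "\<lambda>T s. T \<union> (\<lambda>g. g \<otimes>\<^bsub>G\<^esub> s) ` T"
  let ?T0 = "{\<one>\<^bsub>G\<^esub>}"
  define T1 where "T1 = ?adj ?T0 s1"
  define T2 where "T2 = ?adj T1 s2"
  define T3 where "T3 = ?adj T2 s3"
  have T1: "T1 = {\<one>\<^bsub>G\<^esub>, s1}" using sc by (auto simp: T1_def)
  have T2: "T2 = {\<one>\<^bsub>G\<^esub>, s1, s2, s1 \<otimes>\<^bsub>G\<^esub> s2}" using sc by (auto simp: T2_def T1)
  have T3: "T3 = {\<one>\<^bsub>G\<^esub>, s1, s2, s1 \<otimes>\<^bsub>G\<^esub> s2, s3, s1 \<otimes>\<^bsub>G\<^esub> s3, s2 \<otimes>\<^bsub>G\<^esub> s3, s1 \<otimes>\<^bsub>G\<^esub> s2 \<otimes>\<^bsub>G\<^esub> s3}"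
    using sc by (auto simp: T3_def T2)
  note adj = subgroup_adjoin_involution[OF G]
  have sub: "subgroup T1 G" "subgroup T2 G" "subgroup T3 G"
    using adj[OF G.triv_subgroup sc(1)] adj[of T1, OF _ sc(2)] adj[of T2, OF _ sc(3)] el(2) sc
    unfolding T1_def[symmetric] T2_def[symmetric] T3_def[symmetric] by blast+
  have "{s1, s2, s3} \<subseteq> T3" unfolding T3 by blast
  then have "generate G {s1, s2, s3} \<subseteq> T3" by (rule G.generate_subgroup_incl[OF _ sub(3)])
  then have C: "carrier G = T3" using s(2) subgroup.subset[OF sub(3)] by blast
  have cd: "card (?adj T s) \<le> 2 * card T" if "finite T" for T s
    using card_Un_le[of T "(\<lambda>g. g \<otimes>\<^bsub>G\<^esub> s) ` T"] card_image_le[OF that, of "\<lambda>g. g \<otimes>\<^bsub>G\<^esub> s"] by linarith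
  have cd': "card (?adj T s) \<le> card T" if "finite T" "subgroup T G" "s \<in> T" for T s
  proof (rule card_mono[OF that(1)])
    show "?adj T s \<subseteq> T" using subgroup.m_closed[OF that(2)] that(3) by auto
  qed
  have f: "finite T1" "finite T2" by (simp_all add: T1 T2)
  have c1: "card T1 \<le> 2" "card T2 \<le> 2 * card T1" "card T3 \<le> 2 * card T2" "card T3 = 8"
    using cd[of ?T0 s1] cd[OF f(1), of s2] cd[OF f(2), of s3] el(1) C
    unfolding T1_def[symmetric] T2_def[symmetric] T3_def[symmetric] by auto
  \<comment> \<open>\<open>|T3| = 8\<close> leaves no room for a step that does not double\<close>
  have n3: "s3 \<notin> T2" using cd'[OF f(2) sub(2), of s3] c1 unfolding T3_def[symmetric] by linarith
  have n2: "s2 \<notin> T1" using cd'[OF f(1) sub(1), of s2] c1 unfolding T2_def[symmetric] by linarith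
  have n1: "s1 \<notin> ?T0" using cd'[OF _ G.triv_subgroup, of s1] c1 unfolding T1_def[symmetric] by auto
  let ?A = "span {unit}"
  note tw = base_triple_tower[OF ch t]
  have g0: "graded_on G ?T0 \<Gamma> ?A" by (rule graded_on_trivial[where \<Gamma> = \<Gamma>, OF G.is_group tw(1) \<Gamma>8(1)])
  have g1: "graded_on G T1 \<Gamma> (dbl ?A u)"
    unfolding T1_def
    by (rule graded_on_dbl[OF tw(1-3) G g0 sc(1) n1])
      (use sc el(2) \<Gamma>8 line_mult[of unit u] in \<open>auto simp: one_mult\<close>)
  have g2: "graded_on G T2 \<Gamma> (dbl (dbl ?A u) v)"
    unfolding T2_def
    by (rule graded_on_dbl[OF tw(4-6) G g1 sc(2) n2])
      (use sc el(2) \<Gamma>8 line_mult[of unit v] line_mult[of u v] in \<open>auto simp: one_mult T1\<close>)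
  have g3: "graded_on G T3 \<Gamma> UNIV"
    unfolding T3_def tw(10)[symmetric]
    by (rule graded_on_dbl[OF tw(7-9) G g2 sc(3) n3])
      (use sc el(2) \<Gamma>8 line_mult[of unit w] line_mult[of u w] line_mult[of v w] line_mult[of "u \<star> v" w] in \<open>auto simp: one_mult T2\<close>)
  have gr: "grading scale mul G \<Gamma>" by (rule graded_on_grading[OF G g3]) (simp add: C)
  have lines: "\<exists>b. n b \<noteq> 0 \<and> \<Gamma> g = span {b}" if "g \<in> carrier G" for g
  proof -
    have "n unit \<noteq> 0" "n (u \<star> v) \<noteq> 0" "n (u \<star> w) \<noteq> 0" "n (v \<star> w) \<noteq> 0" "n ((u \<star> v) \<star> w) \<noteq> 0"
      using u v w by (auto simp: norm_mult)
    then show ?thesis using that u(1) v(1) w(1) \<Gamma>8 unfolding C T3 by blast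
  qed
  have d: "division_grading G \<Gamma>"
    unfolding division_grading_def
  proof (rule conjI[OF gr], rule ballI, rule conjI)
    fix g assume "g \<in> carrier G"
    then obtain b where "n b \<noteq> 0" "\<Gamma> g = span {b}" using lines by blast
    then show "\<Gamma> g \<noteq> {0}" "\<forall>x\<in>\<Gamma> g. x \<noteq> 0 \<longrightarrow> n x \<noteq> 0" using line_anisotropic by auto
  qed
  show thesis
  proof (rule that[OF t s])
    show "finite (carrier G)" using el(1) by (intro card_ge_0_finite) simp
    show "\<exists>b. \<Gamma> g = span {b}" if "g \<in> carrier G" for g using lines[OF that] by blast
  qed (use n1 n2 n3 u v w \<Gamma>8 d in \<open>auto simp: T1 T2 span_base\<close>)
qed

lemma Gamma_base_norms:
  assumes ch: "CHAR('f) \<noteq> 2" and G: "comm_group G"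
    and \<mu>: "\<mu> \<in> hom G (field_units Mod unit_squares)"
    and \<Gamma>: "Gamma_base scale mul unit n G (carrier G) \<mu> \<Gamma>" and g: "g \<in> carrier G"
  shows "\<mu> g = norms (\<Gamma> g)"
proof -
  interpret G: comm_group G by fact
  obtain s1 s2 s3 u v w where *: "base_triple u v w" "{s1, s2, s3} \<subseteq> carrier G"
    "generate G {s1, s2, s3} = carrier G"
    "u \<in> \<Gamma> s1" "v \<in> \<Gamma> s2" "w \<in> \<Gamma> s3" "n u \<in> \<mu> s1" "n v \<in> \<mu> s2" "n w \<in> \<mu> s3"
    "division_grading G \<Gamma>" "\<Gamma> \<one>\<^bsub>G\<^esub> = span {unit}"
    by (rule Gamma_base_structure[OF ch G \<Gamma>]) blast
  have \<mu>': "\<mu> \<in> hom G (field_units Mod norms (\<Gamma> \<one>\<^bsub>G\<^esub>))" using \<mu> by (simp add: *(11) norms_line_unit)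
  note nd = norms_determined[OF *(10) \<mu>']
  have "carrier G \<subseteq> {g \<in> carrier G. \<mu> g = norms (\<Gamma> g)}"
  proof (rule involutive_generate[OF G division_square[OF *(10)] *(3)])
    have nz: "u \<noteq> 0" "v \<noteq> 0" "w \<noteq> 0" using *(1) by (auto simp: base_triple_def)
    then show "{s1, s2, s3} \<subseteq> {g \<in> carrier G. \<mu> g = norms (\<Gamma> g)}"
      using nd(2) *(2,4-9) by auto
  qed (use nd(1,3) in auto)
  then show ?thesis using g by blast
qed

lemma Gamma_base_fine:
  assumes ch: "CHAR('f) \<noteq> 2" and G: "comm_group G"
    and \<Gamma>: "Gamma_base scale mul unit n G (carrier G) \<mu> \<Gamma>"
  shows "fine_grading scale mul G \<Gamma>" "universal_group scale mul G \<Gamma> \<cong> G"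
proof -
  obtain d: "division_grading G \<Gamma>" and l: "\<And>g. g \<in> carrier G \<Longrightarrow> \<exists>b. \<Gamma> g = span {b}"
    by (rule Gamma_base_structure[OF ch G \<Gamma>]) blast
  show "fine_grading scale mul G \<Gamma>"
    by (rule fine_grading_if_lines[OF division_grading_grading[OF d] l]) (simp add: support_def)
  show "universal_group scale mul G \<Gamma> \<cong> G" by (rule division_universal_group[OF d])
qed

text \<open>For one direction, an equivalence relabels degrees while preserving norms. For the other, a relabelling
  that respects \<open>\<mu>\<close> provides homogeneous elements of \<open>\<Gamma>'\<close> with the norms of \<open>u, v, w\<close>. They form a
  second triple of doubling generators, so an automorphism takes one triple to the other.\<close>

lemma Gamma_base_equivalent_iff:
  assumes ch: "CHAR('f) \<noteq> 2" and G: "comm_group G"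
    and \<mu>: "\<mu> \<in> hom G (field_units Mod unit_squares)" "\<mu>' \<in> hom G (field_units Mod unit_squares)"
    and \<Gamma>: "Gamma_base scale mul unit n G (carrier G) \<mu> \<Gamma>" "Gamma_base scale mul unit n G (carrier G) \<mu>' \<Gamma>'"
  shows "equivalent_gradings scale mul G \<Gamma> G \<Gamma>' \<longleftrightarrow> (\<exists>\<phi>\<in>iso G G. \<forall>t\<in>carrier G. \<mu>' t = \<mu> (\<phi> t))"
proof
  interpret G: comm_group G by fact
  note N = Gamma_base_norms[OF ch G \<mu>(1) \<Gamma>(1)] and N' = Gamma_base_norms[OF ch G \<mu>(2) \<Gamma>(2)]
  obtain s1 s2 s3 u v w where *: "base_triple u v w" "{s1, s2, s3} \<subseteq> carrier G"
    "generate G {s1, s2, s3} = carrier G"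
    "s1 \<noteq> \<one>\<^bsub>G\<^esub>" "s2 \<notin> {\<one>\<^bsub>G\<^esub>, s1}" "s3 \<notin> {\<one>\<^bsub>G\<^esub>, s1, s2, s1 \<otimes>\<^bsub>G\<^esub> s2}"
    "u \<in> \<Gamma> s1" "v \<in> \<Gamma> s2" "w \<in> \<Gamma> s3" "division_grading G \<Gamma>" "\<Gamma> \<one>\<^bsub>G\<^esub> = span {unit}"
    by (rule Gamma_base_structure[OF ch G \<Gamma>(1)]) blast
  obtain d': "division_grading G \<Gamma>'" and o': "\<Gamma>' \<one>\<^bsub>G\<^esub> = span {unit}"
    by (rule Gamma_base_structure[OF ch G \<Gamma>(2)]) blast
  {
    assume "equivalent_gradings scale mul G \<Gamma> G \<Gamma>'"
    then obtain \<alpha> where \<alpha>: "\<alpha> \<in> iso G G" "\<And>g. g \<in> carrier G \<Longrightarrow> norms (\<Gamma> g) = norms (\<Gamma>' (\<alpha> g))"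
      using division_equivalence_iso[OF *(10) d'] by metis
    have "\<forall>t\<in>carrier G. \<mu> t = \<mu>' (\<alpha> t)" using N N' \<alpha>(2) group_isoD(1)[OF \<alpha>(1) G G] by simp
    then show "\<exists>\<phi>\<in>iso G G. \<forall>t\<in>carrier G. \<mu>' t = \<mu> (\<phi> t)"
      by (rule iso_relabel_sym[OF G.is_group \<alpha>(1)])
  next
    assume "\<exists>\<phi>\<in>iso G G. \<forall>t\<in>carrier G. \<mu>' t = \<mu> (\<phi> t)"
    then obtain \<chi> where \<chi>: "\<chi> \<in> iso G G" "\<forall>t\<in>carrier G. \<mu> t = \<mu>' (\<chi> t)"
      using iso_relabel_sym[OF G.is_group] by metis
    have sc: "s1 \<in> carrier G" "s2 \<in> carrier G" "s3 \<in> carrier G" using *(2) by auto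
    note X = group_isoD[OF \<chi>(1) G G]
    have pick: "\<exists>y\<in>\<Gamma>' (\<chi> g). y \<noteq> 0 \<and> n y = n x" if "x \<in> \<Gamma> g" "n x \<noteq> 0" "g \<in> carrier G" for x g
      by (rule norms_match[OF _ that(1,2)]) (use N N' \<chi>(2) X(1) that(3) in simp)
    have nz: "n u \<noteq> 0" "n v \<noteq> 0" "n w \<noteq> 0" using *(1) by (auto simp: base_triple_def)
    obtain u' where u': "u' \<in> \<Gamma>' (\<chi> s1)" "n u' = n u" using pick[OF *(7) nz(1) sc(1)] by blast
    obtain v' where v': "v' \<in> \<Gamma>' (\<chi> s2)" "n v' = n v" using pick[OF *(8) nz(2) sc(2)] by blast
    obtain w' where w': "w' \<in> \<Gamma>' (\<chi> s3)" "n w' = n w" using pick[OF *(9) nz(3) sc(3)] by blast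
    have "unit \<in> \<Gamma>' (\<chi> \<one>\<^bsub>G\<^esub>)" by (simp add: X(3) o' span_base)
    moreover have "u' \<star> v' \<in> \<Gamma>' (\<chi> (s1 \<otimes>\<^bsub>G\<^esub> s2))"
      using grading_mult[OF division_grading_grading[OF d'] X(1)[OF sc(1)] X(1)[OF sc(2)] u'(1) v'(1)] sc
      by (simp add: X(2))
    moreover have "\<langle>x, y\<rangle> = 0" if "x \<in> \<Gamma>' (\<chi> g)" "y \<in> \<Gamma>' (\<chi> h)" "g \<in> carrier G" "h \<in> carrier G" "g \<noteq> h" for x y g h
      using division_orthogonal[OF d' X(1)[OF that(3)] X(1)[OF that(4)] _ that(1,2)] X(4) that by blast
    ultimately have "base_triple u' v' w'"
      unfolding base_triple_def perp_def using u' v' w' nz sc *(4-6) by auto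
    then obtain \<psi> where \<psi>: "alg_iso_on scale mul \<psi> UNIV UNIV" "\<psi> u = u'" "\<psi> v = v'" "\<psi> w = w'"
      using base_triple_automorphism[OF ch *(1) _ u'(2) v'(2) w'(2)] by blast
    have "\<psi> ` span {unit} = span {unit}"
      using alg_iso_onD(3)[OF \<psi>(1)] alg_iso_on_unit[OF \<psi>(1)] by (simp add: span_singleton image_image)
    then have "\<psi> ` \<Gamma> \<one>\<^bsub>G\<^esub> = \<Gamma>' \<one>\<^bsub>G\<^esub>" by (simp add: *(11) o')
    then show "equivalent_gradings scale mul G \<Gamma> G \<Gamma>'"
    proof (rule division_equivalenceI[OF *(10) d' \<psi>(1) _ \<chi>(1)])
      show "carrier G \<subseteq> Y" if "Y \<subseteq> carrier G" "\<And>g h. g \<in> Y \<Longrightarrow> h \<in> Y \<Longrightarrow> g \<otimes>\<^bsub>G\<^esub> h \<in> Y" "\<one>\<^bsub>G\<^esub> \<in> Y" "{s1, s2, s3} \<subseteq> Y" for Y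
        by (rule involutive_generate[OF G division_square[OF *(10)] *(3) that])
      show "\<exists>x\<in>\<Gamma> g. x \<noteq> 0 \<and> \<psi> x \<in> \<Gamma>' (\<chi> g)" if "g \<in> {s1, s2, s3}" for g
      proof -
        have "u \<noteq> 0" "v \<noteq> 0" "w \<noteq> 0" using nz by auto
        then show ?thesis using that *(7-9) \<psi> u' v' w' by blast
      qed
    qed (rule *(2))
  }
qed

end

section \<open>Gradings by the elementary abelian group of order 8\<close>

lemma carrier_Z2 [simp]: "carrier (integer_mod_group 2) = {0, 1}"
  by (auto simp: carrier_integer_mod_group)

lemma comm_group_Z2_cube: "comm_group Z2_cube"
  by (intro comm_group_DirProd abelian_integer_mod_group)

lemma comm_group_Z2_sq: "comm_group Z2_sq"
  by (intro comm_group_DirProd abelian_integer_mod_group)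

lemma Z2_cube_simps:
  "carrier Z2_cube = {0, 1} \<times> {0, 1} \<times> {0, 1}" "\<one>\<^bsub>Z2_cube\<^esub> = (0, 0, 0)"
  "(a, b, c) \<otimes>\<^bsub>Z2_cube\<^esub> (a', b', c') = ((a + a') mod 2, (b + b') mod 2, (c + c') mod 2)"
  by (simp_all add: mult_DirProd')

lemma Z2_sq_simps:
  "carrier Z2_sq = {0, 1} \<times> {0, 1}" "\<one>\<^bsub>Z2_sq\<^esub> = (0, 0)"
  "(a, b) \<otimes>\<^bsub>Z2_sq\<^esub> (a', b') = ((a + a') mod 2, (b + b') mod 2)"
  by (simp_all add: mult_DirProd')

lemma elementary_2_subgroup_Z2_cube: "elementary_2_subgroup Z2_cube (carrier Z2_cube) 8"
proof -
  interpret comm_group Z2_cube by (rule comm_group_Z2_cube)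
  have "card (carrier Z2_cube) = 8" by (simp add: Z2_cube_simps card_cartesian_product)
  then show ?thesis
    unfolding elementary_2_subgroup_def using subgroup_self by (auto simp: Z2_cube_simps)
qed

lemma elementary_2_subgroup_Z2_sq: "elementary_2_subgroup Z2_sq (carrier Z2_sq) 4"
proof -
  interpret comm_group Z2_sq by (rule comm_group_Z2_sq)
  have "card (carrier Z2_sq) = 4" by (simp add: Z2_sq_simps card_cartesian_product)
  then show ?thesis
    unfolding elementary_2_subgroup_def using subgroup_self by (auto simp: Z2_sq_simps)
qed

lemma generate_Z2_cube: "generate Z2_cube {(1, 0, 0), (0, 1, 0), (0, 0, 1)} = carrier Z2_cube"
proof -
  interpret comm_group Z2_cube by (rule comm_group_Z2_cube)
  let ?M = "{(1, 0, 0), (0, 1, 0), (0, 0, 1)} :: (int \<times> int \<times> int) set"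
  have M: "?M \<subseteq> carrier Z2_cube" by (simp add: Z2_cube_simps)
  have sub: "subgroup (generate Z2_cube ?M) Z2_cube" by (rule generate_is_subgroup[OF M])
  have g: "(1, 0, 0) \<in> generate Z2_cube ?M" "(0, 1, 0) \<in> generate Z2_cube ?M" "(0, 0, 1) \<in> generate Z2_cube ?M"
    by (auto intro: generate.incl)
  note m = subgroup.m_closed[OF sub]
  have "(0, 0, 0) \<in> generate Z2_cube ?M" using generate.one[of Z2_cube ?M] by (simp add: Z2_cube_simps)
  moreover have "(1, 1, 0) \<in> generate Z2_cube ?M" using m[OF g(1,2)] by (simp add: Z2_cube_simps)
  moreover have "(1, 0, 1) \<in> generate Z2_cube ?M" using m[OF g(1,3)] by (simp add: Z2_cube_simps)
  moreover have "(0, 1, 1) \<in> generate Z2_cube ?M" using m[OF g(2,3)] by (simp add: Z2_cube_simps)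
  moreover have "(1, 1, 1) \<in> generate Z2_cube ?M" using m[OF m[OF g(1,2)] g(3)] by (simp add: Z2_cube_simps)
  ultimately have "carrier Z2_cube \<subseteq> generate Z2_cube ?M" using g unfolding Z2_cube_simps(1) by auto
  then show ?thesis using subgroup.subset[OF sub] by blast
qed

context cayley_algebra
begin

definition base_family :: "'c \<Rightarrow> 'c \<Rightarrow> 'c \<Rightarrow> int \<times> int \<times> int \<Rightarrow> 'c set" where
  "base_family u v w g =
     (if g = (0, 0, 0) then span {unit} else if g = (1, 0, 0) then span {u}
      else if g = (0, 1, 0) then span {v} else if g = (1, 1, 0) then span {u \<star> v}
      else if g = (0, 0, 1) then span {w} else if g = (1, 0, 1) then span {u \<star> w}
      else if g = (0, 1, 1) then span {v \<star> w} else if g = (1, 1, 1) then span {(u \<star> v) \<star> w} else {0})"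

lemma base_family_cases:
  assumes "g \<in> carrier Z2_cube"
  obtains b where "b \<in> {unit, u, v, u \<star> v, w, u \<star> w, v \<star> w, (u \<star> v) \<star> w}" "base_family u v w g = span {b}"
proof -
  obtain i j k where g: "g = (i, j, k)" "i = 0 \<or> i = 1" "j = 0 \<or> j = 1" "k = 0 \<or> k = 1"
    using assms unfolding Z2_cube_simps(1) by blast
  have "\<exists>b\<in>{unit, u, v, u \<star> v, w, u \<star> w, v \<star> w, (u \<star> v) \<star> w}. base_family u v w g = span {b}"
    using g(2-4) unfolding g(1) by (elim disjE) (simp_all add: base_family_def)
  then show thesis using that by blast
qed

lemma Gamma_base_family:
  assumes t: "base_triple u v w" and \<mu>: "n u \<in> \<mu> (1, 0, 0)" "n v \<in> \<mu> (0, 1, 0)" "n w \<in> \<mu> (0, 0, 1)"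
  shows "Gamma_base scale mul unit n Z2_cube (carrier Z2_cube) \<mu> (base_family u v w)"
  unfolding Gamma_base_def
proof (rule conjI[OF elementary_2_subgroup_Z2_cube], rule exI[of _ "(1, 0, 0)"], rule exI[of _ "(0, 1, 0)"],
    rule exI[of _ "(0, 0, 1)"], rule exI[of _ u], rule exI[of _ v], rule exI[of _ w], intro conjI)
  have p: "(1, 0, 0) \<otimes>\<^bsub>Z2_cube\<^esub> (0, 1, 0) = (1, 1, 0)" "(1, 0, 0) \<otimes>\<^bsub>Z2_cube\<^esub> (0, 0, 1) = (1, 0, 1)"
    "(0, 1, 0) \<otimes>\<^bsub>Z2_cube\<^esub> (0, 0, 1) = (0, 1, 1)" "(1, 1, 0) \<otimes>\<^bsub>Z2_cube\<^esub> (0, 0, 1) = (1, 1, 1)"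
    by (simp_all add: Z2_cube_simps)
  let ?B = "base_family u v w"
  show "?B \<one>\<^bsub>Z2_cube\<^esub> = span {unit}" "?B (1, 0, 0) = span {u}" "?B (0, 1, 0) = span {v}"
    "?B (0, 0, 1) = span {w}" "?B ((1, 0, 0) \<otimes>\<^bsub>Z2_cube\<^esub> (0, 1, 0)) = span {u \<star> v}"
    "?B ((1, 0, 0) \<otimes>\<^bsub>Z2_cube\<^esub> (0, 0, 1)) = span {u \<star> w}"
    "?B ((0, 1, 0) \<otimes>\<^bsub>Z2_cube\<^esub> (0, 0, 1)) = span {v \<star> w}"
    "?B ((1, 0, 0) \<otimes>\<^bsub>Z2_cube\<^esub> (0, 1, 0) \<otimes>\<^bsub>Z2_cube\<^esub> (0, 0, 1)) = span {(u \<star> v) \<star> w}"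
    unfolding p Z2_cube_simps(2) by (simp_all add: base_family_def)
  show "{(1, 0, 0), (0, 1, 0), (0, 0, 1)} \<subseteq> carrier Z2_cube" by (simp add: Z2_cube_simps)
  show "generate Z2_cube {(1, 0, 0), (0, 1, 0), (0, 0, 1)} = carrier Z2_cube" by (rule generate_Z2_cube)
qed (use t \<mu> in \<open>simp_all only: base_triple_def perp_def Diff_cancel mem_Collect_eq ball_simps not_False_eq_True\<close>)

lemma hom_full_carrier: "hom (G\<lparr>carrier := carrier G\<rparr>) H = hom G H"
  by (simp add: hom_def)

text \<open>Every triple of doubling generators gives a grading by \<open>Z\<^sub>2\<^sup>3\<close>; its norms form an admissible
  homomorphism, as the grading itself diagonalises the norm.\<close>

lemma admissible_base_norms:
  assumes ch: "CHAR('f) \<noteq> 2" and t: "base_triple u v w"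
  defines "\<Gamma> \<equiv> base_family u v w"
  shows "admissible_base scale n Z2_cube (carrier Z2_cube) (\<lambda>t. norms (\<Gamma> t))"
    "Gamma_base scale mul unit n Z2_cube (carrier Z2_cube) (\<lambda>t. norms (\<Gamma> t)) \<Gamma>"
proof -
  have nz: "n u \<noteq> 0" "n v \<noteq> 0" "n w \<noteq> 0" using t by (auto simp: base_triple_def)
  have *: "n b \<in> norms (span {b})" if "n b \<noteq> 0" for b
    using that by (auto simp: norms_def span_base)
  show \<Gamma>: "Gamma_base scale mul unit n Z2_cube (carrier Z2_cube) (\<lambda>t. norms (\<Gamma> t)) \<Gamma>"
    unfolding \<Gamma>_def by (rule Gamma_base_family[OF t]) (use * nz in \<open>auto simp: base_family_def\<close>)
  obtain d: "division_grading Z2_cube \<Gamma>" and o: "\<Gamma> \<one>\<^bsub>Z2_cube\<^esub> = span {unit}" and fin: "finite (carrier Z2_cube)"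
    by (rule Gamma_base_structure[OF ch comm_group_Z2_cube \<Gamma>]) blast
  obtain b where b: "\<And>t. t \<in> carrier Z2_cube \<Longrightarrow> b t \<in> \<Gamma> t" "\<And>t. t \<in> carrier Z2_cube \<Longrightarrow> b t \<noteq> 0" "b \<one>\<^bsub>Z2_cube\<^esub> = unit"
    by (rule division_representatives[OF d]) blast
  have "isometric scale UNIV n (orth_scale (*)) (orth_space (carrier Z2_cube) UNIV)
           (orth_form (carrier Z2_cube) (\<lambda>t. n (b t)) power2)"
  \<comment> \<open>the neutral component is the ground field with the squaring form\<close>
  proof (rule division_isometric[OF d fin, where \<iota> = "\<lambda>c. c \<cdot> unit"])
    show "bij_betw (\<lambda>c. c \<cdot> unit) UNIV (\<Gamma> \<one>\<^bsub>Z2_cube\<^esub>)"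
      unfolding o span_singleton bij_betw_def using unit_nonzero by (auto simp: inj_on_def)
  qed (use b in \<open>auto simp: scale_left_distrib norm_scale\<close>)
  moreover have "n (b \<one>\<^bsub>Z2_cube\<^esub>) = 1" unfolding b(3) by (rule norm_unit)
  moreover have "\<forall>t\<in>carrier Z2_cube. n (b t) \<in> norms (\<Gamma> t)" using b by (auto simp: norms_def)
  ultimately show "admissible_base scale n Z2_cube (carrier Z2_cube) (\<lambda>t. norms (\<Gamma> t))"
    unfolding admissible_base_def hom_full_carrier using norms_hom[OF d] unfolding o norms_line_unit
    by (intro conjI exI[of _ "\<lambda>t. n (b t)"]) auto
qed

text \<open>Only the frame vectors of degrees \<open>e, s1, s2, s1 s2, s3\<close> are used. That \<open>\<mu>\<close> is a homomorphism makes the norm of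
  the fourth equal, up to a square, to the product of those of the second and third.\<close>

lemma Gamma_base_exists:
  assumes ch: "CHAR('f) \<noteq> 2" and a: "admissible_base scale n Z2_cube (carrier Z2_cube) \<mu>"
  shows "\<exists>\<Gamma>. Gamma_base scale mul unit n Z2_cube (carrier Z2_cube) \<mu> \<Gamma>"
proof -
  let ?C = "carrier Z2_cube"
  have \<mu>: "\<mu> \<in> hom Z2_cube (field_units Mod unit_squares)" using a unfolding admissible_base_def hom_full_carrier by (rule conjunct1)
  obtain r where r: "r \<one>\<^bsub>Z2_cube\<^esub> = 1" "\<forall>t\<in>?C. r t \<in> \<mu> t"
    and iso: "isometric scale UNIV n (orth_scale (*)) (orth_space ?C UNIV) (orth_form ?C r power2)"
    using a unfolding admissible_base_def by blast
  have fin: "finite ?C" by (simp add: Z2_cube_simps)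
  obtain g where g: "\<And>t x. t \<in> ?C \<Longrightarrow> n (g t x) = r t * x\<^sup>2"
    "\<And>t t' x y. t \<in> ?C \<Longrightarrow> t' \<in> ?C \<Longrightarrow> t \<noteq> t' \<Longrightarrow> \<langle>g t x, g t' y\<rangle> = 0"
    by (rule isometric_frame[OF iso fin]) auto
  define ts :: "(int \<times> int \<times> int) list" where "ts = [(0, 0, 0), (1, 0, 0), (0, 1, 0), (1, 1, 0), (0, 0, 1)]"
  define x where "x i = g (ts ! i) 1" for i
  have tsC: "ts ! i \<in> ?C" if "i < 5" for i
  proof -
    have "set ts \<subseteq> ?C" by (simp add: ts_def Z2_cube_simps)
    moreover have "ts ! i \<in> set ts" by (rule nth_mem) (use that in \<open>simp add: ts_def\<close>)
    ultimately show ?thesis by blast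
  qed
  have tsd: "ts ! i \<noteq> ts ! j" if "i < 5" "j < 5" "i \<noteq> j" for i j
  proof -
    have "distinct ts" "length ts = 5" by (simp_all add: ts_def)
    then show ?thesis using that by (simp add: nth_eq_iff_index_eq)
  qed
  have nx: "n (x i) = r (ts ! i)" if "i < 5" for i using g(1)[OF tsC[OF that]] by (simp add: x_def)
  have \<mu>c: "\<mu> t \<in> carrier (field_units Mod unit_squares)" if "t \<in> ?C" for t
    using \<mu> that by (auto simp: hom_def)
  have cC: "(1, 0, 0) \<in> ?C" "(0, 1, 0) \<in> ?C" "(1, 1, 0) \<in> ?C" "(0, 0, 1) \<in> ?C" by (simp_all add: Z2_cube_simps)
  have rn: "r t \<noteq> 0" if "t \<in> ?C" for t
    by (rule unit_squares_coset[OF \<mu>c[OF that] r(2)[rule_format, OF that] r(2)[rule_format, OF that]])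
  have m: "\<mu> (1, 1, 0) = \<mu> (1, 0, 0) <#>\<^bsub>field_units\<^esub> \<mu> (0, 1, 0)"
    using hom_mult[OF \<mu> cC(1,2)] by (simp add: Z2_cube_simps FactGroup_def)
  have "r (1, 1, 0) \<in> \<mu> (1, 0, 0) <#>\<^bsub>field_units\<^esub> \<mu> (0, 1, 0)" using r(2) cC(3) unfolding m[symmetric] by blast
  then obtain a b where ab: "a \<in> \<mu> (1, 0, 0)" "b \<in> \<mu> (0, 1, 0)" "r (1, 1, 0) = a * b"
    by (auto simp: set_mult_def)
  obtain p where p: "p \<noteq> 0" "a = p\<^sup>2 * r (1, 0, 0)"
    using unit_squares_coset[OF \<mu>c[OF cC(1)] r(2)[rule_format, OF cC(1)] ab(1)] by metis
  obtain q where q: "q \<noteq> 0" "b = q\<^sup>2 * r (0, 1, 0)"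
    using unit_squares_coset[OF \<mu>c[OF cC(2)] r(2)[rule_format, OF cC(2)] ab(2)] by metis
  obtain u v w where t: "base_triple u v w" and uvw: "n u = n (x 1)" "n v = n (x 2)" "n w = n (x 4)"
  proof (rule base_triple_exists[OF ch, of x "p * q"])
    show "\<langle>x i, x j\<rangle> = 0" if "i < 5" "j < 5" "i \<noteq> j" for i j
      unfolding x_def by (rule g(2)[OF tsC[OF that(1)] tsC[OF that(2)] tsd[OF that]])
    show "n (x 0) = 1" using nx[of 0] r(1) by (simp add: ts_def Z2_cube_simps)
    show "n (x 3) = (p * q)\<^sup>2 * (n (x 1) * n (x 2))"
      using nx[of 1] nx[of 2] nx[of 3] ab p q by (simp add: ts_def power_mult_distrib mult_ac)
  qed (use nx[of 1] nx[of 2] nx[of 4] rn cC p q in \<open>auto simp: ts_def\<close>)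
  have "Gamma_base scale mul unit n Z2_cube ?C \<mu> (base_family u v w)"
    by (rule Gamma_base_family[OF t])
      (use uvw nx[of 1] nx[of 2] nx[of 4] r(2) cC in \<open>simp_all add: ts_def\<close>)
  then show ?thesis by blast
qed

lemma span_ne_UNIV: assumes "finite S" "card S < 8" shows "span S \<noteq> UNIV"
proof
  assume "span S = UNIV"
  then have "dim (UNIV :: 'c set) \<le> card S" by (intro dim_le_card assms(1)) simp
  then show False using assms(2) dim_eq_8 by simp
qed

text \<open>The greedy step of the classification: below dimension 8 the complement of a homogeneous composition
  subalgebra is nonzero, and it is a graded subspace.\<close>

lemma homogeneous_orthogonal_exists:
  assumes gr: "grading scale mul G \<Gamma>"
    and S: "comp_subalgebra (span S)" "finite S" "card S < 8" "\<And>b. b \<in> S \<Longrightarrow> \<exists>k\<in>carrier G. b \<in> \<Gamma> k"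
  obtains g x where "g \<in> carrier G" "x \<in> \<Gamma> g" "x \<in> perp S" "x \<noteq> 0"
proof -
  obtain y where y: "y \<in> perp (span S)" "n y \<noteq> 0"
    by (rule comp_subalgebra_perp_anisotropic[OF S(1) span_ne_UNIV[OF S(2,3)]])
  then have "y \<in> perp S" "y \<noteq> 0" by (auto simp: perp_span)
  then show thesis using homogeneous_in_perp[OF gr S(4)] that by metis
qed

lemma homogeneous_base_triple:
  assumes ch: "CHAR('f) \<noteq> 2" and gr: "grading scale mul G \<Gamma>"
    and an: "\<And>g x. g \<in> carrier G \<Longrightarrow> x \<in> \<Gamma> g \<Longrightarrow> x \<noteq> 0 \<Longrightarrow> n x \<noteq> 0"
  obtains g h k u v w where "base_triple u v w" "g \<in> carrier G" "h \<in> carrier G" "k \<in> carrier G"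
    "u \<in> \<Gamma> g" "v \<in> \<Gamma> h" "w \<in> \<Gamma> k"
proof -
  interpret G: comm_group G by (rule grading_comm_group[OF gr])
  have A: "comp_subalgebra (span {unit})" by (rule comp_subalgebra_base[OF ch])
  have h1: "\<exists>k\<in>carrier G. b \<in> \<Gamma> k" if "b \<in> {unit}" for b using unit_homogeneous[OF gr] that by auto
  obtain g u where u: "g \<in> carrier G" "u \<in> \<Gamma> g" "u \<in> perp {unit}" "u \<noteq> 0"
    by (rule homogeneous_orthogonal_exists[OF gr A _ _ h1]) auto
  have nu: "n u \<noteq> 0" by (rule an[OF u(1,2,4)])
  have B: "comp_subalgebra (span {unit, u})"
    using comp_subalgebra_dbl[OF A _ nu] u(3) by (simp add: perp_span dbl_span one_mult insert_commute)
  have h2: "\<exists>k\<in>carrier G. b \<in> \<Gamma> k" if "b \<in> {unit, u}" for b using h1 u that by auto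
  obtain h v where v: "h \<in> carrier G" "v \<in> \<Gamma> h" "v \<in> perp {unit, u}" "v \<noteq> 0"
    by (rule homogeneous_orthogonal_exists[OF gr B _ _ h2]) (auto simp: card_insert_if)
  have nv: "n v \<noteq> 0" by (rule an[OF v(1,2,4)])
  have C: "comp_subalgebra (span {unit, u, v, u \<star> v})"
    using comp_subalgebra_dbl[OF B _ nv] v(3) by (simp add: perp_span dbl_span one_mult insert_commute)
  have "u \<star> v \<in> \<Gamma> (g \<otimes>\<^bsub>G\<^esub> h)" by (rule grading_mult[OF gr u(1) v(1) u(2) v(2)])
  then have h3: "\<exists>k\<in>carrier G. b \<in> \<Gamma> k" if "b \<in> {unit, u, v, u \<star> v}" for b using h2 u v that by blast
  obtain k w where w: "k \<in> carrier G" "w \<in> \<Gamma> k" "w \<in> perp {unit, u, v, u \<star> v}" "w \<noteq> 0"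
    by (rule homogeneous_orthogonal_exists[OF gr C _ _ h3]) (auto simp: card_insert_if)
  have nw: "n w \<noteq> 0" by (rule an[OF w(1,2,4)])
  have "base_triple u v w" using u v w nu nv nw by (simp add: base_triple_def)
  then show thesis using that u v w by blast
qed

lemma fine_anisotropic_char_not_2:
  assumes ch: "CHAR('f) \<noteq> 2" and fine: "fine_grading scale mul G \<Gamma>"
    and an: "\<And>g x. g \<in> carrier G \<Longrightarrow> x \<in> \<Gamma> g \<Longrightarrow> x \<noteq> 0 \<Longrightarrow> n x \<noteq> 0"
  shows "\<exists>\<mu> \<Delta>. admissible_base scale n Z2_cube (carrier Z2_cube) \<mu> \<and>
            Gamma_base scale mul unit n Z2_cube (carrier Z2_cube) \<mu> \<Delta> \<and>
            equivalent_gradings scale mul G \<Gamma> Z2_cube \<Delta>"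
proof -
  have gr: "grading scale mul G \<Gamma>" using fine by (simp add: fine_grading_def)
  interpret G: comm_group G by (rule grading_comm_group[OF gr])
  obtain g h k u v w where t: "base_triple u v w" and c: "g \<in> carrier G" "h \<in> carrier G" "k \<in> carrier G"
    and uvw: "u \<in> \<Gamma> g" "v \<in> \<Gamma> h" "w \<in> \<Gamma> k" by (rule homogeneous_base_triple[OF ch gr an])
  let ?\<Delta> = "base_family u v w"
  note A = admissible_base_norms[OF ch t]
  obtain d: "division_grading Z2_cube ?\<Delta>"
    by (rule Gamma_base_structure[OF ch comm_group_Z2_cube A(2)]) blast
  have hom: "\<exists>k\<in>carrier G. b \<in> \<Gamma> k"
    if "b \<in> {unit, u, v, u \<star> v, w, u \<star> w, v \<star> w, (u \<star> v) \<star> w}" for b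
  proof -
    note m = grading_mult[OF gr]
    have "unit \<in> \<Gamma> \<one>\<^bsub>G\<^esub>" by (rule unit_homogeneous[OF gr])
    moreover have "u \<star> v \<in> \<Gamma> (g \<otimes>\<^bsub>G\<^esub> h)" "u \<star> w \<in> \<Gamma> (g \<otimes>\<^bsub>G\<^esub> k)" "v \<star> w \<in> \<Gamma> (h \<otimes>\<^bsub>G\<^esub> k)"
      using m c uvw by auto
    moreover have "(u \<star> v) \<star> w \<in> \<Gamma> (g \<otimes>\<^bsub>G\<^esub> h \<otimes>\<^bsub>G\<^esub> k)" using m[OF _ c(3) calculation(2) uvw(3)] c by simp
    ultimately show ?thesis using that c uvw by (elim insertE) (metis G.m_closed G.one_closed emptyE)+
  qed
  have "equivalent_gradings scale mul G \<Gamma> Z2_cube ?\<Delta>"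
  proof (rule fine_grading_equivalent[OF fine division_grading_grading[OF d]])
    fix t assume t: "t \<in> support Z2_cube ?\<Delta>"
    then have tc: "t \<in> carrier Z2_cube" "?\<Delta> t \<noteq> {0}" unfolding support_def by blast+
    obtain b where b: "b \<in> {unit, u, v, u \<star> v, w, u \<star> w, v \<star> w, (u \<star> v) \<star> w}" "?\<Delta> t = span {b}"
      by (rule base_family_cases[OF tc(1)])
    obtain k where k: "k \<in> carrier G" "b \<in> \<Gamma> k" using hom[OF b(1)] by blast
    have "span {b} \<subseteq> \<Gamma> k" using k by (intro span_minimal grading_subspace[OF gr]) auto
    then show "\<exists>k\<in>carrier G. ?\<Delta> t \<subseteq> \<Gamma> k" unfolding b(2) using k(1) by blast
  qed
  then show ?thesis using A by blast
qed

section \<open>Separable quadratic subfields in characteristic 2\<close>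

lemma alg_poly_pCons:
  "alg_poly scale mul unit (pCons a p) x = a \<cdot> unit + x \<star> alg_poly scale mul unit p x"
proof -
  have bound: "alg_poly scale mul unit q x = (\<Sum>i\<le>N. coeff q i \<cdot> (mul x ^^ i) unit)"
    if "degree q \<le> N" for q N
    unfolding alg_poly_def
    by (rule sum.mono_neutral_left) (use that in \<open>auto simp: coeff_eq_0\<close>)
  have "alg_poly scale mul unit (pCons a p) x = (\<Sum>i\<le>Suc (degree p). coeff (pCons a p) i \<cdot> (mul x ^^ i) unit)"
    by (rule bound) (simp add: degree_pCons_le)
  also have "\<dots> = a \<cdot> unit + (\<Sum>i\<le>degree p. x \<star> (coeff p i \<cdot> (mul x ^^ i) unit))"
    by (simp add: sum.atMost_Suc_shift mult_scale_right del: sum.atMost_Suc)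
  also have "\<dots> = a \<cdot> unit + x \<star> alg_poly scale mul unit p x"
    by (simp add: alg_poly_def mult_sum_right)
  finally show ?thesis .
qed

lemma alg_poly_0: "alg_poly scale mul unit 0 x = 0"
  by (simp add: alg_poly_def)

lemma alg_poly_add:
  "alg_poly scale mul unit (p + q) x = alg_poly scale mul unit p x + alg_poly scale mul unit q x"
proof (induction p arbitrary: q)
  case (pCons a p)
  show ?case
    by (cases q rule: pCons_cases) (simp add: pCons.IH alg_poly_pCons scale_left_distrib mult_add_right)
qed (simp add: alg_poly_0)

lemma alg_poly_smult: "alg_poly scale mul unit (smult a p) x = a \<cdot> alg_poly scale mul unit p x"
  by (induction p) (simp_all add: alg_poly_0 alg_poly_pCons scale_right_distrib mult_scale_right)

text \<open>In characteristic 2 a trace-zero element satisfies \<open>X\<^sup>2 + n(k)\<close>, whose derivative vanishes. If \<open>k\<close> is not a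
  scalar this is its minimal polynomial, so every polynomial annihilating \<open>k\<close> shares this factor with
  its derivative.\<close>

lemma traceless_not_separable:
  assumes ch: "CHAR('f) = 2" and k: "\<langle>k, unit\<rangle> = 0" "k \<notin> span {unit}"
    and p: "coprime p (pderiv p)" "alg_poly scale mul unit p k = 0"
  shows False
proof -
  let ?E = "\<lambda>p. alg_poly scale mul unit p k" and ?q = "[:n k, 0, 1:]"
  have "cnj k = - k" using k(1) by (simp add: cnj_def)
  then have kk: "k \<star> (k \<star> y) = - (n k \<cdot> y)" for y using cnj_mult_mult[of k y] by (simp add: minus_equation_iff)
  have q: "?E (?q * d) = 0" for d
  proof -
    have "?q * d = smult (n k) d + pCons 0 (pCons 0 d)" by simp
    then show ?thesis by (simp only: alg_poly_add alg_poly_smult alg_poly_pCons) (simp add: kk)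
  qed
  \<comment> \<open>the remainder of \<open>p\<close> modulo \<open>X\<^sup>2 + n(k)\<close> is linear and annihilates \<open>k\<close>, so it is zero\<close>
  define r where "r = p mod ?q"
  have "degree r < 2 \<or> r = 0" using degree_mod_less[of ?q p] by (auto simp: r_def)
  then have "degree r \<le> 1" by auto
  then obtain a b where ab: "r = [:a, b:]" by (metis degree1_coeffs degree_0_id le_neq_implies_less less_one degree_eq_zeroE pCons_0_0)
  have "p = ?q * (p div ?q) + r" unfolding r_def by (rule mult_div_mod_eq[symmetric])
  then have "?E r = 0" using q[of "p div ?q"] alg_poly_add[of "?q * (p div ?q)" r k] p(2) by simp
  then have e: "a \<cdot> unit + b \<cdot> k = 0" by (simp add: ab alg_poly_pCons alg_poly_0 mult_scale_right mult_one)
  have "b = 0"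
  proof (rule ccontr)
    assume b: "b \<noteq> 0"
    have "b \<cdot> k = (- a) \<cdot> unit" using e by (simp add: eq_neg_iff_add_eq_0 add.commute)
    then have "inverse b \<cdot> (b \<cdot> k) = inverse b \<cdot> ((- a) \<cdot> unit)" by simp
    then have "k = (inverse b * (- a)) \<cdot> unit" using b by simp
    then show False using k(2) by (metis rangeI span_singleton)
  qed
  then have "r = 0" using e ab unit_nonzero by simp
  then have d: "?q dvd p" by (simp add: r_def mod_eq_0_iff_dvd)
  have "pderiv ?q = 0" using two_zero[OF ch] by (simp add: pderiv_pCons)
  obtain e where "p = ?q * e" using d by (rule dvdE)
  then have "pderiv p = ?q * pderiv e" using \<open>pderiv ?q = 0\<close> by (simp only: pderiv_mult) simp
  then have "?q dvd pderiv p" by (rule dvdI)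
  then have "is_unit ?q" using p(1) d by (rule coprime_common_divisor[rotated 2])
  then show False by (simp add: is_unit_pCons_iff)
qed

text \<open>Separability is exactly what makes the trace nonzero, and with it the polar form nondegenerate on \<open>K\<close>; the
  invertibility of nonzero elements makes the norm anisotropic.\<close>

lemma separable_subfieldD:
  assumes ch: "CHAR('f) = 2" and K: "quadratic_separable_subfield scale mul unit K"
  obtains k where "K = span {unit, k}" "\<langle>k, unit\<rangle> \<noteq> 0" "comp_subalgebra K" "dim K = 2"
    "\<And>x. x \<in> K \<Longrightarrow> x \<noteq> 0 \<Longrightarrow> n x \<noteq> 0"
proof -
  have K1: "subspace K" "dim K = 2" "unit \<in> K" "\<forall>x\<in>K. x \<noteq> 0 \<longrightarrow> (\<exists>y\<in>K. x \<star> y = unit)"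
    "\<forall>x\<in>K. \<exists>p. coprime p (pderiv p) \<and> alg_poly scale mul unit p x = 0"
    using K unfolding quadratic_separable_subfield_def by blast+
  have "\<not> K \<subseteq> span {unit}"
  proof
    assume "K \<subseteq> span {unit}"
    then have "dim K \<le> 1" using dim_le_card[of K "{unit}"] by simp
    then show False using K1(2) by simp
  qed
  then obtain k where k: "k \<in> K" "k \<notin> span {unit}" by blast
  then have "k \<noteq> unit" using span_base[of unit "{unit}"] by auto
  have "independent {k, unit}" using k(2) unit_nonzero by (intro independent_insertI) (auto simp: independent_empty)
  then have Kk: "K = span {unit, k}"
    using independent_spans_subspace[of "{k, unit}" K] k K1(1-3) \<open>k \<noteq> unit\<close> by (simp add: insert_commute)
  have tk: "\<langle>k, unit\<rangle> \<noteq> 0"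
  proof
    assume t: "\<langle>k, unit\<rangle> = 0"
    obtain p where "coprime p (pderiv p)" "alg_poly scale mul unit p k = 0" using K1(5) k(1) by blast
    then show False by (rule traceless_not_separable[OF ch t k(2)])
  qed
  have an: "n x \<noteq> 0" if x: "x \<in> K" "x \<noteq> 0" for x
  proof -
    obtain y where "x \<star> y = unit" using K1(4) x by blast
    then have "n x * n y = 1" using norm_mult[of x y] by simp
    then show ?thesis by auto
  qed
  have "comp_subalgebra K" unfolding Kk by (rule comp_subalgebra_quadratic_char_2[OF ch tk])
  then show thesis using that Kk tk K1(2) an by blast
qed

text \<open>The converse: an anisotropic plane \<open>span {1, k}\<close> with nonzero trace is a field, since \<open>n(x)\<inverse> cnj(x)\<close>
  inverts \<open>x\<close>; and \<open>X\<^sup>2 - t(x) X + n(x)\<close> is separable, its derivative being the nonzero constant \<open>- t(x)\<close>.\<close>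

lemma separable_subfieldI:
  assumes ch: "CHAR('f) = 2" and k: "\<langle>k, unit\<rangle> \<noteq> 0"
    and an: "\<And>x. x \<in> span {unit, k} \<Longrightarrow> x \<noteq> 0 \<Longrightarrow> n x \<noteq> 0"
  shows "quadratic_separable_subfield scale mul unit (span {unit, k})"
proof -
  let ?K = "span {unit, k}"
  note D = comp_subalgebraD[OF comp_subalgebra_quadratic_char_2[OF ch k]]
  have two: "(2::'f) = 0" by (rule two_zero[OF ch])
  have ku: "k \<notin> span {unit}" using k two by (auto simp: span_singleton bil_simps)
  then have ne: "k \<noteq> unit" using span_base[of unit "{unit}"] by auto
  have "independent {k, unit}" using ku unit_nonzero by (intro independent_insertI) (auto simp: independent_empty)
  then have "dim ?K = card {k, unit}" using dim_eq_card_independent[of "{k, unit}"] by (simp add: insert_commute)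
  then have d: "dim ?K = 2" using ne by simp
  have alt: "(k \<star> k) \<star> k = k \<star> (k \<star> k)" by (simp add: square_eq mult_simps)
  have com: "x \<star> y = y \<star> x" if xy: "x \<in> ?K" "y \<in> ?K" for x y
  proof -
    obtain a b where x: "x = a \<cdot> unit + b \<cdot> k" using xy(1) by (rule span_pairE)
    obtain c d where y: "y = c \<cdot> unit + d \<cdot> k" using xy(2) by (rule span_pairE)
    show ?thesis unfolding x y by (simp add: mult_simps scale_right_distrib algebra_simps)
  qed
  have ass: "(x \<star> y) \<star> z = x \<star> (y \<star> z)" if xy: "x \<in> ?K" "y \<in> ?K" "z \<in> ?K" for x y z
  proof -
    obtain a b where x: "x = a \<cdot> unit + b \<cdot> k" using xy(1) by (rule span_pairE)
    obtain c d where y: "y = c \<cdot> unit + d \<cdot> k" using xy(2) by (rule span_pairE)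
    obtain e f where z: "z = e \<cdot> unit + f \<cdot> k" using xy(3) by (rule span_pairE)
    show ?thesis unfolding x y z by (simp add: mult_simps scale_right_distrib alt algebra_simps)
  qed
  have inv: "\<exists>y\<in>?K. x \<star> y = unit" if "x \<in> ?K" "x \<noteq> 0" for x
    using that D(4,8) an[OF that]
    by (intro bexI[of _ "inverse (n x) \<cdot> cnj x"]) (auto simp: mult_scale_right mult_cnj_self)
  have sep: "\<exists>p. coprime p (pderiv p) \<and> alg_poly scale mul unit p x = 0" if x: "x \<in> ?K" for x
  proof -
    obtain a b where ab: "x = a \<cdot> unit + b \<cdot> k" using x by (rule span_pairE)
    show ?thesis
    proof (cases "b = 0")
      case True
      have "coprime [:- a, 1:] (pderiv [:- a, 1:])"
        by (rule is_unit_right_imp_coprime) (simp add: pderiv_pCons is_unit_pCons_iff)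
      moreover have "alg_poly scale mul unit [:- a, 1:] x = 0"
        by (simp add: alg_poly_pCons alg_poly_0 ab True mult_one)
      ultimately show ?thesis by blast
    next
      case False
      let ?p = "[:n x, - \<langle>x, unit\<rangle>, 1:]"
      have "\<langle>x, unit\<rangle> = b * \<langle>k, unit\<rangle>" by (simp add: ab bil_simps two)
      then have t: "\<langle>x, unit\<rangle> \<noteq> 0" using False k by simp
      have "pderiv ?p = [:- \<langle>x, unit\<rangle>:]" by (simp add: pderiv_pCons two)
      moreover have "is_unit [:- \<langle>x, unit\<rangle>:]" using t by (simp add: is_unit_pCons_iff)
      ultimately have "coprime ?p (pderiv ?p)" by (simp add: is_unit_right_imp_coprime)
      moreover have "alg_poly scale mul unit ?p x = 0"
        by (simp add: alg_poly_pCons alg_poly_0 mult_one mult_simps square_eq)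
      ultimately show ?thesis by blast
    qed
  qed
  show ?thesis
    unfolding quadratic_separable_subfield_def
    by (intro conjI ballI impI; (rule D(1) D(2) d | (rule D(3) com ass inv sep; assumption)))
qed

section \<open>Doubling a quadratic subfield: components of dimension 2\<close>

text \<open>Two applications of \<open>graded_on_dbl\<close>, as for the ground field. The definition describes the last
  component as \<open>K (u v)\<close>, the doubling as \<open>(K u) v\<close>; these agree because \<open>x (u v) = (cnj(x) u) v\<close>.\<close>

lemma Gamma_quadratic_structure:
  assumes K: "comp_subalgebra K" "dim K = 2" "\<And>x. x \<in> K \<Longrightarrow> x \<noteq> 0 \<Longrightarrow> n x \<noteq> 0" and G: "comm_group G"
    and \<Gamma>: "Gamma_quadratic scale mul n G K (carrier G) \<mu> \<Gamma>"
  obtains t1 t2 u v where "u \<in> perp K" "n u \<noteq> 0" "v \<in> perp (dbl K u)" "n v \<noteq> 0"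
    "t1 \<in> carrier G" "t2 \<in> carrier G" "carrier G = {\<one>\<^bsub>G\<^esub>, t1, t2, t1 \<otimes>\<^bsub>G\<^esub> t2}"
    "t1 \<noteq> \<one>\<^bsub>G\<^esub>" "t2 \<notin> {\<one>\<^bsub>G\<^esub>, t1}" "u \<in> \<Gamma> t1" "v \<in> \<Gamma> t2" "n u \<in> \<mu> t1" "n v \<in> \<mu> t2"
    "division_grading G \<Gamma>" "\<Gamma> \<one>\<^bsub>G\<^esub> = K" "finite (carrier G)"
proof -
  interpret G: comm_group G by fact
  note D = comp_subalgebraD[OF K(1)]
  obtain t1 t2 u v where C: "carrier G = {\<one>\<^bsub>G\<^esub>, t1, t2, t1 \<otimes>\<^bsub>G\<^esub> t2}"
    and u: "n u \<noteq> 0" "\<forall>x\<in>K. polar n u x = 0" "n u \<in> \<mu> t1"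
    and v: "n v \<noteq> 0" "\<forall>x\<in>K. \<forall>y\<in>K. polar n v (x + y \<star> u) = 0" "n v \<in> \<mu> t2"
    and \<Gamma>4: "\<Gamma> \<one>\<^bsub>G\<^esub> = K" "\<Gamma> t1 = {x \<star> u | x. x \<in> K}" "\<Gamma> t2 = {x \<star> v | x. x \<in> K}"
      "\<Gamma> (t1 \<otimes>\<^bsub>G\<^esub> t2) = {x \<star> (u \<star> v) | x. x \<in> K}"
    using \<Gamma>[unfolded Gamma_quadratic_def, THEN conjunct2] by (elim exE conjE) (rule that; assumption)
  have el: "card (carrier G) = 4" "\<forall>t\<in>carrier G. t \<otimes>\<^bsub>G\<^esub> t = \<one>\<^bsub>G\<^esub>"
    using \<Gamma>[unfolded Gamma_quadratic_def, THEN conjunct1] unfolding elementary_2_subgroup_def by auto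
  have tc: "t1 \<in> carrier G" "t2 \<in> carrier G" unfolding C by simp_all
  have le3: "card {a, b, c} \<le> 3" "card {a, b} \<le> 2" for a b c :: 'd by (auto simp: card_insert_if)
  have t1: "t1 \<noteq> \<one>\<^bsub>G\<^esub>"
  proof
    assume t: "t1 = \<one>\<^bsub>G\<^esub>"
    have "carrier G = {\<one>\<^bsub>G\<^esub>, t2}" using tc by (subst C) (auto simp: t)
    then show False using el(1) le3(2)[of "\<one>\<^bsub>G\<^esub>" t2] by simp
  qed
  have t2: "t2 \<notin> {\<one>\<^bsub>G\<^esub>, t1}"
  proof
    assume t: "t2 \<in> {\<one>\<^bsub>G\<^esub>, t1}"
    have "carrier G \<subseteq> {\<one>\<^bsub>G\<^esub>, t1}" using t tc el(2) by (subst C) auto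
    then have "card (carrier G) \<le> card {\<one>\<^bsub>G\<^esub>, t1}" by (intro card_mono) auto
    then show False using el(1) le3(2)[of "\<one>\<^bsub>G\<^esub>" t1] by simp
  qed
  have pu: "u \<in> perp K" using u by (simp add: perp_def)
  have pv: "v \<in> perp (dbl K u)" using v by (auto simp: perp_def dbl_def)
  note B = comp_subalgebra_dbl[OF K(1) pu u(1)]
  let ?T1 = "{\<one>\<^bsub>G\<^esub>} \<union> (\<lambda>g. g \<otimes>\<^bsub>G\<^esub> t1) ` {\<one>\<^bsub>G\<^esub>}"
  have T1: "?T1 = {\<one>\<^bsub>G\<^esub>, t1}" using tc by auto
  have T2: "{\<one>\<^bsub>G\<^esub>, t1} \<union> (\<lambda>g. g \<otimes>\<^bsub>G\<^esub> t2) ` {\<one>\<^bsub>G\<^esub>, t1} = carrier G" using tc by (subst C) auto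
  have g0: "graded_on G {\<one>\<^bsub>G\<^esub>} \<Gamma> K" by (rule graded_on_trivial[where \<Gamma> = \<Gamma>, OF G.is_group K(1) \<Gamma>4(1)])
  have g1: "graded_on G {\<one>\<^bsub>G\<^esub>, t1} \<Gamma> (dbl K u)"
    unfolding T1[symmetric]
    by (rule graded_on_dbl[OF K(1) pu u(1) G g0 tc(1)])
      (use t1 tc el(2) \<Gamma>4 in \<open>auto simp: Setcompr_eq_image\<close>)
  have uv: "{x \<star> (u \<star> v) | x. x \<in> K} = (\<lambda>y. y \<star> v) ` {x \<star> u | x. x \<in> K}"
  proof -
    have e: "x \<star> (u \<star> v) = (cnj x \<star> u) \<star> v" if x: "x \<in> K" for x
    proof -
      have "x \<star> (u \<star> v) = (u \<star> x) \<star> v"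
        by (rule dbl_mult_1[OF B pv v(1)]) (use dbl_base[OF K(1) pu u(1)] x in auto)
      then show ?thesis using mult_u_commute[OF K(1) pu u(1) x] by simp
    qed
    have cK: "cnj ` K = K"
    proof
      show "K \<subseteq> cnj ` K"
      proof
        fix x assume "x \<in> K"
        then show "x \<in> cnj ` K" using D(4) by (intro image_eqI[of _ _ "cnj x"]) auto
      qed
    qed (use D(4) in auto)
    have "{x \<star> (u \<star> v) | x. x \<in> K} = (\<lambda>x. x \<star> (u \<star> v)) ` K" by (rule Setcompr_eq_image)
    also have "\<dots> = (\<lambda>x. (cnj x \<star> u) \<star> v) ` K" by (rule image_cong[OF refl e])
    also have "\<dots> = (\<lambda>x. (x \<star> u) \<star> v) ` (cnj ` K)" by (simp add: image_image)
    also have "\<dots> = (\<lambda>y. y \<star> v) ` {x \<star> u | x. x \<in> K}" unfolding cK by (simp add: Setcompr_eq_image image_image)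
    finally show ?thesis .
  qed
  have g2: "graded_on G (carrier G) \<Gamma> UNIV"
    unfolding T2[symmetric] quadratic_tower[OF K(1,2) pu u(1) pv v(1), symmetric]
    by (rule graded_on_dbl[OF B pv v(1) G g1 tc(2) t2])
      (use tc el(2) \<Gamma>4 uv in \<open>auto simp: Setcompr_eq_image image_image\<close>)
  have gr: "grading scale mul G \<Gamma>" by (rule graded_on_grading[OF G g2]) simp
  have shape: "\<exists>b. n b \<noteq> 0 \<and> \<Gamma> g = (\<lambda>x. x \<star> b) ` K" if g: "g \<in> carrier G" for g
  proof -
    have "K = (\<lambda>x. x \<star> unit) ` K" by (simp add: mult_one)
    moreover have "n (u \<star> v) \<noteq> 0" "n unit \<noteq> 0" using u v by (auto simp: norm_mult)
    moreover have "g = \<one>\<^bsub>G\<^esub> \<or> g = t1 \<or> g = t2 \<or> g = t1 \<otimes>\<^bsub>G\<^esub> t2" using g C by blast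
    ultimately show ?thesis using \<Gamma>4[unfolded Setcompr_eq_image] u(1) v(1) by metis
  qed
  have d: "division_grading G \<Gamma>"
    unfolding division_grading_def
  proof (rule conjI[OF gr], rule ballI, rule conjI)
    fix g assume "g \<in> carrier G"
    then obtain b where b: "n b \<noteq> 0" "\<Gamma> g = (\<lambda>x. x \<star> b) ` K" using shape by blast
    have "unit \<star> b \<in> \<Gamma> g" unfolding b(2) using D(2) by blast
    moreover have "b \<noteq> 0" using b(1) by auto
    ultimately show "\<Gamma> g \<noteq> {0}" by (auto simp: one_mult)
    show "\<forall>x\<in>\<Gamma> g. x \<noteq> 0 \<longrightarrow> n x \<noteq> 0"
    proof (intro ballI impI)
      fix x assume "x \<in> \<Gamma> g" "x \<noteq> 0"
      then obtain y where y: "y \<in> K" "x = y \<star> b" unfolding b(2) by blast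
      then have "y \<noteq> 0" using \<open>x \<noteq> 0\<close> by auto
      then show "n x \<noteq> 0" using K(3) y b(1) by (simp add: norm_mult)
    qed
  qed
  have "unit \<star> u \<in> \<Gamma> t1" "unit \<star> v \<in> \<Gamma> t2" using D(2) \<Gamma>4 by blast+
  then have "u \<in> \<Gamma> t1" "v \<in> \<Gamma> t2" by (simp_all add: one_mult)
  moreover have "finite (carrier G)" using el(1) by (intro card_ge_0_finite) simp
  ultimately show thesis
    by (intro that[OF pu u(1) pv v(1) tc C t1 t2 _ _ u(3) v(3) d \<Gamma>4(1)])
qed

lemma Gamma_quadratic_norms:
  assumes K: "comp_subalgebra K" "dim K = 2" "\<And>x. x \<in> K \<Longrightarrow> x \<noteq> 0 \<Longrightarrow> n x \<noteq> 0" and G: "comm_group G"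
    and \<mu>: "\<mu> \<in> hom G (field_units Mod (n ` (K - {0})))"
    and \<Gamma>: "Gamma_quadratic scale mul n G K (carrier G) \<mu> \<Gamma>" and g: "g \<in> carrier G"
  shows "\<mu> g = norms (\<Gamma> g)"
proof -
  interpret G: comm_group G by fact
  obtain t1 t2 u v where *: "n u \<noteq> 0" "n v \<noteq> 0" "t1 \<in> carrier G" "t2 \<in> carrier G"
    "carrier G = {\<one>\<^bsub>G\<^esub>, t1, t2, t1 \<otimes>\<^bsub>G\<^esub> t2}"
    "u \<in> \<Gamma> t1" "v \<in> \<Gamma> t2" "n u \<in> \<mu> t1" "n v \<in> \<mu> t2" "division_grading G \<Gamma>" "\<Gamma> \<one>\<^bsub>G\<^esub> = K"
    by (rule Gamma_quadratic_structure[OF K G \<Gamma>]) blast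
  have "\<mu> \<in> hom G (field_units Mod norms (\<Gamma> \<one>\<^bsub>G\<^esub>))" using \<mu> by (simp add: *(11) norms_def)
  note nd = norms_determined[OF *(10) this]
  have nz: "u \<noteq> 0" "v \<noteq> 0" using *(1,2) by auto
  have 1: "\<mu> t1 = norms (\<Gamma> t1)" "\<mu> t2 = norms (\<Gamma> t2)"
    using nd(2)[OF *(3,6) nz(1) *(8)] nd(2)[OF *(4,7) nz(2) *(9)] .
  have "g = \<one>\<^bsub>G\<^esub> \<or> g = t1 \<or> g = t2 \<or> g = t1 \<otimes>\<^bsub>G\<^esub> t2" using g *(5) by blast
  then show ?thesis using nd(1) nd(3)[OF *(3,4) 1] 1 by blast
qed

text \<open>In characteristic 2 a trace-zero element of \<open>K\<close> is a scalar. So for any refinement, the components outside its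
  neutral degree of an element of \<open>K\<close>, which lie in \<open>K\<close> and have trace zero, are scalars and
  vanish. Thus \<open>K\<close> stays in one piece, and so does every component \<open>K x\<close>.\<close>

lemma Gamma_quadratic_fine:
  assumes ch: "CHAR('f) = 2" and K: "quadratic_separable_subfield scale mul unit K" and G: "comm_group G"
    and \<Gamma>: "Gamma_quadratic scale mul n G K (carrier G) \<mu> \<Gamma>"
  shows "fine_grading scale mul G \<Gamma>" "universal_group scale mul G \<Gamma> \<cong> G"
proof -
  interpret G: comm_group G by fact
  obtain k where k: "K = span {unit, k}" "\<langle>k, unit\<rangle> \<noteq> 0" and K': "comp_subalgebra K" "dim K = 2"
    "\<And>x. x \<in> K \<Longrightarrow> x \<noteq> 0 \<Longrightarrow> n x \<noteq> 0" by (rule separable_subfieldD[OF ch K]) blast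
  obtain d: "division_grading G \<Gamma>" and o: "\<Gamma> \<one>\<^bsub>G\<^esub> = K"
    by (rule Gamma_quadratic_structure[OF K' G \<Gamma>]) blast
  show "universal_group scale mul G \<Gamma> \<cong> G" by (rule division_universal_group[OF d])
  note gr = division_grading_grading[OF d]
  show "fine_grading scale mul G \<Gamma>"
  proof (rule fine_gradingI[OF gr])
    fix H :: "nat monoid" and \<Delta> g
    assume H: "grading scale mul H \<Delta>" "refines H \<Delta> G \<Gamma>" and g: "g \<in> support G \<Gamma>"
    interpret H: comm_group H by (rule grading_comm_group[OF H(1)])
    have KD: "z \<in> \<Delta> \<one>\<^bsub>H\<^esub>" if z: "z \<in> K" for z
    proof -
      have z0: "hcomp H \<Delta> z h = 0" if h: "h \<in> carrier H" "h \<noteq> \<one>\<^bsub>H\<^esub>" for h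
      proof -
        let ?z = "hcomp H \<Delta> z h"
        have zh: "?z \<in> \<Delta> h" by (rule hcomp_in[OF H(1) h(1)])
        have "?z \<in> K" using refinement_hcomp[OF gr H, of z "\<one>\<^bsub>G\<^esub>" h] z h by (simp add: o)
        then obtain a b where ab: "?z = a \<cdot> unit + b \<cdot> k" unfolding k(1) by (rule span_pairE)
        have "\<langle>?z, unit\<rangle> = 0" by (rule trace_homogeneous[OF H(1) zh h])
        then have "b = 0" using k(2) two_zero[OF ch] by (simp add: ab bil_simps)
        then have "?z \<in> \<Delta> \<one>\<^bsub>H\<^esub>"
          using unit_homogeneous[OF H(1)] grading_subspace[OF H(1)] by (simp add: ab subspace_scale)
        then show ?thesis using homogeneous_unique[OF H(1) zh _ h(1)] h(2) by (metis H.one_closed)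
      qed
      have "z = (\<Sum>h\<in>support H \<Delta>. hcomp H \<Delta> z h)" by (simp add: hcomp_sum[OF H(1)])
      also have "\<dots> \<in> \<Delta> \<one>\<^bsub>H\<^esub>"
      proof (rule subspace_sum[OF grading_subspace[OF H(1) H.one_closed]])
        fix h assume "h \<in> support H \<Delta>"
        then have h: "h \<in> carrier H" by (simp add: support_def)
        show "hcomp H \<Delta> z h \<in> \<Delta> \<one>\<^bsub>H\<^esub>"
          using z0[OF h] hcomp_in[OF H(1) h, of z] grading_0[OF H(1) H.one_closed] by (cases "h = \<one>\<^bsub>H\<^esub>") auto
      qed
      finally show ?thesis .
    qed
    have gc: "g \<in> carrier G" using g by (simp add: support_def)
    obtain y where y: "y \<in> \<Gamma> g" "y \<noteq> 0" by (rule division_nonzero[OF d gc])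
    obtain h where h: "h \<in> carrier H" "hcomp H \<Delta> y h \<noteq> 0" by (rule hcomp_nonzero[OF H(1) y(2)])
    let ?x = "hcomp H \<Delta> y h"
    have "\<Gamma> g = {z \<star> ?x | z. z \<in> K}"
      using division_component[OF d gc refinement_hcomp[OF gr H y(1) gc h(1)] h(2)] by (simp add: o)
    moreover have "z \<star> ?x \<in> \<Delta> h" if "z \<in> K" for z
      using grading_mult[OF H(1) H.one_closed h(1) KD[OF that] hcomp_in[OF H(1) h(1)]] h(1) by simp
    ultimately have "\<Gamma> g \<subseteq> \<Delta> h" by auto
    then show "\<exists>h\<in>carrier H. \<Gamma> g \<subseteq> \<Delta> h" using h(1) by blast
  qed
qed

text \<open>As for the ground field, but the isomorphism of the neutral components has to be given: it is the start
  of the extension process, which no longer begins with the scalars.\<close>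

lemma Gamma_quadratic_equivalent_iff:
  assumes K: "comp_subalgebra K" "dim K = 2" "\<And>x. x \<in> K \<Longrightarrow> x \<noteq> 0 \<Longrightarrow> n x \<noteq> 0"
    and K': "comp_subalgebra K'" "dim K' = 2" "\<And>x. x \<in> K' \<Longrightarrow> x \<noteq> 0 \<Longrightarrow> n x \<noteq> 0"
    and G: "comm_group G"
    and \<mu>: "\<mu> \<in> hom G (field_units Mod (n ` (K - {0})))" "\<mu>' \<in> hom G (field_units Mod (n ` (K' - {0})))"
    and \<Gamma>: "Gamma_quadratic scale mul n G K (carrier G) \<mu> \<Gamma>" "Gamma_quadratic scale mul n G K' (carrier G) \<mu>' \<Gamma>'"
  shows "equivalent_gradings scale mul G \<Gamma> G \<Gamma>' \<longleftrightarrow>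
    (\<exists>\<sigma>. alg_iso_on scale mul \<sigma> K K') \<and> (\<exists>\<phi>\<in>iso G G. \<forall>t\<in>carrier G. \<mu>' t = \<mu> (\<phi> t))"
proof
  interpret G: comm_group G by fact
  note N = Gamma_quadratic_norms[OF K G \<mu>(1) \<Gamma>(1)] and N' = Gamma_quadratic_norms[OF K' G \<mu>(2) \<Gamma>(2)]
  obtain t1 t2 u v where *: "u \<in> perp K" "n u \<noteq> 0" "v \<in> perp (dbl K u)" "n v \<noteq> 0"
    "t1 \<in> carrier G" "t2 \<in> carrier G" "carrier G = {\<one>\<^bsub>G\<^esub>, t1, t2, t1 \<otimes>\<^bsub>G\<^esub> t2}"
    "t1 \<noteq> \<one>\<^bsub>G\<^esub>" "t2 \<notin> {\<one>\<^bsub>G\<^esub>, t1}" "u \<in> \<Gamma> t1" "v \<in> \<Gamma> t2" "division_grading G \<Gamma>" "\<Gamma> \<one>\<^bsub>G\<^esub> = K"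
    by (rule Gamma_quadratic_structure[OF K G \<Gamma>(1)]) blast
  obtain d': "division_grading G \<Gamma>'" and o': "\<Gamma>' \<one>\<^bsub>G\<^esub> = K'"
    by (rule Gamma_quadratic_structure[OF K' G \<Gamma>(2)]) blast
  {
    assume eq: "equivalent_gradings scale mul G \<Gamma> G \<Gamma>'"
    obtain \<alpha> \<psi> where \<alpha>: "\<alpha> \<in> iso G G" "\<And>g. g \<in> carrier G \<Longrightarrow> norms (\<Gamma> g) = norms (\<Gamma>' (\<alpha> g))"
      and \<psi>: "alg_iso_on scale mul \<psi> UNIV UNIV" "\<psi> ` \<Gamma> \<one>\<^bsub>G\<^esub> = \<Gamma>' \<one>\<^bsub>G\<^esub>"
      by (rule division_equivalence_iso[OF *(12) d' eq]) blast
    have "\<forall>t\<in>carrier G. \<mu> t = \<mu>' (\<alpha> t)" using N N' \<alpha>(2) group_isoD(1)[OF \<alpha>(1) G G] by simp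
    then have "\<exists>\<phi>\<in>iso G G. \<forall>t\<in>carrier G. \<mu>' t = \<mu> (\<phi> t)"
      by (rule iso_relabel_sym[OF G.is_group \<alpha>(1)])
    moreover have "alg_iso_on scale mul \<psi> K K'"
      using \<psi> unfolding *(13) o' alg_iso_on_def by (auto simp: bij_betw_def inj_on_def)
    ultimately show "(\<exists>\<sigma>. alg_iso_on scale mul \<sigma> K K') \<and> (\<exists>\<phi>\<in>iso G G. \<forall>t\<in>carrier G. \<mu>' t = \<mu> (\<phi> t))" by blast
  next
    assume "(\<exists>\<sigma>. alg_iso_on scale mul \<sigma> K K') \<and> (\<exists>\<phi>\<in>iso G G. \<forall>t\<in>carrier G. \<mu>' t = \<mu> (\<phi> t))"
    then obtain \<sigma> \<chi> where \<sigma>: "alg_iso_on scale mul \<sigma> K K'" and \<chi>: "\<chi> \<in> iso G G" "\<forall>t\<in>carrier G. \<mu> t = \<mu>' (\<chi> t)"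
      using iso_relabel_sym[OF G.is_group] by metis
    note X = group_isoD[OF \<chi>(1) G G]
    have pick: "\<exists>y\<in>\<Gamma>' (\<chi> g). y \<noteq> 0 \<and> n y = n x" if "x \<in> \<Gamma> g" "n x \<noteq> 0" "g \<in> carrier G" for x g
      by (rule norms_match[OF _ that(1,2)]) (use N N' \<chi>(2) X(1) that(3) in simp)
    obtain u' where u': "u' \<in> \<Gamma>' (\<chi> t1)" "n u' = n u" using pick[OF *(10,2,5)] by blast
    obtain v' where v': "v' \<in> \<Gamma>' (\<chi> t2)" "n v' = n v" using pick[OF *(11,4,6)] by blast
    have orth: "\<langle>x, y\<rangle> = 0" if "x \<in> \<Gamma>' (\<chi> g)" "y \<in> \<Gamma>' (\<chi> h)" "g \<in> carrier G" "h \<in> carrier G" "g \<noteq> h" for x y g h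
      using division_orthogonal[OF d' X(1)[OF that(3)] X(1)[OF that(4)] _ that(1,2)] X(4) that by blast
    have K1: "x \<in> \<Gamma>' (\<chi> \<one>\<^bsub>G\<^esub>)" if "x \<in> K'" for x using that by (simp add: X(3) o')
    have pu: "u' \<in> perp K'"
      unfolding perp_def using orth[OF u'(1) K1 *(5) G.one_closed *(8)] by blast
    have ku: "y \<star> u' \<in> \<Gamma>' (\<chi> t1)" if "y \<in> K'" for y
      using grading_mult[OF division_grading_grading[OF d'] G.one_closed X(1)[OF *(5)] _ u'(1), of y] that o' X(1)[OF *(5)]
      by simp
    have "\<langle>v', x\<rangle> = 0" "\<langle>v', x \<star> u'\<rangle> = 0" if "x \<in> K'" for x
      using orth[OF v'(1) K1[OF that] *(6) G.one_closed] orth[OF v'(1) ku[OF that] *(6,5)] *(9) by auto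
    then have pv: "v' \<in> perp (dbl K' u')" by (auto simp: perp_def dbl_def bil_simps)
    obtain \<psi> where \<psi>: "alg_iso_on scale mul \<psi> UNIV UNIV" "\<And>x. x \<in> K \<Longrightarrow> \<psi> x = \<sigma> x" "\<psi> u = u'" "\<psi> v = v'"
      by (rule quadratic_automorphism[OF K(1) K'(1) K(2) K'(2) \<sigma> *(1-4) pu u'(2) pv v'(2)]) blast
    have "\<psi> ` K = \<sigma> ` K" by (rule image_cong[OF refl \<psi>(2)])
    also have "\<dots> = K'" using alg_iso_onD(1)[OF \<sigma>] by (simp add: bij_betw_def)
    finally have "\<psi> ` \<Gamma> \<one>\<^bsub>G\<^esub> = \<Gamma>' \<one>\<^bsub>G\<^esub>" by (simp add: *(13) o')
    then show "equivalent_gradings scale mul G \<Gamma> G \<Gamma>'"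
    proof (rule division_equivalenceI[OF *(12) d' \<psi>(1) _ \<chi>(1), where M = "{t1, t2}"])
      show "carrier G \<subseteq> Y" if "Y \<subseteq> carrier G" "\<And>g h. g \<in> Y \<Longrightarrow> h \<in> Y \<Longrightarrow> g \<otimes>\<^bsub>G\<^esub> h \<in> Y" "\<one>\<^bsub>G\<^esub> \<in> Y" "{t1, t2} \<subseteq> Y" for Y
        using that by (subst *(7)) blast
      show "{t1, t2} \<subseteq> carrier G" using *(5,6) by blast
      show "\<exists>x\<in>\<Gamma> g. x \<noteq> 0 \<and> \<psi> x \<in> \<Gamma>' (\<chi> g)" if "g \<in> {t1, t2}" for g
      proof -
        have "u \<noteq> 0" "v \<noteq> 0" using *(2,4) by auto
        then show ?thesis using that *(10,11) \<psi>(3,4) u'(1) v'(1) by blast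
      qed
    qed
  }
qed

definition quadratic_family :: "'c set \<Rightarrow> 'c \<Rightarrow> 'c \<Rightarrow> int \<times> int \<Rightarrow> 'c set" where
  "quadratic_family K u v g =
     (if g = (0, 0) then K else if g = (1, 0) then {x \<star> u | x. x \<in> K}
      else if g = (0, 1) then {x \<star> v | x. x \<in> K}
      else if g = (1, 1) then {x \<star> (u \<star> v) | x. x \<in> K} else {0})"

lemma quadratic_family_cases:
  assumes "g \<in> carrier Z2_sq"
  obtains b where "b \<in> {unit, u, v, u \<star> v}" "quadratic_family K u v g = {x \<star> b | x. x \<in> K}"
proof -
  obtain i j where g: "g = (i, j)" "i = 0 \<or> i = 1" "j = 0 \<or> j = 1"
    using assms unfolding Z2_sq_simps(1) by blast
  have "\<exists>b\<in>{unit, u, v, u \<star> v}. quadratic_family K u v g = {x \<star> b | x. x \<in> K}"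
    using g(2,3) unfolding g(1) by (elim disjE) (simp_all add: quadratic_family_def mult_one)
  then show thesis using that by blast
qed

lemma Gamma_quadratic_family:
  assumes u: "u \<in> perp K" "n u \<noteq> 0" and v: "v \<in> perp (dbl K u)" "n v \<noteq> 0"
    and \<mu>: "n u \<in> \<mu> (1, 0)" "n v \<in> \<mu> (0, 1)"
  shows "Gamma_quadratic scale mul n Z2_sq K (carrier Z2_sq) \<mu> (quadratic_family K u v)"
  unfolding Gamma_quadratic_def
proof (rule conjI[OF elementary_2_subgroup_Z2_sq], rule exI[of _ "(1, 0)"], rule exI[of _ "(0, 1)"],
    rule exI[of _ u], rule exI[of _ v], intro conjI)
  have p: "(1, 0) \<otimes>\<^bsub>Z2_sq\<^esub> (0, 1) = (1, 1)" by (simp add: Z2_sq_simps)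
  let ?B = "quadratic_family K u v"
  show "?B \<one>\<^bsub>Z2_sq\<^esub> = K" "?B (1, 0) = {x \<star> u | x. x \<in> K}" "?B (0, 1) = {x \<star> v | x. x \<in> K}"
    "?B ((1, 0) \<otimes>\<^bsub>Z2_sq\<^esub> (0, 1)) = {x \<star> (u \<star> v) | x. x \<in> K}"
    unfolding p Z2_sq_simps(2) by (simp_all add: quadratic_family_def)
  show "carrier Z2_sq = {\<one>\<^bsub>Z2_sq\<^esub>, (1, 0), (0, 1), (1, 0) \<otimes>\<^bsub>Z2_sq\<^esub> (0, 1)}"
    unfolding p Z2_sq_simps(1,2) by auto
  show "\<forall>x\<in>K. polar n u x = 0" using perpD(1)[OF u(1)] by blast
  show "\<forall>x\<in>K. \<forall>y\<in>K. polar n v (x + y \<star> u) = 0" using perpD(1)[OF v(1) dblI] by blast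
qed (use u(2) v(2) \<mu> in simp_all)

lemma admissible_quadratic_norms:
  assumes K: "comp_subalgebra K" "dim K = 2" "\<And>x. x \<in> K \<Longrightarrow> x \<noteq> 0 \<Longrightarrow> n x \<noteq> 0"
    and u: "u \<in> perp K" "n u \<noteq> 0" and v: "v \<in> perp (dbl K u)" "n v \<noteq> 0"
  defines "\<Gamma> \<equiv> quadratic_family K u v"
  shows "admissible_quadratic scale n Z2_sq K (carrier Z2_sq) (\<lambda>t. norms (\<Gamma> t))"
    "Gamma_quadratic scale mul n Z2_sq K (carrier Z2_sq) (\<lambda>t. norms (\<Gamma> t)) \<Gamma>"
proof -
  note D = comp_subalgebraD[OF K(1)]
  have *: "n b \<in> norms {x \<star> b | x. x \<in> K}" if "n b \<noteq> 0" for b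
  proof -
    have "unit \<star> b \<in> {x \<star> b | x. x \<in> K}" using D(2) by blast
    moreover have "b \<noteq> 0" using that by auto
    ultimately show ?thesis unfolding norms_def by (intro image_eqI[of _ _ b]) (simp_all add: one_mult)
  qed
  show \<Gamma>: "Gamma_quadratic scale mul n Z2_sq K (carrier Z2_sq) (\<lambda>t. norms (\<Gamma> t)) \<Gamma>"
    unfolding \<Gamma>_def
    by (rule Gamma_quadratic_family[OF u v]) (use *[OF u(2)] *[OF v(2)] in \<open>simp_all add: quadratic_family_def\<close>)
  obtain d: "division_grading Z2_sq \<Gamma>" and o: "\<Gamma> \<one>\<^bsub>Z2_sq\<^esub> = K" and fin: "finite (carrier Z2_sq)"
    by (rule Gamma_quadratic_structure[OF K comm_group_Z2_sq \<Gamma>]) blast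
  obtain b where b: "\<And>t. t \<in> carrier Z2_sq \<Longrightarrow> b t \<in> \<Gamma> t" "\<And>t. t \<in> carrier Z2_sq \<Longrightarrow> b t \<noteq> 0" "b \<one>\<^bsub>Z2_sq\<^esub> = unit"
    by (rule division_representatives[OF d]) blast
  have "isometric scale UNIV n (orth_scale scale) (orth_space (carrier Z2_sq) K)
           (orth_form (carrier Z2_sq) (\<lambda>t. n (b t)) n)"
  proof (rule division_isometric[OF d fin, where \<iota> = "\<lambda>x. x"])
    show "bij_betw (\<lambda>x. x) K (\<Gamma> \<one>\<^bsub>Z2_sq\<^esub>)" unfolding o by (simp add: bij_betw_def)
  qed (use b D in auto)
  moreover have "n (b \<one>\<^bsub>Z2_sq\<^esub>) = 1" unfolding b(3) by (rule norm_unit)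
  moreover have "\<forall>t\<in>carrier Z2_sq. n (b t) \<in> norms (\<Gamma> t)" using b by (auto simp: norms_def)
  moreover have "n ` (K - {0}) = norms K" by (simp add: norms_def)
  ultimately show "admissible_quadratic scale n Z2_sq K (carrier Z2_sq) (\<lambda>t. norms (\<Gamma> t))"
    unfolding admissible_quadratic_def hom_full_carrier using norms_hom[OF d] unfolding o
    by (intro conjI exI[of _ "\<lambda>t. n (b t)"]) auto
qed

lemma Gamma_quadratic_exists:
  assumes ch: "CHAR('f) = 2" and K: "quadratic_separable_subfield scale mul unit K"
    and a: "admissible_quadratic scale n Z2_sq K (carrier Z2_sq) \<mu>"
  shows "\<exists>\<Gamma>. Gamma_quadratic scale mul n Z2_sq K (carrier Z2_sq) \<mu> \<Gamma>"
proof -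
  let ?C = "carrier Z2_sq"
  obtain k where k: "K = span {unit, k}" "\<langle>k, unit\<rangle> \<noteq> 0" and K': "comp_subalgebra K" "dim K = 2"
    "\<And>x. x \<in> K \<Longrightarrow> x \<noteq> 0 \<Longrightarrow> n x \<noteq> 0" by (rule separable_subfieldD[OF ch K]) blast
  note D = comp_subalgebraD[OF K'(1)]
  have kK: "k \<in> K" unfolding k(1) by (simp add: span_base)
  have \<mu>: "\<mu> \<in> hom Z2_sq (field_units Mod (n ` (K - {0})))"
    using a unfolding admissible_quadratic_def hom_full_carrier by (rule conjunct1)
  obtain r where r: "r \<one>\<^bsub>Z2_sq\<^esub> = 1" "\<forall>t\<in>?C. r t \<in> \<mu> t"
    and iso: "isometric scale UNIV n (orth_scale scale) (orth_space ?C K) (orth_form ?C r n)"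
    using a unfolding admissible_quadratic_def by blast
  have fin: "finite ?C" by (simp add: Z2_sq_simps)
  obtain g where g: "\<And>t x. t \<in> ?C \<Longrightarrow> x \<in> K \<Longrightarrow> n (g t x) = r t * n x"
    "\<And>t t' x y. t \<in> ?C \<Longrightarrow> t' \<in> ?C \<Longrightarrow> t \<noteq> t' \<Longrightarrow> x \<in> K \<Longrightarrow> y \<in> K \<Longrightarrow> \<langle>g t x, g t' y\<rangle> = 0"
    "\<And>t x y. t \<in> ?C \<Longrightarrow> x \<in> K \<Longrightarrow> y \<in> K \<Longrightarrow> g t (x + y) = g t x + g t y"
    by (rule isometric_frame[OF iso fin D(5) _ D(6)]) auto
  define ts :: "(int \<times> int) list" where "ts = [(0, 0), (1, 0), (0, 1)]"
  define x where "x i = g (ts ! i) unit" for i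
  define x' where "x' i = g (ts ! i) k" for i
  have tsC: "ts ! i \<in> ?C" if "i < 3" for i
  proof -
    have "set ts \<subseteq> ?C" by (simp add: ts_def Z2_sq_simps)
    moreover have "ts ! i \<in> set ts" by (rule nth_mem) (use that in \<open>simp add: ts_def\<close>)
    ultimately show ?thesis by blast
  qed
  have tsd: "ts ! i \<noteq> ts ! j" if "i < 3" "j < 3" "i \<noteq> j" for i j
  proof -
    have "distinct ts" "length ts = 3" by (simp_all add: ts_def)
    then show ?thesis using that by (simp add: nth_eq_iff_index_eq)
  qed
  have nx: "n (x i) = r (ts ! i)" "n (x' i) = r (ts ! i) * n k"
    "\<langle>x i, x' i\<rangle> = r (ts ! i) * \<langle>unit, k\<rangle>" if "i < 3" for i
  proof -
    note t = tsC[OF that]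
    show 1: "n (x i) = r (ts ! i)" "n (x' i) = r (ts ! i) * n k"
      using g(1)[OF t D(2)] g(1)[OF t kK] by (simp_all add: x_def x'_def)
    have "n (x i + x' i) = r (ts ! i) * n (unit + k)"
      using g(1)[OF t D(6)[OF D(2) kK]] g(3)[OF t D(2) kK] by (simp add: x_def x'_def)
    then show "\<langle>x i, x' i\<rangle> = r (ts ! i) * \<langle>unit, k\<rangle>" using 1 by (simp add: norm_add distrib_left)
  qed
  have \<mu>c: "\<mu> t \<in> carrier (field_units Mod (n ` (K - {0})))" if "t \<in> ?C" for t
    using \<mu> that by (auto simp: hom_def)
  have cC: "(1, 0) \<in> ?C" "(0, 1) \<in> ?C" by (simp_all add: Z2_sq_simps)
  have rn: "r t \<noteq> 0" if tC: "t \<in> ?C" for t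
  proof -
    obtain c where c: "c \<noteq> 0" "\<mu> t = (n ` (K - {0})) #>\<^bsub>field_units\<^esub> c"
      using \<mu>c[OF tC] by (auto simp: FactGroup_def RCOSETS_def)
    have "r t \<in> \<mu> t" using r(2) that by blast
    then obtain y where "y \<in> K" "y \<noteq> 0" "r t = n y * c" unfolding c(2) by (auto simp: r_coset_def)
    then show ?thesis using K'(3) c(1) by simp
  qed
  obtain u v where u: "u \<in> perp K" "v \<in> perp (dbl K u)" and uv: "n u = n (x 1)" "n v = n (x 2)"
  proof (rule quadratic_pair_exists[OF ch k(1,2), of x x'])
    show "\<langle>x i, x j\<rangle> = 0 \<and> \<langle>x' i, x j\<rangle> = 0 \<and> \<langle>x i, x' j\<rangle> = 0 \<and> \<langle>x' i, x' j\<rangle> = 0"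
      if "i < 3" "j < 3" "i \<noteq> j" for i j
      using g(2)[OF tsC[OF that(1)] tsC[OF that(2)] tsd[OF that]] D(2) kK by (simp add: x_def x'_def)
    show "n (x 0) = 1" using nx[of 0] r(1) by (simp add: ts_def Z2_sq_simps)
    show "n (x 1) \<noteq> 0" "n (x 2) \<noteq> 0" using nx(1)[of 1] nx(1)[of 2] rn cC by (simp_all add: ts_def)
    show "n (x' i) = n (x i) * n k" "\<langle>x i, x' i\<rangle> = n (x i) * \<langle>unit, k\<rangle>" if "i < 2" for i
      using nx[of i] that by simp_all
  qed blast
  have ts12: "n u = r (1, 0)" "n v = r (0, 1)" using uv nx(1)[of 1] nx(1)[of 2] by (simp_all add: ts_def)
  have "Gamma_quadratic scale mul n Z2_sq K ?C \<mu> (quadratic_family K u v)"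
    by (rule Gamma_quadratic_family[OF u(1) _ u(2)]) (use ts12 rn cC r(2) in simp_all)
  then show ?thesis by blast
qed

text \<open>Traces vanish outside \<open>C\<^sub>e\<close>, but the trace is not the zero map.\<close>

lemma traceful_in_identity_component:
  assumes gr: "grading scale mul G \<Gamma>"
  obtains k where "k \<in> \<Gamma> \<one>\<^bsub>G\<^esub>" "\<langle>k, unit\<rangle> \<noteq> 0"
proof -
  interpret G: comm_group G by (rule grading_comm_group[OF gr])
  obtain y where y: "\<langle>y, unit\<rangle> \<noteq> 0" using polar_nondegenerate[of unit] unit_nonzero by (metis bil_commute)
  have "\<langle>y, unit\<rangle> = (\<Sum>g\<in>support G \<Gamma>. \<langle>hcomp G \<Gamma> y g, unit\<rangle>)"
    unfolding bil_sum[symmetric] hcomp_sum[OF gr] ..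
  then obtain g where g: "g \<in> support G \<Gamma>" "\<langle>hcomp G \<Gamma> y g, unit\<rangle> \<noteq> 0"
    using y sum.not_neutral_contains_not_neutral[of "\<lambda>g. \<langle>hcomp G \<Gamma> y g, unit\<rangle>"] by metis
  have gc: "g \<in> carrier G" using g(1) by (simp add: support_def)
  have "g = \<one>\<^bsub>G\<^esub>" using trace_homogeneous[OF gr hcomp_in[OF gr gc] gc] g(2) by blast
  then show thesis using that g(2) hcomp_in[OF gr gc] by metis
qed

lemma fine_anisotropic_char_2:
  assumes ch: "CHAR('f) = 2" and fine: "fine_grading scale mul G \<Gamma>"
    and an: "\<And>g x. g \<in> carrier G \<Longrightarrow> x \<in> \<Gamma> g \<Longrightarrow> x \<noteq> 0 \<Longrightarrow> n x \<noteq> 0"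
  shows "\<exists>K \<mu> \<Delta>. quadratic_separable_subfield scale mul unit K \<and>
            admissible_quadratic scale n Z2_sq K (carrier Z2_sq) \<mu> \<and>
            Gamma_quadratic scale mul n Z2_sq K (carrier Z2_sq) \<mu> \<Delta> \<and>
            equivalent_gradings scale mul G \<Gamma> Z2_sq \<Delta>"
proof -
  have gr: "grading scale mul G \<Gamma>" using fine by (simp add: fine_grading_def)
  interpret G: comm_group G by (rule grading_comm_group[OF gr])
  obtain k where k: "k \<in> \<Gamma> \<one>\<^bsub>G\<^esub>" "\<langle>k, unit\<rangle> \<noteq> 0" by (rule traceful_in_identity_component[OF gr])
  let ?K = "span {unit, k}"
  have unit1: "unit \<in> \<Gamma> \<one>\<^bsub>G\<^esub>" by (rule unit_homogeneous[OF gr])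
  have K1: "?K \<subseteq> \<Gamma> \<one>\<^bsub>G\<^esub>" by (intro span_minimal grading_subspace[OF gr]) (use k unit1 in auto)
  have anK: "n x \<noteq> 0" if "x \<in> ?K" "x \<noteq> 0" for x using an[OF G.one_closed _ that(2)] K1 that(1) by blast
  have sf: "quadratic_separable_subfield scale mul unit ?K" by (rule separable_subfieldI[OF ch k(2) anK])
  have K: "comp_subalgebra ?K" by (rule comp_subalgebra_quadratic_char_2[OF ch k(2)])
  have dK: "dim ?K = 2" using sf unfolding quadratic_separable_subfield_def by blast
  have h1: "\<exists>g\<in>carrier G. b \<in> \<Gamma> g" if "b \<in> {unit, k}" for b using k(1) unit1 that by blast
  obtain g u where u: "g \<in> carrier G" "u \<in> \<Gamma> g" "u \<in> perp {unit, k}" "u \<noteq> 0"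
    by (rule homogeneous_orthogonal_exists[OF gr K _ _ h1]) (auto simp: card_insert_if)
  have nu: "n u \<noteq> 0" by (rule an[OF u(1,2,4)])
  have pu: "u \<in> perp ?K" using u(3) by (simp add: perp_span)
  have dS: "dbl ?K u = span {unit, k, u, k \<star> u}"
    by (simp add: dbl_span one_mult insert_commute)
  have B: "comp_subalgebra (span {unit, k, u, k \<star> u})" using comp_subalgebra_dbl[OF K pu nu] by (simp add: dS)
  have "k \<star> u \<in> \<Gamma> g" using grading_mult[OF gr G.one_closed u(1) k(1) u(2)] u(1) by simp
  then have h2: "\<exists>g\<in>carrier G. b \<in> \<Gamma> g" if "b \<in> {unit, k, u, k \<star> u}" for b using h1 u(1,2) that by blast
  obtain h v where v: "h \<in> carrier G" "v \<in> \<Gamma> h" "v \<in> perp {unit, k, u, k \<star> u}" "v \<noteq> 0"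
    by (rule homogeneous_orthogonal_exists[OF gr B _ _ h2]) (auto simp: card_insert_if)
  have nv: "n v \<noteq> 0" by (rule an[OF v(1,2,4)])
  have pv: "v \<in> perp (dbl ?K u)" using v(3) by (simp add: dS perp_span)
  let ?\<Delta> = "quadratic_family ?K u v"
  note A = admissible_quadratic_norms[OF K dK anK pu nu pv nv]
  obtain d: "division_grading Z2_sq ?\<Delta>"
    by (rule Gamma_quadratic_structure[OF K dK anK comm_group_Z2_sq A(2)]) blast
  have "equivalent_gradings scale mul G \<Gamma> Z2_sq ?\<Delta>"
  proof (rule fine_grading_equivalent[OF fine division_grading_grading[OF d]])
    fix t assume "t \<in> support Z2_sq ?\<Delta>"
    then have tc: "t \<in> carrier Z2_sq" by (simp only: support_def mem_Collect_eq)
    obtain b where b: "b \<in> {unit, u, v, u \<star> v}" "?\<Delta> t = {x \<star> b | x. x \<in> ?K}"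
      by (rule quadratic_family_cases[OF tc])
    have "u \<star> v \<in> \<Gamma> (g \<otimes>\<^bsub>G\<^esub> h)" by (rule grading_mult[OF gr u(1) v(1) u(2) v(2)])
    then obtain j where j: "j \<in> carrier G" "b \<in> \<Gamma> j"
      using b(1) unit1 u(1,2) v(1,2) G.one_closed G.m_closed[OF u(1) v(1)] by blast
    have "?\<Delta> t \<subseteq> \<Gamma> j"
    proof
      fix y assume "y \<in> ?\<Delta> t"
      then obtain x where x: "x \<in> ?K" "y = x \<star> b" unfolding b(2) by blast
      have "x \<star> b \<in> \<Gamma> (\<one>\<^bsub>G\<^esub> \<otimes>\<^bsub>G\<^esub> j)" by (rule grading_mult[OF gr G.one_closed j(1) subsetD[OF K1 x(1)] j(2)])
      then show "y \<in> \<Gamma> j" using x(2) j(1) by simp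
    qed
    then show "\<exists>k\<in>carrier G. ?\<Delta> t \<subseteq> \<Gamma> k" using j(1) by blast
  qed
  then show ?thesis using A sf by blast
qed

section \<open>Split bases\<close>

text \<open>The multiplication table of \<open>split_basis\<close> written out without indices and Levi-Civita symbols, in a form
  suitable for rewriting.\<close>

definition split_table :: "'c \<Rightarrow> 'c \<Rightarrow> 'c \<Rightarrow> 'c \<Rightarrow> 'c \<Rightarrow> 'c \<Rightarrow> 'c \<Rightarrow> 'c \<Rightarrow> bool" where
  "split_table e1 e2 u1 u2 u3 v1 v2 v3 \<longleftrightarrow>
     e1 \<star> e1 = e1 \<and> e1 \<star> e2 = 0 \<and> e2 \<star> e1 = 0 \<and> e2 \<star> e2 = e2 \<and> e1 \<star> u1 = u1 \<and>
     e2 \<star> u1 = 0 \<and> u1 \<star> e1 = 0 \<and> u1 \<star> e2 = u1 \<and> e1 \<star> u2 = u2 \<and> e2 \<star> u2 = 0 \<and>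
     u2 \<star> e1 = 0 \<and> u2 \<star> e2 = u2 \<and> e1 \<star> u3 = u3 \<and> e2 \<star> u3 = 0 \<and> u3 \<star> e1 = 0 \<and>
     u3 \<star> e2 = u3 \<and> e1 \<star> v1 = 0 \<and> e2 \<star> v1 = v1 \<and> v1 \<star> e1 = v1 \<and> v1 \<star> e2 = 0 \<and>
     e1 \<star> v2 = 0 \<and> e2 \<star> v2 = v2 \<and> v2 \<star> e1 = v2 \<and> v2 \<star> e2 = 0 \<and> e1 \<star> v3 = 0 \<and>
     e2 \<star> v3 = v3 \<and> v3 \<star> e1 = v3 \<and> v3 \<star> e2 = 0 \<and> u1 \<star> u1 = 0 \<and> u1 \<star> u2 = v3 \<and>
     u1 \<star> u3 = - v2 \<and> u2 \<star> u1 = - v3 \<and> u2 \<star> u2 = 0 \<and> u2 \<star> u3 = v1 \<and> u3 \<star> u1 = v2 \<and>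
     u3 \<star> u2 = - v1 \<and> u3 \<star> u3 = 0 \<and> v1 \<star> v1 = 0 \<and> v1 \<star> v2 = u3 \<and> v1 \<star> v3 = - u2 \<and>
     v2 \<star> v1 = - u3 \<and> v2 \<star> v2 = 0 \<and> v2 \<star> v3 = u1 \<and> v3 \<star> v1 = u2 \<and> v3 \<star> v2 = - u1 \<and>
     v3 \<star> v3 = 0 \<and> u1 \<star> v1 = - e1 \<and> u1 \<star> v2 = 0 \<and> u1 \<star> v3 = 0 \<and> u2 \<star> v1 = 0 \<and>
     u2 \<star> v2 = - e1 \<and> u2 \<star> v3 = 0 \<and> u3 \<star> v1 = 0 \<and> u3 \<star> v2 = 0 \<and> u3 \<star> v3 = - e1 \<and>
     v1 \<star> u1 = - e2 \<and> v1 \<star> u2 = 0 \<and> v1 \<star> u3 = 0 \<and> v2 \<star> u1 = 0 \<and> v2 \<star> u2 = - e2 \<and>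
     v2 \<star> u3 = 0 \<and> v3 \<star> u1 = 0 \<and> v3 \<star> u2 = 0 \<and> v3 \<star> u3 = - e2"

lemma split_basis_iff_split_table:
  "split_basis scale mul e1 e2 u v \<longleftrightarrow>
     distinct [e1, e2, u 1, u 2, u 3, v 1, v 2, v 3] \<and> independent {e1, e2, u 1, u 2, u 3, v 1, v 2, v 3} \<and>
     span {e1, e2, u 1, u 2, u 3, v 1, v 2, v 3} = UNIV \<and>
     split_table e1 e2 (u 1) (u 2) (u 3) (v 1) (v 2) (v 3)"
proof -
  define u1 u2 u3 v1 v2 v3 where "u1 = u 1" "u2 = u 2" "u3 = u 3" "v1 = v 1" "v2 = v 2" "v3 = v 3"
  have sum3: "(\<Sum>l\<in>{1, 2, 3}. f l) = f 1 + (f 2 + f 3)" for f :: "nat \<Rightarrow> 'c" by simp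
  have lc: "(levi_civita 1 1 l :: 'f) = 0" "(levi_civita 2 2 l :: 'f) = 0" "(levi_civita 3 3 l :: 'f) = 0"
    "(levi_civita 1 2 l :: 'f) = (if l = 3 then 1 else 0)" "(levi_civita 2 1 l :: 'f) = (if l = 3 then - 1 else 0)"
    "(levi_civita 2 3 l :: 'f) = (if l = 1 then 1 else 0)" "(levi_civita 3 2 l :: 'f) = (if l = 1 then - 1 else 0)"
    "(levi_civita 3 1 l :: 'f) = (if l = 2 then 1 else 0)" "(levi_civita 1 3 l :: 'f) = (if l = 2 then - 1 else 0)" for l
    by (simp_all add: levi_civita_def)
  have all3: "(\<forall>j\<in>{1, 2, 3}. P j) \<longleftrightarrow> P 1 \<and> P 2 \<and> P 3" for P :: "nat \<Rightarrow> bool" by simp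
  have ne: "(1::nat) \<noteq> 2" "(1::nat) \<noteq> 3" "(2::nat) \<noteq> 3" "(2::nat) \<noteq> 1" "(3::nat) \<noteq> 1" "(3::nat) \<noteq> 2" by simp_all
  show ?thesis
    unfolding split_basis_def split_table_def all3 sum3 lc
    by (simp only: ne if_True if_False refl scale_zero_left scale_one scale_minus_left add_0_left add_0_right
        u1_u2_u3_v1_v2_v3_def[symmetric]) blast
qed

text \<open>An isotropic element of trace 1 is an idempotent, and it comes with the complementary one.\<close>

lemma idempotent_pair:
  assumes e: "n e = 0" "\<langle>e, unit\<rangle> = 1" and f: "f = unit - e"
  shows "cnj e = f" "cnj f = e" "e \<star> (e \<star> x) = e \<star> x" "f \<star> (f \<star> x) = f \<star> x" "n f = 0" "\<langle>f, unit\<rangle> = 1"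
    "e = unit - f"
proof -
  show c: "cnj e = f" using e(2) by (simp add: cnj_def f)
  then show c': "cnj f = e" by auto
  show nf: "n f = 0" using norm_cnj[of e] e(1) c by simp
  show "\<langle>f, unit\<rangle> = 1" using bil_cnj_unit[of e] e(2) c by simp
  show "e = unit - f" by (simp add: f)
  have s: "x = e \<star> x + f \<star> x" for x using one_mult[of x] by (simp add: f mult_diff_left one_mult)
  show "e \<star> (e \<star> x) = e \<star> x" using s[of "e \<star> x"] cnj_mult_mult[of e x] e(1) c by simp
  show "f \<star> (f \<star> x) = f \<star> x" using s[of "f \<star> x"] cnj_mult_mult[of f x] nf c' by simp
qed

lemma comp_subalgebra_idempotents:
  assumes "n e = 0" "\<langle>e, unit\<rangle> = 1" "f = unit - e" shows "comp_subalgebra (span {e, f})"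
proof -
  have "span {e, f} = span {unit, e}"
    unfolding span_eq
  proof
    show "{e, f} \<subseteq> span {unit, e}" unfolding assms(3) by (auto intro: span_diff span_base)
    have "unit = e + f" by (simp add: assms(3))
    then have "unit \<in> span {e, f}" using span_add[OF span_base span_base, of e "{e, f}" f] by simp
    then show "{unit, e} \<subseteq> span {e, f}" by (simp add: span_base)
  qed
  moreover have "comp_subalgebra (span {unit, e})" by (rule comp_subalgebra_quadratic) (simp add: assms)
  ultimately show ?thesis by simp
qed

lemma hyperbolic_sum:
  assumes e: "n e = 0" "\<langle>e, unit\<rangle> = 1" "f = unit - e" and xy: "e \<star> x = x" "f \<star> y = y" "\<langle>x, y\<rangle> = 1"
  shows "n x = 0" "n y = 0" "f \<star> x = 0" "e \<star> y = 0" "e \<star> (x + y) = x" "f \<star> (x + y) = y" "n (x + y) = 1"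
proof -
  show n: "n x = 0" "n y = 0"
    using norm_mult[of e x] norm_mult[of f y] xy e(1) idempotent_pair(5)[OF e] by simp_all
  show z: "f \<star> x = 0" "e \<star> y = 0" using xy by (simp_all add: e(3) mult_diff_left one_mult)
  show "e \<star> (x + y) = x" "f \<star> (x + y) = y" by (simp_all add: mult_add_right xy z)
  show "n (x + y) = 1" by (simp add: norm_add n xy(3))
qed

lemma split_quaternion:
  assumes e: "n e = 0" "\<langle>e, unit\<rangle> = 1" "f = unit - e"
    and x: "x \<in> perp {e, f}" "e \<star> x = x" and y: "y \<in> perp {e, f}" "f \<star> y = y" and xy: "\<langle>x, y\<rangle> = 1"
  shows "x + y \<in> perp (span {e, f})" "dbl (span {e, f}) (x + y) = span {e, f, x, y}"
    "comp_subalgebra (span {e, f, x, y})"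
proof -
  note h = hyperbolic_sum[OF e x(2) y(2) xy]
  show p: "x + y \<in> perp (span {e, f})" unfolding perp_span by (rule subspace_add[OF subspace_perp x(1) y(1)])
  show d: "dbl (span {e, f}) (x + y) = span {e, f, x, y}" unfolding dbl_span by (simp add: h insert_commute)
  have "n (x + y) \<noteq> 0" by (simp add: h)
  then show "comp_subalgebra (span {e, f, x, y})"
    using comp_subalgebra_dbl[OF comp_subalgebra_idempotents[OF e] p] by (simp add: d)
qed

text \<open>A split basis is determined by an idempotent and two hyperbolic pairs in its Peirce spaces. The algebra is
  the double doubling of \<open>span {e1, e2}\<close> by \<open>a = u1 + v1\<close> and \<open>b = u2 + v2\<close>, both of norm 1; as \<open>u1, v1, u2, v2\<close> are
  \<open>e1 a, e2 a, e1 b, e2 b\<close> and \<open>v3, u3\<close> are \<open>u1 b, v1 b\<close>, all 64 products follow from the doubling formulas.\<close>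

lemma split_table_from_pairs:
  assumes e1: "n e1 = 0" "\<langle>e1, unit\<rangle> = 1" and e2: "e2 = unit - e1"
    and u1: "u1 \<in> perp {e1, e2}" "e1 \<star> u1 = u1" and v1: "v1 \<in> perp {e1, e2}" "e2 \<star> v1 = v1" and uv1: "\<langle>u1, v1\<rangle> = 1"
    and u2: "u2 \<in> perp {e1, e2, u1, v1}" "e1 \<star> u2 = u2" and v2: "v2 \<in> perp {e1, e2, u1, v1}" "e2 \<star> v2 = v2"
    and uv2: "\<langle>u2, v2\<rangle> = 1"
  shows "split_table e1 e2 u1 u2 (v1 \<star> v2) v1 v2 (u1 \<star> u2)"
    "distinct [e1, e2, u1, u2, v1 \<star> v2, v1, v2, u1 \<star> u2]"
    "independent {e1, e2, u1, u2, v1 \<star> v2, v1, v2, u1 \<star> u2}"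
    "span {e1, e2, u1, u2, v1 \<star> v2, v1, v2, u1 \<star> u2} = UNIV"
proof -
  let ?K = "span {e1, e2}"
  have e: "n e1 = 0" "\<langle>e1, unit\<rangle> = 1" by (fact e1)+
  note ip = idempotent_pair[OF e e2]
  note c1 = ip(1) and c2 = ip(2) and ne2 = ip(5)
  have sum: "unit = e1 + e2" by (simp add: e2)
  have e11: "e1 \<star> e1 = e1" using square_eq[of e1] e1 by simp
  have e12: "e1 \<star> e2 = 0" "e2 \<star> e1 = 0" "e2 \<star> e2 = e2" by (simp_all add: e2 mult_simps e11)
  have K: "comp_subalgebra ?K" by (rule comp_subalgebra_idempotents[OF e e2])
  define a b where "a = u1 + v1" and "b = u2 + v2"
  note ha = hyperbolic_sum[OF e e2 u1(2) v1(2) uv1, folded a_def]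
    and hb = hyperbolic_sum[OF e e2 u2(2) v2(2) uv2, folded b_def]
  note z = ha(3,4) hb(3,4) and ea = ha(5,6) hb(5,6) and na = ha(7) hb(7)
  have na0: "n a \<noteq> 0" "n b \<noteq> 0" by (simp_all add: na)
  note sq = split_quaternion[OF e e2 u1 v1 uv1, folded a_def]
  note pa = sq(1)
  define Q where "Q = dbl ?K a"
  have Qs: "Q = span {e1, e2, u1, v1}" unfolding Q_def by (rule sq(2))
  have Q: "comp_subalgebra Q" unfolding Qs by (rule sq(3))
  have pb: "b \<in> perp Q" unfolding Qs perp_span b_def by (rule subspace_add[OF subspace_perp u2(1) v2(1)])
  have "e1 \<noteq> 0" "e2 \<noteq> 0" "\<langle>e1, e2\<rangle> = 1"
    using e1 by (auto simp: e2 bil_simps bil_self)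
  have "e1 \<notin> span {e2}"
  proof
    assume "e1 \<in> span {e2}"
    then obtain c where "e1 = c \<cdot> e2" by (auto simp: span_singleton)
    then have "\<langle>e1, e2\<rangle> = 0" by (simp add: bil_simps bil_self ne2)
    then show False using \<open>\<langle>e1, e2\<rangle> = 1\<close> by simp
  qed
  then have "independent {e1, e2}"
    using \<open>e2 \<noteq> 0\<close> by (intro independent_insertI) (simp_all add: independent_empty)
  moreover have "e1 \<noteq> e2" using \<open>e1 \<notin> span {e2}\<close> span_base[of e2 "{e2}"] by auto
  ultimately have d: "dim ?K = 2" using dim_eq_card_independent[of "{e1, e2}"] by simp
  have U: "dbl Q b = UNIV" unfolding Q_def by (rule quadratic_tower[OF K d pa na0(1) pb[unfolded Q_def] na0(2)])
  have kK: "e1 \<in> ?K" "e2 \<in> ?K" by (simp_all add: span_base)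
  have mQ: "e1 \<in> Q" "e2 \<in> Q" "u1 \<in> Q" "v1 \<in> Q" unfolding Qs by (simp_all add: span_base)
  note k2 = dbl_mult_2[OF K pa na0(1)] and k3 = dbl_mult_3[OF K pa na0(1)]
  have t1: "u1 \<star> e1 = 0" "u1 \<star> e2 = u1" "v1 \<star> e1 = v1" "v1 \<star> e2 = 0"
    using k2[OF kK(1,1)] k2[OF kK(1,2)] k2[OF kK(2,1)] k2[OF kK(2,2)] by (simp_all add: ea c1 c2 e11 e12)
  have t2: "u1 \<star> u1 = 0" "u1 \<star> v1 = - e1" "v1 \<star> u1 = - e2" "v1 \<star> v1 = 0"
    using k3[OF kK(1,1)] k3[OF kK(1,2)] k3[OF kK(2,1)] k3[OF kK(2,2)] by (simp_all add: ea c1 c2 e11 e12 na)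
  have "\<langle>u1, unit\<rangle> = 0" "\<langle>v1, unit\<rangle> = 0" using u1(1) v1(1) unfolding sum by (simp_all add: perp_def bil_simps)
  then have c3: "cnj u1 = - u1" "cnj v1 = - v1" by (simp_all add: cnj_def)
  note M1 = dbl_mult_1[OF Q pb na0(2)] and M2 = dbl_mult_2[OF Q pb na0(2)] and M3 = dbl_mult_3[OF Q pb na0(2)]
  have u3: "u1 \<star> u2 = u1 \<star> b" "v1 \<star> v2 = v1 \<star> b"
    using M1[OF mQ(3,1)] M1[OF mQ(4,2)] by (simp_all add: ea u1(2) v1(2))
  show "split_table e1 e2 u1 u2 (v1 \<star> v2) v1 v2 (u1 \<star> u2)"
    unfolding u3 unfolding ea(3,4)[symmetric] split_table_def
    by (simp add: M1 M2 M3 mQ e11 e12 c1 c2 c3 t1 t2 u1(2) v1(2) z na)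
  let ?S = "{e1, e2, u1, u2, v1 \<star> v2, v1, v2, u1 \<star> u2}" and ?L = "[e1, e2, u1, u2, v1 \<star> v2, v1, v2, u1 \<star> u2]"
  have "dbl Q b = span ?S"
    unfolding Qs dbl_span u3 by (simp add: ea insert_commute)
  then show sp: "span ?S = UNIV" using U by simp
  have "dim (UNIV :: 'c set) \<le> card ?S" by (rule dim_le_card) (simp_all add: sp)
  then have "8 \<le> card (set ?L)" using dim_eq_8 by simp
  moreover have "card (set ?L) \<le> 8" using card_length[of ?L] by simp
  ultimately have 8: "card (set ?L) = 8" by (rule le_antisym[rotated])
  then show "distinct ?L" by (intro card_distinct) simp
  show "independent ?S" by (rule spanning_8_independent[OF sp]) (use 8 in simp)
qed

section \<open>Homogeneous split bases\<close>

definition split_frame :: "'c \<Rightarrow> 'c \<Rightarrow> 'c \<Rightarrow> 'c \<Rightarrow> 'c \<Rightarrow> 'c \<Rightarrow> 'c \<Rightarrow> 'c \<Rightarrow> bool" where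
  "split_frame e1 e2 u1 u2 u3 v1 v2 v3 \<longleftrightarrow>
     distinct [e1, e2, u1, u2, u3, v1, v2, v3] \<and> independent {e1, e2, u1, u2, u3, v1, v2, v3} \<and>
     span {e1, e2, u1, u2, u3, v1, v2, v3} = UNIV \<and> split_table e1 e2 u1 u2 u3 v1 v2 v3"

text \<open>Only the component of inverse degree pairs with \<open>x\<close>.\<close>

lemma bil_hcomp:
  assumes gr: "grading scale mul G \<Gamma>" and x: "x \<in> \<Gamma> g" "g \<in> carrier G"
  shows "\<langle>x, hcomp G \<Gamma> z (inv\<^bsub>G\<^esub> g)\<rangle> = \<langle>x, z\<rangle>"
proof -
  interpret G: comm_group G by (rule grading_comm_group[OF gr])
  let ?i = "inv\<^bsub>G\<^esub> g" and ?c = "hcomp G \<Gamma> z"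
  have ic: "?i \<in> carrier G" using x(2) by simp
  have zero: "\<langle>?c h, x\<rangle> = 0" if "h \<in> carrier G" "h \<noteq> ?i" for h
  proof (rule bil_homogeneous[OF gr hcomp_in[OF gr that(1)] x(1) that(1) x(2)])
    show "h \<otimes>\<^bsub>G\<^esub> g \<noteq> \<one>\<^bsub>G\<^esub>" using G.inv_equality[OF _ x(2) that(1)] that(2) by blast
  qed
  have "\<langle>z, x\<rangle> = (\<Sum>h\<in>support G \<Gamma>. \<langle>?c h, x\<rangle>)" unfolding bil_sum[symmetric] hcomp_sum[OF gr] ..
  also have "\<dots> = (\<Sum>h\<in>support G \<Gamma>. if h = ?i then \<langle>?c ?i, x\<rangle> else 0)"
    by (rule sum.cong) (use zero in \<open>auto simp: support_def\<close>)
  also have "\<dots> = (if ?i \<in> support G \<Gamma> then \<langle>?c ?i, x\<rangle> else 0)" by (simp add: finite_support[OF gr])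
  also have "\<dots> = \<langle>?c ?i, x\<rangle>" using not_support[OF gr ic _ hcomp_in[OF gr ic, of z]] by auto
  finally show ?thesis by (simp add: bil_commute)
qed

text \<open>Complements of subalgebras containing \<open>e\<close> and \<open>f\<close> are stable under both, and multiplication by \<open>f\<close> is
  adjoint to the one by \<open>e\<close>. So a homogeneous vector in the image of \<open>e\<close> has a homogeneous dual vector
  in the image of \<open>f\<close>, still in the complement.\<close>

lemma homogeneous_hyperbolic_partner:
  assumes gr: "grading scale mul G \<Gamma>" and e: "n e = 0" "\<langle>e, unit\<rangle> = 1" "f = unit - e"
    and h1: "e \<in> \<Gamma> \<one>\<^bsub>G\<^esub>" "f \<in> \<Gamma> \<one>\<^bsub>G\<^esub>"
    and S: "comp_subalgebra (span S)" "\<And>b. b \<in> S \<Longrightarrow> \<exists>k\<in>carrier G. b \<in> \<Gamma> k" "e \<in> S" "f \<in> S"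
    and z: "z \<in> \<Gamma> h" "h \<in> carrier G" "z \<in> perp S" "e \<star> z \<noteq> 0"
  obtains x y where "x \<in> \<Gamma> h" "y \<in> \<Gamma> (inv\<^bsub>G\<^esub> h)" "x \<in> perp S" "y \<in> perp S"
    "e \<star> x = x" "f \<star> y = y" "\<langle>x, y\<rangle> = 1"
proof -
  interpret G: comm_group G by (rule grading_comm_group[OF gr])
  note ip = idempotent_pair[OF e] and D = comp_subalgebraD[OF S(1)]
  have ef: "e \<in> span S" "f \<in> span S" using S(3,4) by (auto intro: span_base)
  have perp_stable: "k \<star> w \<in> perp S" if w: "w \<in> perp S" and k: "k \<in> span S" for w k
    unfolding perp_def
  proof (intro CollectI ballI)
    fix s assume "s \<in> S"
    then have "cnj k \<star> s \<in> span S" using D(3,4) k span_base by blast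
    moreover have "w \<in> perp (span S)" using w by (simp add: perp_span)
    ultimately show "\<langle>k \<star> w, s\<rangle> = 0" by (simp add: adjoint_left perpD)
  qed
  define x where "x = e \<star> z"
  have xh: "x \<in> \<Gamma> h" using grading_mult[OF gr G.one_closed z(2) h1(1) z(1)] z(2) by (simp add: x_def)
  have xp: "x \<in> perp S" unfolding x_def by (rule perp_stable[OF z(3) ef(1)])
  have ex: "e \<star> x = x" unfolding x_def by (rule ip(3))
  have "x \<noteq> 0" using z(4) by (simp add: x_def)
  then obtain w where w: "\<langle>x, w\<rangle> \<noteq> 0" using polar_nondegenerate[of x] by blast
  obtain a where a: "a \<in> span S" "w - a \<in> perp (span S)" by (rule comp_subalgebra_proj[OF S(1)])
  have "\<langle>x, a\<rangle> = 0" by (rule perpD(1)[OF _ a(1)]) (simp add: perp_span xp)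
  then have c: "\<langle>x, w - a\<rangle> \<noteq> 0" using w by (simp add: bil_simps)
  have ic: "inv\<^bsub>G\<^esub> h \<in> carrier G" using z(2) by simp
  define y0 where "y0 = hcomp G \<Gamma> (w - a) (inv\<^bsub>G\<^esub> h)"
  have y0: "y0 \<in> \<Gamma> (inv\<^bsub>G\<^esub> h)" unfolding y0_def by (rule hcomp_in[OF gr ic])
  have y0p: "y0 \<in> perp S"
    unfolding y0_def by (rule hcomp_perp[OF gr S(2) _ ic]) (use a(2) in \<open>simp_all add: perp_span\<close>)
  have c0: "\<langle>x, y0\<rangle> \<noteq> 0" unfolding y0_def bil_hcomp[OF gr xh z(2)] by (rule c)
  define y where "y = inverse \<langle>x, y0\<rangle> \<cdot> (f \<star> y0)"
  have fy0: "f \<star> y0 \<in> \<Gamma> (inv\<^bsub>G\<^esub> h)" using grading_mult[OF gr G.one_closed ic h1(2) y0] ic by simp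
  have "\<langle>x, f \<star> y0\<rangle> = \<langle>x, y0\<rangle>" using adjoint_left[of f y0 x] ex ip(2) by (simp add: bil_commute)
  then have "\<langle>x, y\<rangle> = 1" using c0 by (simp add: y_def bil_simps)
  moreover have "y \<in> \<Gamma> (inv\<^bsub>G\<^esub> h)" unfolding y_def by (rule subspace_scale[OF grading_subspace[OF gr ic] fy0])
  moreover have "y \<in> perp S"
    unfolding y_def by (rule subspace_scale[OF subspace_perp perp_stable[OF y0p ef(2)]])
  moreover have "f \<star> y = y" by (simp add: y_def mult_scale_right ip(4))
  ultimately show thesis using that xh xp ex by blast
qed

text \<open>A nonzero homogeneous vector of the complement is moved to a nonzero one by \<open>e1\<close> or by \<open>e2\<close>; in the second
  case the roles of the two idempotents are exchanged.\<close>

lemma homogeneous_hyperbolic_pair: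
  assumes gr: "grading scale mul G \<Gamma>" and e: "n e1 = 0" "\<langle>e1, unit\<rangle> = 1" "e2 = unit - e1"
    and h1: "e1 \<in> \<Gamma> \<one>\<^bsub>G\<^esub>" "e2 \<in> \<Gamma> \<one>\<^bsub>G\<^esub>"
    and S: "comp_subalgebra (span S)" "finite S" "card S < 8" "\<And>b. b \<in> S \<Longrightarrow> \<exists>k\<in>carrier G. b \<in> \<Gamma> k" "e1 \<in> S" "e2 \<in> S"
  obtains g x y where "g \<in> carrier G" "x \<in> \<Gamma> g" "y \<in> \<Gamma> (inv\<^bsub>G\<^esub> g)" "x \<in> perp S" "y \<in> perp S"
    "e1 \<star> x = x" "e2 \<star> y = y" "\<langle>x, y\<rangle> = 1"
proof -
  interpret G: comm_group G by (rule grading_comm_group[OF gr])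
  note ip = idempotent_pair[OF e]
  obtain h z where z: "h \<in> carrier G" "z \<in> \<Gamma> h" "z \<in> perp S" "z \<noteq> 0"
    by (rule homogeneous_orthogonal_exists[OF gr S(1-4)])
  show thesis
  proof (cases "e1 \<star> z = 0")
    case False
    obtain x y where "x \<in> \<Gamma> h" "y \<in> \<Gamma> (inv\<^bsub>G\<^esub> h)" "x \<in> perp S" "y \<in> perp S"
      "e1 \<star> x = x" "e2 \<star> y = y" "\<langle>x, y\<rangle> = 1"
      by (rule homogeneous_hyperbolic_partner[OF gr e h1 S(1,4,5,6) z(2,1,3) False]) blast
    then show ?thesis by (rule that[OF z(1)])
  next
    case True
    then have "e2 \<star> z \<noteq> 0" using z(4) by (simp add: e(3) mult_diff_left one_mult)
    then obtain x y where xy: "x \<in> \<Gamma> h" "y \<in> \<Gamma> (inv\<^bsub>G\<^esub> h)" "x \<in> perp S" "y \<in> perp S"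
      "e2 \<star> x = x" "e1 \<star> y = y" "\<langle>x, y\<rangle> = 1"
      using homogeneous_hyperbolic_partner[OF gr ip(5,6,7) h1(2,1) S(1,4,6,5) z(2,1,3)] by metis
    show ?thesis
      by (rule that[of "inv\<^bsub>G\<^esub> h" y x]) (use xy z(1) in \<open>simp_all add: bil_commute[of y]\<close>)
  qed
qed

text \<open>For \<open>\<langle>x, y\<rangle> = 1\<close> with \<open>x\<close> isotropic, \<open>x cnj(y)\<close> has norm 0 and trace 1, and its degree is \<open>e\<close> because that of \<open>y\<close>
  is inverse to the one of \<open>x\<close>. The two hyperbolic pairs are chosen greedily.\<close>

lemma homogeneous_split_frame:
  assumes gr: "grading scale mul G \<Gamma>" and x: "g \<in> carrier G" "x \<in> \<Gamma> g" "x \<noteq> 0" "n x = 0"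
  obtains s t e1 e2 u1 u2 u3 v1 v2 v3 where "split_frame e1 e2 u1 u2 u3 v1 v2 v3"
    "s \<in> carrier G" "t \<in> carrier G" "e1 \<in> \<Gamma> \<one>\<^bsub>G\<^esub>" "e2 \<in> \<Gamma> \<one>\<^bsub>G\<^esub>"
    "u1 \<in> \<Gamma> s" "v1 \<in> \<Gamma> (inv\<^bsub>G\<^esub> s)" "u2 \<in> \<Gamma> t" "v2 \<in> \<Gamma> (inv\<^bsub>G\<^esub> t)"
    "v3 \<in> \<Gamma> (s \<otimes>\<^bsub>G\<^esub> t)" "u3 \<in> \<Gamma> (inv\<^bsub>G\<^esub> s \<otimes>\<^bsub>G\<^esub> inv\<^bsub>G\<^esub> t)"
proof -
  interpret G: comm_group G by (rule grading_comm_group[OF gr])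
  have ic: "inv\<^bsub>G\<^esub> g \<in> carrier G" using x(1) by simp
  obtain z where z: "\<langle>x, z\<rangle> \<noteq> 0" using polar_nondegenerate[of x] x(3) by blast
  define y where "y = inverse \<langle>x, z\<rangle> \<cdot> hcomp G \<Gamma> z (inv\<^bsub>G\<^esub> g)"
  have y: "y \<in> \<Gamma> (inv\<^bsub>G\<^esub> g)" unfolding y_def by (rule subspace_scale[OF grading_subspace[OF gr ic] hcomp_in[OF gr ic]])
  have xy: "\<langle>x, y\<rangle> = 1" using z by (simp add: y_def bil_simps bil_hcomp[OF gr x(2,1)])
  define e1 where "e1 = x \<star> cnj y"
  define e2 where "e2 = unit - e1"
  have e: "n e1 = 0" "\<langle>e1, unit\<rangle> = 1" by (simp_all add: e1_def norm_mult x(4) trace_mult_cnj xy)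
  have h1: "e1 \<in> \<Gamma> \<one>\<^bsub>G\<^esub>"
    using grading_mult[OF gr x(1) ic x(2) cnj_homogeneous[OF gr y ic]] x(1) by (simp add: e1_def)
  then have h2: "e2 \<in> \<Gamma> \<one>\<^bsub>G\<^esub>"
    unfolding e2_def by (intro subspace_diff[OF grading_subspace[OF gr]] unit_homogeneous[OF gr]) simp_all
  have hK: "\<exists>k\<in>carrier G. b \<in> \<Gamma> k" if "b \<in> {e1, e2}" for b using h1 h2 that by blast
  have K: "comp_subalgebra (span {e1, e2})" by (rule comp_subalgebra_idempotents[OF e e2_def])
  obtain s u1 v1 where 1: "s \<in> carrier G" "u1 \<in> \<Gamma> s" "v1 \<in> \<Gamma> (inv\<^bsub>G\<^esub> s)" "u1 \<in> perp {e1, e2}" "v1 \<in> perp {e1, e2}"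
    "e1 \<star> u1 = u1" "e2 \<star> v1 = v1" "\<langle>u1, v1\<rangle> = 1"
    by (rule homogeneous_hyperbolic_pair[OF gr e e2_def h1 h2 K _ _ hK]) (auto simp: card_insert_if)
  have ics: "inv\<^bsub>G\<^esub> s \<in> carrier G" using 1(1) by simp
  let ?S = "{e1, e2, u1, v1}"
  have Q: "comp_subalgebra (span ?S)" by (rule split_quaternion(3)[OF e e2_def 1(4,6,5,7,8)])
  have hQ: "\<exists>k\<in>carrier G. b \<in> \<Gamma> k" if "b \<in> ?S" for b using hK 1(1,2,3) ics that by blast
  obtain t u2 v2 where 2: "t \<in> carrier G" "u2 \<in> \<Gamma> t" "v2 \<in> \<Gamma> (inv\<^bsub>G\<^esub> t)" "u2 \<in> perp ?S" "v2 \<in> perp ?S"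
    "e1 \<star> u2 = u2" "e2 \<star> v2 = v2" "\<langle>u2, v2\<rangle> = 1"
    by (rule homogeneous_hyperbolic_pair[OF gr e e2_def h1 h2 Q _ _ hQ]) (auto simp: card_insert_if)
  have it: "inv\<^bsub>G\<^esub> t \<in> carrier G" using 2(1) by simp
  note F = split_table_from_pairs[OF e e2_def 1(4,6,5,7,8) 2(4,6,5,7,8)]
  have "split_frame e1 e2 u1 u2 (v1 \<star> v2) v1 v2 (u1 \<star> u2)"
    unfolding split_frame_def by (intro conjI F)
  moreover have "u1 \<star> u2 \<in> \<Gamma> (s \<otimes>\<^bsub>G\<^esub> t)" by (rule grading_mult[OF gr 1(1) 2(1) 1(2) 2(2)])
  moreover have "v1 \<star> v2 \<in> \<Gamma> (inv\<^bsub>G\<^esub> s \<otimes>\<^bsub>G\<^esub> inv\<^bsub>G\<^esub> t)" by (rule grading_mult[OF gr ics it 1(3) 2(3)])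
  ultimately show thesis using that 1(1,2,3) 2(1,2,3) h1 h2 by blast
qed

end

section \<open>The Cartan grading\<close>

lemma comm_group_Z_sq: "comm_group Z_sq"
  by (intro comm_group_DirProd abelian_integer_group)

lemma Z_sq_simps: "carrier Z_sq = UNIV" "\<one>\<^bsub>Z_sq\<^esub> = (0, 0)"
  "g \<otimes>\<^bsub>Z_sq\<^esub> h = (fst g + fst h, snd g + snd h)"
  by (simp_all add: mult_DirProd' split: prod.split)

text \<open>The support: zero and the six short roots of \<open>G\<^sub>2\<close>.\<close>

definition cartan_roots :: "(int \<times> int) set" where
  "cartan_roots = {(0, 0), (1, 0), (- 1, 0), (0, 1), (0, - 1), (- 1, - 1), (1, 1)}"

lemma finite_cartan_roots: "finite cartan_roots" "card cartan_roots = 7"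
  by (simp_all add: cartan_roots_def)

lemma sum_cartan_roots:
  "sum f cartan_roots = f (0, 0) + f (1, 0) + f (- 1, 0) + f (0, 1) + f (0, - 1) + f (- 1, - 1) + (f (1, 1) :: 'a::ab_group_add)"
  by (simp add: cartan_roots_def add.assoc)

lemma Z_sq_generated_by_roots:
  assumes H: "subgroup H Z_sq" and "cartan_roots \<subseteq> H" shows "carrier Z_sq \<subseteq> H"
proof
  fix g :: "int \<times> int"
  have r: "(0, 0) \<in> H" "(1, 0) \<in> H" "(- 1, 0) \<in> H" "(0, 1) \<in> H" "(0, - 1) \<in> H"
    using assms(2) by (auto simp: cartan_roots_def)
  have m: "(fst g + fst h, snd g + snd h) \<in> H" if "g \<in> H" "h \<in> H" for g h
    using subgroup.m_closed[OF H that] unfolding Z_sq_simps .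
  have a: "(a, 0) \<in> H" for a
  proof (induction a rule: int_induct[where k = 0])
    case (step1 i) then show ?case using m[OF step1.IH r(2)] by simp
  next
    case (step2 i) then show ?case using m[OF step2.IH r(3)] by simp
  qed (rule r(1))
  have b: "(a, b) \<in> H" for a b
  proof (induction b rule: int_induct[where k = 0])
    case (step1 i) then show ?case using m[OF step1.IH r(4)] by simp
  next
    case (step2 i) then show ?case using m[OF step2.IH r(5)] by simp
  qed (rule a)
  show "g \<in> H" using b[of "fst g" "snd g"] by simp
qed

definition cartan_basis :: "'c \<Rightarrow> 'c \<Rightarrow> 'c \<Rightarrow> 'c \<Rightarrow> 'c \<Rightarrow> 'c \<Rightarrow> 'c \<Rightarrow> 'c \<Rightarrow> int \<times> int \<Rightarrow> 'c set" where
  "cartan_basis e1 e2 u1 u2 u3 v1 v2 v3 g =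
     (if g = (0, 0) then {e1, e2} else if g = (1, 0) then {u1} else if g = (- 1, 0) then {v1}
      else if g = (0, 1) then {u2} else if g = (0, - 1) then {v2}
      else if g = (- 1, - 1) then {u3} else if g = (1, 1) then {v3} else {})"

lemma cartan_basis_simps:
  "cartan_basis e1 e2 u1 u2 u3 v1 v2 v3 (0, 0) = {e1, e2}" "cartan_basis e1 e2 u1 u2 u3 v1 v2 v3 (1, 0) = {u1}"
  "cartan_basis e1 e2 u1 u2 u3 v1 v2 v3 (- 1, 0) = {v1}" "cartan_basis e1 e2 u1 u2 u3 v1 v2 v3 (0, 1) = {u2}"
  "cartan_basis e1 e2 u1 u2 u3 v1 v2 v3 (0, - 1) = {v2}" "cartan_basis e1 e2 u1 u2 u3 v1 v2 v3 (- 1, - 1) = {u3}"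
  "cartan_basis e1 e2 u1 u2 u3 v1 v2 v3 (1, 1) = {v3}" "g \<notin> cartan_roots \<Longrightarrow> cartan_basis e1 e2 u1 u2 u3 v1 v2 v3 g = {}"
  by (simp_all add: cartan_basis_def cartan_roots_def)

lemma cartan_basis_degree:
  "b \<in> cartan_basis e1 e2 u1 u2 u3 v1 v2 v3 g \<Longrightarrow>
     (b, g) \<in> {(e1, (0, 0)), (e2, (0, 0)), (u1, (1, 0)), (u2, (0, 1)), (u3, (- 1, - 1)), (v1, (- 1, 0)), (v2, (0, - 1)), (v3, (1, 1))}"
  by (auto simp: cartan_basis_def split: if_splits)

context cayley_algebra
begin

lemma split_frameD:
  assumes "split_frame e1 e2 u1 u2 u3 v1 v2 v3"
  shows "distinct [e1, e2, u1, u2, u3, v1, v2, v3]" "independent {e1, e2, u1, u2, u3, v1, v2, v3}"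
    "span {e1, e2, u1, u2, u3, v1, v2, v3} = UNIV" "split_table e1 e2 u1 u2 u3 v1 v2 v3"
  using assms unfolding split_frame_def by blast+

abbreviation cartan_family :: "'c \<Rightarrow> 'c \<Rightarrow> 'c \<Rightarrow> 'c \<Rightarrow> 'c \<Rightarrow> 'c \<Rightarrow> 'c \<Rightarrow> 'c \<Rightarrow> int \<times> int \<Rightarrow> 'c set" where
  "cartan_family e1 e2 u1 u2 u3 v1 v2 v3 g \<equiv> span (cartan_basis e1 e2 u1 u2 u3 v1 v2 v3 g)"

lemma cartan_grading_iff:
  "cartan_grading scale mul \<Gamma> \<longleftrightarrow>
     (\<exists>e1 e2 u1 u2 u3 v1 v2 v3. split_frame e1 e2 u1 u2 u3 v1 v2 v3 \<and> \<Gamma> = cartan_family e1 e2 u1 u2 u3 v1 v2 v3)"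
proof
  assume "cartan_grading scale mul \<Gamma>"
  then obtain e1 e2 u v where b: "split_basis scale mul e1 e2 u v" and \<Gamma>:
    "\<Gamma> (0, 0) = span {e1, e2}" "\<Gamma> (1, 0) = span {u 1}" "\<Gamma> (- 1, 0) = span {v 1}"
    "\<Gamma> (0, 1) = span {u 2}" "\<Gamma> (0, - 1) = span {v 2}" "\<Gamma> (- 1, - 1) = span {u 3}" "\<Gamma> (1, 1) = span {v 3}"
    "\<forall>g. g \<notin> {(0, 0), (1, 0), (- 1, 0), (0, 1), (0, - 1), (- 1, - 1), (1, 1)} \<longrightarrow> \<Gamma> g = {0}"
    unfolding cartan_grading_def by (elim exE conjE) (rule that; assumption)
  have "\<Gamma> g = span (cartan_basis e1 e2 (u 1) (u 2) (u 3) (v 1) (v 2) (v 3) g)" for g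
  proof (cases "g \<in> cartan_roots")
    case True
    then show ?thesis unfolding cartan_roots_def
      by (elim insertE emptyE) (simp_all only: \<Gamma>(1-7) cartan_basis_simps)
  next
    case False
    then show ?thesis using \<Gamma>(8)[rule_format, OF False[unfolded cartan_roots_def]]
      by (simp add: cartan_basis_simps(8))
  qed
  moreover have "split_frame e1 e2 (u 1) (u 2) (u 3) (v 1) (v 2) (v 3)"
    using b unfolding split_basis_iff_split_table split_frame_def .
  ultimately show "\<exists>e1 e2 u1 u2 u3 v1 v2 v3. split_frame e1 e2 u1 u2 u3 v1 v2 v3 \<and> \<Gamma> = cartan_family e1 e2 u1 u2 u3 v1 v2 v3" by blast
next
  assume "\<exists>e1 e2 u1 u2 u3 v1 v2 v3. split_frame e1 e2 u1 u2 u3 v1 v2 v3 \<and> \<Gamma> = cartan_family e1 e2 u1 u2 u3 v1 v2 v3"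
  then obtain e1 e2 u1 u2 u3 v1 v2 v3 where f: "split_frame e1 e2 u1 u2 u3 v1 v2 v3" and \<Gamma>: "\<Gamma> = cartan_family e1 e2 u1 u2 u3 v1 v2 v3" by blast
  define u :: "nat \<Rightarrow> 'c" where "u i = (if i = 1 then u1 else if i = 2 then u2 else u3)" for i
  define v :: "nat \<Rightarrow> 'c" where "v i = (if i = 1 then v1 else if i = 2 then v2 else v3)" for i
  have uv: "u 1 = u1" "u 2 = u2" "u 3 = u3" "v 1 = v1" "v 2 = v2" "v 3 = v3" by (simp_all add: u_def v_def)
  have b: "split_basis scale mul e1 e2 u v"
    unfolding split_basis_iff_split_table uv using f unfolding split_frame_def .
  show "cartan_grading scale mul \<Gamma>"
    unfolding cartan_grading_def
    by (rule exI[of _ e1], rule exI[of _ e2], rule exI[of _ u], rule exI[of _ v], intro conjI b)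
      (unfold uv \<Gamma> cartan_basis_simps, simp_all add: cartan_basis_simps(8) cartan_roots_def)
qed

lemma span_mult_closed:
  assumes "subspace W" "\<And>b c. b \<in> B \<Longrightarrow> c \<in> C \<Longrightarrow> b \<star> c \<in> W" and xy: "x \<in> span B" "y \<in> span C"
  shows "x \<star> y \<in> W"
proof -
  have "b \<star> y \<in> W" if b: "b \<in> B" for b
  proof -
    have "subspace {y. b \<star> y \<in> W}"
      using assms(1) by (auto simp: subspace_def mult_simps)
    then have "span C \<subseteq> {y. b \<star> y \<in> W}" by (intro span_minimal) (use assms(2) b in auto)
    then show ?thesis using xy(2) by blast
  qed
  moreover have "subspace {x. x \<star> y \<in> W}"
    using assms(1) by (auto simp: subspace_def mult_simps)
  ultimately have "span B \<subseteq> {x. x \<star> y \<in> W}" by (intro span_minimal) auto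
  then show ?thesis using xy(1) by blast
qed

context
  fixes e1 e2 u1 u2 u3 v1 v2 v3 :: 'c
  assumes frame: "split_frame e1 e2 u1 u2 u3 v1 v2 v3"
begin

private abbreviation (input) "\<B> \<equiv> cartan_basis e1 e2 u1 u2 u3 v1 v2 v3"

private abbreviation (input) "\<C> \<equiv> cartan_family e1 e2 u1 u2 u3 v1 v2 v3"

lemmas table = split_frameD(4)[OF frame, unfolded split_table_def]

lemma split_frame_coords:
  assumes "a1 \<cdot> e1 + a2 \<cdot> e2 + b1 \<cdot> u1 + c1 \<cdot> v1 + b2 \<cdot> u2 + c2 \<cdot> v2 + b3 \<cdot> u3 + c3 \<cdot> v3 = 0"
  shows "a1 = 0" "a2 = 0" "b1 = 0" "b2 = 0" "b3 = 0" "c1 = 0" "c2 = 0" "c3 = 0"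
proof -
  note F = split_frameD[OF frame]
  let ?B = "{e1, e2, u1, u2, u3, v1, v2, v3}"
  define k where "k b = (if b = e1 then a1 else if b = e2 then a2 else if b = u1 then b1 else if b = u2 then b2
    else if b = u3 then b3 else if b = v1 then c1 else if b = v2 then c2 else c3)" for b
  have k: "k e1 = a1" "k e2 = a2" "k u1 = b1" "k u2 = b2" "k u3 = b3" "k v1 = c1" "k v2 = c2" "k v3 = c3"
    using F(1) by (auto simp: k_def)
  have "(\<Sum>b\<in>?B. k b \<cdot> b) = sum_list (map (\<lambda>b. k b \<cdot> b) [e1, e2, u1, u2, u3, v1, v2, v3])"
    using sum_list_distinct_conv_sum_set[OF F(1), of "\<lambda>b. k b \<cdot> b"] by simp
  also have "\<dots> = 0" using assms by (simp add: k add.assoc add.commute add.left_commute)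
  finally have s: "(\<Sum>b\<in>?B. k b \<cdot> b) = 0" .
  have "k b = 0" if "b \<in> ?B" for b
    by (rule F(2)[unfolded independent_explicit_module, rule_format, OF _ subset_refl s that]) simp
  then show "a1 = 0" "a2 = 0" "b1 = 0" "b2 = 0" "b3 = 0" "c1 = 0" "c2 = 0" "c3 = 0"
    using k by (metis insertCI)+
qed

lemma split_frame_nonzero: "e1 \<noteq> 0" "e2 \<noteq> 0" "u1 \<noteq> 0" "u2 \<noteq> 0" "u3 \<noteq> 0" "v1 \<noteq> 0" "v2 \<noteq> 0" "v3 \<noteq> 0"
proof -
  have "0 \<notin> {e1, e2, u1, u2, u3, v1, v2, v3}" using split_frameD(2)[OF frame] dependent_zero by metis
  then show "e1 \<noteq> 0" "e2 \<noteq> 0" "u1 \<noteq> 0" "u2 \<noteq> 0" "u3 \<noteq> 0" "v1 \<noteq> 0" "v2 \<noteq> 0" "v3 \<noteq> 0"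
    by auto
qed

lemma cartan_mult:
  assumes "b \<in> \<B> g" "c \<in> \<B> h"
  shows "b \<star> c \<in> \<C> (fst g + fst h, snd g + snd h)"
  using cartan_basis_degree[OF assms(1)] cartan_basis_degree[OF assms(2)]
  by (elim insertE emptyE Pair_inject; hypsubst)
    (simp_all add: table cartan_basis_simps(1-7) span_base span_neg span_zero)

lemma grading_cartan: "grading scale mul Z_sq \<C>"
proof (rule gradingI[OF vector_space_axioms comm_group_Z_sq, where T = cartan_roots])
  show "subspace (\<C> g)" for g by simp
  show "\<C> g = {0}" if "g \<notin> cartan_roots" for g using that by (simp add: cartan_basis_simps(8))
  show "x \<star> y \<in> \<C> (g \<otimes>\<^bsub>Z_sq\<^esub> h)" if "x \<in> \<C> g" "y \<in> \<C> h" for g h x y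
    unfolding Z_sq_simps by (rule span_mult_closed[OF subspace_span cartan_mult that])
  show "\<exists>f. (\<forall>g\<in>cartan_roots. f g \<in> \<C> g) \<and> x = (\<Sum>g\<in>cartan_roots. f g)" for x
  proof -
    let ?W = "{x. \<exists>f. (\<forall>g\<in>cartan_roots. f g \<in> \<C> g) \<and> x = (\<Sum>g\<in>cartan_roots. f g)}"
    have W: "subspace ?W"
      unfolding subspace_def
    proof (intro conjI ballI allI)
      show "0 \<in> ?W" by (intro CollectI exI[of _ "\<lambda>_. 0"]) (simp add: span_zero)
      fix x assume "x \<in> ?W"
      then obtain f where f: "\<forall>g\<in>cartan_roots. f g \<in> \<C> g" "x = (\<Sum>g\<in>cartan_roots. f g)" by blast
      show "k \<cdot> x \<in> ?W" for k
        using f by (intro CollectI exI[of _ "\<lambda>g. k \<cdot> f g"]) (simp add: span_scale scale_sum_right)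
      fix y assume "y \<in> ?W"
      then obtain f' where f': "\<forall>g\<in>cartan_roots. f' g \<in> \<C> g" "y = (\<Sum>g\<in>cartan_roots. f' g)" by blast
      show "x + y \<in> ?W"
        using f f' by (intro CollectI exI[of _ "\<lambda>g. f g + f' g"]) (simp add: span_add sum.distrib)
    qed
    have "b \<in> ?W" if "b \<in> \<C> g" "g \<in> cartan_roots" for b g
      using that finite_cartan_roots by (intro CollectI exI[of _ "\<lambda>h. if h = g then b else 0"]) (auto simp: span_zero)
    then have 1: "(\<Union>g\<in>cartan_roots. \<B> g) \<subseteq> ?W"
      using span_base by blast
    have 2: "{e1, e2, u1, u2, u3, v1, v2, v3} \<subseteq> (\<Union>g\<in>cartan_roots. \<B> g)"
      unfolding cartan_roots_def by (simp add: cartan_basis_simps(1-7))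
    have "span {e1, e2, u1, u2, u3, v1, v2, v3} \<subseteq> ?W"
      by (rule span_minimal[OF subset_trans[OF 2 1] W])
    then show ?thesis using split_frameD(3)[OF frame] by blast
  qed
  show "f g = 0" if f: "\<And>g. g \<in> cartan_roots \<Longrightarrow> f g \<in> \<C> g" and s: "(\<Sum>g\<in>cartan_roots. f g) = 0" and g: "g \<in> cartan_roots" for f g
  proof -
    have m: "f (0, 0) \<in> span {e1, e2}" "f (1, 0) \<in> span {u1}" "f (- 1, 0) \<in> span {v1}" "f (0, 1) \<in> span {u2}"
      "f (0, - 1) \<in> span {v2}" "f (- 1, - 1) \<in> span {u3}" "f (1, 1) \<in> span {v3}"
      using f[of "(0, 0)"] f[of "(1, 0)"] f[of "(- 1, 0)"] f[of "(0, 1)"] f[of "(0, - 1)"] f[of "(- 1, - 1)"] f[of "(1, 1)"]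
      unfolding cartan_basis_simps(1-7) by (simp_all add: cartan_roots_def)
    obtain a1 a2 where 0: "f (0, 0) = a1 \<cdot> e1 + a2 \<cdot> e2" using m(1) by (rule span_pairE)
    obtain b1 c1 b2 c2 b3 c3 where r: "f (1, 0) = b1 \<cdot> u1" "f (- 1, 0) = c1 \<cdot> v1" "f (0, 1) = b2 \<cdot> u2"
      "f (0, - 1) = c2 \<cdot> v2" "f (- 1, - 1) = b3 \<cdot> u3" "f (1, 1) = c3 \<cdot> v3"
      using m(2-7) unfolding span_singleton by blast
    note c = split_frame_coords[of a1 a2 b1 c1 b2 c2 b3 c3, OF s[unfolded sum_cartan_roots 0 r]]
    show ?thesis using g unfolding cartan_roots_def by (elim insertE emptyE) (simp_all add: 0 r c)
  qed
qed (use finite_cartan_roots in \<open>simp_all add: Z_sq_simps\<close>)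

lemma support_cartan: "support Z_sq \<C> = cartan_roots"
proof -
  have "\<C> g \<noteq> {0}" if "g \<in> cartan_roots" for g
  proof -
    have "\<exists>b\<in>\<B> g. b \<noteq> 0"
      using that split_frame_nonzero unfolding cartan_roots_def
      by (elim insertE emptyE) (simp_all add: cartan_basis_simps(1-7))
    then show ?thesis using span_base by blast
  qed
  then show ?thesis by (auto simp: support_def Z_sq_simps cartan_basis_simps(8))
qed

private lemma cartan_mem: "e1 \<in> \<C> (0, 0)" "e2 \<in> \<C> (0, 0)" "u1 \<in> \<C> (1, 0)" "v1 \<in> \<C> (- 1, 0)"
  "u2 \<in> \<C> (0, 1)" "v2 \<in> \<C> (0, - 1)" "u3 \<in> \<C> (- 1, - 1)" "v3 \<in> \<C> (1, 1)"
  unfolding cartan_basis_simps(1-7) by (simp_all add: span_base)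

text \<open>The lines cannot be split, and \<open>e1\<close>, \<open>e2\<close> are up to sign the products \<open>u1 v1\<close>, \<open>v1 u1\<close>, which have equal degree in
  every refinement by an abelian group.\<close>

lemma cartan_fine: "fine_grading scale mul Z_sq \<C>"
proof (rule fine_gradingI[OF grading_cartan])
  fix H :: "nat monoid" and \<Delta> g
  assume H: "grading scale mul H \<Delta>" "refines H \<Delta> Z_sq \<C>"
    and g: "g \<in> support Z_sq \<C>"
  interpret H: comm_group H by (rule grading_comm_group[OF H(1)])
  have line: "\<exists>p\<in>carrier H. b \<in> \<Delta> p" if "\<B> g = {b}" "b \<noteq> 0" for b g
    using line_in_refinement[OF grading_cartan H, of g b] that by (auto simp: Z_sq_simps)
  have "\<exists>h\<in>carrier H. \<B> g \<subseteq> \<Delta> h"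
  proof (cases "g = (0, 0)")
    case False
    then have "\<exists>b. \<B> g = {b} \<and> b \<noteq> 0"
      using g unfolding support_cartan cartan_roots_def
      by (elim insertE emptyE) (simp_all add: cartan_basis_simps(1-7) split_frame_nonzero)
    then obtain b where b: "\<B> g = {b}" "b \<noteq> 0" by blast
    show ?thesis using line[OF b] unfolding b(1) by simp
  next
    case True
    obtain p q where p: "p \<in> carrier H" "u1 \<in> \<Delta> p" and q: "q \<in> carrier H" "v1 \<in> \<Delta> q"
      using line[of "(1, 0)" u1] line[of "(- 1, 0)" v1] split_frame_nonzero by (auto simp: cartan_basis_simps)
    have pq: "p \<otimes>\<^bsub>H\<^esub> q \<in> carrier H" "q \<otimes>\<^bsub>H\<^esub> p = p \<otimes>\<^bsub>H\<^esub> q" using p q by (simp_all add: H.m_comm)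
    have "- e1 \<in> \<Delta> (p \<otimes>\<^bsub>H\<^esub> q)" "- e2 \<in> \<Delta> (p \<otimes>\<^bsub>H\<^esub> q)"
      using grading_mult[OF H(1) p(1) q(1) p(2) q(2)] grading_mult[OF H(1) q(1) p(1) q(2) p(2)] pq(2)
      by (simp_all add: table)
    then have "{e1, e2} \<subseteq> \<Delta> (p \<otimes>\<^bsub>H\<^esub> q)"
      using subspace_neg[OF grading_subspace[OF H(1) pq(1)]] by (metis insert_subset empty_subsetI minus_minus)
    then show ?thesis using pq(1) True cartan_basis_simps(1) by metis
  qed
  then obtain h where h: "h \<in> carrier H" "\<B> g \<subseteq> \<Delta> h" by blast
  have "\<C> g \<subseteq> \<Delta> h"
    by (rule span_minimal[OF h(2) grading_subspace[OF H(1) h(1)]])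
  then show "\<exists>h\<in>carrier H. \<C> g \<subseteq> \<Delta> h" using h(1) by blast
qed

text \<open>The section writes each degree in terms of \<open>(1, 0)\<close> and \<open>(0, 1)\<close>. The relators from \<open>e1 e1\<close>, \<open>u1 v1\<close>, \<open>u2 v2\<close>, \<open>u3 v3\<close>
  and \<open>v1 v2\<close> express the remaining five generators by these two.\<close>

lemma cartan_universal_group: "universal_group scale mul Z_sq \<C> \<cong> Z_sq"
proof (rule universal_group_iso[OF grading_cartan])
  let ?F = "free_Abelian_group (support Z_sq \<C>)"
  let ?N = "generate ?F (universal_relators scale mul Z_sq \<C>)"
  let ?\<rho> = "\<lambda>g. frag_cmul (fst g) (frag_of (1, 0)) + frag_cmul (snd g) (frag_of (0, 1))"
  interpret F: comm_group ?F by (rule abelian_free_Abelian_group)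
  show "carrier Z_sq \<subseteq> H" if "subgroup H Z_sq" "support Z_sq \<C> \<subseteq> H" for H
    using Z_sq_generated_by_roots[OF that(1)] that(2) unfolding support_cartan by blast
  have roots: "(0, 0) \<in> cartan_roots" "(1, 0) \<in> cartan_roots" "(- 1, 0) \<in> cartan_roots" "(0, 1) \<in> cartan_roots"
    "(0, - 1) \<in> cartan_roots" "(- 1, - 1) \<in> cartan_roots" "(1, 1) \<in> cartan_roots" by (simp_all add: cartan_roots_def)
  show "?\<rho> x \<in> carrier ?F" for x :: "int \<times> int"
    using roots(2,4) keys_cmul[of "fst x" "frag_of (1::int, 0::int)"] keys_cmul[of "snd x" "frag_of (0::int, 1::int)"]
      keys_add[of "frag_cmul (fst x) (frag_of (1::int, 0::int))" "frag_cmul (snd x) (frag_of (0::int, 1::int))"]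
    unfolding support_cartan carrier_free_Abelian_group_iff by fastforce
  have N0: "0 \<in> ?N" using generate.one[of ?F] by simp
  have Na: "x + y \<in> ?N" if "x \<in> ?N" "y \<in> ?N" for x y
    using generate.eng[OF that] by simp
  have rel: "frag_of s + frag_of t - frag_of (fst s + fst t, snd s + snd t) \<in> ?N"
    if "s \<in> cartan_roots" "t \<in> cartan_roots" "x \<in> \<C> s" "y \<in> \<C> t" "x \<star> y \<noteq> 0" for s t x y
    using universal_relatorI[OF grading_cartan, of s t x y] that support_cartan unfolding Z_sq_simps by (auto intro: generate.incl)
  have r0: "frag_of (0, 0) \<in> ?N" using rel[OF roots(1,1) cartan_mem(1,1)] split_frame_nonzero by (simp add: table)
  have r1: "frag_of (1, 0) + frag_of (- 1, 0) - frag_of (0, 0) \<in> ?N" using rel[OF roots(2,3) cartan_mem(3,4)] split_frame_nonzero by (simp add: table)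
  have r2: "frag_of (0, 1) + frag_of (0, - 1) - frag_of (0, 0) \<in> ?N" using rel[OF roots(4,5) cartan_mem(5,6)] split_frame_nonzero by (simp add: table)
  have r3: "frag_of (- 1, - 1) + frag_of (1, 1) - frag_of (0, 0) \<in> ?N" using rel[OF roots(6,7) cartan_mem(7,8)] split_frame_nonzero by (simp add: table)
  have r4: "frag_of (- 1, 0) + frag_of (0, - 1) - frag_of (- 1, - 1) \<in> ?N" using rel[OF roots(3,5) cartan_mem(4,6)] split_frame_nonzero by (simp add: table)
  have p1: "frag_of (- 1, 0) + frag_of (1, 0) \<in> ?N" and p2: "frag_of (0, - 1) + frag_of (0, 1) \<in> ?N"
    using Na[OF r1 r0] Na[OF r2 r0] by (simp_all add: algebra_simps)
  have Nm: "- x \<in> ?N" if "x \<in> ?N" for x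
    using F.generate_m_inv_closed[OF universal_relators_subset that] F.generate_in_carrier[OF universal_relators_subset that] by simp
  show "frag_of s - ?\<rho> s \<in> ?N" if "s \<in> support Z_sq \<C>" for s
  proof -
    have 6: "frag_of (- 1, - 1) - (- frag_of (1, 0) - frag_of (0, 1)) \<in> ?N"
      using Na[OF Na[OF p1 p2] Nm[OF r4]] by (simp add: algebra_simps)
    have 7: "frag_of (1, 1) - (frag_of (1, 0) + frag_of (0, 1)) \<in> ?N"
      using Na[OF Na[OF r3 r0] Nm[OF 6]] by (simp add: algebra_simps)
    show ?thesis
      using that r0 p1 p2 6 7 N0 unfolding support_cartan cartan_roots_def
      by (elim insertE emptyE) simp_all
  qed
  show "?\<rho> (x \<otimes>\<^bsub>Z_sq\<^esub> y) - ?\<rho> x - ?\<rho> y \<in> ?N" for x y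
    using N0 unfolding Z_sq_simps by (simp add: frag_cmul_distrib algebra_simps)
qed

end

lemma split_frame_isomorphism:
  assumes f: "split_frame e1 e2 u1 u2 u3 v1 v2 v3" and f': "split_frame e1' e2' u1' u2' u3' v1' v2' v3'"
  obtains \<psi> where "alg_iso_on scale mul \<psi> UNIV UNIV" "\<psi> e1 = e1'" "\<psi> e2 = e2'" "\<psi> u1 = u1'" "\<psi> u2 = u2'" "\<psi> u3 = u3'" "\<psi> v1 = v1'" "\<psi> v2 = v2'" "\<psi> v3 = v3'"
proof -
  interpret vector_space_pair scale scale by unfold_locales
  have hom: "\<exists>\<psi>. Vector_Spaces.linear scale scale \<psi> \<and> \<psi> e1 = e1' \<and> \<psi> e2 = e2' \<and>
      \<psi> u1 = u1' \<and> \<psi> u2 = u2' \<and> \<psi> u3 = u3' \<and> \<psi> v1 = v1' \<and> \<psi> v2 = v2' \<and> \<psi> v3 = v3'"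
    if f: "split_frame e1 e2 u1 u2 u3 v1 v2 v3" for e1 e2 u1 u2 u3 v1 v2 v3 e1' e2' u1' u2' u3' v1' v2' v3'
  proof -
    note F = split_frameD[OF f]
    define k where "k b = (if b = e1 then e1' else if b = e2 then e2' else if b = u1 then u1' else if b = u2 then u2' else if b = u3 then u3' else if b = v1 then v1' else if b = v2 then v2' else v3')" for b
    have k: "k e1 = e1'" "k e2 = e2'" "k u1 = u1'" "k u2 = u2'" "k u3 = u3'" "k v1 = v1'" "k v2 = v2'" "k v3 = v3'"
      using F(1) by (auto simp: k_def)
    obtain \<psi> where "Vector_Spaces.linear scale scale \<psi>" "\<forall>b\<in>{e1, e2, u1, u2, u3, v1, v2, v3}. \<psi> b = k b"
      using linear_independent_extend[OF F(2), of k] by blast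
    then show ?thesis using k by (intro exI[of _ \<psi>]) simp
  qed
  obtain \<psi> where \<psi>: "Vector_Spaces.linear scale scale \<psi>" "\<psi> e1 = e1'" "\<psi> e2 = e2'" "\<psi> u1 = u1'" "\<psi> u2 = u2'" "\<psi> u3 = u3'" "\<psi> v1 = v1'" "\<psi> v2 = v2'" "\<psi> v3 = v3'" using hom[OF f, of e1' e2' u1' u2' u3' v1' v2' v3'] by blast
  obtain \<psi>' where \<psi>': "Vector_Spaces.linear scale scale \<psi>'" "\<psi>' e1' = e1" "\<psi>' e2' = e2" "\<psi>' u1' = u1" "\<psi>' u2' = u2" "\<psi>' u3' = u3" "\<psi>' v1' = v1" "\<psi>' v2' = v2" "\<psi>' v3' = v3" using hom[OF f', of e1 e2 u1 u2 u3 v1 v2 v3] by blast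
  interpret L: Vector_Spaces.linear scale scale \<psi> by (rule \<psi>(1))
  interpret L': Vector_Spaces.linear scale scale \<psi>' by (rule \<psi>'(1))
  have inv: "\<psi>' (\<psi> x) = x" for x
  proof -
    have "subspace {x. \<psi>' (\<psi> x) = x}"
      by (auto simp: subspace_def L.zero L'.zero L.add L'.add L.scale L'.scale)
    then have "span {e1, e2, u1, u2, u3, v1, v2, v3} \<subseteq> {x. \<psi>' (\<psi> x) = x}" by (rule span_minimal[rotated]) (simp add: \<psi>(2-9) \<psi>'(2-9))
    then show ?thesis using split_frameD(3)[OF f] by blast
  qed
  have inv': "\<psi> (\<psi>' x) = x" for x
  proof -
    have "subspace {x. \<psi> (\<psi>' x) = x}"
      by (auto simp: subspace_def L.zero L'.zero L.add L'.add L.scale L'.scale)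
    then have "span {e1', e2', u1', u2', u3', v1', v2', v3'} \<subseteq> {x. \<psi> (\<psi>' x) = x}" by (rule span_minimal[rotated]) (simp add: \<psi>(2-9) \<psi>'(2-9))
    then show ?thesis using split_frameD(3)[OF f'] by blast
  qed
  have bij: "bij_betw \<psi> UNIV UNIV" by (rule o_bij[of \<psi>']) (simp_all add: fun_eq_iff inv inv')
  have basis: "\<psi> (b \<star> c) = \<psi> b \<star> \<psi> c" if "b \<in> {e1, e2, u1, u2, u3, v1, v2, v3}" "c \<in> {e1, e2, u1, u2, u3, v1, v2, v3}" for b c
    using that
    by (elim insertE emptyE; hypsubst) (simp_all add: table[OF f] table[OF f'] \<psi>(2-9) L.zero L.neg)
  have mult: "\<psi> (x \<star> y) = \<psi> x \<star> \<psi> y" for x y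
  proof -
    have s: "subspace {x. \<psi> (x \<star> y) = \<psi> x \<star> \<psi> y}" "subspace {x. \<psi> (y \<star> x) = \<psi> y \<star> \<psi> x}" for y
      by (auto simp: subspace_def L.zero L.add L.scale mult_simps)
    have 1: "\<psi> (b \<star> y) = \<psi> b \<star> \<psi> y" if b: "b \<in> {e1, e2, u1, u2, u3, v1, v2, v3}" for b y
    proof -
      have "span {e1, e2, u1, u2, u3, v1, v2, v3} \<subseteq> {y. \<psi> (b \<star> y) = \<psi> b \<star> \<psi> y}" by (rule span_minimal[OF _ s(2)]) (use basis[OF b] in blast)
      then show ?thesis using split_frameD(3)[OF f] by blast
    qed
    have "span {e1, e2, u1, u2, u3, v1, v2, v3} \<subseteq> {x. \<psi> (x \<star> y) = \<psi> x \<star> \<psi> y}" by (rule span_minimal[OF _ s(1)]) (use 1 in blast)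
    then show ?thesis using split_frameD(3)[OF f] by blast
  qed
  have "alg_iso_on scale mul \<psi> UNIV UNIV"
    unfolding alg_iso_on_def using bij by (simp add: L.add L.scale mult)
  then show thesis using that \<psi>(2-9) by blast
qed

lemma alg_iso_on_span_image:
  assumes "alg_iso_on scale mul \<psi> UNIV UNIV" shows "\<psi> ` span B = span (\<psi> ` B)"
proof -
  note I = alg_iso_onD[OF assms]
  interpret l: Vector_Spaces.linear scale scale \<psi> by unfold_locales (simp_all add: I)
  show ?thesis by (simp add: l.span_image)
qed

lemma cartan_gradings_equivalent:
  assumes "cartan_grading scale mul \<Gamma>" "cartan_grading scale mul \<Gamma>'"
  shows "equivalent_gradings scale mul Z_sq \<Gamma> Z_sq \<Gamma>'"
proof -
  obtain e1 e2 u1 u2 u3 v1 v2 v3 where f: "split_frame e1 e2 u1 u2 u3 v1 v2 v3" and \<Gamma>: "\<Gamma> = (cartan_family e1 e2 u1 u2 u3 v1 v2 v3)"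
    using assms(1) unfolding cartan_grading_iff by blast
  obtain e1' e2' u1' u2' u3' v1' v2' v3' where f': "split_frame e1' e2' u1' u2' u3' v1' v2' v3'" and \<Gamma>': "\<Gamma>' = (cartan_family e1' e2' u1' u2' u3' v1' v2' v3')"
    using assms(2) unfolding cartan_grading_iff by blast
  obtain \<psi> where \<psi>: "alg_iso_on scale mul \<psi> UNIV UNIV" "\<psi> e1 = e1'" "\<psi> e2 = e2'" "\<psi> u1 = u1'" "\<psi> u2 = u2'" "\<psi> u3 = u3'" "\<psi> v1 = v1'" "\<psi> v2 = v2'" "\<psi> v3 = v3'"
    by (rule split_frame_isomorphism[OF f f'])
  have inj: "inj \<psi>" using alg_iso_onD(1)[OF \<psi>(1)] by (simp add: bij_betw_def)
  have "\<psi> ` cartan_basis e1 e2 u1 u2 u3 v1 v2 v3 g = cartan_basis e1' e2' u1' u2' u3' v1' v2' v3' g" for g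
    by (simp add: cartan_basis_def \<psi>(2-9))
  then have im: "\<psi> ` \<Gamma> g = \<Gamma>' g" for g
    unfolding \<Gamma> \<Gamma>' alg_iso_on_span_image[OF \<psi>(1)] by simp
  have "bij_betw ((`) \<psi>) (\<Gamma> ` cartan_roots) (\<Gamma>' ` cartan_roots)"
    unfolding bij_betw_def
  proof
    show "inj_on ((`) \<psi>) (\<Gamma> ` cartan_roots)" by (rule inj_onI) (simp add: inj_image_eq_iff[OF inj])
    show "((`) \<psi>) ` (\<Gamma> ` cartan_roots) = \<Gamma>' ` cartan_roots" by (simp add: image_image im)
  qed
  moreover have "support Z_sq \<Gamma> = cartan_roots" "support Z_sq \<Gamma>' = cartan_roots"
    unfolding \<Gamma> \<Gamma>' by (rule support_cartan[OF f], rule support_cartan[OF f'])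
  ultimately show ?thesis unfolding equivalent_gradings_def components_def using \<psi>(1) by auto
qed

lemma fine_isotropic:
  assumes fine: "fine_grading scale mul G \<Gamma>" and x: "g \<in> carrier G" "x \<in> \<Gamma> g" "x \<noteq> 0" "n x = 0"
  shows "\<exists>\<Delta>. cartan_grading scale mul \<Delta> \<and> equivalent_gradings scale mul G \<Gamma> Z_sq \<Delta>"
proof -
  have gr: "grading scale mul G \<Gamma>" using fine by (simp add: fine_grading_def)
  interpret G: comm_group G by (rule grading_comm_group[OF gr])
  obtain s t e1 e2 u1 u2 u3 v1 v2 v3 where f: "split_frame e1 e2 u1 u2 u3 v1 v2 v3"
    and st: "s \<in> carrier G" "t \<in> carrier G" and m: "e1 \<in> \<Gamma> \<one>\<^bsub>G\<^esub>" "e2 \<in> \<Gamma> \<one>\<^bsub>G\<^esub>"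
    "u1 \<in> \<Gamma> s" "v1 \<in> \<Gamma> (inv\<^bsub>G\<^esub> s)" "u2 \<in> \<Gamma> t" "v2 \<in> \<Gamma> (inv\<^bsub>G\<^esub> t)"
    "v3 \<in> \<Gamma> (s \<otimes>\<^bsub>G\<^esub> t)" "u3 \<in> \<Gamma> (inv\<^bsub>G\<^esub> s \<otimes>\<^bsub>G\<^esub> inv\<^bsub>G\<^esub> t)"
    by (rule homogeneous_split_frame[OF gr x])
  have "equivalent_gradings scale mul G \<Gamma> Z_sq (cartan_family e1 e2 u1 u2 u3 v1 v2 v3)"
  proof (rule fine_grading_equivalent[OF fine grading_cartan[OF f]])
    fix h assume h: "h \<in> support Z_sq (cartan_family e1 e2 u1 u2 u3 v1 v2 v3)"
    have "\<exists>k\<in>carrier G. cartan_basis e1 e2 u1 u2 u3 v1 v2 v3 h \<subseteq> \<Gamma> k"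
      using h m st unfolding support_cartan[OF f] cartan_roots_def
      by (elim insertE emptyE) (simp_all only: cartan_basis_simps(1-7),
        (meson G.one_closed G.inv_closed G.m_closed empty_subsetI insert_subset)+)
    then obtain k where k: "k \<in> carrier G" "cartan_basis e1 e2 u1 u2 u3 v1 v2 v3 h \<subseteq> \<Gamma> k" by blast
    have "cartan_family e1 e2 u1 u2 u3 v1 v2 v3 h \<subseteq> \<Gamma> k" by (rule span_minimal[OF k(2) grading_subspace[OF gr k(1)]])
    then show "\<exists>k\<in>carrier G. cartan_family e1 e2 u1 u2 u3 v1 v2 v3 h \<subseteq> \<Gamma> k" using k(1) by blast
  qed
  moreover have "cartan_grading scale mul (cartan_family e1 e2 u1 u2 u3 v1 v2 v3)" unfolding cartan_grading_iff using f by blast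
  ultimately show ?thesis by (intro exI conjI)
qed

text \<open>For the grading by the trivial group every isotropic vector is homogeneous.\<close>

lemma cartan_grading_exists:
  assumes "split_norm n" shows "\<exists>\<Gamma>. cartan_grading scale mul \<Gamma>"
proof -
  obtain x where x: "x \<noteq> 0" "n x = 0" using assms by (auto simp: split_norm_def)
  let ?G = "integer_mod_group (Suc 0)"
  have C: "carrier ?G = {0}" by (auto simp: carrier_integer_mod_group)
  have "grading scale mul ?G (\<lambda>_. UNIV)"
    by (rule gradingI[OF vector_space_axioms abelian_integer_mod_group, where T = "{0}"]) (auto simp: C subspace_UNIV)
  then obtain e1 e2 u1 u2 u3 v1 v2 v3 where "split_frame e1 e2 u1 u2 u3 v1 v2 v3"
    by (rule homogeneous_split_frame[of ?G _ 0 x]) (use x C in auto)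
  then show ?thesis unfolding cartan_grading_iff by blast
qed

lemma card_components:
  assumes gr: "grading scale mul G \<Gamma>" shows "card (components G \<Gamma>) = card (support G \<Gamma>)"
  unfolding components_def
proof (rule card_image, rule inj_onI)
  fix g h assume gh: "g \<in> support G \<Gamma>" "h \<in> support G \<Gamma>" "\<Gamma> g = \<Gamma> h"
  then have c: "g \<in> carrier G" "h \<in> carrier G" by (simp_all add: support_def)
  obtain x where x: "x \<in> \<Gamma> g" "x \<noteq> 0" using gh(1) support_iff[OF gr c(1)] by blast
  then show "g = h" using homogeneous_unique[OF gr x(1) _ c x(2)] gh(3) by simp
qed

text \<open>The number of components is an invariant, and a Cartan grading has seven.\<close>

lemma cartan_not_equivalent_division:
  assumes "cartan_grading scale mul \<Gamma>" and d: "division_grading G \<Delta>" and c: "card (carrier G) \<noteq> 7"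
  shows "\<not> equivalent_gradings scale mul Z_sq \<Gamma> G \<Delta>"
proof
  assume "equivalent_gradings scale mul Z_sq \<Gamma> G \<Delta>"
  then have "card (components Z_sq \<Gamma>) = card (components G \<Delta>)"
    unfolding equivalent_gradings_def using bij_betw_same_card by blast
  moreover obtain e1 e2 u1 u2 u3 v1 v2 v3 where f: "split_frame e1 e2 u1 u2 u3 v1 v2 v3" and \<Gamma>: "\<Gamma> = (cartan_family e1 e2 u1 u2 u3 v1 v2 v3)"
    using assms(1) unfolding cartan_grading_iff by blast
  have "card (components Z_sq \<Gamma>) = 7"
    unfolding \<Gamma> card_components[OF grading_cartan[OF f]] support_cartan[OF f] by (rule finite_cartan_roots(2))
  moreover have "card (components G \<Delta>) = card (carrier G)"
    using card_components[OF division_grading_grading[OF d]] division_support[OF d] by simp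
  ultimately show False using c by simp
qed

end

theorem corollary11:
  fixes scale :: "'f::field \<Rightarrow> 'c::ab_group_add \<Rightarrow> 'c"
    and mul :: "'c \<Rightarrow> 'c \<Rightarrow> 'c" and unit :: 'c and n :: "'c \<Rightarrow> 'f"
  assumes "cayley_algebra scale mul unit n"
  shows
    "(\<comment> \<open>the Cartan grading\<close>
      split_norm n \<longrightarrow>
        (\<exists>\<Gamma>. cartan_grading scale mul \<Gamma>) \<and>
        (\<forall>\<Gamma>. cartan_grading scale mul \<Gamma> \<longrightarrow>
           fine_grading scale mul Z_sq \<Gamma> \<and> universal_group scale mul Z_sq \<Gamma> \<cong> Z_sq) \<and>
        (\<forall>\<Gamma> \<Gamma>'. cartan_grading scale mul \<Gamma> \<and> cartan_grading scale mul \<Gamma>' \<longrightarrow>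
           equivalent_gradings scale mul Z_sq \<Gamma> Z_sq \<Gamma>')) \<and>
     (\<comment> \<open>characteristic different from 2\<close>
      CHAR('f) \<noteq> 2 \<longrightarrow>
        (\<forall>\<mu>. admissible_base scale n Z2_cube (carrier Z2_cube) \<mu> \<longrightarrow>
           (\<exists>\<Gamma>. Gamma_base scale mul unit n Z2_cube (carrier Z2_cube) \<mu> \<Gamma>) \<and>
           (\<forall>\<Gamma>. Gamma_base scale mul unit n Z2_cube (carrier Z2_cube) \<mu> \<Gamma> \<longrightarrow>
              fine_grading scale mul Z2_cube \<Gamma> \<and>
              universal_group scale mul Z2_cube \<Gamma> \<cong> Z2_cube)) \<and>
        (\<forall>\<mu> \<mu>' \<Gamma> \<Gamma>'.
           admissible_base scale n Z2_cube (carrier Z2_cube) \<mu> \<and>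
           admissible_base scale n Z2_cube (carrier Z2_cube) \<mu>' \<and>
           Gamma_base scale mul unit n Z2_cube (carrier Z2_cube) \<mu> \<Gamma> \<and>
           Gamma_base scale mul unit n Z2_cube (carrier Z2_cube) \<mu>' \<Gamma>' \<longrightarrow>
           (equivalent_gradings scale mul Z2_cube \<Gamma> Z2_cube \<Gamma>' \<longleftrightarrow>
            (\<exists>\<phi>\<in>iso Z2_cube Z2_cube. \<forall>t\<in>carrier Z2_cube. \<mu>' t = \<mu> (\<phi> t))))) \<and>
     (\<comment> \<open>characteristic 2\<close>
      CHAR('f) = 2 \<longrightarrow>
        (\<forall>K \<mu>. quadratic_separable_subfield scale mul unit K \<and>
           admissible_quadratic scale n Z2_sq K (carrier Z2_sq) \<mu> \<longrightarrow>
           (\<exists>\<Gamma>. Gamma_quadratic scale mul n Z2_sq K (carrier Z2_sq) \<mu> \<Gamma>) \<and>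
           (\<forall>\<Gamma>. Gamma_quadratic scale mul n Z2_sq K (carrier Z2_sq) \<mu> \<Gamma> \<longrightarrow>
              fine_grading scale mul Z2_sq \<Gamma> \<and>
              universal_group scale mul Z2_sq \<Gamma> \<cong> Z2_sq)) \<and>
        (\<forall>K K' \<mu> \<mu>' \<Gamma> \<Gamma>'.
           quadratic_separable_subfield scale mul unit K \<and>
           quadratic_separable_subfield scale mul unit K' \<and>
           admissible_quadratic scale n Z2_sq K (carrier Z2_sq) \<mu> \<and>
           admissible_quadratic scale n Z2_sq K' (carrier Z2_sq) \<mu>' \<and>
           Gamma_quadratic scale mul n Z2_sq K (carrier Z2_sq) \<mu> \<Gamma> \<and>
           Gamma_quadratic scale mul n Z2_sq K' (carrier Z2_sq) \<mu>' \<Gamma>' \<longrightarrow>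
           (equivalent_gradings scale mul Z2_sq \<Gamma> Z2_sq \<Gamma>' \<longleftrightarrow>
            (\<exists>\<sigma>. alg_iso_on scale mul \<sigma> K K') \<and>
            (\<exists>\<phi>\<in>iso Z2_sq Z2_sq. \<forall>t\<in>carrier Z2_sq. \<mu>' t = \<mu> (\<phi> t))))) \<and>
     (\<comment> \<open>gradings of different kinds are not equivalent\<close>
      (\<forall>\<Gamma> \<mu> \<Gamma>'. cartan_grading scale mul \<Gamma> \<and>
         admissible_base scale n Z2_cube (carrier Z2_cube) \<mu> \<and>
         Gamma_base scale mul unit n Z2_cube (carrier Z2_cube) \<mu> \<Gamma>' \<and> CHAR('f) \<noteq> 2 \<longrightarrow>
         \<not> equivalent_gradings scale mul Z_sq \<Gamma> Z2_cube \<Gamma>') \<and>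
      (\<forall>\<Gamma> K \<mu> \<Gamma>'. cartan_grading scale mul \<Gamma> \<and>
         quadratic_separable_subfield scale mul unit K \<and>
         admissible_quadratic scale n Z2_sq K (carrier Z2_sq) \<mu> \<and>
         Gamma_quadratic scale mul n Z2_sq K (carrier Z2_sq) \<mu> \<Gamma>' \<and> CHAR('f) = 2 \<longrightarrow>
         \<not> equivalent_gradings scale mul Z_sq \<Gamma> Z2_sq \<Gamma>')) \<and>
     (\<comment> \<open>every fine grading occurs in the list\<close>
      \<forall>(G :: ('g, 'm) monoid_scheme) \<Gamma>. fine_grading scale mul G \<Gamma> \<longrightarrow>
        (split_norm n \<and>
         (\<exists>\<Delta>. cartan_grading scale mul \<Delta> \<and> equivalent_gradings scale mul G \<Gamma> Z_sq \<Delta>)) \<or>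
        (CHAR('f) \<noteq> 2 \<and>
         (\<exists>\<mu> \<Delta>. admissible_base scale n Z2_cube (carrier Z2_cube) \<mu> \<and>
            Gamma_base scale mul unit n Z2_cube (carrier Z2_cube) \<mu> \<Delta> \<and>
            equivalent_gradings scale mul G \<Gamma> Z2_cube \<Delta>)) \<or>
        (CHAR('f) = 2 \<and>
         (\<exists>K \<mu> \<Delta>. quadratic_separable_subfield scale mul unit K \<and>
            admissible_quadratic scale n Z2_sq K (carrier Z2_sq) \<mu> \<and>
            Gamma_quadratic scale mul n Z2_sq K (carrier Z2_sq) \<mu> \<Delta> \<and>
            equivalent_gradings scale mul G \<Gamma> Z2_sq \<Delta>)))"
proof -
  interpret cayley_algebra scale mul unit n by (rule assms)
  have cube: "\<mu> \<in> hom Z2_cube (field_units Mod unit_squares)"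
    if "admissible_base scale n Z2_cube (carrier Z2_cube) \<mu>" for \<mu>
    using that unfolding admissible_base_def hom_full_carrier by (rule conjunct1)
  have sq: "\<mu> \<in> hom Z2_sq (field_units Mod (n ` (K - {0})))"
    if "admissible_quadratic scale n Z2_sq K (carrier Z2_sq) \<mu>" for K \<mu>
    using that unfolding admissible_quadratic_def hom_full_carrier by (rule conjunct1)
  have card: "card (carrier Z2_cube) \<noteq> 7" "card (carrier Z2_sq) \<noteq> 7"
    using elementary_2_subgroup_Z2_cube elementary_2_subgroup_Z2_sq
    unfolding elementary_2_subgroup_def by presburger+
  have cartan: "fine_grading scale mul Z_sq \<Gamma>" "universal_group scale mul Z_sq \<Gamma> \<cong> Z_sq"
    if "cartan_grading scale mul \<Gamma>" for \<Gamma>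
    using that cartan_fine cartan_universal_group unfolding cartan_grading_iff by blast+
  have subfield: "comp_subalgebra K" "dim K = 2" "x \<in> K \<Longrightarrow> x \<noteq> 0 \<Longrightarrow> n x \<noteq> 0"
    if "quadratic_separable_subfield scale mul unit K" "CHAR('f) = 2" for K x
    using separable_subfieldD[OF that(2,1)] by metis+
  have base_ne: "\<not> equivalent_gradings scale mul Z_sq \<Gamma> Z2_cube \<Gamma>'"
    if "cartan_grading scale mul \<Gamma>" "Gamma_base scale mul unit n Z2_cube (carrier Z2_cube) \<mu> \<Gamma>'"
      "CHAR('f) \<noteq> 2" for \<Gamma> \<mu> \<Gamma>'
    by (rule Gamma_base_structure[OF that(3) comm_group_Z2_cube that(2)])
      (rule cartan_not_equivalent_division[OF that(1) _ card(1)])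
  have quadratic_ne: "\<not> equivalent_gradings scale mul Z_sq \<Gamma> Z2_sq \<Gamma>'"
    if \<Gamma>: "cartan_grading scale mul \<Gamma>" and K: "quadratic_separable_subfield scale mul unit K"
      and \<Gamma>': "Gamma_quadratic scale mul n Z2_sq K (carrier Z2_sq) \<mu> \<Gamma>'" and ch: "CHAR('f) = 2" for \<Gamma> K \<mu> \<Gamma>'
    by (rule Gamma_quadratic_structure[OF subfield[OF K ch] comm_group_Z2_sq \<Gamma>'], assumption, assumption)
      (rule cartan_not_equivalent_division[OF \<Gamma> _ card(2)])
  have quadratic_eq: "equivalent_gradings scale mul Z2_sq \<Gamma> Z2_sq \<Gamma>' \<longleftrightarrow>
      (\<exists>\<sigma>. alg_iso_on scale mul \<sigma> K K') \<and> (\<exists>\<phi>\<in>iso Z2_sq Z2_sq. \<forall>t\<in>carrier Z2_sq. \<mu>' t = \<mu> (\<phi> t))"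
    if ch: "CHAR('f) = 2"
      and K: "quadratic_separable_subfield scale mul unit K" "quadratic_separable_subfield scale mul unit K'"
      and \<mu>: "admissible_quadratic scale n Z2_sq K (carrier Z2_sq) \<mu>"
        "admissible_quadratic scale n Z2_sq K' (carrier Z2_sq) \<mu>'"
      and \<Gamma>: "Gamma_quadratic scale mul n Z2_sq K (carrier Z2_sq) \<mu> \<Gamma>"
        "Gamma_quadratic scale mul n Z2_sq K' (carrier Z2_sq) \<mu>' \<Gamma>'" for K K' \<mu> \<mu>' \<Gamma> \<Gamma>'
    by (rule Gamma_quadratic_equivalent_iff[OF subfield[OF K(1) ch] subfield[OF K(2) ch]
          comm_group_Z2_sq sq[OF \<mu>(1)] sq[OF \<mu>(2)] \<Gamma>])
  show ?thesis
  proof (intro conjI allI impI; (elim conjE)?)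
    fix G :: "('g, 'm) monoid_scheme" and \<Gamma> assume fine: "fine_grading scale mul G \<Gamma>"
    show "(split_norm n \<and>
         (\<exists>\<Delta>. cartan_grading scale mul \<Delta> \<and> equivalent_gradings scale mul G \<Gamma> Z_sq \<Delta>)) \<or>
        (CHAR('f) \<noteq> 2 \<and>
         (\<exists>\<mu> \<Delta>. admissible_base scale n Z2_cube (carrier Z2_cube) \<mu> \<and>
            Gamma_base scale mul unit n Z2_cube (carrier Z2_cube) \<mu> \<Delta> \<and>
            equivalent_gradings scale mul G \<Gamma> Z2_cube \<Delta>)) \<or>
        (CHAR('f) = 2 \<and>
         (\<exists>K \<mu> \<Delta>. quadratic_separable_subfield scale mul unit K \<and>
            admissible_quadratic scale n Z2_sq K (carrier Z2_sq) \<mu> \<and>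
            Gamma_quadratic scale mul n Z2_sq K (carrier Z2_sq) \<mu> \<Delta> \<and>
            equivalent_gradings scale mul G \<Gamma> Z2_sq \<Delta>))"
    proof (cases "\<exists>g\<in>carrier G. \<exists>x\<in>\<Gamma> g. x \<noteq> 0 \<and> n x = 0")
      case True
      then obtain g x where x: "g \<in> carrier G" "x \<in> \<Gamma> g" "x \<noteq> 0" "n x = 0" by blast
      then have "split_norm n" unfolding split_norm_def by blast
      then show ?thesis using fine_isotropic[OF fine x] by (intro disjI1 conjI)
    next
      case False
      then have an: "\<And>g x. g \<in> carrier G \<Longrightarrow> x \<in> \<Gamma> g \<Longrightarrow> x \<noteq> 0 \<Longrightarrow> n x \<noteq> 0" by blast
      show ?thesis
      proof (cases "CHAR('f) = 2")
        case True
        then show ?thesis using fine_anisotropic_char_2[OF True fine an] by (intro disjI2 conjI)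
      next
        case False
        then show ?thesis using fine_anisotropic_char_not_2[OF False fine an] by (intro disjI2[OF disjI1] conjI)
      qed
    qed
  qed ((rule cartan_grading_exists cartan cartan_gradings_equivalent Gamma_base_exists
      Gamma_base_fine[OF _ comm_group_Z2_cube] Gamma_base_equivalent_iff[OF _ comm_group_Z2_cube cube cube]
      Gamma_quadratic_exists Gamma_quadratic_fine[OF _ _ comm_group_Z2_sq] quadratic_eq base_ne quadratic_ne,
      assumption+)+)
qed

end
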